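(* Suppose that $\alpha\models n$ is a nonempty composition with at most one odd part. For $S\subseteq D(\alpha)$ set $$G_{\alpha,S}(t,q)=\sum_{S\subseteq T\subseteq D(\alpha)}(-1)^{|T|-|S|}\prod_i Q_{(\gamma_T)_i}(t,q).$$ Then $G_{\alpha,S}(t,q)\in\mathbb N[t,q]$, and $$G_{\alpha,S}(t,q)=\sum_{\substack{\theta\in\mathcal D_n\\ F_\alpha(\theta)=S}}t^{\deg_t\theta}q^{\deg_q\theta},$$ $$\operatorname{ch}_{t,q}H_k(C_\bullet^{t,q}(\alpha))=\sum_{\substack{S\subseteq D(\alpha)\\ |S|=k-1}}G_{\alpha,S}(t,q)\,r_{\gamma_S}.$$ In top degree, writing $r=\ell(\alpha)$, $$\operatorname{ch}_{t,q}H_r(C_\bullet^{t,q}(\alpha))=\Bigl(\prod_{i=1}^r Q_{\alpha_i}(t,q)\Bigr)r_\alpha .$$ For $\alpha=\delta_n$ with $n\ge1$, this specializes to $$\operatorname{ch}_{t,q}H_{\ell(\delta_n)}(C_\bullet^{t,q}(\delta_n))=t^{\lceil n/2\rceil}(1+t)^{\lfloor n/2\rfloor}r_{\delta_n},$$ which lies in $q$-degree zero.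
   Context: Conventions. $\mathbb N$ includes $0$; $[m]=\{1,\dots,m\}$, $[0]=\varnothing$; $\mathbb K$ is a field of characteristic zero and all vector spaces are over $\mathbb K$. For $m\ge0$, $m^+=\lceil m/2\rceil$ and $m^-=\lfloor m/2\rfloor$. A composition $\alpha=(\alpha_1,\dots,\alpha_r)\models n$ is a sequence of positive integers with sum $n$; $\ell(\alpha)=r$; its cut set is $D(\alpha)=\{\alpha_1,\alpha_1+\alpha_2,\dots,\alpha_1+\cdots+\alpha_{r-1}\}\subseteq[n-1]$. For $\beta,\alpha\models n$, $\beta\succeq\alpha$ ($\beta$ is a coarsening of $\alpha$) means $D(\beta)\subseteq D(\alpha)$. For $S\subseteq[n-1]$, $\gamma_S$ is the composition of $n$ with $D(\gamma_S)=S$, and $(\gamma_S)_i$ is its $i$-th part. The ribbon Schur function is $r_\alpha=\sum_{\beta\succeq\alpha}(-1)^{\ell(\alpha)-\ell(\beta)}h_\beta$, with $h_\beta=h_{\beta_1}h_{\beta_2}\cdots$ complete homogeneous. Zigzag compositions: $\delta_{2N}=(2,\dots,2)$ ($N$ parts) and $\delta_{2N+1}=(2,\dots,2,1)$ ($N$ twos). Decorations. $c(\cdot)$ is the number of cycles of a permutation, fixed points included. For $\sigma\in\mathfrak S_a$, $\sigma'\in\mathfrak S_b$, $\sigma\oplus\sigma'\in\mathfrak S_{a+b}$ acts as $\sigma$ on $[a]$ and by $a+j\mapsto a+\sigma'(j)$ on the rest. $\mathfrak R_s$ is the set of permutations of $\{\ast,1,\dots,s\}$ (rooted permutations); the cycle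 containing $\ast$ is the root cycle, written starting at $\ast$. For $\tau\in\mathfrak R_a$, $\upsilon\in\mathfrak R_b$ with root cycles $(\ast,a_1,\dots,a_u)$ and $(\ast,b_1,\dots,b_v)$, $\tau\star\upsilon\in\mathfrak R_{a+b}$ has root cycle $(\ast,a_1,\dots,a_u,a+b_1,\dots,a+b_v)$, and its nonroot cycles are those of $\tau$ together with those of $\upsilon$ with every letter shifted by $a$. For $m\ge1$, $\mathcal D_m=\mathfrak S_{m^+}\times\mathfrak R_{m^-}$; for $\xi=(\sigma,\tau)\in\mathcal D_m$, $\deg_q\xi=m^+-c(\sigma)$ and $\deg_t\xi=c(\sigma)+c(\tau)-1$. If $a,b$ are not both odd, $(\sigma,\tau)\diamond(\sigma',\tau')=(\sigma\oplus\sigma',\tau\star\tau')$ defines $\diamond:\mathcal D_a\times\mathcal D_b\to\mathcal D_{a+b}$ (associative, bidegree-additive). The local enumerator is $Q_m(t,q)=\sum_{\xi\in\mathcal D_m}q^{\deg_q\xi}t^{\deg_t\xi}$. Decorated complex. For $\beta=(\beta_1,\dots,\beta_k)\models n$, $\operatorname{OSP}_\beta[n]$ is the set of ordered set partitions $(B_1,\dots,B_k)$ of $[n]$ with $|B_i|=\beta_i$. $C_k^{t,q}(\alpha)$ has basis the elements $(B_1,\dots,B_k;\xi_1,\dots,\xi_k)$ with $\beta\succeq\alpha$, $\ell(\beta)=k$, $(B_1,\dots,B_k)\in\operatorname{OSP}_\beta[n]$, $\xi_i\in\mathcal D_{\beta_i}$; it is bigraded by the sums of the $\deg_t\xi_i$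 and of the $\deg_q\xi_i$; $\mathfrak S_n$ acts on block labels and fixes decorations. The differential is $\sum_{i=1}^{k-1}(-1)^{i-1}d_i^{t,q}$, where $d_i^{t,q}$ merges $B_i,B_{i+1}$ into $B_i\sqcup B_{i+1}$ and replaces $\xi_i,\xi_{i+1}$ by $\xi_i\diamond\xi_{i+1}$ if $\beta_i,\beta_{i+1}$ are not both odd, and is $0$ if both are odd. Factorization cuts. Let $\alpha\models n$ have at most one odd part and $\theta=(\sigma,\tau)\in\mathcal D_n$. A cut $c\in D(\alpha)$ is a factorization cut of $\theta$ if (a) $\sigma([c^+])=[c^+]$; and (b) every nonroot cycle of $\tau$ lies entirely in $[c^-]$ or entirely in $\{c^-+1,\dots,n^-\}$, and in the root cycle $(\ast,a_1,\dots,a_u)$ all letters $\le c^-$ come before all letters $>c^-$. $F_\alpha(\theta)$ is the set of factorization cuts $c\in D(\alpha)$ of $\theta$. For a finite-dimensional bigraded $\mathfrak S_n$-module $V=\bigoplus V_{d,e}$, $\operatorname{ch}_{t,q}V=\sum_{d,e}\operatorname{ch}(V_{d,e})t^dq^e$, with $\operatorname{ch}$ the Frobenius characteristic. *)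

theory Defs
  imports
    "HOL-Computational_Algebra.Polynomial"
    "HOL-Library.Poly_Mapping"
    "HOL-Library.Multiset"
    "HOL-Combinatorics.Cycles"
    "HOL-Combinatorics.Orbits"
    "Jordan_Normal_Form.VS_Connect"
begin

section \<open>Power series in countably many variables, and symmetric functions\<close>

text \<open>
  A monomial in the variables \<open>x\<^sub>0, x\<^sub>1, x\<^sub>2, \<dots>\<close> is a finite multiset of indices, and a power series
  is the function giving the coefficient of every monomial.  The ring of symmetric functions with
  coefficients in \<open>'a\<close> is the subring of the symmetric series of bounded degree; all the series
  below lie in it, and it is enough to compare them in the ambient ring.
\<close>

typedef 'a mpser = "UNIV :: (nat multiset \<Rightarrow> 'a) set"
  morphisms mcoeff Abs_mpser
  by simp

lemma mpser_eqI: "(\<And>M. mcoeff f M = mcoeff g M) \<Longrightarrow> f = g"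
  by (metis ext mcoeff_inject)

lemma mcoeff_Abs [simp]: "mcoeff (Abs_mpser f) = f"
  by (simp add: Abs_mpser_inverse)

definition msplits :: "'b multiset \<Rightarrow> ('b multiset \<times> 'b multiset) set" where
  "msplits M = {(A, B). A + B = M}"

lemma finite_submultisets: "finite {A. A \<subseteq># M}"
proof (rule finite_subset)
  show "{A. A \<subseteq># M} \<subseteq> mset ` {xs. set xs \<subseteq> set_mset M \<and> length xs \<le> size M}"
  proof
    fix A assume "A \<in> {A. A \<subseteq># M}"
    hence A: "A \<subseteq># M" by simp
    obtain xs where xs: "A = mset xs" by (metis ex_mset)
    have "set xs \<subseteq> set_mset M" using set_mset_mono[OF A] by (simp add: xs)
    moreover have "length xs \<le> size M" using size_mset_mono[OF A] by (simp add: xs)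
    ultimately show "A \<in> mset ` {xs. set xs \<subseteq> set_mset M \<and> length xs \<le> size M}"
      using xs by blast
  qed
  show "finite (mset ` {xs. set xs \<subseteq> set_mset M \<and> length xs \<le> size M})"
    by (intro finite_imageI finite_lists_length_le) simp
qed

lemma finite_msplits [simp]: "finite (msplits M)"
proof (rule finite_subset)
  show "msplits M \<subseteq> {A. A \<subseteq># M} \<times> {A. A \<subseteq># M}"
    by (auto simp: msplits_def)
  show "finite ({A. A \<subseteq># M} \<times> {A. A \<subseteq># M})"
    by (simp add: finite_submultisets)
qed

instantiation mpser :: (comm_ring_1) comm_ring_1
begin

definition "0 = Abs_mpser (\<lambda>_. 0)"
definition "1 = Abs_mpser (\<lambda>M. if M = {#} then 1 else 0)"
definition "f + g = Abs_mpser (\<lambda>M. mcoeff f M + mcoeff g M)"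
definition "f - g = Abs_mpser (\<lambda>M. mcoeff f M - mcoeff g M)"
definition "- f = Abs_mpser (\<lambda>M. - mcoeff f M)"
definition "f * g = Abs_mpser (\<lambda>M. \<Sum>(A, B)\<in>msplits M. mcoeff f A * mcoeff g B)"

instance
proof
  fix f g h :: "'a mpser"
  show "f + g + h = f + (g + h)"
    by (rule mpser_eqI) (simp add: plus_mpser_def)
  show "f + g = g + f"
    by (rule mpser_eqI) (simp add: plus_mpser_def)
  show "0 + f = f"
    by (rule mpser_eqI) (simp add: plus_mpser_def zero_mpser_def)
  show "- f + f = 0"
    by (rule mpser_eqI) (simp add: plus_mpser_def zero_mpser_def uminus_mpser_def)
  show "f - g = f + - g"
    by (rule mpser_eqI) (simp add: plus_mpser_def minus_mpser_def uminus_mpser_def)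
  show "(0 :: 'a mpser) \<noteq> 1"
  proof
    assume "(0 :: 'a mpser) = 1"
    hence "mcoeff (0 :: 'a mpser) {#} = mcoeff 1 {#}" by simp
    thus False by (simp add: zero_mpser_def one_mpser_def)
  qed
  show "(f + g) * h = f * h + g * h"
    by (rule mpser_eqI)
       (simp only: plus_mpser_def times_mpser_def mcoeff_Abs case_prod_unfold distrib_right sum.distrib)
  show "f * g = g * f"
  proof (rule mpser_eqI)
    fix M
    show "mcoeff (f * g) M = mcoeff (g * f) M"
      unfolding times_mpser_def mcoeff_Abs
      by (rule sum.reindex_bij_witness[of _ prod.swap prod.swap])
         (auto simp: msplits_def ac_simps)
  qed
  show "1 * f = f"
  proof (rule mpser_eqI)
    fix M
    have "mcoeff (1 * f) M = (\<Sum>(A, B)\<in>msplits M. if A = {#} then mcoeff f B else 0)"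
      unfolding times_mpser_def one_mpser_def mcoeff_Abs by (rule sum.cong) auto
    also have "\<dots> = (\<Sum>(A, B)\<in>{({#} :: nat multiset, M)}. if A = {#} then mcoeff f B else 0)"
      by (rule sum.mono_neutral_right, rule finite_msplits) (auto simp: msplits_def split: if_splits)
    finally show "mcoeff (1 * f) M = mcoeff f M" by simp
  qed
  show "f * g * h = f * (g * h)"
  proof (rule mpser_eqI)
    fix M
    have "mcoeff (f * g * h) M
        = (\<Sum>p\<in>msplits M. \<Sum>q\<in>msplits (fst p). mcoeff f (fst q) * mcoeff g (snd q) * mcoeff h (snd p))"
      by (simp add: times_mpser_def case_prod_unfold sum_distrib_right)
    also have "\<dots> = (\<Sum>z\<in>(SIGMA p:msplits M. msplits (fst p)).
        mcoeff f (fst (snd z)) * mcoeff g (snd (snd z)) * mcoeff h (snd (fst z)))"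
      by (subst sum.Sigma) (auto simp: case_prod_unfold)
    also have "\<dots> = (\<Sum>z\<in>(SIGMA p:msplits M. msplits (snd p)).
        mcoeff f (fst (fst z)) * (mcoeff g (fst (snd z)) * mcoeff h (snd (snd z))))"
      by (rule sum.reindex_bij_witness[where
            i = "\<lambda>((A, R), (B, C)). ((A + B, C), (A, B))" and
            j = "\<lambda>((P, C), (A, B)). ((A, B + C), (B, C))"])
         (auto simp: msplits_def add.assoc mult.assoc)
    also have "\<dots> = (\<Sum>p\<in>msplits M. \<Sum>q\<in>msplits (snd p).
        mcoeff f (fst p) * (mcoeff g (fst q) * mcoeff h (snd q)))"
      by (subst sum.Sigma) (auto simp: case_prod_unfold)
    also have "\<dots> = mcoeff (f * (g * h)) M"
      by (simp add: times_mpser_def case_prod_unfold sum_distrib_left)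
    finally show "mcoeff (f * g * h) M = mcoeff (f * (g * h)) M" .
  qed
qed

end

definition mconst :: "'a::comm_ring_1 \<Rightarrow> 'a mpser" where
  "mconst c = Abs_mpser (\<lambda>M. if M = {#} then c else 0)"

definition complete_sym :: "nat \<Rightarrow> 'a::comm_ring_1 mpser" where
  "complete_sym r = Abs_mpser (\<lambda>M. if size M = r then 1 else 0)"

definition power_sum :: "nat \<Rightarrow> 'a::comm_ring_1 mpser" where
  "power_sum r = Abs_mpser (\<lambda>M. if \<exists>i. M = replicate_mset r i then 1 else 0)"


section \<open>Compositions and ribbon Schur functions\<close>

definition composition :: "nat \<Rightarrow> nat list \<Rightarrow> bool" where
  "composition n \<alpha> \<longleftrightarrow> (\<forall>a\<in>set \<alpha>. 0 < a) \<and> sum_list \<alpha> = n"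

definition cuts :: "nat list \<Rightarrow> nat set" where
  "cuts \<alpha> = {sum_list (take i \<alpha>) | i. 1 \<le> i \<and> i < length \<alpha>}"

definition coarsening :: "nat list \<Rightarrow> nat list \<Rightarrow> bool" where
  "coarsening \<beta> \<alpha> \<longleftrightarrow> composition (sum_list \<alpha>) \<beta> \<and> cuts \<beta> \<subseteq> cuts \<alpha>"

definition comp_of_cuts :: "nat \<Rightarrow> nat set \<Rightarrow> nat list" where
  "comp_of_cuts n S = (THE \<gamma>. composition n \<gamma> \<and> cuts \<gamma> = S)"

definition ribbon :: "nat list \<Rightarrow> 'a::comm_ring_1 mpser" where
  "ribbon \<alpha> = (\<Sum>\<beta> | coarsening \<beta> \<alpha>.
     (-1) ^ (length \<alpha> - length \<beta>) * prod_list (map complete_sym \<beta>))"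

definition zigzag :: "nat \<Rightarrow> nat list" where
  "zigzag n = replicate (n div 2) 2 @ (if odd n then [1] else [])"


section \<open>Frobenius characteristic\<close>

text \<open>
  A vector space over the field \<open>'a\<close> is a module record over \<^term>\<open>class_ring\<close>.  The trace of an
  endomorphism of a finite-dimensional space does not depend on the basis that is chosen.
\<close>

definition basis_coords :: "('a::field, 'v) module \<Rightarrow> 'v set \<Rightarrow> 'v \<Rightarrow> 'v \<Rightarrow> 'a" where
  "basis_coords V A v = (THE c. c \<in> extensional A \<and> v = LinearCombinations.module.lincomb V c A)"

definition lin_trace :: "('a::field, 'v) module \<Rightarrow> ('v \<Rightarrow> 'v) \<Rightarrow> 'a" where
  "lin_trace V f =
     (let A = (SOME A. finite A \<and> vectorspace.basis class_ring V A)
      in \<Sum>v\<in>A. basis_coords V A (f v) v)"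

text \<open>
  For a permutation \<open>p\<close> of a finite set \<open>X\<close>, the cycles (fixed points included) are the orbits of
  the points of \<open>X\<close>.
\<close>

definition cycles_on :: "'b set \<Rightarrow> ('b \<Rightarrow> 'b) \<Rightarrow> 'b set set" where
  "cycles_on X p = orbit p ` X"

definition frobenius_ch ::
  "nat \<Rightarrow> ('a::field_char_0, 'v) module \<Rightarrow> ((nat \<Rightarrow> nat) \<Rightarrow> 'v \<Rightarrow> 'v) \<Rightarrow> 'a mpser" where
  "frobenius_ch n V \<rho> = mconst (1 / fact n) *
     (\<Sum>w | w permutes {1..n}.
        mconst (lin_trace V (\<rho> w)) * (\<Prod>Z\<in>cycles_on {1..n} w. power_sum (card Z)))"

text \<open>
  Polynomials in \<open>t\<close> and \<open>q\<close> are polynomials in \<open>t\<close> with coefficients that are polynomials in \<open>q\<close>.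
\<close>

abbreviation tq_monom :: "'b::zero \<Rightarrow> nat \<Rightarrow> nat \<Rightarrow> 'b poly poly" where
  "tq_monom c d e \<equiv> Polynomial.monom (Polynomial.monom c e) d"

definition frobenius_ch_tq ::
  "nat \<Rightarrow> (nat \<Rightarrow> nat \<Rightarrow> ('a::field_char_0, 'v) module) \<Rightarrow> ((nat \<Rightarrow> nat) \<Rightarrow> 'v \<Rightarrow> 'v)
     \<Rightarrow> 'a mpser poly poly" where
  "frobenius_ch_tq n V \<rho> =
     (\<Sum>(d, e) | carrier (V d e) \<noteq> {\<zero>\<^bsub>V d e\<^esub>}. tq_monom (frobenius_ch n (V d e) \<rho>) d e)"

definition tq_times :: "int poly poly \<Rightarrow> 'a::comm_ring_1 mpser \<Rightarrow> 'a mpser poly poly"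
    (infixl \<open>\<cdot>\<^sub>t\<^sub>q\<close> 70) where
  "P \<cdot>\<^sub>t\<^sub>q s = map_poly (map_poly of_int) P * [:[:s:]:]"


section \<open>Decorations\<close>

text \<open>
  Rooted permutations of \<open>{\<ast>, 1, \<dots>, s}\<close> are permutations of \<open>{0..s}\<close>, with \<open>0\<close> in the role of \<open>\<ast>\<close>.
\<close>

type_synonym decoration = "(nat \<Rightarrow> nat) \<times> (nat \<Rightarrow> nat)"

abbreviation (input) half_up :: "nat \<Rightarrow> nat" where
  "half_up m \<equiv> (m + 1) div 2"

abbreviation (input) half_down :: "nat \<Rightarrow> nat" where
  "half_down m \<equiv> m div 2"

definition dsum :: "nat \<Rightarrow> (nat \<Rightarrow> nat) \<Rightarrow> (nat \<Rightarrow> nat) \<Rightarrow> nat \<Rightarrow> nat" where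
  "dsum a \<sigma> \<sigma>' x = (if x \<le> a then \<sigma> x else a + \<sigma>' (x - a))"

text \<open>\<^term>\<open>support \<tau> 0\<close> is the root cycle \<open>(\<ast>, a\<^sub>1, \<dots>, a\<^sub>u)\<close>; the letters after \<open>\<ast>\<close> form its tail.\<close>

definition root_word :: "(nat \<Rightarrow> nat) \<Rightarrow> nat list" where
  "root_word \<tau> = tl (support \<tau> 0)"

definition rooted_prod :: "nat \<Rightarrow> (nat \<Rightarrow> nat) \<Rightarrow> (nat \<Rightarrow> nat) \<Rightarrow> nat \<Rightarrow> nat" where
  "rooted_prod a \<tau> \<upsilon> x =
     (let R = 0 # root_word \<tau> @ map (\<lambda>b. a + b) (root_word \<upsilon>)
      in if x \<in> set R then cycle_of_list R x
         else if x \<le> a then \<tau> x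
         else a + \<upsilon> (x - a))"

definition decorations :: "nat \<Rightarrow> decoration set" where
  "decorations m = {\<sigma>. \<sigma> permutes {1..half_up m}} \<times> {\<tau>. \<tau> permutes {0..half_down m}}"

definition deg_q :: "nat \<Rightarrow> decoration \<Rightarrow> nat" where
  "deg_q m = (\<lambda>(\<sigma>, \<tau>). half_up m - card (cycles_on {1..half_up m} \<sigma>))"

definition deg_t :: "nat \<Rightarrow> decoration \<Rightarrow> nat" where
  "deg_t m = (\<lambda>(\<sigma>, \<tau>).
     card (cycles_on {1..half_up m} \<sigma>) + card (cycles_on {0..half_down m} \<tau>) - 1)"

text \<open>The product of a decoration in size \<open>a\<close> with a second one; meant for sizes not both odd.\<close>

definition deco_prod :: "nat \<Rightarrow> decoration \<Rightarrow> decoration \<Rightarrow> decoration" where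
  "deco_prod a = (\<lambda>(\<sigma>, \<tau>) (\<sigma>', \<tau>'). (dsum (half_up a) \<sigma> \<sigma>', rooted_prod (half_down a) \<tau> \<tau>'))"

definition local_enum :: "nat \<Rightarrow> int poly poly" where
  "local_enum m = (\<Sum>\<xi>\<in>decorations m. tq_monom 1 (deg_t m \<xi>) (deg_q m \<xi>))"

definition is_fact_cut :: "nat \<Rightarrow> decoration \<Rightarrow> nat \<Rightarrow> bool" where
  "is_fact_cut n = (\<lambda>(\<sigma>, \<tau>) c.
     \<sigma> ` {1..half_up c} = {1..half_up c} \<and>
     (\<forall>Z\<in>cycles_on {0..half_down n} \<tau>. 0 \<notin> Z \<longrightarrow>
        Z \<subseteq> {1..half_down c} \<or> Z \<subseteq> {half_down c + 1..half_down n}) \<and>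
     (\<forall>i j. i < length (root_word \<tau>) \<and> j < length (root_word \<tau>) \<and>
        root_word \<tau> ! i \<le> half_down c \<and> half_down c < root_word \<tau> ! j \<longrightarrow> i < j))"

definition fact_cuts :: "nat list \<Rightarrow> decoration \<Rightarrow> nat set" where
  "fact_cuts \<alpha> \<theta> = {c \<in> cuts \<alpha>. is_fact_cut (sum_list \<alpha>) \<theta> c}"

definition G_poly :: "nat list \<Rightarrow> nat set \<Rightarrow> int poly poly" where
  "G_poly \<alpha> S = (\<Sum>T | S \<subseteq> T \<and> T \<subseteq> cuts \<alpha>.
     (-1) ^ (card T - card S) * prod_list (map local_enum (comp_of_cuts (sum_list \<alpha>) T)))"


section \<open>The decorated complex and its homology\<close>

definition osp :: "nat \<Rightarrow> nat list \<Rightarrow> nat set list set" where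
  "osp n \<beta> = {Bs. length Bs = length \<beta> \<and> (\<forall>i<length \<beta>. card (Bs ! i) = \<beta> ! i) \<and>
     (\<forall>i<length \<beta>. \<forall>j<length \<beta>. i \<noteq> j \<longrightarrow> Bs ! i \<inter> Bs ! j = {}) \<and> \<Union> (set Bs) = {1..n}}"

type_synonym cell = "nat set list \<times> decoration list"

definition cell_deg :: "(nat \<Rightarrow> decoration \<Rightarrow> nat) \<Rightarrow> cell \<Rightarrow> nat" where
  "cell_deg deg = (\<lambda>(Bs, \<xi>s). \<Sum>i<length Bs. deg (card (Bs ! i)) (\<xi>s ! i))"

text \<open>The basis elements of \<open>C\<^sub>k(\<alpha>)\<close> of \<open>t\<close>-degree \<open>d\<close> and \<open>q\<close>-degree \<open>e\<close>.\<close>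

definition cells :: "nat list \<Rightarrow> nat \<Rightarrow> nat \<Rightarrow> nat \<Rightarrow> cell set" where
  "cells \<alpha> k d e = {(Bs, \<xi>s). \<exists>\<beta>. coarsening \<beta> \<alpha> \<and> length \<beta> = k \<and> Bs \<in> osp (sum_list \<alpha>) \<beta> \<and>
     length \<xi>s = k \<and> (\<forall>i<k. \<xi>s ! i \<in> decorations (\<beta> ! i)) \<and>
     cell_deg deg_t (Bs, \<xi>s) = d \<and> cell_deg deg_q (Bs, \<xi>s) = e}"

text \<open>
  A vector is a finitely supported function \<open>'b \<Rightarrow>\<^sub>0 'a\<close>, that is, a formal linear combination
  of basis elements.
\<close>

definition scale_vec :: "'a::field \<Rightarrow> ('b \<Rightarrow>\<^sub>0 'a) \<Rightarrow> ('b \<Rightarrow>\<^sub>0 'a)" where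
  "scale_vec c x = Poly_Mapping.map ((*) c) x"

definition lin_extend :: "('b \<Rightarrow> ('c \<Rightarrow>\<^sub>0 'a)) \<Rightarrow> ('b \<Rightarrow>\<^sub>0 'a::field) \<Rightarrow> ('c \<Rightarrow>\<^sub>0 'a)" where
  "lin_extend f x = (\<Sum>b\<in>Poly_Mapping.keys x. scale_vec (Poly_Mapping.lookup x b) (f b))"

definition chains :: "nat list \<Rightarrow> nat \<Rightarrow> nat \<Rightarrow> nat \<Rightarrow> (cell \<Rightarrow>\<^sub>0 'a::field) set" where
  "chains \<alpha> k d e = {x. Poly_Mapping.keys x \<subseteq> cells \<alpha> k d e}"

text \<open>List positions start at \<open>0\<close>, so \<open>face i\<close> merges the blocks number \<open>i + 1\<close> and \<open>i + 2\<close>, with sign \<open>(-1)\<^sup>i\<close>.\<close>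

definition merge_cell :: "nat \<Rightarrow> cell \<Rightarrow> cell" where
  "merge_cell i = (\<lambda>(Bs, \<xi>s).
     (take i Bs @ [Bs ! i \<union> Bs ! (i + 1)] @ drop (i + 2) Bs,
      take i \<xi>s @ [deco_prod (card (Bs ! i)) (\<xi>s ! i) (\<xi>s ! (i + 1))] @ drop (i + 2) \<xi>s))"

definition face :: "nat \<Rightarrow> cell \<Rightarrow> (cell \<Rightarrow>\<^sub>0 'a::field)" where
  "face i c = (if odd (card (fst c ! i)) \<and> odd (card (fst c ! (i + 1))) then 0
     else Poly_Mapping.single (merge_cell i c) 1)"

definition boundary :: "(cell \<Rightarrow>\<^sub>0 'a::field) \<Rightarrow> (cell \<Rightarrow>\<^sub>0 'a)" where
  "boundary = lin_extend (\<lambda>c. \<Sum>i<length (fst c) - 1. scale_vec ((-1) ^ i) (face i c))"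

definition relabel :: "(nat \<Rightarrow> nat) \<Rightarrow> (cell \<Rightarrow>\<^sub>0 'a::field) \<Rightarrow> (cell \<Rightarrow>\<^sub>0 'a)" where
  "relabel w = lin_extend (\<lambda>(Bs, \<xi>s). Poly_Mapping.single (map ((`) w) Bs, \<xi>s) 1)"

text \<open>
  The quotient \<open>Z / B\<close> of subspaces \<open>B \<subseteq> Z\<close>, with cosets as elements.  The fields \<open>mult\<close> and \<open>one\<close>
  of the record play no role for modules.
\<close>

definition quotient_space ::
  "('b \<Rightarrow>\<^sub>0 'a::field) set \<Rightarrow> ('b \<Rightarrow>\<^sub>0 'a) set \<Rightarrow> ('a, ('b \<Rightarrow>\<^sub>0 'a) set) module" where
  "quotient_space Z B =
     \<lparr>carrier = {{z + b | b. b \<in> B} | z. z \<in> Z}, mult = undefined, one = undefined,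
      zero = B, add = (\<lambda>X Y. {x + y | x y. x \<in> X \<and> y \<in> Y}),
      smult = (\<lambda>c X. {scale_vec c x + b | x b. x \<in> X \<and> b \<in> B})\<rparr>"

text \<open>
  The part of bidegree \<open>(d, e)\<close> of \<open>H\<^sub>k\<close>: the differential preserves the bidegree, so homology is
  taken in each bidegree separately.
\<close>

definition homology ::
  "nat list \<Rightarrow> nat \<Rightarrow> nat \<Rightarrow> nat \<Rightarrow> ('a::field, (cell \<Rightarrow>\<^sub>0 'a) set) module" where
  "homology \<alpha> k d e =
     quotient_space {x \<in> chains \<alpha> k d e. boundary x = 0} (boundary ` chains \<alpha> (k + 1) d e)"

definition ch_homology :: "nat list \<Rightarrow> nat \<Rightarrow> 'a::field_char_0 mpser poly poly" where
  "ch_homology \<alpha> k = frobenius_ch_tq (sum_list \<alpha>) (homology \<alpha> k) (\<lambda>w. (`) (relabel w))"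

end

theory Submission
  imports Defs
begin

text \<open>
  Why the theorem holds.  Let \<open>\<alpha>\<close> have at most one odd part.  Then neighbouring blocks of a cell are
  never both odd, the product of decorations is always defined, and by associativity the differential
  preserves the iterated product \<open>\<theta>\<close> of the decorations of a cell.  The product of a pair of decorations
  determines the pair, and its values are exactly the decorations that have the cut between the two as
  a factorization cut (\<open>bij_betw_deco_prod\<close>, iterated in \<open>bij_betw_deco_fold\<close>).  Hence a cell is the same
  thing as its ordered set partition together with \<open>\<theta>\<close>, subject to the single condition that the cuts
  between its blocks are factorization cuts of \<open>\<theta>\<close>.  Replacing an ordered set partition by the chain of
  its proper initial unions turns merging of blocks into deletion of a member of the chain, so the
  decorated complex is the direct sum, over all \<open>\<theta>\<close>, of the augmented order complexes of the Boolean
  lattice of \<open>{1..n}\<close> with ranks restricted to the set \<open>F(\<theta>)\<close> of factorization cuts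
  (\<open>cell_flag_bij\<close>, \<open>flag_map_boundary\<close>, \<open>flag_map_relabel\<close>).

  Rank-selected Boolean lattices are Cohen-Macaulay, so each summand has homology only in its top degree
  (\<open>flag_complex_exact\<close>).  The argument here is a discrete Morse matching: call a pair \<open>b < a\<close> inverted
  if \<open>a\<close> enters the chain before \<open>b\<close>, and call a set free if inserting or deleting it does not change
  the inverted pairs.  A chain that misses a rank has a free set; toggling a chosen free set is a
  contracting homotopy up to terms with fewer inverted pairs.

  It follows that \<open>H\<^sub>k\<close> collects exactly the \<open>\<theta>\<close> with \<open>k - 1\<close> factorization cuts, and the Hopf trace
  formula expresses the trace of a permutation on it as an alternating sum of numbers of fixed chains
  (\<open>homology_trace\<close>).  The chains with rank set \<open>S\<close> correspond to the ordered set partitions with block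
  sizes \<open>\<gamma>\<^sub>S\<close>, whose permutation module has characteristic \<open>h\<close> indexed by \<open>\<gamma>\<^sub>S\<close> (\<open>frobenius_osp\<close>), and
  the alternating sum over the subsets of \<open>F(\<theta>)\<close> is the definition of a ribbon Schur function.  So
  each \<open>\<theta>\<close> contributes its bidegree times the ribbon of \<open>F(\<theta>)\<close> (\<open>ch_homology_Suc\<close>).

  Finally, the product of the local enumerators along \<open>\<gamma>\<^sub>T\<close> counts the \<open>\<theta>\<close> with \<open>T\<close> contained in
  \<open>F(\<theta>)\<close>, because the bidegree is additive.  Moebius inversion over the subsets of \<open>D(\<alpha>)\<close> then shows
  that \<open>G\<close> counts the \<open>\<theta>\<close> with \<open>F(\<theta>) = S\<close> (\<open>G_poly_enumerates\<close>), which is nonnegative.  In top degree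
  only \<open>S = D(\<alpha>)\<close> survives, and the zigzag case needs the two enumerators for \<open>m = 1\<close> and \<open>m = 2\<close>.
\<close>


section \<open>Linear maps on finitely supported functions\<close>

lemma lookup_scale_vec [simp]:
  "Poly_Mapping.lookup (scale_vec c x) b = c * Poly_Mapping.lookup x b"
  by (simp add: scale_vec_def Poly_Mapping.map.rep_eq when_def)

global_interpretation pm: vector_space "scale_vec :: 'a::field \<Rightarrow> ('b \<Rightarrow>\<^sub>0 'a) \<Rightarrow> ('b \<Rightarrow>\<^sub>0 'a)"
  by unfold_locales (auto intro!: poly_mapping_eqI simp: lookup_add algebra_simps)

global_interpretation pm: vector_space_pair
  "scale_vec :: 'a::field \<Rightarrow> ('b \<Rightarrow>\<^sub>0 'a) \<Rightarrow> ('b \<Rightarrow>\<^sub>0 'a)"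
  "scale_vec :: 'a::field \<Rightarrow> ('c \<Rightarrow>\<^sub>0 'a) \<Rightarrow> ('c \<Rightarrow>\<^sub>0 'a)"
  by unfold_locales

abbreviation linmap :: "(('b \<Rightarrow>\<^sub>0 'a::field) \<Rightarrow> ('c \<Rightarrow>\<^sub>0 'a)) \<Rightarrow> bool" where
  "linmap \<equiv> Vector_Spaces.linear scale_vec scale_vec"

abbreviation unitvec :: "'b \<Rightarrow> ('b \<Rightarrow>\<^sub>0 'a::field)" where
  "unitvec b \<equiv> Poly_Mapping.single b 1"

definition supported_on :: "'b set \<Rightarrow> ('b \<Rightarrow>\<^sub>0 'a::field) set" where
  "supported_on X = {x. Poly_Mapping.keys x \<subseteq> X}"

lemma keys_scale_vec: "Poly_Mapping.keys (scale_vec c x) \<subseteq> Poly_Mapping.keys x"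
  by (auto simp: in_keys_iff)

lemma linmap_iff:
  "linmap f \<longleftrightarrow> (\<forall>x y. f (x + y) = f x + f y) \<and> (\<forall>c x. f (scale_vec c x) = scale_vec c (f x))"
  unfolding Vector_Spaces.linear_def module_hom_def module_hom_axioms_def
  by (auto intro: pm.vector_space_axioms pm.module_axioms)

lemma subspace_supported_on:
  fixes X :: "'b set"
  shows "pm.subspace (supported_on X :: ('b \<Rightarrow>\<^sub>0 'a::field) set)"
proof (rule pm.subspaceI)
  fix x y :: "'b \<Rightarrow>\<^sub>0 'a" and c
  show "0 \<in> supported_on X" by (simp add: supported_on_def)
  assume "x \<in> supported_on X"
  then show "scale_vec c x \<in> supported_on X"
    using keys_scale_vec[of c x] by (auto simp: supported_on_def)
  assume "y \<in> supported_on X"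
  with \<open>x \<in> supported_on X\<close> show "x + y \<in> supported_on X"
    using Poly_Mapping.keys_add[of x y] by (auto simp: supported_on_def)
qed

lemma vec_expand:
  assumes "x \<in> supported_on X" "finite X"
  shows "x = (\<Sum>b\<in>X. scale_vec (Poly_Mapping.lookup x b) (unitvec b))"
proof (rule poly_mapping_eqI)
  fix k
  have "Poly_Mapping.lookup (\<Sum>b\<in>X. scale_vec (Poly_Mapping.lookup x b) (unitvec b)) k
      = (\<Sum>b\<in>X. if b = k then Poly_Mapping.lookup x k else 0)"
    unfolding lookup_sum by (rule sum.cong) (auto simp: lookup_single when_def)
  also have "\<dots> = Poly_Mapping.lookup x k"
    using assms by (auto simp: supported_on_def in_keys_iff)
  finally show "Poly_Mapping.lookup x k = Poly_Mapping.lookup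
      (\<Sum>b\<in>X. scale_vec (Poly_Mapping.lookup x b) (unitvec b)) k" by simp
qed

lemma lin_extend_supported:
  assumes "x \<in> supported_on X" "finite X"
  shows "lin_extend f x = (\<Sum>b\<in>X. scale_vec (Poly_Mapping.lookup x b) (f b))"
  unfolding lin_extend_def using assms
  by (intro sum.mono_neutral_left) (auto simp: supported_on_def in_keys_iff)

lemma linmap_lin_extend [simp]:
  fixes f :: "'b \<Rightarrow> ('c \<Rightarrow>\<^sub>0 'a::field)"
  shows "linmap (lin_extend f)"
proof (unfold linmap_iff, intro conjI allI)
  fix x y :: "'b \<Rightarrow>\<^sub>0 'a" and c
  let ?X = "Poly_Mapping.keys x \<union> Poly_Mapping.keys y"
  have 1: "x \<in> supported_on ?X" "y \<in> supported_on ?X" "x + y \<in> supported_on ?X" "scale_vec c x \<in> supported_on ?X"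
    using Poly_Mapping.keys_add[of x y] keys_scale_vec[of c x] by (auto simp: supported_on_def)
  show "lin_extend f (x + y) = lin_extend f x + lin_extend f y"
    by (simp add: lin_extend_supported[OF 1(1)] lin_extend_supported[OF 1(2)] lin_extend_supported[OF 1(3)]
        lookup_add pm.scale_left_distrib sum.distrib)
  show "lin_extend f (scale_vec c x) = scale_vec c (lin_extend f x)"
    by (simp add: lin_extend_supported[OF 1(1)] lin_extend_supported[OF 1(4)] pm.scale_sum_right)
qed

lemma lin_extend_unitvec [simp]: "lin_extend f (unitvec b) = f b"
  by (simp add: lin_extend_def)

lemma linmap_expand:
  assumes "linmap f" "x \<in> supported_on X" "finite X"
  shows "f x = (\<Sum>b\<in>X. scale_vec (Poly_Mapping.lookup x b) (f (unitvec b)))"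
proof -
  have "f x = f (\<Sum>b\<in>X. scale_vec (Poly_Mapping.lookup x b) (unitvec b))"
    using vec_expand[OF assms(2,3)] by simp
  also have "\<dots> = (\<Sum>b\<in>X. scale_vec (Poly_Mapping.lookup x b) (f (unitvec b)))"
    by (simp add: pm.linear_sum[OF assms(1)] pm.linear_scale[OF assms(1)])
  finally show ?thesis .
qed

text \<open>
  Together with the next lemma, this is how every identity and inclusion between the linear maps
  below is reduced to basis elements.
\<close>
lemma linmap_eq_on:
  assumes "linmap f" "linmap g" "x \<in> supported_on X" "\<And>b. b \<in> X \<Longrightarrow> f (unitvec b) = g (unitvec b)"
  shows "f x = g x"
proof -
  have x: "x \<in> supported_on (Poly_Mapping.keys x)" by (simp add: supported_on_def)
  show ?thesis
    unfolding linmap_expand[OF assms(1) x finite_keys] linmap_expand[OF assms(2) x finite_keys]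
    using assms(3,4) by (intro sum.cong) (auto simp: supported_on_def)
qed

lemma linmap_maps_into:
  assumes "linmap f" "x \<in> supported_on X" "pm.subspace V" "\<And>b. b \<in> X \<Longrightarrow> f (unitvec b) \<in> V"
  shows "f x \<in> V"
proof -
  have x: "x \<in> supported_on (Poly_Mapping.keys x)" by (simp add: supported_on_def)
  show ?thesis
    unfolding linmap_expand[OF assms(1) x finite_keys]
    using assms(2-4) by (intro pm.subspace_sum pm.subspace_scale) (auto simp: supported_on_def)
qed

lemma unitvec_supported_on [simp]: "unitvec b \<in> supported_on X \<longleftrightarrow> b \<in> X"
  by (simp add: supported_on_def)

text \<open>
  The diagonal sum over \<open>X\<close>. It is the trace when \<open>X\<close> is finite and the functions supported on \<open>X\<close>
  are mapped to themselves.
\<close>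
definition trace_on :: "'b set \<Rightarrow> (('b \<Rightarrow>\<^sub>0 'a::field) \<Rightarrow> ('b \<Rightarrow>\<^sub>0 'a)) \<Rightarrow> 'a" where
  "trace_on X f = (\<Sum>b\<in>X. Poly_Mapping.lookup (f (unitvec b)) b)"

text \<open>
  Cyclicity of the trace, for maps between two different spaces. It replaces every change of basis
  below.
\<close>
lemma trace_on_commute:
  assumes "linmap f" "linmap g" "finite X" "finite Y"
    "\<And>b. b \<in> X \<Longrightarrow> f (unitvec b) \<in> supported_on Y" "\<And>b. b \<in> Y \<Longrightarrow> g (unitvec b) \<in> supported_on X"
  shows "trace_on X (\<lambda>x. g (f x)) = trace_on Y (\<lambda>y. f (g y))"
proof -
  have "trace_on X (\<lambda>x. g (f x)) = (\<Sum>b\<in>X. \<Sum>c\<in>Y. Poly_Mapping.lookup (f (unitvec b)) c * Poly_Mapping.lookup (g (unitvec c)) b)"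
    unfolding trace_on_def
    by (intro sum.cong refl) (subst linmap_expand[OF assms(2) assms(5) assms(4)], auto simp: lookup_sum)
  also have "\<dots> = (\<Sum>c\<in>Y. \<Sum>b\<in>X. Poly_Mapping.lookup (g (unitvec c)) b * Poly_Mapping.lookup (f (unitvec b)) c)"
    by (subst sum.swap) (simp add: mult.commute)
  also have "\<dots> = trace_on Y (\<lambda>y. f (g y))"
    unfolding trace_on_def
    by (intro sum.cong refl) (subst linmap_expand[OF assms(1) assms(6) assms(3)], auto simp: lookup_sum)
  finally show ?thesis .
qed

lemma trace_on_diff: "trace_on X (\<lambda>x. f x - g x) = trace_on X f - trace_on X g"
  by (simp add: trace_on_def lookup_minus sum_subtractf)

lemma trace_on_cong: "(\<And>b. b \<in> X \<Longrightarrow> f (unitvec b) = g (unitvec b)) \<Longrightarrow> trace_on X f = trace_on X g"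
  by (simp add: trace_on_def)

lemma trace_on_lin_extend_unitvec:
  assumes "finite X"
  shows "trace_on X (lin_extend (\<lambda>b. unitvec (p b))) = of_nat (card {b\<in>X. p b = b})"
  using assms by (simp add: trace_on_def lookup_single when_def sum.If_cases Int_def)


section \<open>Flags of subsets and their free sets\<close>

text \<open>
  The letter \<open>a\<close> enters a chain through \<open>A\<close> while the smaller letter \<open>b\<close> is still missing. The
  condition \<open>0 < b\<close> keeps \<open>b\<close> in the ground set \<open>{1..n}\<close>.
\<close>
definition inversions :: "nat set \<Rightarrow> (nat \<times> nat) set" where
  "inversions A = {(a, b). a \<in> A \<and> b \<notin> A \<and> 0 < b \<and> b < a}"

text \<open>
  Chains in the Boolean lattice of \<open>{1..n}\<close>, kept as sets of sets and not as lists, whose members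
  have cardinalities in \<open>S\<close>. The empty chain is a flag, so the complex built from flags is the
  augmented one.
\<close>
definition flags :: "nat \<Rightarrow> nat set \<Rightarrow> nat set set set" where
  "flags n S = {\<Gamma>. \<Gamma> \<subseteq> Pow {1..n} \<and> (\<forall>A\<in>\<Gamma>. \<forall>G\<in>\<Gamma>. A \<subseteq> G \<or> G \<subseteq> A) \<and> card ` \<Gamma> \<subseteq> S}"

text \<open>
  The sets that can be toggled: such a set is a member of the flag or can be inserted into it, and
  in both cases the union of the inversions of the flag is the same with and without it. If the flag
  is read as an ordered set partition, a member is free when all letters of the block that ends at
  it are smaller than all letters of the next block.
\<close>
definition free_sets :: "nat \<Rightarrow> nat set \<Rightarrow> nat set set \<Rightarrow> nat set set" where
  "free_sets n S \<Gamma> = {A. A \<subseteq> {1..n} \<and> card A \<in> S \<and> (\<forall>G\<in>\<Gamma>. A \<subseteq> G \<or> G \<subseteq> A) \<and>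
     inversions A \<subseteq> \<Union> (inversions ` (\<Gamma> - {A}))}"

text \<open>
  Two incomparable sets would differ in letters \<open>a\<close> and \<open>b\<close> on opposite sides. The larger of the two
  gives an inversion of one of the sets, and the member \<open>G\<close> that accounts for it separates the
  letters in the order which contradicts comparability of \<open>G\<close> with the other set.
\<close>
lemma free_sets_comparable:
  assumes "\<And>G. G \<in> \<Gamma> \<Longrightarrow> A \<subseteq> G \<or> G \<subseteq> A" "\<And>G. G \<in> \<Gamma> \<Longrightarrow> A' \<subseteq> G \<or> G \<subseteq> A'"
    "inversions A \<subseteq> \<Union> (inversions ` \<Gamma>)" "inversions A' \<subseteq> \<Union> (inversions ` \<Gamma>)"
    "0 \<notin> A" "0 \<notin> A'"
  shows "A \<subseteq> A' \<or> A' \<subseteq> A"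
proof (rule ccontr)
  assume "\<not> ?thesis"
  then obtain a b where ab: "a \<in> A" "a \<notin> A'" "b \<in> A'" "b \<notin> A" by blast
  have pos: "0 < a" "0 < b" using ab assms(5,6) by (metis gr0I)+
  have "a \<noteq> b" using ab by auto
  then consider "b < a" | "a < b" by linarith
  then show False
  proof cases
    case 1
    then have "(a, b) \<in> inversions A" using ab pos by (simp add: inversions_def)
    then obtain G where "G \<in> \<Gamma>" "a \<in> G" "b \<notin> G" using assms(3) by (fastforce simp: inversions_def)
    then show False using assms(2)[of G] ab by blast
  next
    case 2
    then have "(b, a) \<in> inversions A'" using ab pos by (simp add: inversions_def)
    then obtain G where "G \<in> \<Gamma>" "b \<in> G" "a \<notin> G" using assms(4) by (fastforce simp: inversions_def)
    then show False using assms(1)[of G] ab by blast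
  qed
qed

text \<open>
  If the two sets only accounted for a common inversion \<open>(a, b)\<close> of each other, take a letter \<open>z\<close>
  that lies in exactly one of them. Since \<open>b < a\<close>, either \<open>z < a\<close> or \<open>b < z\<close>, so \<open>(a, z)\<close> or
  \<open>(z, b)\<close> is an inversion of exactly one of the sets. A member \<open>G\<close> of \<open>\<Gamma>\<close> accounts for it, and by
  comparability \<open>G\<close> already contains the inversion \<open>(a, b)\<close>.
\<close>
lemma free_sets_exchange:
  assumes "\<And>G. G \<in> \<Gamma> \<Longrightarrow> A \<subseteq> G \<or> G \<subseteq> A" "\<And>G. G \<in> \<Gamma> \<Longrightarrow> A' \<subseteq> G \<or> G \<subseteq> A'"
    "inversions A \<subseteq> \<Union> (inversions ` insert A' \<Gamma>)" "inversions A' \<subseteq> \<Union> (inversions ` insert A \<Gamma>)"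
    "0 \<notin> A" "0 \<notin> A'" "A \<noteq> A'" "A \<subseteq> A' \<or> A' \<subseteq> A"
  shows "inversions A' \<subseteq> \<Union> (inversions ` \<Gamma>)"
proof (rule subrelI, rule ccontr)
  fix a b assume ab: "(a, b) \<in> inversions A'" "(a, b) \<notin> \<Union> (inversions ` \<Gamma>)"
  then have *: "a \<in> A'" "b \<notin> A'" "0 < b" "b < a" by (auto simp: inversions_def)
  have A: "(a, b) \<in> inversions A" using assms(4) ab by auto
  then have **: "a \<in> A" "b \<notin> A" by (auto simp: inversions_def)
  have noG: "b \<in> G" if "G \<in> \<Gamma>" "a \<in> G" for G using ab(2) that * by (auto simp: inversions_def)
  \<comment> \<open>A letter that the two sets disagree on.\<close>
  from assms(7,8) obtain z where z: "z \<in> A \<and> z \<notin> A' \<or> z \<in> A' \<and> z \<notin> A" by blast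
  have z0: "0 < z" using z assms(5,6) by (metis gr0I)
  have in1: "p \<in> inversions A \<Longrightarrow> p \<notin> inversions A' \<Longrightarrow> \<exists>G\<in>\<Gamma>. p \<in> inversions G" for p
    using assms(3) by blast
  have in2: "p \<in> inversions A' \<Longrightarrow> p \<notin> inversions A \<Longrightarrow> \<exists>G\<in>\<Gamma>. p \<in> inversions G" for p
    using assms(4) by blast
  consider "z < a" | "b < z" using *(4) by linarith
  then show False
  proof cases
    case 1
    then obtain G where G: "G \<in> \<Gamma>" "a \<in> G" "z \<notin> G"
      using z in1[of "(a, z)"] in2[of "(a, z)"] z0 * ** by (fastforce simp: inversions_def)
    then show False using noG[of G] assms(1,2)[of G] z * ** by blast
  next
    case 2
    then obtain G where G: "G \<in> \<Gamma>" "z \<in> G" "b \<notin> G"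
      using z in1[of "(z, b)"] in2[of "(z, b)"] z0 * ** by (fastforce simp: inversions_def)
    then have "a \<notin> G" using noG by blast
    then show False using G assms(1,2)[of G] z * ** by blast
  qed
qed

text \<open>
  The property that makes a consistent matching possible: a choice that depends only on the free
  sets is not affected by toggling a free set.
\<close>
lemma free_sets_insert:
  assumes \<Gamma>: "insert A \<Gamma> \<in> flags n S" and A: "A \<notin> \<Gamma>"
    and free: "inversions A \<subseteq> \<Union> (inversions ` \<Gamma>)"
  shows "free_sets n S (insert A \<Gamma>) = free_sets n S \<Gamma>"
proof (rule Set.set_eqI)
  fix B
  have z: "0 \<notin> G" if "G \<in> insert A \<Gamma>" for G
  proof -
    have "G \<subseteq> {1..n}" using \<Gamma> that unfolding flags_def by blast
    then show ?thesis by auto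
  qed
  have comp: "\<And>G H. G \<in> insert A \<Gamma> \<Longrightarrow> H \<in> insert A \<Gamma> \<Longrightarrow> G \<subseteq> H \<or> H \<subseteq> G"
    using \<Gamma> unfolding flags_def by blast
  have AS: "A \<subseteq> {1..n}" "card A \<in> S" using \<Gamma> by (auto simp: flags_def)
  show "B \<in> free_sets n S (insert A \<Gamma>) \<longleftrightarrow> B \<in> free_sets n S \<Gamma>"
  proof (cases "B = A")
    case True
    then show ?thesis using AS free A comp by (auto simp: free_sets_def)
  next
    case BA: False
    show ?thesis
    proof (cases "B \<in> \<Gamma>")
      case True
      let ?D = "\<Gamma> - {B}"
      have "inversions B \<subseteq> \<Union> (inversions ` ?D)" if "inversions B \<subseteq> \<Union> (inversions ` (insert A \<Gamma> - {B}))"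
      proof (rule free_sets_exchange[where A = A and \<Gamma> = ?D])
        show "inversions A \<subseteq> \<Union> (inversions ` insert B (\<Gamma> - {B}))"
          using free True by (simp add: insert_absorb)
        show "inversions B \<subseteq> \<Union> (inversions ` insert A (\<Gamma> - {B}))"
          using that BA by (simp add: insert_Diff_if)
      qed (use comp z True BA in auto)
      then show ?thesis using comp True BA by (auto simp: free_sets_def insert_Diff_if)
    next
      case False
      have "A \<subseteq> B \<or> B \<subseteq> A" if "B \<in> free_sets n S \<Gamma>"
      proof (rule free_sets_comparable[where \<Gamma> = \<Gamma>])
        show "inversions B \<subseteq> \<Union> (inversions ` \<Gamma>)" "0 \<notin> B" using that False by (auto simp: free_sets_def)
        show "\<And>G. G \<in> \<Gamma> \<Longrightarrow> B \<subseteq> G \<or> G \<subseteq> B" using that by (auto simp: free_sets_def)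
      qed (use comp z free in auto)
      moreover have "\<Union> (inversions ` insert A \<Gamma>) = \<Union> (inversions ` \<Gamma>)" using free by auto
      moreover have "insert A \<Gamma> - {B} = insert A \<Gamma>" "\<Gamma> - {B} = \<Gamma>" using False BA by auto
      ultimately show ?thesis by (auto simp: free_sets_def)
    qed
  qed
qed

lemma initial_part_exists:
  fixes W :: "nat set"
  assumes "finite W" "m \<le> card W"
  shows "\<exists>B\<subseteq>W. card B = m \<and> (\<forall>x\<in>B. \<forall>y\<in>W - B. x < y)"
  using assms
proof (induction m arbitrary: W)
  case 0
  show ?case by (rule exI[of _ "{}"]) simp
next
  case (Suc m)
  have ne: "W \<noteq> {}" using Suc.prems(2) by (metis card.empty not_less_eq_eq zero_le)
  define x where "x = Min W"
  have x: "x \<in> W" unfolding x_def using ne Suc.prems(1) by simp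
  have min: "x < y" if "y \<in> W" "y \<noteq> x" for y
    using Min_le[OF Suc.prems(1) that(1)] that(2) unfolding x_def by linarith
  have "m \<le> card (W - {x})" "finite (W - {x})" using Suc.prems x by simp_all
  from Suc.IH[OF this(2,1)] obtain B where
    B: "B \<subseteq> W - {x}" "card B = m" "\<forall>a\<in>B. \<forall>y\<in>W - {x} - B. a < y" by blast
  have "finite B" using B(1) Suc.prems(1) finite_subset by blast
  moreover have "x \<notin> B" using B(1) by blast
  ultimately have "card (insert x B) = Suc m" using B(2) by simp
  moreover have "\<forall>a\<in>insert x B. \<forall>y\<in>W - insert x B. a < y" using B(3) min by blast
  moreover have "insert x B \<subseteq> W" using B(1) x by blast
  ultimately show ?case by blast
qed

lemma Union_chain_mem:
  assumes "finite C" "C \<noteq> {}" "\<And>A G. A \<in> C \<Longrightarrow> G \<in> C \<Longrightarrow> A \<subseteq> G \<or> G \<subseteq> A"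
  shows "\<Union> C \<in> C \<and> \<Inter> C \<in> C"
  using assms
proof (induction rule: finite_ne_induct)
  case (insert A C)
  then have IH: "\<Union> C \<in> C" "\<Inter> C \<in> C" by simp_all
  have "A \<subseteq> \<Union> C \<or> \<Union> C \<subseteq> A" "A \<subseteq> \<Inter> C \<or> \<Inter> C \<subseteq> A"
    using insert.prems IH by simp_all
  then have "A \<union> \<Union> C \<in> {A, \<Union> C}" "A \<inter> \<Inter> C \<in> {A, \<Inter> C}"
    by auto
  then show ?case using IH by auto
qed auto

text \<open>
  Let \<open>U\<close> and \<open>V\<close> be the members of the chain (or \<open>\<emptyset>\<close> and \<open>{1..n}\<close>) next to the missing rank \<open>c\<close>.
  Adding the smallest letters of \<open>V - U\<close> to \<open>U\<close> until the rank is \<open>c\<close> creates no inversion inside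
  \<open>V - U\<close>, so every inversion of the resulting set is one of a member contained in \<open>U\<close> or containing
  \<open>V\<close>.
\<close>
lemma free_sets_nonempty:
  assumes \<Gamma>: "\<Gamma> \<in> flags n S" and c: "c \<in> S" "c \<le> n" "c \<notin> card ` \<Gamma>"
  shows "free_sets n S \<Gamma> \<noteq> {}"
proof -
  have fin: "finite \<Gamma>" using \<Gamma> finite_subset[of \<Gamma> "Pow {1..n}"] by (auto simp: flags_def)
  have finm: "finite G" "G \<subseteq> {1..n}" if "G \<in> \<Gamma>" for G
    using \<Gamma> that finite_subset[of G "{1..n}"] by (auto simp: flags_def)
  have comp: "\<And>A G. A \<in> \<Gamma> \<Longrightarrow> G \<in> \<Gamma> \<Longrightarrow> A \<subseteq> G \<or> G \<subseteq> A" using \<Gamma> by (auto simp: flags_def)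
  \<comment> \<open>The sets \<open>\<emptyset>\<close> and \<open>{1..n}\<close> stand in when the chain has no member below or above rank \<open>c\<close>.\<close>
  define C where "C = insert {} {G\<in>\<Gamma>. card G < c}"
  define D where "D = insert {1..n} {G\<in>\<Gamma>. c < card G}"
  define U where "U = \<Union> C"
  define V where "V = \<Inter> D"
  have "U \<in> C" unfolding U_def
    by (rule Union_chain_mem[THEN conjunct1]) (use fin comp in \<open>auto simp: C_def\<close>)
  have "V \<in> D" unfolding V_def
    by (rule Union_chain_mem[THEN conjunct2]) (use fin comp finm(2) in \<open>auto simp del: atLeastAtMost_iff simp: D_def\<close>)
  have cU: "card U \<le> c" using \<open>U \<in> C\<close> by (auto simp: C_def)
  have cV: "c \<le> card V" using \<open>V \<in> D\<close> c by (auto simp: D_def)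
  have UV: "U \<subseteq> V"
  proof -
    have "G \<subseteq> H" if "G \<in> \<Gamma>" "card G < c" "H \<in> \<Gamma>" "c < card H" for G H
      using comp[OF that(1,3)] card_mono[of G H] finm that by auto
    then show ?thesis using finm unfolding U_def V_def C_def D_def by blast
  qed
  have Vn: "V \<subseteq> {1..n}" by (auto simp: V_def D_def)
  then have fV: "finite V" "finite U" using UV by (auto intro: finite_subset)
  have "c - card U \<le> card (V - U)" using cV cU UV fV by (simp add: card_Diff_subset)
  with initial_part_exists[of "V - U" "c - card U"] fV obtain B where
    B: "B \<subseteq> V - U" "card B = c - card U" "\<forall>x\<in>B. \<forall>y\<in>V - U - B. x < y" by auto
  let ?A = "U \<union> B"
  have "finite B" using B(1) fV finite_subset by blast
  have cA: "card ?A = c" using B cU fV \<open>finite B\<close> by (subst card_Un_disjoint) auto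
  have "?A \<subseteq> G \<or> G \<subseteq> ?A" if "G \<in> \<Gamma>" for G
  proof -
    have "card G \<noteq> c" using c that by auto
    then consider "card G < c" | "c < card G" by linarith
    then show ?thesis
    proof cases
      case 1 then have "G \<subseteq> U" using that by (auto simp: U_def C_def)
      then show ?thesis by auto
    next
      case 2 then have "V \<subseteq> G" using that by (auto simp: V_def D_def)
      then show ?thesis using B UV by auto
    qed
  qed
  moreover have "inversions ?A \<subseteq> \<Union> (inversions ` (\<Gamma> - {?A}))"
  proof (rule subrelI)
    fix a b assume "(a, b) \<in> inversions ?A"
    then have ab: "a \<in> ?A" "b \<notin> ?A" "0 < b" "b < a" by (auto simp: inversions_def)
    show "(a, b) \<in> \<Union> (inversions ` (\<Gamma> - {?A}))"
    proof (cases "a \<in> U")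
      case True
      then obtain G where G: "G \<in> \<Gamma>" "card G < c" "a \<in> G" by (auto simp: U_def C_def)
      moreover have "G \<subseteq> U" using G by (auto simp: U_def C_def)
      moreover have "G \<noteq> ?A" using G(2) cA by blast
      ultimately show ?thesis using ab by (auto simp: inversions_def)
    next
      case False
      then have "a \<in> B" "b \<notin> U" "b \<notin> B" using ab by auto
      then have "b \<notin> V" using B(3) ab(4) by (meson DiffI not_less_iff_gr_or_eq)
      moreover have aV: "a \<in> V" using ab B UV by auto
      then have "b \<in> {1..n}" using ab Vn by auto
      ultimately obtain G where G: "G \<in> \<Gamma>" "c < card G" "b \<notin> G" by (auto simp: V_def D_def)
      moreover have "a \<in> G" using G aV by (auto simp: V_def D_def)
      moreover have "G \<noteq> ?A" using G(2) cA by blast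
      ultimately show ?thesis using ab by (auto simp: inversions_def)
    qed
  qed
  moreover have "?A \<subseteq> {1..n}" using UV Vn B by auto
  ultimately have "?A \<in> free_sets n S \<Gamma>" using c cA unfolding free_sets_def by blast
  then show ?thesis by auto
qed


section \<open>Exactness below the top of the complex of labelled flags\<close>

definition flag_sign :: "nat set set \<Rightarrow> nat set \<Rightarrow> 'a::field" where
  "flag_sign \<Gamma> A = (-1) ^ card {G\<in>\<Gamma>. G \<subset> A}"

text \<open>
  The simplicial boundary. The position of \<open>A\<close> in the chain, which gives the sign, is the number of
  members strictly below \<open>A\<close>.
\<close>
definition flag_boundary :: "(nat set set \<times> 'l \<Rightarrow>\<^sub>0 'a::field) \<Rightarrow> (nat set set \<times> 'l \<Rightarrow>\<^sub>0 'a)" where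
  "flag_boundary = lin_extend (\<lambda>(\<Gamma>, l). \<Sum>A\<in>\<Gamma>. scale_vec (flag_sign \<Gamma> A) (unitvec (\<Gamma> - {A}, l)))"

text \<open>
  A label \<open>l\<close> carries its own set \<open>F l\<close> of admissible ranks, so this is the basis, in degree \<open>j\<close>, of
  a direct sum of order complexes indexed by \<open>L\<close>.
\<close>
definition labelled_flags :: "nat \<Rightarrow> ('l \<Rightarrow> nat set) \<Rightarrow> 'l set \<Rightarrow> nat \<Rightarrow> (nat set set \<times> 'l) set" where
  "labelled_flags n F L j = {(\<Gamma>, l). l \<in> L \<and> \<Gamma> \<in> flags n (F l) \<and> card \<Gamma> = j}"

text \<open>
  The choice may be arbitrary, because it is made from the set of free sets alone and this set is
  invariant under toggling.
\<close>
definition pivot :: "nat \<Rightarrow> nat set \<Rightarrow> nat set set \<Rightarrow> nat set" where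
  "pivot n S \<Gamma> = (SOME A. A \<in> free_sets n S \<Gamma>)"

text \<open>Insertion of the pivot, signed so that deleting the pivot again gives back the flag.\<close>
definition flag_htpy :: "nat \<Rightarrow> ('l \<Rightarrow> nat set) \<Rightarrow> (nat set set \<times> 'l \<Rightarrow>\<^sub>0 'a::field) \<Rightarrow> (nat set set \<times> 'l \<Rightarrow>\<^sub>0 'a)" where
  "flag_htpy n F = lin_extend (\<lambda>(\<Gamma>, l). let A = pivot n (F l) \<Gamma> in
     if A \<in> \<Gamma> then 0 else scale_vec (flag_sign \<Gamma> A) (unitvec (insert A \<Gamma>, l)))"

lemma linmap_compose: "linmap f \<Longrightarrow> linmap g \<Longrightarrow> linmap (g \<circ> f)"
  by (simp add: linmap_iff)

lemma finite_flag: "\<Gamma> \<in> flags n S \<Longrightarrow> finite \<Gamma>"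
  using finite_subset[of \<Gamma> "Pow {1..n}"] by (auto simp: flags_def)

lemma finite_flags: "finite (flags n S)"
  by (rule finite_subset[of _ "Pow (Pow {1..n})"]) (auto simp: flags_def)

lemma flags_subset: "\<Gamma> \<in> flags n S \<Longrightarrow> \<Gamma>' \<subseteq> \<Gamma> \<Longrightarrow> \<Gamma>' \<in> flags n S"
  unfolding flags_def mem_Collect_eq by (meson image_mono order_trans subsetD)

lemma finite_labelled_flags: "finite L \<Longrightarrow> finite (labelled_flags n F L j)"
  by (rule finite_subset[of _ "(\<Union>l\<in>L. flags n (F l)) \<times> L"]) (auto simp: labelled_flags_def finite_flags)

lemma flag_sign_square [simp]: "flag_sign \<Gamma> A * flag_sign \<Gamma> A = 1"
  by (simp add: flag_sign_def flip: power_add mult_2)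

lemma flag_sign_insert:
  assumes "finite \<Gamma>" "G \<notin> \<Gamma>"
  shows "flag_sign (insert G \<Gamma>) A = (if G \<subset> A then - flag_sign \<Gamma> A else flag_sign \<Gamma> A)"
proof -
  have "{H \<in> insert G \<Gamma>. H \<subset> A} = (if G \<subset> A then insert G {H\<in>\<Gamma>. H \<subset> A} else {H\<in>\<Gamma>. H \<subset> A})" by auto
  then show ?thesis using assms by (simp add: flag_sign_def)
qed

lemma flag_sign_remove:
  assumes "finite \<Gamma>" "G \<in> \<Gamma>"
  shows "flag_sign (\<Gamma> - {G}) A = (if G \<subset> A then - flag_sign \<Gamma> A else flag_sign \<Gamma> A :: 'a::field)"
  using flag_sign_insert[of "\<Gamma> - {G}" G A, where 'a = 'a] assms by (simp add: insert_absorb)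

lemma linmap_flag_boundary [simp]: "linmap flag_boundary"
  and linmap_flag_htpy [simp]: "linmap (flag_htpy n F)"
  by (simp_all add: flag_boundary_def flag_htpy_def)

lemma flag_boundary_unitvec:
  "flag_boundary (unitvec (\<Gamma>, l)) = (\<Sum>A\<in>\<Gamma>. scale_vec (flag_sign \<Gamma> A) (unitvec (\<Gamma> - {A}, l)))"
  by (simp add: flag_boundary_def)

lemma flag_htpy_unitvec:
  "flag_htpy n F (unitvec (\<Gamma>, l)) = (if pivot n (F l) \<Gamma> \<in> \<Gamma> then 0
     else scale_vec (flag_sign \<Gamma> (pivot n (F l) \<Gamma>)) (unitvec (insert (pivot n (F l) \<Gamma>) \<Gamma>, l)))"
  by (simp add: flag_htpy_def Let_def)

lemma flag_boundary_supported:
  assumes "x \<in> supported_on (labelled_flags n F L (Suc j))"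
  shows "flag_boundary x \<in> supported_on (labelled_flags n F L j)"
proof (rule linmap_maps_into[OF _ assms])
  fix b assume "b \<in> labelled_flags n F L (Suc j)"
  then obtain \<Gamma> l where b: "b = (\<Gamma>, l)" "l \<in> L" "\<Gamma> \<in> flags n (F l)" "card \<Gamma> = Suc j"
    by (auto simp: labelled_flags_def)
  have "unitvec (\<Gamma> - {A}, l) \<in> supported_on (labelled_flags n F L j)" if "A \<in> \<Gamma>" for A
    using b that finite_flag[OF b(3)] flags_subset[OF b(3), of "\<Gamma> - {A}"] by (auto simp: labelled_flags_def)
  then show "flag_boundary (unitvec b) \<in> supported_on (labelled_flags n F L j)"
    unfolding b(1) flag_boundary_unitvec
    by (intro pm.subspace_sum pm.subspace_scale subspace_supported_on)
qed (auto simp: subspace_supported_on)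

lemma flag_boundary_zero:
  assumes "x \<in> supported_on (labelled_flags n F L 0)"
  shows "flag_boundary x = 0"
proof -
  have "flag_boundary x \<in> {0}"
  proof (rule linmap_maps_into[OF _ assms])
    fix b assume "b \<in> labelled_flags n F L 0"
    then have "fst b = {}" by (auto simp: labelled_flags_def dest!: finite_flag)
    then show "flag_boundary (unitvec b) \<in> {0}" by (cases b) (simp add: flag_boundary_unitvec)
  qed auto
  then show ?thesis by simp
qed

text \<open>
  Deleting \<open>A\<close> and then \<open>G\<close> cancels against deleting \<open>G\<close> and then \<open>A\<close>: removing the smaller of the
  two changes the sign that belongs to the larger.
\<close>
lemma flag_boundary_boundary:
  fixes x :: "nat set set \<times> 'l \<Rightarrow>\<^sub>0 'a::field_char_0"
  assumes "x \<in> supported_on (labelled_flags n F L j)"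
  shows "flag_boundary (flag_boundary x) = 0"
proof -
  have "(flag_boundary \<circ> flag_boundary) x \<in> {0}"
  proof (rule linmap_maps_into[OF linmap_compose[OF linmap_flag_boundary linmap_flag_boundary] assms])
    fix b assume "b \<in> labelled_flags n F L j"
    then obtain \<Gamma> l where b: "b = (\<Gamma>, l)" "\<Gamma> \<in> flags n (F l)" by (auto simp: labelled_flags_def)
    have fin: "finite \<Gamma>" using finite_flag b by blast
    let ?P = "SIGMA A:\<Gamma>. \<Gamma> - {A}"
    define f where "f = (\<lambda>(A, G). scale_vec (flag_sign \<Gamma> A * flag_sign (\<Gamma> - {A}) G :: 'a) (unitvec (\<Gamma> - {A} - {G}, l)))"
    have "flag_boundary (flag_boundary (unitvec b)) = (\<Sum>A\<in>\<Gamma>. \<Sum>G\<in>\<Gamma> - {A}. f (A, G))"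
      unfolding b(1) flag_boundary_unitvec f_def
      by (simp add: pm.linear_sum[OF linmap_flag_boundary] pm.linear_scale[OF linmap_flag_boundary]
          flag_boundary_unitvec pm.scale_sum_right)
    also have "\<dots> = (\<Sum>p\<in>?P. f p)" using fin by (subst sum.Sigma) auto
    finally have 1: "flag_boundary (flag_boundary (unitvec b)) = (\<Sum>p\<in>?P. f p)" .
    have "(\<Sum>p\<in>?P. f p) = (\<Sum>p\<in>?P. f (prod.swap p))"
      by (rule sum.reindex_bij_witness[of _ prod.swap prod.swap]) auto
    also have "\<dots> = (\<Sum>p\<in>?P. - f p)"
    proof (rule sum.cong)
      fix p assume "p \<in> ?P"
      then obtain A G where p: "p = (A, G)" "A \<in> \<Gamma>" "G \<in> \<Gamma>" "A \<noteq> G" by auto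
      then have "A \<subset> G \<or> G \<subset> A" using b(2) unfolding flags_def by blast
      then have "flag_sign \<Gamma> G * flag_sign (\<Gamma> - {G}) A = - (flag_sign \<Gamma> A * flag_sign (\<Gamma> - {A}) G :: 'a)"
        using p fin by (auto simp: flag_sign_remove)
      moreover have "\<Gamma> - {G} - {A} = \<Gamma> - {A} - {G}" by auto
      ultimately show "f (prod.swap p) = - f p" by (simp add: p f_def)
    qed simp
    also have "\<dots> = - (\<Sum>p\<in>?P. f p)" by (simp add: sum_negf)
    finally have 2: "(\<Sum>p\<in>?P. f p) = - (\<Sum>p\<in>?P. f p)" .
    \<comment> \<open>In characteristic zero, a vector equal to its negative is zero.\<close>
    have "(\<Sum>p\<in>?P. f p) = 0"
    proof (rule poly_mapping_eqI)
      fix k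
      have "Poly_Mapping.lookup (\<Sum>p\<in>?P. f p) k = - Poly_Mapping.lookup (\<Sum>p\<in>?P. f p) k"
        using arg_cong[OF 2, of "\<lambda>x. Poly_Mapping.lookup x k"] by simp
      then show "Poly_Mapping.lookup (\<Sum>p\<in>?P. f p) k = Poly_Mapping.lookup 0 k" by simp
    qed
    with 1 show "(flag_boundary \<circ> flag_boundary) (unitvec b :: nat set set \<times> 'l \<Rightarrow>\<^sub>0 'a) \<in> {0}" by simp
  qed simp
  then show ?thesis by simp
qed

lemma pivot_free:
  assumes "\<Gamma> \<in> flags n S" "card \<Gamma> < card S" "S \<subseteq> {..n}"
  shows "pivot n S \<Gamma> \<in> free_sets n S \<Gamma>"
proof -
  have "card ` \<Gamma> \<noteq> S" using assms(2) card_image_le[OF finite_flag[OF assms(1)], of card] by auto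
  moreover have "card ` \<Gamma> \<subseteq> S" using assms(1) by (auto simp: flags_def)
  ultimately obtain c where "c \<in> S" "c \<notin> card ` \<Gamma>" by blast
  then have "free_sets n S \<Gamma> \<noteq> {}" using free_sets_nonempty[OF assms(1)] assms(3) by blast
  then show ?thesis unfolding pivot_def by (simp add: some_in_eq)
qed

lemma insert_free_set:
  assumes "\<Gamma> \<in> flags n S" "A \<in> free_sets n S \<Gamma>"
  shows "insert A \<Gamma> \<in> flags n S" "\<Union> (inversions ` insert A \<Gamma>) = \<Union> (inversions ` \<Gamma>)"
proof -
  have A: "A \<subseteq> {1..n}" "card A \<in> S" "\<And>G. G \<in> \<Gamma> \<Longrightarrow> A \<subseteq> G \<or> G \<subseteq> A"
    "inversions A \<subseteq> \<Union> (inversions ` (\<Gamma> - {A}))"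
    using assms(2) by (simp_all add: free_sets_def)
  have \<Gamma>: "\<Gamma> \<subseteq> Pow {1..n}" "\<And>G H. G \<in> \<Gamma> \<Longrightarrow> H \<in> \<Gamma> \<Longrightarrow> G \<subseteq> H \<or> H \<subseteq> G" "card ` \<Gamma> \<subseteq> S"
    using assms(1) by (simp_all add: flags_def)
  show "insert A \<Gamma> \<in> flags n S"
    unfolding flags_def mem_Collect_eq using A(1-3) \<Gamma> by (metis (no_types, lifting) PowI image_insert insert_iff insert_subset order_refl)
  show "\<Union> (inversions ` insert A \<Gamma>) = \<Union> (inversions ` \<Gamma>)" using A(4) by auto
qed

lemma finite_inversions: "\<Gamma> \<in> flags n S \<Longrightarrow> finite (\<Union> (inversions ` \<Gamma>))"
  by (rule finite_subset[of _ "{..n} \<times> {..n}"]) (fastforce simp: flags_def inversions_def)+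

lemma flag_htpy_supported:
  assumes "x \<in> supported_on (labelled_flags n F L j)"
    "\<And>l. l \<in> L \<Longrightarrow> F l \<subseteq> {..n} \<and> j < card (F l)"
  shows "flag_htpy n F x \<in> supported_on (labelled_flags n F L (Suc j))"
proof (rule linmap_maps_into[OF _ assms(1)])
  fix b assume "b \<in> labelled_flags n F L j"
  then obtain \<Gamma> l where b: "b = (\<Gamma>, l)" "l \<in> L" "\<Gamma> \<in> flags n (F l)" "card \<Gamma> = j"
    by (auto simp: labelled_flags_def)
  have "pivot n (F l) \<Gamma> \<in> free_sets n (F l) \<Gamma>" using assms(2)[OF b(2)] pivot_free b by blast
  then have "unitvec (insert (pivot n (F l) \<Gamma>) \<Gamma>, l) \<in> supported_on (labelled_flags n F L (Suc j))" 
    if "pivot n (F l) \<Gamma> \<notin> \<Gamma>"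
    using b that insert_free_set[OF b(3)] finite_flag[OF b(3)] by (auto simp: labelled_flags_def)
  then show "flag_htpy n F (unitvec b) \<in> supported_on (labelled_flags n F L (Suc j))"
    unfolding b(1) flag_htpy_unitvec
    by (auto intro: pm.subspace_scale pm.subspace_0 subspace_supported_on)
qed (auto simp: subspace_supported_on)

text \<open>The filtration by the number of inversions.\<close>
definition low_flags :: "nat \<Rightarrow> ('l \<Rightarrow> nat set) \<Rightarrow> 'l set \<Rightarrow> nat \<Rightarrow> nat \<Rightarrow> (nat set set \<times> 'l) set" where
  "low_flags n F L j m = {(\<Gamma>, l) \<in> labelled_flags n F L j. card (\<Union> (inversions ` \<Gamma>)) < m}"

text \<open>
  The terms that toggle the pivot reproduce \<open>u\<close>. Deleting any other free member \<open>G\<close> leaves the pivot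
  unchanged, so inserting the pivot and deleting \<open>G\<close> commute up to sign and these terms cancel or
  vanish. What remains are deletions of members \<open>G\<close> that are not free. Each of them loses an
  inversion, and inserting a pivot afterwards does not bring it back.
\<close>
lemma flag_htpy_error:
  fixes \<Gamma> :: "nat set set" and l :: 'l
  assumes l: "l \<in> L" and \<Gamma>: "\<Gamma> \<in> flags n (F l)" and S: "card \<Gamma> < card (F l)" "F l \<subseteq> {..n}"
  defines "u \<equiv> unitvec (\<Gamma>, l) :: nat set set \<times> 'l \<Rightarrow>\<^sub>0 'a::field"
  shows "u - flag_boundary (flag_htpy n F u) - flag_htpy n F (flag_boundary u)
    \<in> supported_on (low_flags n F L (card \<Gamma>) (card (\<Union> (inversions ` \<Gamma>))))" (is "_ \<in> ?V")
proof -
  let ?S = "F l" and ?inv = "\<lambda>\<Gamma>. \<Union> (inversions ` \<Gamma>)"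
  let ?A = "pivot n ?S \<Gamma>"
  have V: "pm.subspace ?V" by (rule subspace_supported_on)
  have fin: "finite \<Gamma>" using finite_flag \<Gamma> by blast
  have A: "?A \<in> free_sets n ?S \<Gamma>" using pivot_free[OF \<Gamma>] S by blast
  have low: "unitvec (\<Gamma>', l) \<in> ?V"
    if "\<Gamma>' \<in> flags n ?S" "card \<Gamma>' = card \<Gamma>" "?inv \<Gamma>' \<subset> ?inv \<Gamma>" for \<Gamma>'
    using that l psubset_card_mono[OF finite_inversions[OF \<Gamma>] that(3)]
    by (auto simp: low_flags_def labelled_flags_def)
  have sub: "\<Gamma> - {G} \<in> flags n ?S" "card (\<Gamma> - {G}) < card ?S" for G
    using flags_subset[OF \<Gamma>] S(1) card_Diff1_le[of \<Gamma> G] by auto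
  have pivot_same: "free_sets n ?S (\<Gamma> - {G}) = free_sets n ?S \<Gamma>"
    if "G \<in> \<Gamma>" "inversions G \<subseteq> ?inv (\<Gamma> - {G})" for G
    using free_sets_insert[of G "\<Gamma> - {G}" n ?S] that \<Gamma> by (simp add: insert_absorb)
  have nonfree: "scale_vec c (flag_htpy n F (unitvec (\<Gamma> - {G}, l))) \<in> ?V"
    if G: "G \<in> \<Gamma>" "\<not> inversions G \<subseteq> ?inv (\<Gamma> - {G})" for G c
  proof -
    let ?B = "pivot n ?S (\<Gamma> - {G})"
    have B: "?B \<in> free_sets n ?S (\<Gamma> - {G})" using pivot_free[OF sub S(2)] .
    have "?inv (\<Gamma> - {G}) \<subset> ?inv \<Gamma>" using G by blast
    moreover have "card (insert ?B (\<Gamma> - {G})) = card \<Gamma>" if "?B \<notin> \<Gamma> - {G}"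
      using that fin G(1) by (metis card_insert_disjoint card_Suc_Diff1 finite_Diff)
    ultimately have "unitvec (insert ?B (\<Gamma> - {G}), l) \<in> ?V" if "?B \<notin> \<Gamma> - {G}"
      using low insert_free_set[OF sub(1) B] that by metis
    then show ?thesis unfolding flag_htpy_unitvec
      using V by (auto intro!: pm.subspace_scale dest: pm.subspace_0)
  qed
  have hb: "flag_htpy n F (flag_boundary u) = (\<Sum>G\<in>\<Gamma>. scale_vec (flag_sign \<Gamma> G) (flag_htpy n F (unitvec (\<Gamma> - {G}, l))))"
    unfolding u_def flag_boundary_unitvec
    by (simp add: pm.linear_sum[OF linmap_flag_htpy] pm.linear_scale[OF linmap_flag_htpy])
  show ?thesis
  proof (cases "?A \<in> \<Gamma>")
    case True
    have Afree: "inversions ?A \<subseteq> ?inv (\<Gamma> - {?A})" using A by (simp add: free_sets_def)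
    have "flag_htpy n F (unitvec (\<Gamma> - {?A}, l)) = scale_vec (flag_sign \<Gamma> ?A) u"
    proof -
      have "pivot n ?S (\<Gamma> - {?A}) = ?A" using pivot_same[OF True Afree] by (simp add: pivot_def)
      then show ?thesis using True fin
        by (simp add: flag_htpy_unitvec u_def insert_absorb flag_sign_remove)
    qed
    then have "flag_htpy n F (flag_boundary u) = u +
        (\<Sum>G\<in>\<Gamma> - {?A}. scale_vec (flag_sign \<Gamma> G) (flag_htpy n F (unitvec (\<Gamma> - {G}, l))))"
      unfolding hb by (simp add: sum.remove[OF fin True])
    moreover have "flag_htpy n F u = 0" using True by (simp add: u_def flag_htpy_unitvec)
    ultimately have "u - flag_boundary (flag_htpy n F u) - flag_htpy n F (flag_boundary u)
        = - (\<Sum>G\<in>\<Gamma> - {?A}. scale_vec (flag_sign \<Gamma> G) (flag_htpy n F (unitvec (\<Gamma> - {G}, l))))"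
      by (simp add: pm.linear_0[OF linmap_flag_boundary])
    also have "\<dots> \<in> ?V"
    proof (intro pm.subspace_neg pm.subspace_sum V)
      fix G assume G: "G \<in> \<Gamma> - {?A}"
      show "scale_vec (flag_sign \<Gamma> G) (flag_htpy n F (unitvec (\<Gamma> - {G}, l))) \<in> ?V"
      proof (cases "inversions G \<subseteq> ?inv (\<Gamma> - {G})")
        case True
        then have "pivot n ?S (\<Gamma> - {G}) = ?A" using pivot_same[of G] G by (simp add: pivot_def)
        then have "flag_htpy n F (unitvec (\<Gamma> - {G}, l)) = (0 :: nat set set \<times> 'l \<Rightarrow>\<^sub>0 'a)"
          using \<open>?A \<in> \<Gamma>\<close> G by (auto simp: flag_htpy_unitvec)
        then show ?thesis using V by (simp add: pm.subspace_0)
      qed (use nonfree G in auto)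
    qed
    finally show ?thesis .
  next
    case False
    let ?B = "insert ?A \<Gamma>"
    have B: "?B \<in> flags n ?S" "?inv ?B = ?inv \<Gamma>" using insert_free_set[OF \<Gamma> A] by auto
    have Bfree: "free_sets n ?S ?B = free_sets n ?S \<Gamma>"
      using free_sets_insert[OF B(1) False] B(2) by auto
    have "flag_boundary (flag_htpy n F u) = scale_vec (flag_sign \<Gamma> ?A) 
       (\<Sum>G\<in>?B. scale_vec (flag_sign ?B G) (unitvec (?B - {G}, l)))"
      using False by (simp add: u_def flag_htpy_unitvec pm.linear_scale[OF linmap_flag_boundary] flag_boundary_unitvec)
    also have "\<dots> = u + (\<Sum>G\<in>\<Gamma>. scale_vec (flag_sign \<Gamma> ?A * flag_sign ?B G) (unitvec (?B - {G}, l)))"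
      using False fin by (simp add: pm.scale_right_distrib pm.scale_sum_right flag_sign_insert u_def)
    finally have "u - flag_boundary (flag_htpy n F u) - flag_htpy n F (flag_boundary u) = 
      - (\<Sum>G\<in>\<Gamma>. scale_vec (flag_sign \<Gamma> ?A * flag_sign ?B G) (unitvec (?B - {G}, l)) + 
         scale_vec (flag_sign \<Gamma> G) (flag_htpy n F (unitvec (\<Gamma> - {G}, l))))"
      unfolding hb by (simp add: sum.distrib)
    also have "\<dots> \<in> ?V"
    proof (intro pm.subspace_neg pm.subspace_sum V)
      fix G assume G: "G \<in> \<Gamma>"
      have AG: "?A \<noteq> G" using False G by auto
      show "scale_vec (flag_sign \<Gamma> ?A * flag_sign ?B G) (unitvec (?B - {G}, l)) + 
         scale_vec (flag_sign \<Gamma> G) (flag_htpy n F (unitvec (\<Gamma> - {G}, l))) \<in> ?V"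
      proof (cases "inversions G \<subseteq> ?inv (\<Gamma> - {G})")
        case True
        then have "pivot n ?S (\<Gamma> - {G}) = ?A" using pivot_same[of G] G by (simp add: pivot_def)
        then have "flag_htpy n F (unitvec (\<Gamma> - {G}, l)) = scale_vec (flag_sign (\<Gamma> - {G}) ?A :: 'a) (unitvec (?B - {G}, l))"
          using False AG by (simp add: flag_htpy_unitvec insert_Diff_if)
        moreover have "flag_sign \<Gamma> ?A * flag_sign ?B G + flag_sign \<Gamma> G * flag_sign (\<Gamma> - {G}) ?A = (0::'a)"
        proof -
          have "?A \<subset> G \<or> G \<subset> ?A" using B(1) G AG unfolding flags_def by blast
          then show ?thesis using False fin G by (auto simp: flag_sign_insert flag_sign_remove)
        qed
        ultimately show ?thesis using V by (simp add: pm.subspace_0 flip: pm.scale_left_distrib)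
      next
        case nf: False
        have "G \<notin> free_sets n ?S \<Gamma>" using nf by (auto simp: free_sets_def)
        then have "G \<notin> free_sets n ?S ?B" using Bfree by simp
        moreover have "G \<subseteq> {1..n}" "card G \<in> ?S" "\<forall>H\<in>?B. G \<subseteq> H \<or> H \<subseteq> G"
          using B(1) G unfolding flags_def by blast+
        ultimately have "\<not> inversions G \<subseteq> ?inv (?B - {G})" by (auto simp: free_sets_def)
        then have "?inv (?B - {G}) \<subset> ?inv ?B" using G by blast
        moreover have "card (?B - {G}) = card \<Gamma>" using G False fin by simp
        ultimately have "unitvec (?B - {G}, l) \<in> ?V"
          using low[of "?B - {G}"] B flags_subset[OF B(1), of "?B - {G}"] by auto
        then show ?thesis by (rule pm.subspace_add[OF V pm.subspace_scale[OF V] nonfree[OF G nf]])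
      qed
    qed
    finally show ?thesis .
  qed
qed

text \<open>
  For a cycle \<open>x\<close> the homotopy error is \<open>x\<close> minus a boundary. It is again a cycle, with fewer
  inversions in every flag that occurs, so induction on the maximal number of inversions shows that
  \<open>x\<close> is a boundary.
\<close>
lemma flag_complex_exact:
  fixes x :: "nat set set \<times> 'l \<Rightarrow>\<^sub>0 'a::field_char_0"
  assumes "x \<in> supported_on (labelled_flags n F L j)" "flag_boundary x = 0"
    and L: "\<And>l. l \<in> L \<Longrightarrow> F l \<subseteq> {..n} \<and> j < card (F l)"
  shows "\<exists>y\<in>supported_on (labelled_flags n F L (Suc j)). flag_boundary y = x"
proof -
  have ex: "\<exists>y\<in>supported_on (labelled_flags n F L (Suc j)). flag_boundary y = x"
    if "x \<in> supported_on (low_flags n F L j m)" "flag_boundary x = 0" for x :: "nat set set \<times> 'l \<Rightarrow>\<^sub>0 'a" and m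
    using that
  proof (induction m arbitrary: x)
    case 0
    then have "x = 0" by (simp add: low_flags_def supported_on_def)
    then show ?case
      by (intro bexI[of _ 0]) (auto simp: pm.subspace_0 subspace_supported_on pm.linear_0[OF linmap_flag_boundary])
  next
    case (Suc m)
    let ?N = "\<lambda>x :: nat set set \<times> 'l \<Rightarrow>\<^sub>0 'a. x - flag_boundary (flag_htpy n F x) - flag_htpy n F (flag_boundary x)"
    have xs: "x \<in> supported_on (labelled_flags n F L j)"
      using Suc.prems(1) by (auto simp: supported_on_def low_flags_def)
    have "linmap ?N"
      by (intro pm.linear_compose_sub pm.linear_id[unfolded id_def]
          linmap_compose[OF linmap_flag_htpy linmap_flag_boundary, unfolded o_def]
          linmap_compose[OF linmap_flag_boundary linmap_flag_htpy, unfolded o_def])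
    then have "?N x \<in> supported_on (low_flags n F L j m)"
    proof (rule linmap_maps_into[OF _ Suc.prems(1)])
      fix b assume "b \<in> low_flags n F L j (Suc m)"
      then obtain \<Gamma> l where b: "b = (\<Gamma>, l)" "l \<in> L" "\<Gamma> \<in> flags n (F l)" "card \<Gamma> = j"
        "card (\<Union> (inversions ` \<Gamma>)) \<le> m" by (auto simp: low_flags_def labelled_flags_def)
      have "?N (unitvec b) \<in> supported_on (low_flags n F L (card \<Gamma>) (card (\<Union> (inversions ` \<Gamma>))))"
        unfolding b(1) using L[OF b(2)] b(4) by (intro flag_htpy_error b) auto
      moreover have "low_flags n F L (card \<Gamma>) (card (\<Union> (inversions ` \<Gamma>))) \<subseteq> low_flags n F L j m"
        using b(4,5) by (auto simp: low_flags_def)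
      ultimately show "?N (unitvec b) \<in> supported_on (low_flags n F L j m)"
        by (auto simp: supported_on_def)
    qed (rule subspace_supported_on)
    moreover have hx: "flag_htpy n F x \<in> supported_on (labelled_flags n F L (Suc j))"
      using flag_htpy_supported[OF xs L] .
    moreover have Nx: "?N x = x - flag_boundary (flag_htpy n F x)"
      using Suc.prems(2) by (simp add: pm.linear_0[OF linmap_flag_htpy])
    moreover have "flag_boundary (x - flag_boundary (flag_htpy n F x)) = 0"
      using Suc.prems(2) flag_boundary_boundary[OF hx] by (simp add: pm.linear_diff[OF linmap_flag_boundary])
    ultimately obtain y where y: "y \<in> supported_on (labelled_flags n F L (Suc j))"
      "flag_boundary y = x - flag_boundary (flag_htpy n F x)"
      using Suc.IH[of "?N x"] by auto
    then have "flag_boundary (y + flag_htpy n F x) = x" by (simp add: pm.linear_add[OF linmap_flag_boundary])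
    moreover have "y + flag_htpy n F x \<in> supported_on (labelled_flags n F L (Suc j))"
      using y hx by (intro pm.subspace_add subspace_supported_on)
    ultimately show ?case by blast
  qed
  have "x \<in> supported_on (low_flags n F L j (Suc (Max ((\<lambda>(\<Gamma>, l). card (\<Union> (inversions ` \<Gamma>))) ` Poly_Mapping.keys x))))"
    using assms(1) by (auto simp: supported_on_def low_flags_def less_Suc_eq_le intro!: Max_ge)
  from ex[OF this assms(2)] show ?thesis .
qed


section \<open>Quotient spaces and traces\<close>

definition coset :: "('b \<Rightarrow>\<^sub>0 'a::field) set \<Rightarrow> ('b \<Rightarrow>\<^sub>0 'a) \<Rightarrow> ('b \<Rightarrow>\<^sub>0 'a) set" where
  "coset B z = {z + b | b. b \<in> B}"

context
  fixes Z B :: "('b \<Rightarrow>\<^sub>0 'a::field) set"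
  assumes Z: "pm.subspace Z" and B: "pm.subspace B" and BZ: "B \<subseteq> Z"
begin

lemma coset_eq_iff: "coset B x = coset B y \<longleftrightarrow> x - y \<in> B"
proof
  assume "coset B x = coset B y"
  moreover have "x \<in> coset B x" using pm.subspace_0[OF B] by (force simp: coset_def)
  ultimately show "x - y \<in> B" by (auto simp: coset_def)
next
  assume "x - y \<in> B"
  then have "b + (x - y) \<in> B" "b - (x - y) \<in> B" if "b \<in> B" for b
    using that by (auto intro: pm.subspace_add[OF B] pm.subspace_diff[OF B])
  then show "coset B x = coset B y"
    unfolding coset_def by (force simp: algebra_simps)
qed

lemma quotient_carrier: "carrier (quotient_space Z B) = coset B ` Z"
  by (auto simp: quotient_space_def coset_def)

lemma quotient_zero: "\<zero>\<^bsub>quotient_space Z B\<^esub> = coset B 0"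
  by (auto simp: quotient_space_def coset_def)

lemma quotient_add: "coset B x \<oplus>\<^bsub>quotient_space Z B\<^esub> coset B y = coset B (x + y)"
proof -
  have "x + b + (y + b') = x + y + (b + b')" for b b' by (simp add: algebra_simps)
  moreover have "\<exists>b1 b2. b = b1 + b2 \<and> b1 \<in> B \<and> b2 \<in> B" if "b \<in> B" for b
    using that pm.subspace_0[OF B] by (intro exI[of _ b] exI[of _ 0]) auto
  ultimately show ?thesis
    unfolding quotient_space_def coset_def by (simp, safe) (metis pm.subspace_add[OF B])+
qed

lemma quotient_smult: "c \<odot>\<^bsub>quotient_space Z B\<^esub> coset B x = coset B (scale_vec c x)"
proof -
  have "scale_vec c (x + b) + b' = scale_vec c x + (scale_vec c b + b')" for b b'
    by (simp add: algebra_simps pm.scale_right_distrib)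
  moreover have "\<exists>b1 b2. scale_vec c x + b = scale_vec c (x + b1) + b2 \<and> b1 \<in> B \<and> b2 \<in> B" if "b \<in> B" for b
    using that pm.subspace_0[OF B] by (intro exI[of _ 0] exI[of _ b]) auto
  ultimately show ?thesis
    unfolding quotient_space_def coset_def
    by (simp, safe) (metis pm.subspace_add[OF B] pm.subspace_scale[OF B])+
qed

lemmas quotient_simps = quotient_carrier quotient_zero quotient_add quotient_smult

lemma quotient_module: "module class_ring (quotient_space Z B)"
proof (rule moduleI)
  show "cring (class_ring :: 'a ring)" by (rule class_cring.is_cring)
  show "abelian_group (quotient_space Z B)"
  proof (rule abelian_groupI)
    show "\<zero>\<^bsub>quotient_space Z B\<^esub> \<in> carrier (quotient_space Z B)"
      using pm.subspace_0[OF Z] by (auto simp: quotient_simps)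
    fix x assume x: "x \<in> carrier (quotient_space Z B)"
    then obtain z where z: "x = coset B z" "z \<in> Z" by (auto simp: quotient_simps)
    then have "coset B (- z) \<oplus>\<^bsub>quotient_space Z B\<^esub> x = \<zero>\<^bsub>quotient_space Z B\<^esub>"
      by (simp add: quotient_simps)
    moreover have "coset B (- z) \<in> carrier (quotient_space Z B)"
      using z pm.subspace_neg[OF Z] by (auto simp: quotient_simps)
    ultimately show "\<exists>y\<in>carrier (quotient_space Z B). y \<oplus>\<^bsub>quotient_space Z B\<^esub> x = \<zero>\<^bsub>quotient_space Z B\<^esub>"
      by blast
  qed (use pm.subspace_add[OF Z] in \<open>auto simp: quotient_simps algebra_simps\<close>)
qed (use pm.subspace_scale[OF Z] in \<open>auto simp: quotient_simps pm.scale_left_distrib pm.scale_right_distrib\<close>)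

lemma quotient_vectorspace: "vectorspace class_ring (quotient_space Z B)"
  by (intro vectorspace.intro quotient_module class_field)

lemma lincomb_quotient:
  assumes "finite A" "\<And>v. v \<in> A \<Longrightarrow> r v \<in> Z" "\<And>v. v \<in> A \<Longrightarrow> coset B (r v) = v"
  shows "module.lincomb (quotient_space Z B) c A = coset B (\<Sum>v\<in>A. scale_vec (c v) (r v))"
proof -
  interpret V: vectorspace class_ring "quotient_space Z B" by (rule quotient_vectorspace)
  show ?thesis unfolding V.lincomb_def using assms
  proof (induction A rule: finite_induct)
    case empty
    then show ?case by (simp add: quotient_zero)
  next
    case (insert w A)
    have mem: "c v \<odot>\<^bsub>quotient_space Z B\<^esub> v \<in> carrier (quotient_space Z B)" if "v \<in> insert w A" for v
    proof -
      have "v \<in> carrier (quotient_space Z B)"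
        unfolding quotient_carrier using insert.prems(1)[OF that] insert.prems(2)[OF that, symmetric] by (rule image_eqI[rotated])
      then show ?thesis by (intro V.smult_closed) auto
    qed
    have "(\<Oplus>\<^bsub>quotient_space Z B\<^esub>v\<in>insert w A. c v \<odot>\<^bsub>quotient_space Z B\<^esub> v) =
        c w \<odot>\<^bsub>quotient_space Z B\<^esub> w \<oplus>\<^bsub>quotient_space Z B\<^esub> (\<Oplus>\<^bsub>quotient_space Z B\<^esub>v\<in>A. c v \<odot>\<^bsub>quotient_space Z B\<^esub> v)"
      using insert.hyps mem by (intro V.finsum_insert) auto
    also have "\<dots> = coset B (scale_vec (c w) (r w)) \<oplus>\<^bsub>quotient_space Z B\<^esub> coset B (\<Sum>v\<in>A. scale_vec (c v) (r v))"
      using insert.IH insert.prems by (simp flip: quotient_smult)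
    finally show ?case using insert.hyps by (simp add: quotient_add)
  qed
qed

text \<open>
  The maps \<open>P\<close> and \<open>J\<close> present the quotient as a retract of the functions supported on \<open>X\<close>: on the
  quotient \<open>J\<close> after \<open>P\<close> is the identity, although \<open>P\<close> after \<open>J\<close> is only a projection. Cyclicity
  gives that \<open>P g J\<close> has the trace of \<open>g J P\<close>, which is that of \<open>g\<close> on the quotient. This evaluates
  a trace that is defined through an unspecified basis of cosets.
\<close>
lemma lin_trace_quotient:
  fixes g :: "('b \<Rightarrow>\<^sub>0 'a) \<Rightarrow> ('b \<Rightarrow>\<^sub>0 'a)" and P :: "('b \<Rightarrow>\<^sub>0 'a) \<Rightarrow> ('c \<Rightarrow>\<^sub>0 'a)" and J :: "('c \<Rightarrow>\<^sub>0 'a) \<Rightarrow> ('b \<Rightarrow>\<^sub>0 'a)"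
  assumes lin: "linmap g" "linmap P" "linmap J" and X: "finite X"
    and gZ: "\<And>z. z \<in> Z \<Longrightarrow> g z \<in> Z" and gB: "g ` B = B"
    and PX: "\<And>z. z \<in> Z \<Longrightarrow> P z \<in> supported_on X" and JZ: "\<And>x. x \<in> supported_on X \<Longrightarrow> J x \<in> Z"
    and PB: "\<And>b. b \<in> B \<Longrightarrow> P b = 0" and JP: "\<And>z. z \<in> Z \<Longrightarrow> z - J (P z) \<in> B"
  shows "lin_trace (quotient_space Z B) ((`) g) = trace_on X (\<lambda>x. P (g (J x)))"
proof -
  let ?V = "quotient_space Z B"
  interpret V: vectorspace class_ring ?V by (rule quotient_vectorspace)
  have fd: "V.fin_dim"
  proof -
    let ?A = "(\<lambda>x. coset B (J (unitvec x))) ` X"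
    have A: "?A \<subseteq> carrier ?V" using JZ by (auto simp: quotient_carrier)
    interpret S: submodule class_ring "V.span ?A" ?V by (rule V.span_is_submodule[OF A])
    have gen: "coset B (\<Sum>x\<in>Y. scale_vec (c x) (J (unitvec x))) \<in> V.span ?A" if "finite Y" "Y \<subseteq> X" for Y c
      using that
    proof (induction Y rule: finite_induct)
      case empty
      then show ?case using S.zero_closed by (simp add: quotient_zero)
    next
      case (insert x Y)
      have "coset B (J (unitvec x)) \<in> V.span ?A" using V.in_own_span[OF A] insert.prems by blast
      then have "c x \<odot>\<^bsub>?V\<^esub> coset B (J (unitvec x)) \<in> V.span ?A" by (intro S.smult_closed) auto
      then have "c x \<odot>\<^bsub>?V\<^esub> coset B (J (unitvec x)) \<oplus>\<^bsub>?V\<^esub> coset B (\<Sum>x\<in>Y. scale_vec (c x) (J (unitvec x))) \<in> V.span ?A"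
        using insert by (intro S.m_closed) auto
      then show ?case using insert.hyps by (simp add: quotient_simps)
    qed
    have "carrier ?V \<subseteq> V.span ?A"
    proof
      fix v assume "v \<in> carrier ?V"
      then obtain z where z: "z \<in> Z" "v = coset B z" by (auto simp: quotient_carrier)
      then have "v = coset B (J (P z))" using JP coset_eq_iff by simp
      also have "J (P z) = (\<Sum>x\<in>X. scale_vec (Poly_Mapping.lookup (P z) x) (J (unitvec x)))"
        by (rule linmap_expand[OF lin(3) PX[OF z(1)] X])
      finally show "v \<in> V.span ?A" using gen[OF X subset_refl] by simp
    qed
    then have "V.span ?A = carrier ?V" using S.subset by blast
    then show ?thesis unfolding V.fin_dim_def using X A by blast
  qed
  define A where "A = (SOME A. finite A \<and> V.basis A)"
  have A: "finite A" "V.basis A" using someI_ex[OF V.finite_basis_exists[OF fd]] unfolding A_def by auto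
  have AV: "A \<subseteq> carrier ?V" using A(2) by (simp add: V.basis_def)
  then have "\<forall>v\<in>A. \<exists>z\<in>Z. coset B z = v" by (auto simp: quotient_carrier)
  then obtain r where r: "\<And>v. v \<in> A \<Longrightarrow> r v \<in> Z" "\<And>v. v \<in> A \<Longrightarrow> coset B (r v) = v" by metis
  \<comment> \<open>The coordinates of the coset of \<open>z\<close>, as linear functions of \<open>z\<close>.\<close>
  define cz where "cz z = basis_coords ?V A (coset B z)" for z
  have ex1: "\<exists>!c. c \<in> extensional A \<and> coset B z = V.lincomb c A" if "z \<in> Z" for z
  proof -
    have "\<exists>!a. a \<in> A \<rightarrow>\<^sub>E carrier class_ring \<and> V.lincomb a A = coset B z"
      using V.basis_criterion[OF A(1) AV] A(2) that by (auto simp: quotient_carrier)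
    then show ?thesis by (auto simp: PiE_def Pi_def eq_commute)
  qed
  have cz: "z - (\<Sum>v\<in>A. scale_vec (cz z v) (r v)) \<in> B" if "z \<in> Z" for z
    using theI'[OF ex1[OF that]] by (simp add: cz_def basis_coords_def lincomb_quotient[OF A(1) r] coset_eq_iff)
  have cz_unique: "cz z v = d v" if "z \<in> Z" "z - (\<Sum>v\<in>A. scale_vec (d v) (r v)) \<in> B" "v \<in> A" for z d v
  proof -
    have "coset B z = V.lincomb (restrict d A) A"
      using that by (simp add: lincomb_quotient[OF A(1) r] coset_eq_iff)
    then have "cz z = restrict d A"
      unfolding cz_def basis_coords_def using ex1[OF that(1)] by (intro the1_equality) auto
    then show ?thesis using that(3) by simp
  qed
  have cz_cong: "cz z v = cz z' v" if "z - z' \<in> B" for z z' v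
    using that by (simp add: cz_def flip: coset_eq_iff)
  have cz_sum: "cz (\<Sum>y\<in>Y. scale_vec (e y) (f y)) v = (\<Sum>y\<in>Y. e y * cz (f y) v)"
    if "finite Y" "\<And>y. y \<in> Y \<Longrightarrow> f y \<in> Z" "v \<in> A" for Y :: "'c set" and e f v
  proof (rule cz_unique[OF _ _ that(3)])
    show "(\<Sum>y\<in>Y. scale_vec (e y) (f y)) \<in> Z" using that(2) by (intro pm.subspace_sum pm.subspace_scale Z)
    have "(\<Sum>v\<in>A. scale_vec (\<Sum>y\<in>Y. e y * cz (f y) v) (r v)) = (\<Sum>y\<in>Y. scale_vec (e y) (\<Sum>v\<in>A. scale_vec (cz (f y) v) (r v)))"
      by (simp add: pm.scale_sum_left pm.scale_sum_right sum.swap[of _ Y])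
    then have "(\<Sum>y\<in>Y. scale_vec (e y) (f y)) - (\<Sum>v\<in>A. scale_vec (\<Sum>y\<in>Y. e y * cz (f y) v) (r v))
      = (\<Sum>y\<in>Y. scale_vec (e y) (f y - (\<Sum>v\<in>A. scale_vec (cz (f y) v) (r v))))"
      by (simp add: pm.scale_right_diff_distrib sum_subtractf)
    also have "\<dots> \<in> B" using cz that(2) by (intro pm.subspace_sum pm.subspace_scale B) auto
    finally show "(\<Sum>y\<in>Y. scale_vec (e y) (f y)) - (\<Sum>v\<in>A. scale_vec (\<Sum>y\<in>Y. e y * cz (f y) v) (r v)) \<in> B" .
  qed
  have Pz: "P z = (\<Sum>v\<in>A. scale_vec (cz z v) (P (r v)))" if "z \<in> Z" for z
  proof -
    have "P (z - (\<Sum>v\<in>A. scale_vec (cz z v) (r v))) = 0" using PB[OF cz[OF that]] .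
    then show ?thesis
      by (simp add: pm.linear_diff[OF lin(2)] pm.linear_sum[OF lin(2)] pm.linear_scale[OF lin(2)])
  qed
  have gcoset: "g ` coset B z = coset B (g z)" for z
  proof -
    have "g ` coset B z = {g z + b | b. b \<in> g ` B}"
      by (force simp: coset_def image_iff pm.linear_add[OF lin(1)])
    then show ?thesis by (simp add: gB coset_def)
  qed
  have "trace_on X (\<lambda>x. P (g (J x))) =
      (\<Sum>x\<in>X. \<Sum>v\<in>A. cz (g (J (unitvec x))) v * Poly_Mapping.lookup (P (r v)) x)"
    unfolding trace_on_def by (intro sum.cong refl) (simp add: Pz gZ JZ lookup_sum)
  also have "\<dots> = (\<Sum>v\<in>A. \<Sum>x\<in>X. Poly_Mapping.lookup (P (r v)) x * cz (g (J (unitvec x))) v)"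
    by (subst sum.swap) (simp add: mult.commute)
  also have "\<dots> = (\<Sum>v\<in>A. cz (g (r v)) v)"
  proof (rule sum.cong)
    fix v assume v: "v \<in> A"
    have "(\<Sum>x\<in>X. Poly_Mapping.lookup (P (r v)) x * cz (g (J (unitvec x))) v)
        = cz (\<Sum>x\<in>X. scale_vec (Poly_Mapping.lookup (P (r v)) x) (g (J (unitvec x)))) v"
      using v by (intro cz_sum[symmetric] X gZ JZ) auto
    also have "(\<Sum>x\<in>X. scale_vec (Poly_Mapping.lookup (P (r v)) x) (g (J (unitvec x)))) = g (J (P (r v)))"
      by (subst linmap_expand[OF lin(3) PX[OF r(1)[OF v]] X])
        (simp add: pm.linear_sum[OF lin(1)] pm.linear_scale[OF lin(1)])
    also have "cz (g (J (P (r v)))) v = cz (g (r v)) v"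
    proof (rule sym, rule cz_cong)
      have "g (r v - J (P (r v))) \<in> B" using JP[OF r(1)[OF v]] gB by blast
      then show "g (r v) - g (J (P (r v))) \<in> B" by (simp add: pm.linear_diff[OF lin(1)])
    qed
    finally show "(\<Sum>x\<in>X. Poly_Mapping.lookup (P (r v)) x * cz (g (J (unitvec x))) v) = cz (g (r v)) v" .
  qed simp
  also have "\<dots> = (\<Sum>v\<in>A. basis_coords ?V A (g ` v) v)"
    by (intro sum.cong refl) (metis cz_def gcoset r(2))
  also have "\<dots> = lin_trace ?V ((`) g)"
    unfolding lin_trace_def Let_def A_def ..
  finally show ?thesis by simp
qed

end


section \<open>Relabelling flags, and the trace on a flag complex\<close>

definition flag_image :: "(nat \<Rightarrow> nat) \<Rightarrow> nat set set \<times> 'l \<Rightarrow> nat set set \<times> 'l" where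
  "flag_image w = (\<lambda>(\<Gamma>, l). ((`) w ` \<Gamma>, l))"

definition flag_relabel :: "(nat \<Rightarrow> nat) \<Rightarrow> (nat set set \<times> 'l \<Rightarrow>\<^sub>0 'a::field) \<Rightarrow> (nat set set \<times> 'l \<Rightarrow>\<^sub>0 'a)" where
  "flag_relabel w = lin_extend (\<lambda>b. unitvec (flag_image w b))"

lemma linmap_flag_relabel [simp]: "linmap (flag_relabel w)"
  by (simp add: flag_relabel_def)

lemma inj_on_image_Pow: "w permutes {1..n} \<Longrightarrow> inj_on ((`) w) \<Gamma>"
  by (rule inj_onI) (metis permutes_inj inj_image_eq_iff)

lemma flag_image_mem:
  assumes "w permutes {1..n}" "b \<in> labelled_flags n F L j"
  shows "flag_image w b \<in> labelled_flags n F L j"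
proof -
  obtain \<Gamma> l where b: "b = (\<Gamma>, l)" "l \<in> L" "\<Gamma> \<subseteq> Pow {1..n}"
    "\<And>A G. A \<in> \<Gamma> \<Longrightarrow> G \<in> \<Gamma> \<Longrightarrow> A \<subseteq> G \<or> G \<subseteq> A" "card ` \<Gamma> \<subseteq> F l" "card \<Gamma> = j"
    using assms(2) by (auto simp: labelled_flags_def flags_def)
  have "w ` A \<subseteq> {1..n}" if "A \<in> \<Gamma>" for A
    using that b(3) permutes_image[OF assms(1)] by blast
  then have "(`) w ` \<Gamma> \<subseteq> Pow {1..n}" by blast
  moreover have "card (w ` A) = card A" for A
    using permutes_inj[OF assms(1)] by (simp add: card_image inj_on_subset)
  then have "card ` (`) w ` \<Gamma> \<subseteq> F l" using b(5) by (simp add: image_image)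
  moreover have "card ((`) w ` \<Gamma>) = j"
    using card_image[OF inj_on_image_Pow[OF assms(1)]] b(6) by metis
  moreover have "A \<subseteq> G \<or> G \<subseteq> A" if AG: "A \<in> (`) w ` \<Gamma>" "G \<in> (`) w ` \<Gamma>" for A G
  proof -
    obtain A' G' where "A = w ` A'" "G = w ` G'" "A' \<in> \<Gamma>" "G' \<in> \<Gamma>" using AG by blast
    then show ?thesis using b(4)[of A' G'] image_mono[of A' G' w] image_mono[of G' A' w] by blast
  qed
  ultimately show ?thesis
    using b(2) by (simp add: b(1) labelled_flags_def flags_def flag_image_def)
qed

lemma flag_sign_image:
  assumes "w permutes {1..n}"
  shows "flag_sign ((`) w ` \<Gamma>) (w ` A) = flag_sign \<Gamma> A"
proof -
  have "w ` G \<subset> w ` A \<longleftrightarrow> G \<subset> A" for G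
    using permutes_inj[OF assms] by (simp add: psubset_eq inj_image_subset_iff inj_image_eq_iff)
  then have "{G \<in> (`) w ` \<Gamma>. G \<subset> w ` A} = (`) w ` {G\<in>\<Gamma>. G \<subset> A}"
    by (simp only: Compr_image_eq)
  then have "card {G \<in> (`) w ` \<Gamma>. G \<subset> w ` A} = card {G\<in>\<Gamma>. G \<subset> A}"
    by (simp only: card_image[OF inj_on_image_Pow[OF assms]])
  then show ?thesis by (simp only: flag_sign_def)
qed

lemma flag_boundary_relabel:
  assumes w: "w permutes {1..n}" and x: "x \<in> supported_on (labelled_flags n F L j)"
  shows "flag_boundary (flag_relabel w x) = flag_relabel w (flag_boundary x)"
proof -
  have "(flag_boundary \<circ> flag_relabel w) x = (flag_relabel w \<circ> flag_boundary) x"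
  proof (rule linmap_eq_on[OF linmap_compose[OF linmap_flag_relabel linmap_flag_boundary]
        linmap_compose[OF linmap_flag_boundary linmap_flag_relabel] x])
    fix b assume "b \<in> labelled_flags n F L j"
    obtain \<Gamma> l where b: "b = (\<Gamma>, l)" by (cases b)
    have "(`) w ` (\<Gamma> - {A}) = (`) w ` \<Gamma> - {w ` A}" for A
      using permutes_inj[OF w] by (auto simp: inj_image_eq_iff)
    then show "(flag_boundary \<circ> flag_relabel w) (unitvec b) = (flag_relabel w \<circ> flag_boundary) (unitvec b)"
      by (simp add: b flag_relabel_def flag_image_def flag_boundary_unitvec pm.linear_sum[OF linmap_lin_extend]
          pm.linear_scale[OF linmap_lin_extend] sum.reindex[OF inj_on_image_Pow[OF w]] flag_sign_image[OF w])
  qed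
  then show ?thesis by simp
qed

lemma flag_relabel_supported:
  assumes "w permutes {1..n}" "x \<in> supported_on (labelled_flags n F L j)"
  shows "flag_relabel w x \<in> supported_on (labelled_flags n F L j)"
  by (rule linmap_maps_into[OF _ assms(2)])
    (simp_all add: flag_relabel_def flag_image_mem[OF assms(1)] subspace_supported_on)

text \<open>
  A linear right inverse of the boundary on its image. It need not commute with the permutations,
  which is why the equivariant information is extracted from traces only.
\<close>
lemma flag_section_exists:
  "\<exists>s :: (nat set set \<times> 'l \<Rightarrow>\<^sub>0 'a::field) \<Rightarrow> (nat set set \<times> 'l \<Rightarrow>\<^sub>0 'a). linmap s \<and> range s \<subseteq> supported_on (labelled_flags n F L j) \<and>
     (\<forall>y\<in>supported_on (labelled_flags n F L j). flag_boundary (s (flag_boundary y)) = (flag_boundary y))"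
  using pm.linear_exists_right_inverse_on[OF linmap_flag_boundary subspace_supported_on] by (metis imageI)

text \<open>
  The map \<open>s\<close> after the boundary projects the \<open>j\<close>-chains onto a complement of the cycles. By
  cyclicity, its composition with \<open>w\<close> has the trace of \<open>w\<close> on the boundaries in degree \<open>j - 1\<close>, that
  is, on the cycles there, because the complex is exact below the top. The cycles are what the
  projection one degree lower leaves out, so the traces satisfy a recursion whose solution is the
  alternating sum.
\<close>
lemma trace_flag_section:
  fixes s :: "(nat set set \<times> 'l \<Rightarrow>\<^sub>0 'a::field_char_0) \<Rightarrow> (nat set set \<times> 'l \<Rightarrow>\<^sub>0 'a)"
  assumes w: "w permutes {1..n}" and L: "finite L" "\<And>l. l \<in> L \<Longrightarrow> F l \<subseteq> {..n} \<and> j \<le> card (F l)"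
    and s: "linmap s" "range s \<subseteq> supported_on (labelled_flags n F L j)"
      "\<And>y. y \<in> supported_on (labelled_flags n F L j) \<Longrightarrow> flag_boundary (s (flag_boundary y)) = flag_boundary y"
  shows "trace_on (labelled_flags n F L j) (\<lambda>x. flag_relabel w (s (flag_boundary x))) =
    (\<Sum>i<j. (-1) ^ (j - 1 - i) * of_nat (card {b\<in>labelled_flags n F L i. flag_image w b = b}))"
  using L(2) s
proof (induction j arbitrary: s)
  case 0
  have "flag_boundary (unitvec b :: nat set set \<times> 'l \<Rightarrow>\<^sub>0 'a) = 0" if "b \<in> labelled_flags n F L 0" for b
    using that by (intro flag_boundary_zero) simp
  then show ?case
    by (simp add: trace_on_def pm.linear_0[OF 0(2)] pm.linear_0[OF linmap_flag_relabel])
next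
  case (Suc j)
  let ?X = "labelled_flags n F L" and ?W = "flag_relabel w"
  have fin: "finite (?X i)" for i using finite_labelled_flags[OF L(1)] .
  from flag_section_exists[of n F L j, where 'a = 'a]
  obtain s' :: "(nat set set \<times> 'l \<Rightarrow>\<^sub>0 'a) \<Rightarrow> (nat set set \<times> 'l \<Rightarrow>\<^sub>0 'a)" where
    s': "linmap s'" "range s' \<subseteq> supported_on (?X j)"
    "\<And>y. y \<in> supported_on (?X j) \<Longrightarrow> flag_boundary (s' (flag_boundary y)) = flag_boundary y"
    by (elim exE conjE) (rule that, auto)
  have IH: "trace_on (?X j) (\<lambda>x. ?W (s' (flag_boundary x))) =
    (\<Sum>i<j. (-1) ^ (j - 1 - i) * of_nat (card {b\<in>?X i. flag_image w b = b}))"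
    using Suc.prems(1) by (intro Suc.IH s') (use Suc_leD in blast)+
  \<comment> \<open>Restricting \<open>s\<close> to the cycles first changes nothing after a boundary, but makes the boundary of \<open>?H\<close> computable.\<close>
  let ?H = "\<lambda>x. s (x - s' (flag_boundary x))"
  have linH: "linmap ?H"
    using linmap_compose[OF pm.linear_compose_sub[OF pm.linear_id[unfolded id_def]
        linmap_compose[OF linmap_flag_boundary s'(1), unfolded o_def]] Suc.prems(2)]
    by (simp add: o_def)
  have linWH: "linmap (\<lambda>x. ?W (?H x))"
    using linmap_compose[OF linH linmap_flag_relabel] by (simp add: o_def)
  have HX: "?H x \<in> supported_on (?X (Suc j))" for x using Suc.prems(3) by auto
  have bd: "flag_boundary (unitvec b :: nat set set \<times> 'l \<Rightarrow>\<^sub>0 'a) \<in> supported_on (?X j)" if "b \<in> ?X (Suc j)" for b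
    using flag_boundary_supported[of "unitvec b"] that by simp
  have "trace_on (?X (Suc j)) (\<lambda>x. ?W (s (flag_boundary x))) = trace_on (?X (Suc j)) (\<lambda>x. ?W (?H (flag_boundary x)))"
  proof (rule trace_on_cong)
    fix b assume "b \<in> ?X (Suc j)"
    then have "flag_boundary (flag_boundary (unitvec b :: nat set set \<times> 'l \<Rightarrow>\<^sub>0 'a)) = 0"
      using flag_boundary_boundary[of "unitvec b"] by simp
    then show "?W (s (flag_boundary (unitvec b))) = ?W (?H (flag_boundary (unitvec b)))"
      by (simp add: pm.linear_0[OF s'(1)])
  qed
  also have "\<dots> = trace_on (?X j) (\<lambda>x. flag_boundary (?W (?H x)))"
    by (rule trace_on_commute[OF linmap_flag_boundary linWH fin fin bd])
      (auto intro!: flag_relabel_supported[OF w] HX)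
  also have "\<dots> = trace_on (?X j) (\<lambda>x. ?W x - ?W (s' (flag_boundary x)))"
  proof (rule trace_on_cong)
    fix b assume b: "b \<in> ?X j"
    let ?u = "unitvec b :: nat set set \<times> 'l \<Rightarrow>\<^sub>0 'a"
    have "flag_boundary (s' (flag_boundary ?u)) = flag_boundary ?u" using s'(3) b by simp
    then have "flag_boundary (?u - s' (flag_boundary ?u)) = 0" by (simp add: pm.linear_diff[OF linmap_flag_boundary])
    moreover have "?u - s' (flag_boundary ?u) \<in> supported_on (?X j)"
      using s'(2) b by (intro pm.subspace_diff subspace_supported_on) auto
    ultimately obtain y where y: "y \<in> supported_on (?X (Suc j))" "flag_boundary y = ?u - s' (flag_boundary ?u)"
      using flag_complex_exact Suc.prems(1) by (metis Suc_le_lessD)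
    have "flag_boundary (?W (?H ?u)) = ?W (flag_boundary (?H ?u))"
      by (rule flag_boundary_relabel[OF w HX])
    also have "flag_boundary (?H ?u) = ?u - s' (flag_boundary ?u)"
      using Suc.prems(4)[OF y(1)] y(2) by simp
    finally show "flag_boundary (?W (?H ?u)) = ?W ?u - ?W (s' (flag_boundary ?u))"
      by (simp add: pm.linear_diff[OF linmap_flag_relabel])
  qed
  also have "\<dots> = of_nat (card {b\<in>?X j. flag_image w b = b}) -
      (\<Sum>i<j. (-1) ^ (j - 1 - i) * of_nat (card {b\<in>?X i. flag_image w b = b}))"
    unfolding trace_on_diff IH by (simp add: flag_relabel_def trace_on_lin_extend_unitvec[OF fin])
  also have "\<dots> = (\<Sum>i<Suc j. (-1) ^ (Suc j - 1 - i) * of_nat (card {b\<in>?X i. flag_image w b = b}))"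
  proof -
    have "(- 1) ^ (j - i) = - ((- 1) ^ (j - 1 - i) :: 'a)" if "i < j" for i
    proof -
      have "j - i = Suc (j - 1 - i)" using that by simp
      then show ?thesis by (metis mult_minus1 power_Suc)
    qed
    then have "(\<Sum>i<j. (-1) ^ (j - i) * of_nat (card {b\<in>?X i. flag_image w b = b})) =
      - (\<Sum>i<j. (-1) ^ (j - 1 - i) * of_nat (card {b\<in>?X i. flag_image w b = b}) :: 'a)"
      by (simp flip: sum_negf)
    then show ?thesis by simp
  qed
  finally show ?case .
qed


section \<open>Frobenius characteristic of the ordered set partitions\<close>

text \<open>
  The multiset of colours used; for colours in \<open>nat\<close> this is the monomial of the colouring.
\<close>
definition colour_content :: "'x set \<Rightarrow> ('x \<Rightarrow> 'c) \<Rightarrow> 'c multiset" where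
  "colour_content X h = image_mset h (mset_set X)"

definition fixed_colourings :: "'x set \<Rightarrow> ('x \<Rightarrow> 'x) \<Rightarrow> ('x \<Rightarrow> 'c) set" where
  "fixed_colourings X w = {h \<in> extensional X. \<forall>x\<in>X. h (w x) = h x}"

lemma finite_colourings_content:
  assumes "finite X"
  shows "finite {h \<in> extensional X. colour_content X h = N}"
proof (rule finite_subset)
  show "{h \<in> extensional X. colour_content X h = N} \<subseteq> X \<rightarrow>\<^sub>E set_mset N"
    using assms by (auto simp: colour_content_def PiE_def)
qed (use assms in \<open>auto intro: finite_PiE\<close>)

lemma colouring_exists:
  assumes "finite X" "size N = card X"
  shows "\<exists>h\<in>extensional X. colour_content X h = N"
  using assms
proof (induction X arbitrary: N rule: finite_induct)
  case empty
  then show ?case by (auto simp: colour_content_def)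
next
  case (insert x X)
  then obtain c N' where N: "N = add_mset c N'" by (metis card_insert_disjoint size_eq_Suc_imp_eq_union add_mset_add_single union_mset_add_mset_right)
  with insert obtain h where h: "h \<in> extensional X" "colour_content X h = N'" by auto
  have "image_mset (h(x := c)) (mset_set X) = image_mset h (mset_set X)"
    using insert.hyps by (intro image_mset_cong) auto
  then have "colour_content (insert x X) (h(x := c)) = N"
    using insert.hyps h(2) by (simp add: colour_content_def N)
  moreover have "h(x := c) \<in> extensional (insert x X)" using h(1) by (auto simp: extensional_def)
  ultimately show ?case by blast
qed

text \<open>
  Burnside: the colourings with a given content form a single orbit under the permutations of \<open>X\<close>.
  The number of pairs of a permutation and a colouring that it fixes is therefore the order of the
  group. The proof compares the stabilizer of \<open>h\<close> with the set of permutations that carry a fixed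
  colouring \<open>h0\<close> to \<open>h\<close>.
\<close>
lemma sum_card_fixed_colourings:
  assumes X: "finite X" and N: "size N = card X"
  shows "(\<Sum>w | w permutes X. card {h \<in> fixed_colourings X w. colour_content X h = N}) = fact (card X)"
proof -
  let ?W = "{w. w permutes X}" and ?H = "{h \<in> extensional X. colour_content X h = N}"
  have finW: "finite ?W" using X by (rule finite_permutations)
  have finH: "finite ?H" using X by (rule finite_colourings_content)
  obtain h0 where h0: "h0 \<in> ?H" using colouring_exists[OF X N] by blast
  have stab: "card {w\<in>?W. \<forall>x\<in>X. h (w x) = h x} = card {w\<in>?W. \<forall>x\<in>X. h0 (w x) = h x}" if h: "h \<in> ?H" for h
  proof -
    have "image_mset h (mset_set X) = image_mset h0 (mset_set X)"
      using h h0 by (simp add: colour_content_def)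
    with X obtain v where v0: "v permutes X" "\<forall>x\<in>X. h x = h0 (v x)"
      by (rule image_mset_eq_implies_permutes)
    then have v: "v permutes X" "\<And>x. x \<in> X \<Longrightarrow> h x = h0 (v x)" by simp_all
    have iv: "inv_into UNIV v permutes X" using permutes_inv[OF v(1)] .
    have "bij_betw (\<lambda>w. v \<circ> w) {w\<in>?W. \<forall>x\<in>X. h (w x) = h x} {w\<in>?W. \<forall>x\<in>X. h0 (w x) = h x}"
    proof (rule bij_betwI[where g = "\<lambda>w. inv_into UNIV v \<circ> w"])
      show "(\<lambda>w. v \<circ> w) \<in> {w\<in>?W. \<forall>x\<in>X. h (w x) = h x} \<rightarrow> {w\<in>?W. \<forall>x\<in>X. h0 (w x) = h x}"
        using v by (auto intro: permutes_compose simp: permutes_in_image)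
      show "(\<lambda>w. inv_into UNIV v \<circ> w) \<in> {w\<in>?W. \<forall>x\<in>X. h0 (w x) = h x} \<rightarrow> {w\<in>?W. \<forall>x\<in>X. h (w x) = h x}"
        using v iv by (auto intro: permutes_compose simp: permutes_in_image permutes_inverses(1)[OF v(1)])
      show "inv_into UNIV v \<circ> (v \<circ> w) = w" "v \<circ> (inv_into UNIV v \<circ> w) = w" for w
        using permutes_inverses[OF v(1)] by (simp_all add: fun_eq_iff)
    qed
    then show ?thesis by (rule bij_betw_same_card)
  qed
  have "(\<Sum>w\<in>?W. card {h \<in> fixed_colourings X w. colour_content X h = N})
      = (\<Sum>w\<in>?W. card {h\<in>?H. \<forall>x\<in>X. h (w x) = h x})"
    by (intro sum.cong refl arg_cong[of _ _ card]) (auto simp: fixed_colourings_def)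
  also have "\<dots> = (\<Sum>h\<in>?H. card {w\<in>?W. \<forall>x\<in>X. h (w x) = h x})"
    using sum.swap_restrict[OF finW finH, of "\<lambda>_ _. 1::nat" "\<lambda>w h. \<forall>x\<in>X. h (w x) = h x"] by simp
  also have "\<dots> = (\<Sum>h\<in>?H. card {w\<in>?W. \<forall>x\<in>X. h0 (w x) = h x})"
    using stab by (intro sum.cong) auto
  also have "\<dots> = (\<Sum>w\<in>?W. card {h\<in>?H. \<forall>x\<in>X. h0 (w x) = h x})"
    using sum.swap_restrict[OF finW finH, of "\<lambda>_ _. 1::nat" "\<lambda>w h. \<forall>x\<in>X. h0 (w x) = h x"] by simp
  also have "\<dots> = (\<Sum>w\<in>?W. 1)"
  proof (intro sum.cong refl)
    fix w assume w: "w \<in> ?W"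
    have "colour_content X (restrict (h0 \<circ> w) X) = image_mset h0 (image_mset w (mset_set X))"
      unfolding colour_content_def image_mset.compositionality using X by (intro image_mset_cong) auto
    also have "image_mset w (mset_set X) = mset_set X"
      using image_mset_mset_set[of w X] w permutes_inj[of w X] permutes_image[of w X] by (auto intro: inj_on_subset)
    finally have "colour_content X (restrict (h0 \<circ> w) X) = N" using h0 by (simp only: colour_content_def mem_Collect_eq)
    then have "restrict (h0 \<circ> w) X \<in> ?H" by simp
    moreover have "h = restrict (h0 \<circ> w) X" if "h \<in> ?H" "\<forall>x\<in>X. h0 (w x) = h x" for h
      using that by (auto intro!: extensionalityI[of h X])
    ultimately have "{h\<in>?H. \<forall>x\<in>X. h0 (w x) = h x} = {restrict (h0 \<circ> w) X}" by auto
    then show "card {h\<in>?H. \<forall>x\<in>X. h0 (w x) = h x} = 1" by simp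
  qed
  also have "\<dots> = fact (card X)" using card_permutations[OF refl X] by simp
  finally show ?thesis .
qed

lemma mcoeff_mult: "mcoeff (f * g) M = (\<Sum>(A, B)\<in>msplits M. mcoeff f A * mcoeff g B)"
  by (simp add: times_mpser_def)

lemma mcoeff_one: "mcoeff 1 M = (if M = {#} then 1 else 0)"
  by (simp add: one_mpser_def)

lemma mcoeff_complete_sym: "mcoeff (complete_sym r) M = (if size M = r then 1 else 0)"
  by (simp add: complete_sym_def)

lemma mcoeff_power_sum: "mcoeff (power_sum r) M = (if \<exists>i. M = replicate_mset r i then 1 else 0)"
  by (simp add: power_sum_def)

text \<open>
  Choosing a variable for each factor is a colouring of the set \<open>\<Z>\<close>, in which \<open>Z\<close> counts \<open>card Z\<close>
  times.
\<close>
lemma mcoeff_prod_power_sum: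
  fixes \<Z> :: "'b set set"
  assumes "finite \<Z>" "\<And>Z. Z \<in> \<Z> \<Longrightarrow> finite Z \<and> Z \<noteq> {}"
  shows "mcoeff (\<Prod>Z\<in>\<Z>. power_sum (card Z) :: 'a::comm_ring_1 mpser) M =
    of_nat (card {g \<in> extensional \<Z>. (\<Sum>Z\<in>\<Z>. replicate_mset (card Z) (g Z)) = M})"
  using assms
proof (induction \<Z> arbitrary: M rule: finite_induct)
  case empty
  have "{g \<in> extensional {}. {#} = M} = (if M = {#} then {\<lambda>_. undefined} else {})" by auto
  then show ?case by (auto simp: mcoeff_one)
next
  case (insert Z \<Z>)
  let ?G = "\<lambda>B. {g \<in> extensional \<Z>. (\<Sum>Z\<in>\<Z>. replicate_mset (card Z) (g Z)) = B}"
  let ?I = "{i. replicate_mset (card Z) i \<subseteq># M}"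
  let ?rep = "\<lambda>i. replicate_mset (card Z) i"
  have pos: "0 < card Z" using insert.prems by (simp add: card_gt_0_iff)
  have repinj: "?rep i = ?rep j \<longleftrightarrow> i = j" for i j :: nat using pos by (metis replicate_mset_eq_empty_iff gr_implies_not0 in_replicate_mset)
  have finG: "finite (?G B)" for B
  proof (rule finite_subset)
    show "?G B \<subseteq> \<Z> \<rightarrow>\<^sub>E set_mset B"
    proof
      fix g assume g: "g \<in> ?G B"
      have "g Z \<in># B" if "Z \<in> \<Z>" for Z
      proof -
        have "g Z \<in># replicate_mset (card Z) (g Z)" using insert.prems[of Z] that by (simp add: card_gt_0_iff)
        moreover have "replicate_mset (card Z) (g Z) \<subseteq># B" using g insert.hyps(1) that by (auto simp: sum.remove)
        ultimately show ?thesis by (rule mset_subset_eqD[rotated])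
      qed
      then show "g \<in> \<Z> \<rightarrow>\<^sub>E set_mset B" using g by (auto simp: PiE_def)
    qed
  qed (use insert.hyps in \<open>auto intro: finite_PiE\<close>)
  have finI: "finite ?I"
  proof (rule finite_subset)
    show "?I \<subseteq> set_mset M" using pos by (metis (no_types, lifting) in_replicate_mset mem_Collect_eq mset_subset_eqD subsetI)
  qed simp
  have "mcoeff (\<Prod>Z\<in>insert Z \<Z>. power_sum (card Z) :: 'a mpser) M =
     (\<Sum>p\<in>msplits M. if \<exists>i. fst p = ?rep i then of_nat (card (?G (snd p))) else 0)"
    using insert by (simp add: mcoeff_mult case_prod_unfold mcoeff_power_sum if_distrib[of "\<lambda>x. x * _"] cong: if_cong)
  also have "\<dots> = (\<Sum>p\<in>{p\<in>msplits M. \<exists>i. fst p = ?rep i}. of_nat (card (?G (snd p))))"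
    by (simp add: sum.inter_filter)
  also have "\<dots> = (\<Sum>i\<in>?I. of_nat (card (?G (M - ?rep i))))"
  proof -
    have "bij_betw (\<lambda>i. (?rep i, M - ?rep i)) ?I {p\<in>msplits M. \<exists>i. fst p = ?rep i}"
      by (auto simp: bij_betw_def inj_on_def repinj msplits_def image_iff)
    from sum.reindex_bij_betw[OF this, of "\<lambda>p. of_nat (card (?G (snd p))) :: 'a"]
    show ?thesis by simp
  qed
  also have "\<dots> = of_nat (card (SIGMA i:?I. ?G (M - ?rep i)))"
    by (subst card_SigmaI) (use finI finG in auto)
  also have "card (SIGMA i:?I. ?G (M - ?rep i)) = 
      card {g \<in> extensional (insert Z \<Z>). (\<Sum>Z\<in>insert Z \<Z>. replicate_mset (card Z) (g Z)) = M}"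
  proof (rule bij_betw_same_card, rule bij_betwI[where g = "\<lambda>g. (g Z, restrict g \<Z>)" and f = "\<lambda>(i, g). g(Z := i)"])
    have s: "(\<Sum>Y\<in>\<Z>. replicate_mset (card Y) (if Y = Z then i else g Y)) = (\<Sum>Y\<in>\<Z>. replicate_mset (card Y) (g Y))" for g :: "'b set \<Rightarrow> nat" and i
      using insert.hyps by (intro sum.cong) auto
    have e: "g(Z := i) \<in> extensional (insert Z \<Z>)" if "g \<in> extensional \<Z>" for g and i :: nat
      using that by (simp add: extensional_def)
    show "(\<lambda>(i, g). g(Z := i)) \<in> (SIGMA i:?I. ?G (M - ?rep i)) \<rightarrow>
      {g \<in> extensional (insert Z \<Z>). (\<Sum>Z\<in>insert Z \<Z>. replicate_mset (card Z) (g Z)) = M}"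
      using insert.hyps s e by auto
    show "(\<lambda>g. (g Z, restrict g \<Z>)) \<in> {g \<in> extensional (insert Z \<Z>). (\<Sum>Z\<in>insert Z \<Z>. replicate_mset (card Z) (g Z)) = M}
      \<rightarrow> (SIGMA i:?I. ?G (M - ?rep i))"
      using insert.hyps by auto
    show "(\<lambda>g. (g Z, restrict g \<Z>)) ((\<lambda>(i, g). g(Z := i)) p) = p" if "p \<in> (SIGMA i:?I. ?G (M - ?rep i))" for p
      using that insert.hyps by (auto simp: fun_eq_iff restrict_def extensional_def)
    show "(\<lambda>(i, g). g(Z := i)) ((\<lambda>g. (g Z, restrict g \<Z>)) g) = g"
      if "g \<in> {g \<in> extensional (insert Z \<Z>). (\<Sum>Z\<in>insert Z \<Z>. replicate_mset (card Z) (g Z)) = M}" for g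
      using that by (auto simp: fun_eq_iff restrict_def extensional_def)
  qed
  finally show ?case .
qed

text \<open>
  Every monomial of degree \<open>b\<close> occurs exactly once in the factor for \<open>b\<close>.
\<close>
lemma mcoeff_prod_complete_sym:
  "mcoeff (prod_list (map complete_sym \<beta>) :: 'a::comm_ring_1 mpser) M =
    of_nat (card {Ms. map size Ms = \<beta> \<and> sum_list Ms = M})"
proof (induction \<beta> arbitrary: M)
  case Nil
  have "{Ms. map size Ms = [] \<and> sum_list Ms = M} = (if M = {#} then {[]} else {})" by auto
  then show ?case by (simp add: mcoeff_one)
next
  case (Cons b \<beta>)
  let ?T = "\<lambda>M :: nat multiset. {Ms. map size Ms = \<beta> \<and> sum_list Ms = M}"
  have fin: "finite (?T M)" for M :: "nat multiset"
  proof (rule finite_subset)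
    show "?T M \<subseteq> {Ms. set Ms \<subseteq> {A. A \<subseteq># M} \<and> length Ms = length \<beta>}"
    proof safe
      fix Ms and A :: "nat multiset" assume A: "A \<in> set Ms" 
      then obtain xs ys where "Ms = xs @ A # ys" by (meson split_list)
      then show "A \<subseteq># sum_list Ms" by simp
    qed auto
    show "finite {Ms. set Ms \<subseteq> {A. A \<subseteq># M} \<and> length Ms = length \<beta>}"
      by (intro finite_lists_length_eq finite_submultisets)
  qed
  have "mcoeff (prod_list (map complete_sym (b # \<beta>)) :: 'a mpser) M
      = (\<Sum>p\<in>msplits M. if size (fst p) = b then of_nat (card (?T (snd p))) else 0)"
    using Cons by (simp add: mcoeff_mult case_prod_unfold mcoeff_complete_sym if_distrib[of "\<lambda>x. x * _"] cong: if_cong)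
  also have "\<dots> = (\<Sum>p\<in>{p\<in>msplits M. size (fst p) = b}. of_nat (card (?T (snd p))))"
    by (simp add: sum.inter_filter)
  also have "\<dots> = of_nat (card (SIGMA p:{p\<in>msplits M. size (fst p) = b}. ?T (snd p)))"
    by (subst card_SigmaI) (use fin in auto)
  also have "card (SIGMA p:{p\<in>msplits M. size (fst p) = b}. ?T (snd p)) =
      card {Ms. map size Ms = b # \<beta> \<and> sum_list Ms = M}"
    by (rule bij_betw_same_card, rule bij_betwI[where f = "\<lambda>(p, Ms). fst p # Ms"
          and g = "\<lambda>Ms. ((hd Ms, sum_list (tl Ms)), tl Ms)"])
      (auto simp: msplits_def map_eq_Cons_conv)
  finally show ?case .
qed

lemma image_mset_sum: "image_mset f (sum g I) = (\<Sum>i\<in>I. image_mset f (g i))"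
  by (induction I rule: infinite_finite_induct) auto

lemma mset_fibres:
  fixes N :: "(nat \<times> 'c) multiset"
  assumes "\<forall>p\<in>#N. fst p < k"
  shows "(\<Sum>i\<in>{0..<k}. filter_mset (\<lambda>p. fst p = i) N) = N"
proof (rule multiset_eqI)
  fix p
  show "count (\<Sum>i\<in>{0..<k}. filter_mset (\<lambda>p. fst p = i) N) p = count N p"
  proof (cases "p \<in># N")
    case True
    then have "fst p \<in> {0..<k}" using assms by simp
    then show ?thesis by (simp add: count_sum sum.delta')
  next
    case False
    then show ?thesis by (simp add: count_sum not_in_iff)
  qed
qed

text \<open>A multiset of pairs is the list of its fibres over the first component.\<close>
lemma card_content_lists:
  fixes M :: "nat multiset" and \<beta> :: "nat list"
  defines "k \<equiv> length \<beta>"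
  shows "card {N :: (nat \<times> nat) multiset. (\<forall>i<k. size (filter_mset (\<lambda>p. fst p = i) N) = \<beta> ! i) \<and>
      (\<forall>p\<in>#N. fst p < k) \<and> image_mset snd N = M} = card {Ms. map size Ms = \<beta> \<and> sum_list Ms = M}"
    (is "card ?N = card ?L")
proof -
  define f where "f = (\<lambda>N :: (nat \<times> nat) multiset. map (\<lambda>i. image_mset snd (filter_mset (\<lambda>p. fst p = i) N)) [0..<k])"
  define g where "g = (\<lambda>Ms :: nat multiset list. \<Sum>i\<in>{0..<k}. image_mset (Pair i) (Ms ! i))"
  have filt: "filter_mset (\<lambda>p. fst p = i) (g Ms) = image_mset (Pair i) (Ms ! i)" if "i < k" for i Ms
  proof -
    have "filter_mset (\<lambda>p. fst p = i) (g Ms) = (\<Sum>j\<in>{0..<k}. if j = i then image_mset (Pair i) (Ms ! i) else {#})"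
      unfolding g_def by (induction k) (auto simp: filter_mset_image_mset)
    then show ?thesis using that by simp
  qed
  have "bij_betw f ?N ?L"
  proof (rule bij_betwI[where g = g])
    show "f \<in> ?N \<rightarrow> ?L"
    proof
      fix N assume N: "N \<in> ?N"
      have "map size (f N) = \<beta>" using N by (intro nth_equalityI) (auto simp: f_def k_def)
      moreover have "sum_list (f N) = image_mset snd (\<Sum>i\<in>{0..<k}. filter_mset (\<lambda>p. fst p = i) N)"
        by (simp add: f_def interv_sum_list_conv_sum_set_nat image_mset_sum)
      ultimately show "f N \<in> ?L" using N mset_fibres[of N k] by simp
    qed
    show "g \<in> ?L \<rightarrow> ?N"
    proof
      fix Ms assume Ms: "Ms \<in> ?L"
      then have l: "length Ms = k" by (auto simp: k_def)
      have "size (Ms ! i) = \<beta> ! i" if "i < k" for i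
        using Ms that l by (metis (mono_tags, lifting) mem_Collect_eq nth_map)
      moreover have "\<forall>p\<in>#g Ms. fst p < k" by (auto simp: g_def set_mset_sum)
      moreover have "image_mset snd (g Ms) = sum_list Ms"
        using l by (simp add: g_def image_mset_sum multiset.map_comp o_def sum_list_sum_nth)
      ultimately show "g Ms \<in> ?N" using Ms filt by simp
    qed
    show "g (f N) = N" if "N \<in> ?N" for N
    proof -
      have "image_mset (Pair i) (image_mset snd (filter_mset (\<lambda>p. fst p = i) N)) = filter_mset (\<lambda>p. fst p = i) N" for i
        unfolding image_mset.compositionality by (rule trans[OF image_mset_cong[where g = id]]) auto
      then show ?thesis using that mset_fibres[of N k] by (simp add: g_def f_def)
    qed
    show "f (g Ms) = Ms" if "Ms \<in> ?L" for Ms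
      using that filt by (intro nth_equalityI) (auto simp: f_def k_def image_mset.compositionality o_def)
  qed
  then show ?thesis by (rule bij_betw_same_card)
qed

lemma mem_cycles_on:
  assumes "finite X" "w permutes X" "x \<in> X" "y \<in> orbit w x"
  shows "x \<in> orbit w x" "y \<in> X" "orbit w y = orbit w x"
proof -
  have "cyclic_on w (orbit w x)" using cyclic_on_orbit[OF assms(2,1)] .
  then show "orbit w y = orbit w x" using assms(4) by (auto simp: cyclic_on_alldef)
  show "x \<in> orbit w x" using assms(1,2) by (intro permutation_self_in_orbit) (auto simp: permutation_permutes)
  show "y \<in> X" using permutes_orbit_subset[OF assms(2,3)] assms(4) by blast
qed

lemma mset_set_disjoint_Union:
  assumes "finite \<Z>" "\<And>Z. Z \<in> \<Z> \<Longrightarrow> finite Z" "\<And>Z Y. Z \<in> \<Z> \<Longrightarrow> Y \<in> \<Z> \<Longrightarrow> Z \<noteq> Y \<Longrightarrow> Z \<inter> Y = {}"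
  shows "mset_set (\<Union> \<Z>) = (\<Sum>Z\<in>\<Z>. mset_set Z)"
  using assms
proof (induction \<Z> rule: finite_induct)
  case (insert Z \<Z>)
  have "Z \<inter> \<Union> \<Z> = {}" using insert.prems(2)[of Z] insert.hyps(2) by blast
  then show ?case using insert by (simp add: mset_set_Union)
qed auto

text \<open>
  A colouring is fixed by \<open>w\<close> exactly if it is constant on the cycles of \<open>w\<close>.
\<close>
lemma card_cycle_colourings:
  fixes w :: "nat \<Rightarrow> nat" and M :: "nat multiset"
  assumes X: "finite X" and w: "w permutes X"
  shows "card {g \<in> extensional (cycles_on X w). (\<Sum>Z\<in>cycles_on X w. replicate_mset (card Z) (g Z)) = M} =
    card {h \<in> fixed_colourings X w. colour_content X h = M}" (is "card ?G = card ?H")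
proof -
  let ?C = "cycles_on X w"
  have finC: "finite ?C" "\<And>Z. Z \<in> ?C \<Longrightarrow> finite Z"
    using X finite_subset[OF permutes_orbit_subset[OF w] X] by (auto simp: cycles_on_def)
  have UC: "\<Union> ?C = X"
  proof
    show "\<Union> ?C \<subseteq> X" using mem_cycles_on(2)[OF X w] by (auto simp: cycles_on_def)
    show "X \<subseteq> \<Union> ?C"
    proof
      fix x assume "x \<in> X"
      then show "x \<in> \<Union> ?C" using mem_cycles_on(1)[OF X w _ orbit.base] unfolding cycles_on_def by blast
    qed
  qed
  have disj: "Z \<inter> Y = {}" if ZY: "Z \<in> ?C" "Y \<in> ?C" "Z \<noteq> Y" for Z Y
  proof (rule ccontr)
    assume "Z \<inter> Y \<noteq> {}"
    then obtain z where z: "z \<in> Z" "z \<in> Y" by blast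
    obtain x where "x \<in> X" "Z = orbit w x" using ZY(1) unfolding cycles_on_def by blast
    moreover obtain y where "y \<in> X" "Y = orbit w y" using ZY(2) unfolding cycles_on_def by blast
    ultimately have "orbit w z = Z" "orbit w z = Y" using mem_cycles_on(3)[OF X w] z by metis+
    then show False using ZY(3) by simp
  qed
  have content: "colour_content X h = (\<Sum>Z\<in>?C. replicate_mset (card Z) (g Z))"
    if "\<And>Z x. Z \<in> ?C \<Longrightarrow> x \<in> Z \<Longrightarrow> h x = g Z" for h :: "nat \<Rightarrow> nat" and g
  proof -
    have "colour_content X h = (\<Sum>Z\<in>?C. image_mset h (mset_set Z))"
      unfolding colour_content_def image_mset_sum[symmetric]
      using mset_set_disjoint_Union[OF finC disj] UC by simp
    also have "\<dots> = (\<Sum>Z\<in>?C. replicate_mset (card Z) (g Z))"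
    proof (intro sum.cong refl)
      fix Z assume Z: "Z \<in> ?C"
      then have "image_mset h (mset_set Z) = image_mset (\<lambda>_. g Z) (mset_set Z)"
        using that finC(2) by (intro image_mset_cong) auto
      then show "image_mset h (mset_set Z) = replicate_mset (card Z) (g Z)" by (simp add: image_mset_const_eq)
    qed
    finally show ?thesis .
  qed
  have const: "h y = h x" if "y \<in> orbit w x" "x \<in> X" "h \<in> fixed_colourings X w" for h :: "nat \<Rightarrow> nat" and x y
    using that(1)
  proof induction
    case base
    then show ?case using that by (simp add: fixed_colourings_def)
  next
    case (step y)
    then have "y \<in> X" using mem_cycles_on(2)[OF X w that(2)] by blast
    then show ?case using step that by (simp add: fixed_colourings_def)
  qed
  define pick where "pick Z = (SOME x. x \<in> Z)" for Z :: "nat set"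
  have pick: "pick Z \<in> Z" if "Z \<in> ?C" for Z
    using that orbit.base unfolding pick_def cycles_on_def by (metis imageE someI)
  have "bij_betw (\<lambda>g. restrict (\<lambda>x. g (orbit w x)) X) ?G ?H"
  proof (rule bij_betwI[where g = "\<lambda>h. restrict (\<lambda>Z. h (pick Z)) ?C"])
    show "(\<lambda>g. restrict (\<lambda>x. g (orbit w x)) X) \<in> ?G \<rightarrow> ?H"
    proof
      fix g assume g: "g \<in> ?G"
      let ?h = "restrict (\<lambda>x. g (orbit w x)) X"
      have "?h x = g Z" if Zx: "Z \<in> ?C" "x \<in> Z" for Z x
      proof -
        obtain y where y: "y \<in> X" "Z = orbit w y" using Zx(1) unfolding cycles_on_def by blast
        then have "x \<in> X" "orbit w x = Z" using mem_cycles_on[OF X w y(1)] Zx(2) by blast+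
        then show ?thesis by simp
      qed
      then have "colour_content X ?h = M" using content[of ?h g] g by simp
      moreover have "orbit w (w x) = orbit w x" "w x \<in> X" if "x \<in> X" for x
        using mem_cycles_on[OF X w that orbit.base] by auto
      then have "?h \<in> fixed_colourings X w" by (simp add: fixed_colourings_def)
      ultimately show "?h \<in> ?H" by simp
    qed
    show "(\<lambda>h. restrict (\<lambda>Z. h (pick Z)) ?C) \<in> ?H \<rightarrow> ?G"
    proof
      fix h assume h: "h \<in> ?H"
      have "h x = restrict (\<lambda>Z. h (pick Z)) ?C Z" if Z: "Z \<in> ?C" "x \<in> Z" for Z x
      proof -
        obtain y where y: "y \<in> X" "Z = orbit w y" using Z by (auto simp: cycles_on_def)
        then have "h x = h y" "h (pick Z) = h y"
          using const[of x y h] const[of "pick Z" y h] pick[OF Z(1)] Z(2) h by blast+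
        then show ?thesis using Z(1) by simp
      qed
      then show "restrict (\<lambda>Z. h (pick Z)) ?C \<in> ?G" using content[of h] h by auto
    qed
    show "restrict (\<lambda>Z. restrict (\<lambda>x. g (orbit w x)) X (pick Z)) ?C = g" if "g \<in> ?G" for g
    proof (rule extensionalityI[where A = ?C])
      fix Z assume Z: "Z \<in> ?C"
      then obtain y where y: "y \<in> X" "Z = orbit w y" by (auto simp: cycles_on_def)
      then show "restrict (\<lambda>Z. restrict (\<lambda>x. g (orbit w x)) X (pick Z)) ?C Z = g Z"
        using mem_cycles_on[OF X w y(1), of "pick Z"] pick[OF Z] Z by simp
    qed (use that in auto)
    show "restrict (\<lambda>x. restrict (\<lambda>Z. h (pick Z)) ?C (orbit w x)) X = h" if "h \<in> ?H" for h
    proof (rule extensionalityI[where A = X])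
      fix x assume x: "x \<in> X"
      then have "orbit w x \<in> ?C" by (auto simp: cycles_on_def)
      then show "restrict (\<lambda>x. restrict (\<lambda>Z. h (pick Z)) ?C (orbit w x)) X x = h x"
        using const[of "pick (orbit w x)" x h] pick x that by simp
    qed (use that in \<open>auto simp: fixed_colourings_def\<close>)
  qed
  then show ?thesis by (rule bij_betw_same_card)
qed

lemma mcoeff_mconst_mult: "mcoeff (mconst c * f) M = c * mcoeff f M"
proof -
  have "mcoeff (mconst c * f) M = (\<Sum>p\<in>msplits M. if p = ({#}, M) then c * mcoeff f M else 0)"
    unfolding mcoeff_mult case_prod_unfold
  proof (intro sum.cong refl)
    fix p assume "p \<in> msplits M"
    then have "fst p = {#} \<longleftrightarrow> p = ({#}, M)" by (cases p) (auto simp: msplits_def)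
    then show "mcoeff (mconst c) (fst p) * mcoeff f (snd p) = (if p = ({#}, M) then c * mcoeff f M else 0)"
      by (auto simp: mconst_def)
  qed
  also have "\<dots> = c * mcoeff f M"
    unfolding sum.delta[OF finite_msplits] by (simp add: msplits_def)
  finally show ?thesis .
qed

lemma mcoeff_sum: "mcoeff (\<Sum>i\<in>I. f i) M = (\<Sum>i\<in>I. mcoeff (f i) M)"
  by (induction I rule: infinite_finite_induct) (simp_all add: plus_mpser_def zero_mpser_def)

lemma size_filter_content:
  assumes "finite X"
  shows "size (filter_mset P (colour_content X h)) = card {x\<in>X. P (h x)}"
  using assms by (simp add: colour_content_def filter_mset_image_mset filter_mset_mset_set)

text \<open>The first component of the colour of a letter is the index of its block.\<close>

lemma card_fixed_osp:
  fixes \<beta> :: "nat list" and M :: "nat multiset" and n :: nat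
  defines "X \<equiv> {1..n}" and "k \<equiv> length \<beta>"
  assumes w: "w permutes X"
  shows "card {Bs \<in> osp n \<beta>. map ((`) w) Bs = Bs} * card {f \<in> fixed_colourings X w. colour_content X f = M} =
    card {h \<in> fixed_colourings X w. (\<forall>i<k. size (filter_mset (\<lambda>p. fst p = i) (colour_content X h)) = \<beta> ! i) \<and>
      (\<forall>p\<in>#colour_content X h. fst p < k) \<and> image_mset snd (colour_content X h) = M}" (is "card ?O * card ?F = card ?H")
proof -
  have X: "finite X" by (simp add: X_def)
  have wX: "w x \<in> X \<longleftrightarrow> x \<in> X" for x using permutes_in_image[OF w] .
  define to where "to h = (map (\<lambda>i. {x\<in>X. fst (h x) = i}) [0..<k], restrict (\<lambda>x. snd (h x)) X)" for h :: "nat \<Rightarrow> nat \<times> nat"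
  define idx where "idx Bs x = (THE i. i < k \<and> x \<in> Bs ! i)" for Bs :: "nat set list" and x
  have H: "h \<in> ?H \<longleftrightarrow> h \<in> fixed_colourings X w \<and> (\<forall>i<k. card {x\<in>X. fst (h x) = i} = \<beta> ! i) \<and>
      (\<forall>x\<in>X. fst (h x) < k) \<and> colour_content X (restrict (\<lambda>x. snd (h x)) X) = M" for h
  proof -
    have "image_mset snd (colour_content X h) = colour_content X (restrict (\<lambda>x. snd (h x)) X)"
      unfolding colour_content_def image_mset.compositionality using X by (intro image_mset_cong) auto
    moreover have "(\<forall>p\<in>#colour_content X h. fst p < k) \<longleftrightarrow> (\<forall>x\<in>X. fst (h x) < k)"
      using X by (auto simp: colour_content_def)
    ultimately show ?thesis by (simp add: size_filter_content[OF X])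
  qed
  have idx: "i < k \<and> x \<in> Bs ! i \<longleftrightarrow> i = idx Bs x" "idx Bs x < k" if Bs: "Bs \<in> osp n \<beta>" and x: "x \<in> X" for Bs x i
  proof -
    have "x \<in> \<Union> (set Bs)" "length Bs = k" using Bs x by (auto simp: osp_def X_def k_def)
    then obtain j where j: "j < k" "x \<in> Bs ! j" by (auto simp: in_set_conv_nth)
    have uniq: "i = j" if "i < k" "x \<in> Bs ! i" for i
      using Bs that j by (auto simp: osp_def k_def)
    then have "idx Bs x = j" unfolding idx_def using j uniq by (intro the_equality) blast+
    with j uniq show "i < k \<and> x \<in> Bs ! i \<longleftrightarrow> i = idx Bs x" "idx Bs x < k" by blast+
  qed
  have blocks: "Bs ! i = {x\<in>X. idx Bs x = i}" if "Bs \<in> osp n \<beta>" "i < k" for Bs i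
  proof -
    have "Bs ! i \<subseteq> X" using that by (fastforce simp: osp_def X_def k_def)
    then show ?thesis using idx(1)[OF that(1), of _ i] that(2) by blast
  qed
  have idx_fixed: "idx Bs (w x) = idx Bs x" if Bs: "Bs \<in> osp n \<beta>" "map ((`) w) Bs = Bs" and x: "x \<in> X" for Bs x
  proof -
    have l: "length Bs = k" using Bs by (simp add: osp_def k_def)
    have i: "idx Bs x < k" "x \<in> Bs ! idx Bs x" using idx(1)[OF Bs(1) x, of "idx Bs x"] by simp_all
    have "w ` (Bs ! idx Bs x) = Bs ! idx Bs x" using arg_cong[OF Bs(2), of "\<lambda>B. B ! idx Bs x"] i l by simp
    then have "w x \<in> Bs ! idx Bs x" using i by blast
    moreover have "w x \<in> X" using x wX by simp
    ultimately show ?thesis using idx(1)[OF Bs(1), of "w x" "idx Bs x"] i(1) by simp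
  qed
  have "bij_betw to ?H (?O \<times> ?F)"
  proof (rule bij_betwI[where g = "\<lambda>(Bs, f). restrict (\<lambda>x. (idx Bs x, f x)) X"])
    show "to \<in> ?H \<rightarrow> ?O \<times> ?F"
    proof
      fix h assume h0: "h \<in> ?H"
      note h = h0[unfolded H]
      let ?Bs = "map (\<lambda>i. {x\<in>X. fst (h x) = i}) [0..<k]"
      have "?Bs \<in> osp n \<beta>" using h by (auto simp: osp_def k_def X_def)
      moreover have "map ((`) w) ?Bs = ?Bs"
      proof (rule nth_equalityI)
        fix i assume i: "i < length (map ((`) w) ?Bs)"
        have "w ` {x\<in>X. fst (h x) = i} \<subseteq> {x\<in>X. fst (h x) = i}"
          using h wX by (auto simp: fixed_colourings_def)
        then have "w ` {x\<in>X. fst (h x) = i} = {x\<in>X. fst (h x) = i}"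
          using X permutes_inj[OF w] by (intro endo_inj_surj) (auto intro: inj_on_subset)
        then show "map ((`) w) ?Bs ! i = ?Bs ! i" using i by simp
      qed simp
      moreover have "restrict (\<lambda>x. snd (h x)) X \<in> ?F" using h wX by (auto simp: fixed_colourings_def)
      ultimately show "to h \<in> ?O \<times> ?F" by (simp add: to_def)
    qed
    show "(\<lambda>(Bs, f). restrict (\<lambda>x. (idx Bs x, f x)) X) \<in> ?O \<times> ?F \<rightarrow> ?H"
    proof
      fix p assume "p \<in> ?O \<times> ?F"
      then obtain Bs f where p: "p = (Bs, f)" and Bs: "Bs \<in> osp n \<beta>" "map ((`) w) Bs = Bs"
        and f: "f \<in> fixed_colourings X w" "colour_content X f = M" by auto
      let ?h = "restrict (\<lambda>x. (idx Bs x, f x)) X"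
      have "?h \<in> fixed_colourings X w"
        using f(1) idx_fixed[OF Bs] wX by (auto simp: fixed_colourings_def)
      moreover have "card {x\<in>X. fst (?h x) = i} = \<beta> ! i" if "i < k" for i
      proof -
        have "{x\<in>X. fst (?h x) = i} = Bs ! i" using blocks[OF Bs(1) that] by auto
        then show ?thesis using Bs(1) that by (simp add: osp_def k_def)
      qed
      moreover have "restrict (\<lambda>x. snd (?h x)) X = f"
        using f(1) by (intro extensionalityI[where A = X]) (auto simp: fixed_colourings_def)
      ultimately have "?h \<in> ?H" unfolding H using idx(2)[OF Bs(1)] f(2) by auto
      then show "(\<lambda>(Bs, f). restrict (\<lambda>x. (idx Bs x, f x)) X) p \<in> ?H" by (simp only: p prod.case)
    qed
    show "(\<lambda>(Bs, f). restrict (\<lambda>x. (idx Bs x, f x)) X) (to h) = h" if "h \<in> ?H" for h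
    proof -
      note h = that[unfolded H]
      have Bs: "fst (to h) \<in> osp n \<beta>" using h by (auto simp: osp_def k_def X_def to_def)
      have "idx (fst (to h)) x = fst (h x)" if "x \<in> X" for x
        using idx(1)[OF Bs that, of "fst (h x)"] h that by (auto simp: to_def)
      then show ?thesis using h
        by (intro extensionalityI[where A = X]) (auto simp: to_def fixed_colourings_def)
    qed
    show "to ((\<lambda>(Bs, f). restrict (\<lambda>x. (idx Bs x, f x)) X) p) = p" if "p \<in> ?O \<times> ?F" for p
    proof -
      obtain Bs f where p: "p = (Bs, f)" "Bs \<in> osp n \<beta>" "f \<in> fixed_colourings X w" using \<open>p \<in> _\<close> by auto
      have "map (\<lambda>i. {x\<in>X. idx Bs x = i}) [0..<k] = Bs"
        using blocks[OF p(2)] p(2) by (intro nth_equalityI) (auto simp: osp_def k_def)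
      moreover have "(\<lambda>x\<in>X. snd (if x \<in> X then (idx Bs x, f x) else undefined)) = f"
        using p(3) by (intro extensionalityI[where A = X]) (auto simp: fixed_colourings_def)
      ultimately show ?thesis by (simp add: p(1) to_def cong: conj_cong)
    qed
  qed
  from bij_betw_same_card[OF this] show ?thesis by (simp only: card_cartesian_product)
qed

text \<open>
  In the coefficient of a monomial \<open>M\<close>, the power sums count the fixed colourings with content \<open>M\<close>.
  Paired with the fixed ordered set partitions they become fixed colourings by pairs (block index,
  colour). Each content of such a colouring contributes \<open>n!\<close> in the sum over all permutations, and
  the possible contents are counted by the coefficient of \<open>M\<close> in the product of complete homogeneous
  functions.
\<close>
theorem frobenius_osp:
  assumes "sum_list \<beta> = n"
  shows "mconst (1 / fact n) * (\<Sum>w | w permutes {1..n}. mconst (of_nat (card {Bs \<in> osp n \<beta>. map ((`) w) Bs = Bs})) *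
      (\<Prod>Z\<in>cycles_on {1..n} w. power_sum (card Z))) = (prod_list (map complete_sym \<beta>) :: 'a::field_char_0 mpser)"
proof (rule mpser_eqI)
  fix M :: "nat multiset"
  let ?X = "{1..n}" and ?k = "length \<beta>"
  define \<N> where "\<N> = {N :: (nat \<times> nat) multiset. (\<forall>i<?k. size (filter_mset (\<lambda>p. fst p = i) N) = \<beta> ! i) \<and>
      (\<forall>p\<in>#N. fst p < ?k) \<and> image_mset snd N = M}"
  have fin: "finite \<N>"
  proof (rule finite_subset)
    show "\<N> \<subseteq> mset ` {xs. set xs \<subseteq> {..<?k} \<times> set_mset M \<and> length xs = size M}"
    proof
      fix N assume N: "N \<in> \<N>"
      obtain xs where xs: "mset xs = N" using ex_mset by blast
      have M: "M = image_mset snd N" using N by (simp add: \<N>_def)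
      have "length xs = size M" unfolding M using xs by auto
      moreover have "set xs \<subseteq> {..<?k} \<times> set_mset M"
        unfolding M using N xs by (force simp: \<N>_def)
      ultimately show "N \<in> mset ` {xs. set xs \<subseteq> {..<?k} \<times> set_mset M \<and> length xs = size M}"
        using xs by blast
    qed
    show "finite (mset ` {xs. set xs \<subseteq> {..<?k} \<times> set_mset M \<and> length xs = size M})"
      by (intro finite_imageI finite_lists_length_eq finite_cartesian_product) auto
  qed
  have size: "size N = n" if "N \<in> \<N>" for N
  proof -
    have "size N = size (\<Sum>i\<in>{0..<?k}. filter_mset (\<lambda>p. fst p = i) N)"
      using that by (subst mset_fibres) (auto simp: \<N>_def)
    also have "\<dots> = (\<Sum>i\<in>{0..<?k}. \<beta> ! i)" using that by (simp add: size_multiset_sum \<N>_def)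
    also have "\<dots> = n" using assms by (simp add: sum_list_sum_nth)
    finally show ?thesis .
  qed
  have cell: "card {Bs \<in> osp n \<beta>. map ((`) w) Bs = Bs} * card {f \<in> fixed_colourings ?X w. colour_content ?X f = M}
    = (\<Sum>N\<in>\<N>. card {h \<in> fixed_colourings ?X w. colour_content ?X h = N})" if w: "w permutes ?X" for w
  proof -
    have "{h \<in> fixed_colourings ?X w. (\<forall>i<?k. size (filter_mset (\<lambda>p. fst p = i) (colour_content ?X h)) = \<beta> ! i) \<and>
      (\<forall>p\<in>#colour_content ?X h. fst p < ?k) \<and> image_mset snd (colour_content ?X h) = M}
      = (\<Union>N\<in>\<N>. {h \<in> fixed_colourings ?X w. colour_content ?X h = N})"
      by (auto simp: \<N>_def)
    moreover have "finite {h \<in> fixed_colourings ?X w. colour_content ?X h = N}" for N :: "(nat \<times> nat) multiset"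
      by (rule finite_subset[OF _ finite_colourings_content[of ?X N]]) (auto simp: fixed_colourings_def)
    ultimately show ?thesis using card_fixed_osp[OF w, of \<beta> M] fin
      by (simp add: card_UN_disjoint disjoint_iff)
  qed
  have "mcoeff (\<Sum>w | w permutes ?X. mconst (of_nat (card {Bs \<in> osp n \<beta>. map ((`) w) Bs = Bs})) *
      (\<Prod>Z\<in>cycles_on ?X w. power_sum (card Z)) :: 'a mpser) M =
     (\<Sum>w | w permutes ?X. of_nat (card {Bs \<in> osp n \<beta>. map ((`) w) Bs = Bs} *
        card {f \<in> fixed_colourings ?X w. colour_content ?X f = M}))"
    unfolding mcoeff_sum
  proof (intro sum.cong refl)
    fix w assume "w \<in> {w. w permutes ?X}"
    then have w: "w permutes ?X" by simp
    have "mcoeff (\<Prod>Z\<in>cycles_on ?X w. power_sum (card Z) :: 'a mpser) M = 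
      of_nat (card {f \<in> fixed_colourings ?X w. colour_content ?X f = M})"
      unfolding card_cycle_colourings[OF finite_atLeastAtMost w, of M, symmetric]
    proof (rule mcoeff_prod_power_sum)
      show "finite (cycles_on ?X w)" by (simp add: cycles_on_def)
      show "finite Z \<and> Z \<noteq> {}" if "Z \<in> cycles_on ?X w" for Z
        using that finite_subset[OF permutes_orbit_subset[OF w]] orbit.base[of w] unfolding cycles_on_def by blast
    qed
    then show "mcoeff (mconst (of_nat (card {Bs \<in> osp n \<beta>. map ((`) w) Bs = Bs})) *
      (\<Prod>Z\<in>cycles_on ?X w. power_sum (card Z)) :: 'a mpser) M = of_nat (card {Bs \<in> osp n \<beta>. map ((`) w) Bs = Bs} *
        card {f \<in> fixed_colourings ?X w. colour_content ?X f = M})"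
      by (simp add: mcoeff_mconst_mult)
  qed
  also have "\<dots> = of_nat (\<Sum>w | w permutes ?X. \<Sum>N\<in>\<N>. card {h \<in> fixed_colourings ?X w. colour_content ?X h = N})"
    using cell by simp
  also have "(\<Sum>w | w permutes ?X. \<Sum>N\<in>\<N>. card {h \<in> fixed_colourings ?X w. colour_content ?X h = N}) = (\<Sum>N\<in>\<N>. fact n)"
  proof (subst sum.swap, intro sum.cong refl)
    fix N assume "N \<in> \<N>"
    then have "size N = card ?X" using size by simp
    then show "(\<Sum>w | w permutes ?X. card {h \<in> fixed_colourings ?X w. colour_content ?X h = N}) = fact n"
      using sum_card_fixed_colourings[of ?X N] by simp
  qed
  also have "\<dots> = card {Ms. map size Ms = \<beta> \<and> sum_list Ms = M} * fact n"
    using card_content_lists[of \<beta> M] by (simp add: \<N>_def)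
  finally show "mcoeff (mconst (1 / fact n) * (\<Sum>w | w permutes ?X. mconst (of_nat (card {Bs \<in> osp n \<beta>. map ((`) w) Bs = Bs})) *
      (\<Prod>Z\<in>cycles_on ?X w. power_sum (card Z))) :: 'a mpser) M = mcoeff (prod_list (map complete_sym \<beta>)) M"
    by (simp add: mcoeff_mconst_mult mcoeff_prod_complete_sym)
qed


section \<open>Direct sums and rooted products of permutations\<close>

text \<open>
  The inclusion of the second summand when \<open>{0..a}\<close> and \<open>{0..b}\<close> are glued at the root \<open>0\<close>.
\<close>
definition wedge_letter :: "nat \<Rightarrow> nat \<Rightarrow> nat" where
  "wedge_letter a j = (if j = 0 then 0 else a + j)"

text \<open>
  The permutation \<open>p\<close> transported along \<open>wedge_letter\<close>, extended by the identity on \<open>{1..a}\<close>.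
\<close>
definition wedge_shift :: "nat \<Rightarrow> (nat \<Rightarrow> nat) \<Rightarrow> nat \<Rightarrow> nat" where
  "wedge_shift a p x = (if x = 0 then wedge_letter a (p 0) else if x \<le> a then x else wedge_letter a (p (x - a)))"

lemma permutes_imp_permutation: "p permutes {m..s::nat} \<Longrightarrow> permutation p"
  by (auto simp: permutation_permutes)

lemma root_cycle:
  fixes p :: "nat \<Rightarrow> nat"
  assumes p: "p permutes {0..s}"
  defines "T \<equiv> support p 0"
  shows "0 < length T" "T ! 0 = 0" "distinct T" "T = 0 # root_word p"
    "\<And>i. i < length T \<Longrightarrow> T ! i = (p ^^ i) 0"
    "\<And>i. i < length T \<Longrightarrow> p (T ! i) = T ! (Suc i mod length T)"
    "set T \<subseteq> {0..s}" "set T = orbit p 0"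
proof -
  have perm: "permutation p" using p by (rule permutes_imp_permutation)
  have len: "length T = least_power p 0" by (simp add: T_def)
  show pos: "0 < length T" unfolding len using least_power_of_permutation(2)[OF perm] .
  show nth: "T ! i = (p ^^ i) 0" if "i < length T" for i using that by (simp add: T_def)
  show T0: "T ! 0 = 0" using nth[OF pos] by simp
  show "distinct T" unfolding T_def by (rule cycle_of_permutation[OF perm])
  show "T = 0 # root_word p" unfolding root_word_def T_def[symmetric]
    using pos T0 by (cases T) auto
  show "p (T ! i) = T ! (Suc i mod length T)" if "i < length T" for i
  proof (cases "Suc i < length T")
    case True
    then show ?thesis using nth[OF that] nth[OF True] by simp
  next
    case False
    then have "Suc i = least_power p 0" using that len by linarith
    then have "p (T ! i) = 0" using least_power_of_permutation(1)[OF perm, of 0] nth[OF that]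
      by (metis comp_apply funpow.simps(2))
    then show ?thesis using \<open>Suc i = _\<close> T0 len by simp
  qed
  have self: "0 \<in> orbit p 0" using permutation_self_in_orbit[OF perm] .
  show "set T = orbit p 0" unfolding T_def support_set[OF perm] orbit_altdef_self_in[OF self] by auto
  then show "set T \<subseteq> {0..s}" using permutes_orbit_subset[OF p, of 0] by simp
qed

lemma cycle_of_list_nth:
  assumes "distinct cs" "i < length cs"
  shows "cycle_of_list cs (cs ! i) = cs ! (Suc i mod length cs)"
proof -
  have "map (cycle_of_list cs ^^ 1) cs ! i = rotate 1 cs ! i"
    using cyclic_rotation[OF assms(1), of 1] by simp
  then show ?thesis using assms(2) nth_rotate[of i cs 1] by simp
qed

text \<open>
  The first permutation runs through its root cycle up to the last letter, which it would send to
  the root; at this moment the shifted second permutation takes over and sends the letter to the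
  successor of the root in the second cycle. All later results use this composition instead of cycle
  words.
\<close>
lemma rooted_prod_eq:
  assumes \<tau>: "\<tau> permutes {0..a}" and \<upsilon>: "\<upsilon> permutes {0..b}"
  shows "rooted_prod a \<tau> \<upsilon> = wedge_shift a \<upsilon> \<circ> \<tau>"
proof
  fix x
  define T U where "T = support \<tau> 0" and "U = support \<upsilon> 0"
  note rT = root_cycle[OF \<tau>, folded T_def] and rU = root_cycle[OF \<upsilon>, folded U_def]
  define R where "R = T @ map ((+) a) (tl U)"
  have R: "0 # root_word \<tau> @ map (\<lambda>b. a + b) (root_word \<upsilon>) = R"
    using rT(4) rU(4) by (metis R_def append_Cons list.sel(3))
  have tlU: "y \<noteq> 0" "y \<in> set U" if "y \<in> set (tl U)" for y
    using that rU(3,4) by (metis distinct.simps(2) list.sel(3), metis list.set_sel(2) list.sel(2))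
  have lenR: "length R = length T + length U - 1" using rU(1) by (cases U) (simp_all add: R_def)
  have R_low: "R ! i = T ! i" if "i < length T" for i using that by (simp add: R_def nth_append)
  have R_high: "R ! i = a + U ! (i - length T + 1)" "U ! (i - length T + 1) \<noteq> 0"
    if "length T \<le> i" "i < length R" for i
  proof -
    have i: "i - length T < length (tl U)" using that by (simp add: R_def)
    then show "R ! i = a + U ! (i - length T + 1)" using that by (simp add: R_def nth_append nth_tl)
    show "U ! (i - length T + 1) \<noteq> 0" using tlU(1)[OF nth_mem[OF i]] i by (simp add: nth_tl)
  qed
  have "distinct (tl U)" using rU(3) by (simp add: distinct_tl)
  then have "distinct R" using rT(3,7) tlU by (fastforce simp: R_def distinct_map)
  have inR: "x \<in> set R \<longleftrightarrow> x \<in> set T \<or> (a < x \<and> x - a \<in> set U)"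
  proof -
    have "x \<in> set R \<longleftrightarrow> x \<in> set T \<or> (\<exists>y\<in>set (tl U). x = a + y)" by (auto simp: R_def)
    moreover have "set U = insert 0 (set (tl U))" using rU(4) by (metis list.sel(3) list.simps(15))
    ultimately show ?thesis using tlU(1) by (auto intro: bexI[of _ "x - a"])
  qed
  show "rooted_prod a \<tau> \<upsilon> x = (wedge_shift a \<upsilon> \<circ> \<tau>) x"
  proof (cases "x \<in> set R")
    case True
    then obtain i where i: "i < length R" "x = R ! i" by (metis in_set_conv_nth)
    have "rooted_prod a \<tau> \<upsilon> x = R ! (Suc i mod length R)"
      using True i cycle_of_list_nth[OF \<open>distinct R\<close> i(1)] by (simp add: rooted_prod_def R)
    also have "\<dots> = wedge_shift a \<upsilon> (\<tau> x)"
    proof -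
      consider "Suc i < length T" | "Suc i = length T" | "length T \<le> i" by linarith
      then show ?thesis
      proof cases
        case 1
        then have "Suc i < length R" using rU(1) lenR by linarith
        then have "R ! (Suc i mod length R) = \<tau> x" using 1 i R_low rT(6)[of i] by simp
        moreover have "\<tau> x = T ! Suc i" using 1 i R_low rT(6)[of i] by simp
        then have "\<tau> x \<noteq> 0" "\<tau> x \<le> a" using rT(2,3,7) 1 by (metis gr_implies_not0 nth_eq_iff_index_eq rT(1) zero_less_Suc less_not_refl, metis atLeastAtMost_iff nth_mem subsetD)
        ultimately show ?thesis by (simp add: wedge_shift_def)
      next
        case 2
        then have "\<tau> x = 0" using i R_low rT(2) rT(6)[of i] by simp
        then have rhs: "wedge_shift a \<upsilon> (\<tau> x) = wedge_letter a (\<upsilon> 0)" by (simp add: wedge_shift_def)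
        have u: "\<upsilon> 0 = U ! (Suc 0 mod length U)" using rU(6)[OF rU(1)] rU(2) by simp
        show ?thesis
        proof (cases "length U = 1")
          case True
          then have "Suc i mod length R = 0" using 2 lenR by simp
          then show ?thesis unfolding rhs u using True R_low[OF rT(1)] rT(2) rU(2) by (simp add: wedge_letter_def)
        next
          case False
          then have l: "1 < length U" using rU(1) by linarith
          then have "Suc i < length R" using 2 lenR by linarith
          then show ?thesis unfolding rhs u using R_high[of "Suc i"] 2 l by (simp add: wedge_letter_def)
        qed
      next
        case 3
        define j where "j = i - length T + 1"
        have x: "x = a + U ! j" "U ! j \<noteq> 0" using R_high[OF 3 i(1)] i(2) by (simp_all add: j_def)
        have j: "j < length U" using 3 i(1) lenR by (simp add: j_def)
        have "\<tau> x = x" using permutes_not_in[OF \<tau>] x by simp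
        then have rhs: "wedge_shift a \<upsilon> (\<tau> x) = wedge_letter a (U ! (Suc j mod length U))"
          using x rU(6)[OF j] by (simp add: wedge_shift_def)
        show ?thesis
        proof (cases "Suc i < length R")
          case True
          then have "Suc j < length U" using 3 lenR by (simp add: j_def)
          moreover have "Suc i - length T + 1 = Suc j" using 3 by (simp add: j_def)
          ultimately show ?thesis unfolding rhs using R_high[of "Suc i"] 3 True by (simp add: wedge_letter_def)
        next
          case False
          then have "Suc i = length R" using i(1) by linarith
          moreover have "Suc j = length U" using 3 lenR rU(1) \<open>Suc i = length R\<close> by (simp add: j_def)
          ultimately show ?thesis unfolding rhs using R_low[OF rT(1)] rT(2) rU(2) by (simp add: wedge_letter_def)
        qed
      qed
    qed
    finally show ?thesis by simp
  next
    case False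
    then have notT: "x \<notin> orbit \<tau> 0" and notU: "a < x \<Longrightarrow> x - a \<notin> orbit \<upsilon> 0"
      using inR rT(8) rU(8) by auto
    have nz: "p x \<noteq> 0" if "p permutes {0..s}" "x \<notin> orbit p 0" for p :: "nat \<Rightarrow> nat" and s x
      using that orbit_inv_eq[OF permutes_imp_permutation[OF that(1)]] permutes_inverses(2)[OF that(1)]
      by (metis orbit.base)
    have "0 < x" using False inR rT(1,2) by (metis gr0I nth_mem)
    show ?thesis
    proof (cases "x \<le> a")
      case True
      then have "\<tau> x \<le> a" using permutes_in_image[OF \<tau>, of x] by simp
      then show ?thesis using False True nz[OF \<tau> notT] by (simp add: rooted_prod_def R wedge_shift_def)
    next
      case hi: False
      then have "\<tau> x = x" using permutes_not_in[OF \<tau>] by simp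
      then show ?thesis using False hi nz[OF \<upsilon> notU] by (simp add: rooted_prod_def R wedge_shift_def wedge_letter_def)
    qed
  qed
qed

lemma wedge_letter_simps [simp]:
  "wedge_letter a 0 = 0" "wedge_letter a j = 0 \<longleftrightarrow> j = 0" "wedge_letter a j - a = j"
  "wedge_letter a i = wedge_letter a j \<longleftrightarrow> i = j" "wedge_letter a j \<le> a \<longleftrightarrow> j = 0"
  by (auto simp: wedge_letter_def)

lemma wedge_letter_wedge_letter: "wedge_letter a (wedge_letter b j) = wedge_letter (a + b) j"
  by (simp add: wedge_letter_def)

lemma wedge_shift_letter [simp]: "wedge_shift a p (wedge_letter a j) = wedge_letter a (p j)"
  by (auto simp: wedge_shift_def wedge_letter_def)

lemma wedge_shift_low: "0 < x \<Longrightarrow> x \<le> a \<Longrightarrow> wedge_shift a p x = x"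
  by (simp add: wedge_shift_def)

lemma wedge_shift_cases:
  fixes a x :: nat
  obtains (low) "0 < x" "x \<le> a" | (letter) j where "x = wedge_letter a j"
proof (cases "0 < x \<and> x \<le> a")
  case True
  then show thesis using low by blast
next
  case False
  then have "x = wedge_letter a (x - a)" by (auto simp: wedge_letter_def)
  then show thesis by (rule letter)
qed

lemma wedge_shift_comp: "wedge_shift a (p \<circ> r) = wedge_shift a p \<circ> wedge_shift a r"
proof
  fix x show "wedge_shift a (p \<circ> r) x = (wedge_shift a p \<circ> wedge_shift a r) x"
    by (cases x a rule: wedge_shift_cases) (simp_all add: wedge_shift_low)
qed

lemma wedge_shift_id: "wedge_shift a id = id"
proof
  fix x show "wedge_shift a id x = id x"
    by (cases x a rule: wedge_shift_cases) (simp_all add: wedge_shift_low)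
qed

lemma wedge_shift_shift: "wedge_shift a (wedge_shift b p) = wedge_shift (a + b) p"
proof
  fix x
  show "wedge_shift a (wedge_shift b p) x = wedge_shift (a + b) p x"
  proof (cases x a rule: wedge_shift_cases)
    case low
    then show ?thesis by (simp add: wedge_shift_low)
  next
    case (letter j)
    show ?thesis
    proof (cases j b rule: wedge_shift_cases)
      case low
      then have "0 < x" "x \<le> a + b" using letter by (simp_all add: wedge_letter_def)
      then show ?thesis using low letter by (simp add: wedge_shift_low)
    next
      case (letter i)
      then have x: "x = wedge_letter a (wedge_letter b i)" "x = wedge_letter (a + b) i"
        using \<open>x = wedge_letter a j\<close> by (simp_all add: wedge_letter_wedge_letter)
      have "wedge_shift a (wedge_shift b p) x = wedge_letter a (wedge_letter b (p i))"
        unfolding x(1) by simp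
      moreover have "wedge_shift (a + b) p x = wedge_letter (a + b) (p i)" unfolding x(2) by simp
      ultimately show ?thesis by (simp add: wedge_letter_wedge_letter)
    qed
  qed
qed

lemma wedge_shift_inj:
  assumes "wedge_shift a p = wedge_shift a r"
  shows "p = r"
proof
  fix x
  have "wedge_shift a p (wedge_letter a x) = wedge_shift a r (wedge_letter a x)" using assms by simp
  then show "p x = r x" by simp
qed

lemma bij_imp_permutes_off: "bij p \<Longrightarrow> (\<And>x. x \<notin> S \<Longrightarrow> p x = x) \<Longrightarrow> p permutes S"
  unfolding permutes_def by (simp add: bij_iff)

lemma wedge_shift_permutes:
  assumes p: "p permutes {0..b}"
  shows "wedge_shift a p permutes insert 0 {a+1..a+b}"
proof (rule bij_imp_permutes_off)
  have "wedge_shift a p \<circ> wedge_shift a (inv_into UNIV p) = id" "wedge_shift a (inv_into UNIV p) \<circ> wedge_shift a p = id"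
    using permutes_inv_o[OF p] by (simp_all add: wedge_shift_comp[symmetric] wedge_shift_id)
  then show "bij (wedge_shift a p)" by (rule o_bij[rotated])
  fix x assume x: "x \<notin> insert 0 {a+1..a+b}"
  show "wedge_shift a p x = x"
  proof (cases x a rule: wedge_shift_cases)
    case low
    then show ?thesis by (rule wedge_shift_low)
  next
    case (letter j)
    then have "j \<notin> {0..b}" using x by (auto simp: wedge_letter_def split: if_splits)
    then show ?thesis using letter permutes_not_in[OF p] by simp
  qed
qed

lemma wedge_comp_permutes:
  assumes "\<tau> permutes {0..a}" "\<upsilon> permutes {0..b}"
  shows "wedge_shift a \<upsilon> \<circ> \<tau> permutes {0..a+b}"
proof (rule permutes_compose)
  show "\<tau> permutes {0..a+b}" using assms(1) by (rule permutes_subset) auto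
  show "wedge_shift a \<upsilon> permutes {0..a+b}"
    using wedge_shift_permutes[OF assms(2)] by (rule permutes_subset) auto
qed

lemma wedge_comp_high:
  assumes "\<tau> permutes {0..a}" "0 < x"
  shows "(wedge_shift a \<upsilon> \<circ> \<tau>) (a + x) = wedge_letter a (\<upsilon> x)"
proof -
  have "a + x = wedge_letter a x" "\<tau> (a + x) = a + x"
    using assms permutes_not_in[OF assms(1), of "a + x"] by (auto simp: wedge_letter_def)
  then show ?thesis by simp
qed

text \<open>
  Let \<open>\<pi>\<close> map the high letters into the high letters and the root. It misses exactly one of these
  values, say \<open>m\<close>. Redirecting the root to \<open>m\<close> gives a permutation \<open>\<rho>\<close> of the high letters and the
  root, and \<open>\<rho>\<close> is the shifted second factor, because the inverse of \<open>\<rho>\<close> after \<open>\<pi>\<close> fixes all high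
  letters.
\<close>
lemma bij_betw_wedge:
  "bij_betw (\<lambda>(\<tau>, \<upsilon>). wedge_shift a \<upsilon> \<circ> \<tau>) ({\<tau>. \<tau> permutes {0..a}} \<times> {\<upsilon>. \<upsilon> permutes {0..b}})
     {\<pi>. \<pi> permutes {0..a+b} \<and> \<pi> ` {a+1..a+b} \<subseteq> insert 0 {a+1..a+b}}" (is "bij_betw ?f ?A ?B")
proof (rule bij_betwI')
  fix p p' assume "p \<in> ?A" "p' \<in> ?A"
  then obtain \<tau> \<upsilon> \<tau>' \<upsilon>' where p: "p = (\<tau>, \<upsilon>)" "p' = (\<tau>', \<upsilon>')"
    and perm: "\<tau> permutes {0..a}" "\<upsilon> permutes {0..b}" "\<tau>' permutes {0..a}" "\<upsilon>' permutes {0..b}" by auto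
  show "?f p = ?f p' \<longleftrightarrow> p = p'"
  proof
    assume eq: "?f p = ?f p'"
    have pos: "\<upsilon> x = \<upsilon>' x" if "0 < x" for x
    proof -
      have "(wedge_shift a \<upsilon> \<circ> \<tau>) (a + x) = (wedge_shift a \<upsilon>' \<circ> \<tau>') (a + x)"
        using eq p by simp
      then show ?thesis unfolding wedge_comp_high[OF perm(1) that] wedge_comp_high[OF perm(3) that] by simp
    qed
    have "\<upsilon> 0 = \<upsilon>' 0"
    proof -
      obtain z where z: "\<upsilon>' z = \<upsilon> 0" using permutes_surj[OF perm(4)] by (metis surjD)
      have "z = 0"
      proof (rule ccontr)
        assume "z \<noteq> 0"
        then have "\<upsilon> z = \<upsilon> 0" using pos z by simp
        then show False using permutes_inj[OF perm(2)] \<open>z \<noteq> 0\<close> by (simp add: inj_eq)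
      qed
      then show ?thesis using z by simp
    qed
    then have "\<upsilon> = \<upsilon>'" using pos by (metis neq0_conv ext)
    moreover have "inj (wedge_shift a \<upsilon>)" using permutes_inj[OF wedge_shift_permutes[OF perm(2)]] .
    then have "\<tau> = \<tau>'" using eq p \<open>\<upsilon> = \<upsilon>'\<close> by (auto simp: fun_eq_iff inj_eq)
    ultimately show "p = p'" using p by simp
  qed simp
next
  fix p assume "p \<in> ?A"
  then obtain \<tau> \<upsilon> where p: "p = (\<tau>, \<upsilon>)" "\<tau> permutes {0..a}" "\<upsilon> permutes {0..b}" by auto
  have "(wedge_shift a \<upsilon> \<circ> \<tau>) (a + x) \<in> insert 0 {a+1..a+b}" if "0 < x" "x \<le> b" for x
    using wedge_comp_high[OF p(2) that(1)] permutes_in_image[OF p(3), of x] that by (auto simp: wedge_letter_def)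
  then have "(wedge_shift a \<upsilon> \<circ> \<tau>) y \<in> insert 0 {a+1..a+b}" if "y \<in> {a+1..a+b}" for y
    using that by (metis Suc_eq_plus1 Suc_le_eq add_le_cancel_left atLeastAtMost_iff le_add_diff_inverse less_imp_le zero_less_diff)
  then have "(wedge_shift a \<upsilon> \<circ> \<tau>) ` {a+1..a+b} \<subseteq> insert 0 {a+1..a+b}" by (rule image_subsetI)
  then show "?f p \<in> ?B" using wedge_comp_permutes[OF p(2,3)] p(1) by simp
next
  fix \<pi> assume "\<pi> \<in> ?B"
  then have \<pi>: "\<pi> permutes {0..a+b}" "\<pi> ` {a+1..a+b} \<subseteq> insert 0 {a+1..a+b}" by auto
  let ?H = "{a+1..a+b}"
  have inj\<pi>: "inj \<pi>" using permutes_inj[OF \<pi>(1)] .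
  have "card (\<pi> ` ?H) = b" by (simp add: card_image inj_on_subset[OF inj\<pi>])
  moreover have "card (insert 0 ?H) = b + 1" by simp
  ultimately have "card (insert 0 ?H - \<pi> ` ?H) = 1" using \<pi>(2) by (simp add: card_Diff_subset)
  then obtain m where m: "m \<in> insert 0 ?H" "m \<notin> \<pi> ` ?H" by (metis DiffD1 DiffD2 card_1_singletonE insertI1)
  \<comment> \<open>The second factor on its own support; \<open>m\<close> is the value that \<open>\<pi>\<close> does not take on high letters.\<close>
  define \<rho> where "\<rho> x = (if x = 0 then m else if x \<in> ?H then \<pi> x else x)" for x
  have \<rho>: "\<rho> permutes insert 0 ?H"
  proof (rule inj_imp_permutes)
    show "inj_on \<rho> (insert 0 ?H)"
    proof (rule inj_onI)
      fix x y assume xy: "x \<in> insert 0 ?H" "y \<in> insert 0 ?H" "\<rho> x = \<rho> y"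
      have mH: "\<rho> z \<noteq> m \<and> \<rho> z = \<pi> z" if "z \<in> insert 0 ?H" "z \<noteq> 0" for z
      proof -
        have "z \<in> ?H" using that by blast
        then show ?thesis using m(2) that(2) by (metis \<rho>_def imageI)
      qed
      have "\<rho> 0 = m" by (simp add: \<rho>_def)
      then show "x = y" using mH[OF xy(1)] mH[OF xy(2)] xy(3) inj\<pi> by (metis injD)
    qed
    show "\<rho> x \<in> insert 0 ?H" if "x \<in> insert 0 ?H" for x
    proof (cases "x = 0")
      case True
      then show ?thesis using m(1) by (simp add: \<rho>_def)
    next
      case False
      then have "x \<in> ?H" using that by simp
      then have "\<pi> x \<in> insert 0 ?H" using \<pi>(2) by blast
      moreover have "\<rho> x = \<pi> x" using \<open>x \<in> ?H\<close> False by (simp add: \<rho>_def)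
      ultimately have "\<rho> x = \<pi> x" "\<pi> x \<in> insert 0 ?H" by simp_all
      then show ?thesis by simp
    qed
  qed (auto simp: \<rho>_def)
  define unshift where "unshift r x = r (wedge_letter a x) - a" for r :: "nat \<Rightarrow> nat" and x
  have unshift: "wedge_shift a (unshift r) = r" if r: "r permutes insert 0 ?H" for r
  proof
    fix x
    have letter: "r (wedge_letter a j) = wedge_letter a (r (wedge_letter a j) - a)" for j
    proof (cases "wedge_letter a j \<in> insert 0 ?H")
      case True
      then have "r (wedge_letter a j) \<in> insert 0 ?H" using permutes_in_image[OF r] by blast
      then show ?thesis by (auto simp: wedge_letter_def)
    next
      case False
      then have "r (wedge_letter a j) = wedge_letter a j" by (rule permutes_not_in[OF r])
      then show ?thesis by (simp only: wedge_letter_simps)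
    qed
    show "wedge_shift a (unshift r) x = r x"
    proof (cases x a rule: wedge_shift_cases)
      case low
      then have "r x = x" using permutes_not_in[OF r, of x] by auto
      then show ?thesis using low by (simp add: wedge_shift_low)
    next
      case (letter j)
      then show ?thesis using \<open>\<And>j. r (wedge_letter a j) = _\<close>[of j] by (simp add: unshift_def)
    qed
  qed
  have "unshift \<rho> permutes {0..b}"
  proof (rule bij_imp_permutes_off)
    have r': "inv_into UNIV \<rho> permutes insert 0 ?H" using permutes_inv[OF \<rho>] .
    have "wedge_shift a (unshift \<rho> \<circ> unshift (inv_into UNIV \<rho>)) = wedge_shift a id"
      "wedge_shift a (unshift (inv_into UNIV \<rho>) \<circ> unshift \<rho>) = wedge_shift a id"
      unfolding wedge_shift_comp unshift[OF \<rho>] unshift[OF r'] wedge_shift_id using permutes_inv_o[OF \<rho>] by simp_all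
    then have "unshift \<rho> \<circ> unshift (inv_into UNIV \<rho>) = id" "unshift (inv_into UNIV \<rho>) \<circ> unshift \<rho> = id"
      by (auto dest: wedge_shift_inj)
    then show "bij (unshift \<rho>)" by (rule o_bij[rotated])
    show "unshift \<rho> x = x" if "x \<notin> {0..b}" for x
      using that by (simp add: unshift_def wedge_letter_def \<rho>_def)
  qed
  moreover have "inv_into UNIV \<rho> \<circ> \<pi> permutes {0..a}"
  proof (rule permutes_superset)
    show "inv_into UNIV \<rho> \<circ> \<pi> permutes {0..a+b}"
    proof (rule permutes_compose[OF \<pi>(1)])
      show "inv_into UNIV \<rho> permutes {0..a+b}"
        using permutes_inv[OF \<rho>] by (rule permutes_subset) auto
    qed
    fix x assume "x \<in> {0..a+b} - {0..a}"
    then have "\<pi> x = \<rho> x" by (auto simp: \<rho>_def)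
    then show "(inv_into UNIV \<rho> \<circ> \<pi>) x = x" using permutes_inverses(2)[OF \<rho>] by simp
  qed
  moreover have "\<pi> = wedge_shift a (unshift \<rho>) \<circ> (inv_into UNIV \<rho> \<circ> \<pi>)"
    unfolding unshift[OF \<rho>] comp_assoc[symmetric] permutes_inv_o(1)[OF \<rho>] by simp
  ultimately show "\<exists>p\<in>?A. \<pi> = ?f p" by (intro bexI[of _ "(inv_into UNIV \<rho> \<circ> \<pi>, unshift \<rho>)"]) auto
qed

lemma dsum_permutes:
  assumes s: "\<sigma> permutes {1..a}" "\<sigma>' permutes {1..b}"
  shows "dsum a \<sigma> \<sigma>' permutes {1..a+b}" "dsum a \<sigma> \<sigma>' ` {1..a} = {1..a}"
proof -
  have low: "1 \<le> \<sigma> x \<and> \<sigma> x \<le> a" if "1 \<le> x" "x \<le> a" for x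
    using permutes_in_image[OF s(1), of x] that by simp
  have hi: "1 \<le> \<sigma>' x \<and> \<sigma>' x \<le> b" if "1 \<le> x" "x \<le> b" for x
    using permutes_in_image[OF s(2), of x] that by simp
  show "dsum a \<sigma> \<sigma>' permutes {1..a+b}"
  proof (rule inj_imp_permutes)
    show "inj_on (dsum a \<sigma> \<sigma>') {1..a+b}"
    proof (rule inj_onI)
      fix x y assume xy: "x \<in> {1..a+b}" "y \<in> {1..a+b}" "dsum a \<sigma> \<sigma>' x = dsum a \<sigma> \<sigma>' y"
      have inj: "inj \<sigma>" "inj \<sigma>'" using s permutes_inj by blast+
      consider "x \<le> a" "y \<le> a" | "x \<le> a" "a < y" | "a < x" "y \<le> a" | "a < x" "a < y" by linarith
      then show "x = y"
      proof cases
        case 1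
        then show ?thesis using xy(3) inj(1) by (simp add: dsum_def inj_eq)
      next
        case 2
        then have "1 \<le> y - a" "y - a \<le> b" "1 \<le> x" using xy(1,2) by auto
        then show ?thesis using 2 xy(3) low[of x] hi[of "y - a"] by (simp add: dsum_def)
      next
        case 3
        then have "1 \<le> x - a" "x - a \<le> b" "1 \<le> y" using xy(1,2) by auto
        then show ?thesis using 3 xy(3) low[of y] hi[of "x - a"] by (simp add: dsum_def)
      next
        case 4
        then have "x - a = y - a" using xy(3) inj(2) by (simp add: dsum_def inj_eq)
        then show ?thesis using 4 by linarith
      qed
    qed
    show "dsum a \<sigma> \<sigma>' x \<in> {1..a+b}" if "x \<in> {1..a+b}" for x
    proof (cases "x \<le> a")
      case True
      then show ?thesis using that low[of x] by (simp add: dsum_def)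
    next
      case False
      then have "1 \<le> x - a" "x - a \<le> b" using that by auto
      then show ?thesis using False hi[of "x - a"] by (simp add: dsum_def)
    qed
    show "dsum a \<sigma> \<sigma>' x = x" if "x \<notin> {1..a+b}" for x
    proof (cases "x \<le> a")
      case True
      then have "x \<notin> {1..a}" using that by simp
      then show ?thesis using True permutes_not_in[OF s(1)] by (simp add: dsum_def)
    next
      case False
      then have "x - a \<notin> {1..b}" using that by auto
      then show ?thesis using False permutes_not_in[OF s(2)] by (simp add: dsum_def)
    qed
  qed simp
  have "dsum a \<sigma> \<sigma>' ` {1..a} = \<sigma> ` {1..a}" by (intro image_cong refl) (simp add: dsum_def)
  then show "dsum a \<sigma> \<sigma>' ` {1..a} = {1..a}" using permutes_image[OF s(1)] by simp
qed

lemma dsum_surj: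
  assumes p: "\<pi> permutes {1..a+b}" "\<pi> ` {1..a} = {1..a}"
  shows "\<exists>\<sigma> \<sigma>'. \<sigma> permutes {1..a} \<and> \<sigma>' permutes {1..b} \<and> \<pi> = dsum a \<sigma> \<sigma>'"
proof -
  define \<sigma> where "\<sigma> x = (if x \<in> {1..a} then \<pi> x else x)" for x
  define \<sigma>' where "\<sigma>' x = (if x \<in> {1..b} then \<pi> (a + x) - a else x)" for x
  have inj: "inj \<pi>" using permutes_inj[OF p(1)] .
  have out: "\<pi> x = x" if "x \<notin> {1..a+b}" for x using permutes_not_in[OF p(1) that] .
  have hi: "\<pi> (a + x) \<in> {a+1..a+b}" if "x \<in> {1..b}" for x
  proof -
    have "\<pi> (a + x) \<notin> \<pi> ` {1..a}" using inj that by (simp add: inj_image_mem_iff)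
    then have "\<pi> (a + x) \<notin> {1..a}" unfolding p(2) .
    moreover have "\<pi> (a + x) \<in> {1..a+b}" using permutes_in_image[OF p(1), of "a + x"] that by simp
    ultimately show ?thesis by simp
  qed
  have "\<sigma> permutes {1..a}"
  proof (rule inj_imp_permutes)
    show "inj_on \<sigma> {1..a}" by (rule inj_onI) (simp add: \<sigma>_def inj_eq[OF inj])
    show "\<sigma> x \<in> {1..a}" if "x \<in> {1..a}" for x using imageI[OF that, of \<pi>] that unfolding p(2) \<sigma>_def by simp
  qed (auto simp: \<sigma>_def)
  moreover have "\<sigma>' permutes {1..b}"
  proof (rule inj_imp_permutes)
    show "inj_on \<sigma>' {1..b}"
    proof (rule inj_onI)
      fix x y assume xy: "x \<in> {1..b}" "y \<in> {1..b}" "\<sigma>' x = \<sigma>' y"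
      then have "\<pi> (a + x) - a = \<pi> (a + y) - a" "a \<le> \<pi> (a + x)" "a \<le> \<pi> (a + y)"
        using hi[of x] hi[of y] by (simp_all add: \<sigma>'_def)
      then have "\<pi> (a + x) = \<pi> (a + y)" by linarith
      then show "x = y" using inj by (simp add: inj_eq)
    qed
    show "\<sigma>' x \<in> {1..b}" if "x \<in> {1..b}" for x
    proof -
      have "\<sigma>' x = \<pi> (a + x) - a" using that by (simp add: \<sigma>'_def)
      then show ?thesis using hi[OF that] by auto
    qed
  qed (auto simp: \<sigma>'_def)
  moreover have "\<pi> = dsum a \<sigma> \<sigma>'"
  proof
    fix x
    consider "x = 0" | "x \<in> {1..a}" | "x - a \<in> {1..b}" "a < x" | "a + b < x" "a < x" by force
    then show "\<pi> x = dsum a \<sigma> \<sigma>' x"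
    proof cases
      case 1
      then show ?thesis using out[of x] by (simp add: dsum_def \<sigma>_def)
    next
      case 2
      then show ?thesis by (simp add: dsum_def \<sigma>_def)
    next
      case 3
      then have "\<sigma>' (x - a) = \<pi> x - a" by (simp add: \<sigma>'_def)
      moreover have "a \<le> \<pi> x" using hi[OF 3(1)] 3(2) by simp
      ultimately show ?thesis using 3 by (simp add: dsum_def)
    next
      case 4
      then have "x - a \<notin> {1..b}" by auto
      then have "\<sigma>' (x - a) = x - a" unfolding \<sigma>'_def by (rule if_not_P)
      then show ?thesis using 4 out[of x] by (simp add: dsum_def)
    qed
  qed
  ultimately show ?thesis by blast
qed

lemma bij_betw_dsum:
  "bij_betw (\<lambda>(\<sigma>, \<sigma>'). dsum a \<sigma> \<sigma>') ({\<sigma>. \<sigma> permutes {1..a}} \<times> {\<sigma>'. \<sigma>' permutes {1..b}})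
     {\<pi>. \<pi> permutes {1..a+b} \<and> \<pi> ` {1..a} = {1..a}}" (is "bij_betw ?f ?A ?B")
proof (rule bij_betwI')
  fix p p' assume "p \<in> ?A" "p' \<in> ?A"
  then obtain \<sigma> \<sigma>' \<rho> \<rho>' where p: "p = (\<sigma>, \<sigma>')" "p' = (\<rho>, \<rho>')"
    and perm: "\<sigma> permutes {1..a}" "\<sigma>' permutes {1..b}" "\<rho> permutes {1..a}" "\<rho>' permutes {1..b}" by auto
  show "?f p = ?f p' \<longleftrightarrow> p = p'"
  proof
    assume eq: "?f p = ?f p'"
    have eqx: "dsum a \<sigma> \<sigma>' x = dsum a \<rho> \<rho>' x" for x using eq p by simp
    have "\<sigma> x = \<rho> x" for x
      using eqx[of x] permutes_not_in[OF perm(1), of x] permutes_not_in[OF perm(3), of x]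
      by (cases "x \<le> a") (simp_all add: dsum_def)
    moreover have "\<sigma>' x = \<rho>' x" for x
      using eqx[of "a + x"] permutes_not_in[OF perm(2), of x] permutes_not_in[OF perm(4), of x]
      by (cases "x = 0") (simp_all add: dsum_def)
    ultimately show "p = p'" using p by (simp add: fun_eq_iff)
  qed simp
next
  fix p assume "p \<in> ?A"
  then obtain \<sigma> \<sigma>' where "p = (\<sigma>, \<sigma>')" "\<sigma> permutes {1..a}" "\<sigma>' permutes {1..b}" by auto
  then show "?f p \<in> ?B" using dsum_permutes[of \<sigma> a \<sigma>' b] by simp
next
  fix \<pi> assume "\<pi> \<in> ?B"
  then show "\<exists>p\<in>?A. \<pi> = ?f p" using dsum_surj[of \<pi> a b] by fastforce
qed


section \<open>Factorization cuts and the product of decorations\<close>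

lemma orbit_same:
  assumes "finite X" "p permutes X" "y \<in> orbit p x"
  shows "orbit p y = orbit p x" "x \<in> orbit p y"
proof -
  have perm: "permutation p" using assms(1,2) by (auto simp: permutation_permutes)
  have "cyclic_on p (orbit p x)" using cyclic_on_orbit'[OF perm] .
  then show "orbit p y = orbit p x" using assms(3) by (auto simp: cyclic_on_alldef)
  then show "x \<in> orbit p y" using permutation_self_in_orbit[OF perm] by simp
qed

text \<open>
  Induction along an orbit, where invariance has to be checked only at the points of the orbit.
\<close>
lemma orbit_within:
  assumes "y \<in> orbit p x" "x \<in> A" "\<And>z. z \<in> A \<Longrightarrow> z \<in> insert x (orbit p x) \<Longrightarrow> p z \<in> A"
  shows "y \<in> A"
  using assms(1)
proof induction
  case base
  then show ?case using assms(2,3) by simp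
next
  case (step y)
  then show ?case using assms(3)[of y] by simp
qed

text \<open>
  Condition (b) of a factorization cut in terms of the map alone. A nonroot cycle that contains a
  letter above \<open>c\<close> must stay above \<open>c\<close>, and the root cycle, once above \<open>c\<close>, can leave only through
  the root.
\<close>
lemma root_cut_iff:
  assumes \<tau>: "\<tau> permutes {0..m}"
  shows "(\<forall>Z\<in>cycles_on {0..m} \<tau>. 0 \<notin> Z \<longrightarrow> Z \<subseteq> {1..c} \<or> Z \<subseteq> {c + 1..m}) \<and>
     (\<forall>i j. i < length (root_word \<tau>) \<and> j < length (root_word \<tau>) \<and>
        root_word \<tau> ! i \<le> c \<and> c < root_word \<tau> ! j \<longrightarrow> i < j) \<longleftrightarrow>
     \<tau> ` {c + 1..m} \<subseteq> insert 0 {c + 1..m}" (is "?cyc \<and> ?word \<longleftrightarrow> ?img")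
proof -
  define T where "T = support \<tau> 0"
  note rT = root_cycle[OF \<tau>, folded T_def]
  have word: "root_word \<tau> ! i = T ! Suc i" "i < length (root_word \<tau>) \<longleftrightarrow> Suc i < length T" for i
    using rT(4) by (metis nth_Cons_Suc, metis Suc_less_eq length_Cons)
  have nz: "T ! Suc i \<noteq> 0" if "Suc i < length T" for i
    using rT(1,2,3) that by (metis nat.simps(3) nth_eq_iff_index_eq)
  show ?thesis
  proof
    assume L: "?cyc \<and> ?word"
    have "\<tau> x \<in> insert 0 {c + 1..m}" if x: "x \<in> {c + 1..m}" for x
    proof (cases "0 \<in> orbit \<tau> x")
      case False
      have "x \<in> orbit \<tau> x" using permutation_self_in_orbit[OF permutes_imp_permutation[OF \<tau>]] .
      then have "orbit \<tau> x \<subseteq> {c + 1..m}"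
      proof -
        have "orbit \<tau> x \<in> cycles_on {0..m} \<tau>" using x by (auto simp: cycles_on_def)
        then have "orbit \<tau> x \<subseteq> {1..c} \<or> orbit \<tau> x \<subseteq> {c + 1..m}" using L False by blast
        moreover have "x \<notin> {1..c}" using x by simp
        ultimately show ?thesis using \<open>x \<in> orbit \<tau> x\<close> by blast
      qed
      then show ?thesis using orbit.base[of \<tau> x] by blast
    next
      case True
      then have "x \<in> set T" using orbit_same(2)[OF _ \<tau>] rT(8) by simp
      then obtain k where k: "k < length T" "T ! k = x" by (metis in_set_conv_nth)
      have "k \<noteq> 0" using rT(2) k x by (intro notI) simp
      then obtain i where i: "k = Suc i" by (metis not0_implies_Suc)
      show ?thesis
      proof (cases "Suc k < length T")
        case False
        then have "Suc k mod length T = 0" using k by (metis mod_self less_antisym Suc_lessI)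
        then show ?thesis using rT(6)[OF k(1)] k(2) rT(2) by simp
      next
        case True
        then have tx: "\<tau> x = root_word \<tau> ! k" using rT(6)[OF k(1)] k(2) word by simp
        have "c < \<tau> x"
        proof (rule ccontr)
          assume "\<not> c < \<tau> x"
          then have "k < i"
            using L[THEN conjunct2, rule_format, of k i] tx True i k x word by simp
          then show False using i by simp
        qed
        moreover have "\<tau> x \<le> m" using permutes_in_image[OF \<tau>, of x] x by simp
        ultimately show ?thesis by simp
      qed
    qed
    then show ?img by (rule image_subsetI)
  next
    assume R: ?img
    have step: "\<tau> x \<in> {c + 1..m}" if "x \<in> {c + 1..m}" "\<tau> x \<noteq> 0" for x
      using subsetD[OF R imageI[OF that(1)]] that(2) by simp
    have ?cyc
    proof (intro ballI impI)
      fix Z assume Z: "Z \<in> cycles_on {0..m} \<tau>" "0 \<notin> Z"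
      then obtain z where z: "z \<in> {0..m}" "Z = orbit \<tau> z" by (auto simp: cycles_on_def)
      have Zm: "Z \<subseteq> {0..m}" using permutes_orbit_subset[OF \<tau> z(1)] z(2) by simp
      show "Z \<subseteq> {1..c} \<or> Z \<subseteq> {c + 1..m}"
      proof (cases "\<exists>x\<in>Z. x \<in> {c + 1..m}")
        case True
        then obtain x where x: "x \<in> Z" "x \<in> {c + 1..m}" by blast
        have Zx: "Z = orbit \<tau> x" using orbit_same(1)[OF _ \<tau>, of x z] x z by simp
        have "Z \<subseteq> {c + 1..m}"
        proof
          fix y assume "y \<in> Z"
          then have "y \<in> orbit \<tau> x" using Zx by simp
          then show "y \<in> {c + 1..m}"
          proof (rule orbit_within[OF _ x(2)])
            fix z assume "z \<in> {c + 1..m}" "z \<in> insert x (orbit \<tau> x)"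
            moreover then have "\<tau> z \<in> Z" unfolding Zx by (auto intro: orbit.intros)
            ultimately show "\<tau> z \<in> {c + 1..m}" using step Z(2) by metis
          qed
        qed
        then show ?thesis by simp
      next
        case False
        have "y \<in> {1..c}" if "y \<in> Z" for y
        proof -
          have "y \<noteq> 0" using that Z(2) by metis
          moreover have "y \<le> m" using that Zm by auto
          moreover have "\<not> (c + 1 \<le> y \<and> y \<le> m)" using that False by auto
          ultimately have "y \<noteq> 0" "y \<le> m" "\<not> (c + 1 \<le> y \<and> y \<le> m)" by blast+
          then show ?thesis by simp
        qed
        then show ?thesis by blast
      qed
    qed
    moreover have ?word
    proof (intro allI impI, rule ccontr)
      fix i j assume A: "i < length (root_word \<tau>) \<and> j < length (root_word \<tau>) \<and>
        root_word \<tau> ! i \<le> c \<and> c < root_word \<tau> ! j" "\<not> i < j"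
      have "T ! Suc k \<in> {c + 1..m}" if "j \<le> k" "Suc k < length T" for k
        using that
      proof (induction k rule: dec_induct)
        case base
        then have "T ! Suc j \<in> set T" by simp
        then have "T ! Suc j \<le> m" using rT(7) by auto
        then show ?case using A word by simp
      next
        case (step k)
        then have "T ! Suc k \<in> {c + 1..m}" by simp
        moreover have "\<tau> (T ! Suc k) = T ! Suc (Suc k)" using rT(6)[of "Suc k"] step by simp
        ultimately show ?case using \<open>\<And>x. x \<in> {c + 1..m} \<Longrightarrow> _ \<Longrightarrow> _\<close>[of "T ! Suc k"] nz[of "Suc k"] step.prems by simp
      qed
      from this[of i] show False using A word by simp
    qed
    ultimately show "?cyc \<and> ?word" ..
  qed
qed

lemma is_fact_cut_iff:
  assumes "(\<sigma>, \<tau>) \<in> decorations n"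
  shows "is_fact_cut n (\<sigma>, \<tau>) c \<longleftrightarrow> \<sigma> ` {1..half_up c} = {1..half_up c} \<and>
     \<tau> ` {half_down c + 1..half_down n} \<subseteq> insert 0 {half_down c + 1..half_down n}"
proof -
  have "\<tau> permutes {0..half_down n}" using assms by (simp add: decorations_def)
  from root_cut_iff[OF this, of "half_down c"] show ?thesis by (simp add: is_fact_cut_def)
qed

text \<open>The parity condition under which the roundings of \<open>m / 2\<close> are additive.\<close>
definition not_both_odd :: "nat \<Rightarrow> nat \<Rightarrow> bool" where
  "not_both_odd a b \<longleftrightarrow> \<not> (odd a \<and> odd b)"

lemma Suc_half_add: "not_both_odd a b \<Longrightarrow> Suc (a + b) div 2 = Suc a div 2 + Suc b div 2"
  unfolding not_both_odd_def by presburger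

lemma half_add:
  assumes "not_both_odd a b"
  shows "half_up (a + b) = half_up a + half_up b" "half_down (a + b) = half_down a + half_down b"
  using assms unfolding not_both_odd_def by presburger+

lemma deco_prod_eq:
  assumes "(\<sigma>, \<tau>) \<in> decorations a" "(\<sigma>', \<tau>') \<in> decorations b"
  shows "deco_prod a (\<sigma>, \<tau>) (\<sigma>', \<tau>') = (dsum (half_up a) \<sigma> \<sigma>', wedge_shift (half_down a) \<tau>' \<circ> \<tau>)"
  using assms rooted_prod_eq[of \<tau> "half_down a" \<tau>' "half_down b"] by (simp add: deco_prod_def decorations_def)

text \<open>
  Both components of the product are unique factorizations: a permutation that preserves an initial
  segment is a direct sum, and one that moves high letters only to high letters or to the root is a
  rooted product. Together these two conditions say that \<open>a\<close> is a factorization cut.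
\<close>
lemma bij_betw_deco_prod:
  assumes "not_both_odd a b"
  shows "bij_betw (\<lambda>(\<xi>, \<xi>'). deco_prod a \<xi> \<xi>') (decorations a \<times> decorations b)
    {\<theta> \<in> decorations (a + b). is_fact_cut (a + b) \<theta> a}" (is "bij_betw ?f ?A ?B")
proof -
  let ?A1 = "{\<sigma>. \<sigma> permutes {1..half_up a}} \<times> {\<sigma>. \<sigma> permutes {1..half_up b}}"
  let ?A2 = "{\<tau>. \<tau> permutes {0..half_down a}} \<times> {\<tau>. \<tau> permutes {0..half_down b}}"
  let ?B1 = "{\<pi>. \<pi> permutes {1..half_up a + half_up b} \<and> \<pi> ` {1..half_up a} = {1..half_up a}}"
  let ?B2 = "{\<pi>. \<pi> permutes {0..half_down a + half_down b} \<and>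
    \<pi> ` {half_down a + 1..half_down a + half_down b} \<subseteq> insert 0 {half_down a + 1..half_down a + half_down b}}"
  let ?f1 = "\<lambda>(\<sigma>, \<sigma>'). dsum (half_up a) \<sigma> \<sigma>'"
  let ?f2 = "\<lambda>(\<tau>, \<tau>'). wedge_shift (half_down a) \<tau>' \<circ> \<tau>"
  let ?s = "\<lambda>((\<sigma>, \<tau>), (\<sigma>', \<tau>')). ((\<sigma>, \<sigma>'), (\<tau>, \<tau>'))"
  have "bij_betw ?s ?A (?A1 \<times> ?A2)"
    by (rule bij_betwI[where g = "\<lambda>((\<sigma>, \<sigma>'), (\<tau>, \<tau>')). ((\<sigma>, \<tau>), (\<sigma>', \<tau>'))"]) (auto simp: decorations_def)
  moreover have "bij_betw (map_prod ?f1 ?f2) (?A1 \<times> ?A2) (?B1 \<times> ?B2)"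
    by (rule bij_betw_map_prod[OF bij_betw_dsum bij_betw_wedge])
  ultimately have bij: "bij_betw (map_prod ?f1 ?f2 \<circ> ?s) ?A (?B1 \<times> ?B2)" by (rule bij_betw_trans)
  have eq: "(map_prod ?f1 ?f2 \<circ> ?s) p = ?f p" if "p \<in> ?A" for p
    using that deco_prod_eq by (cases p) force
  have B: "?B1 \<times> ?B2 = ?B"
  proof -
    have "(\<sigma>, \<tau>) \<in> ?B1 \<times> ?B2 \<longleftrightarrow> (\<sigma>, \<tau>) \<in> ?B" for \<sigma> \<tau>
    proof (cases "(\<sigma>, \<tau>) \<in> decorations (a + b)")
      case True
      then show ?thesis using is_fact_cut_iff[OF True, of a]
        unfolding half_add[OF assms] by (simp del: One_nat_def add: decorations_def half_add[OF assms] Suc_half_add[OF assms])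
    next
      case False
      then have "\<not> (\<sigma> permutes {1..half_up a + half_up b} \<and> \<tau> permutes {0..half_down a + half_down b})"
        by (simp del: One_nat_def add: decorations_def half_add[OF assms])
      then show ?thesis using False by blast
    qed
    then have "p \<in> ?B1 \<times> ?B2 \<longleftrightarrow> p \<in> ?B" for p by (cases p) (simp only:)
    then show ?thesis by (rule Set.set_eqI)
  qed
  have "bij_betw ?f ?A (?B1 \<times> ?B2)"
    using bij bij_betw_cong[of ?A "map_prod ?f1 ?f2 \<circ> ?s" ?f "?B1 \<times> ?B2", OF eq] by (rule iffD1[rotated])
  then show ?thesis by (simp only: B)
qed

lemma deco_prod_mem:
  assumes "not_both_odd a b" "\<xi> \<in> decorations a" "\<xi>' \<in> decorations b"
  shows "deco_prod a \<xi> \<xi>' \<in> decorations (a + b)" "is_fact_cut (a + b) (deco_prod a \<xi> \<xi>') a"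
  using bij_betwE[OF bij_betw_deco_prod[OF assms(1)]] assms(2,3) by fastforce+

text \<open>
  The left factor leaves the letters above its own range alone, so a cut to the right of \<open>a\<close> only
  concerns the right factor.
\<close>
lemma is_fact_cut_deco_prod:
  assumes "not_both_odd a b" "not_both_odd a c" "c \<le> b" "\<xi> \<in> decorations a" "\<xi>' \<in> decorations b"
  shows "is_fact_cut (a + b) (deco_prod a \<xi> \<xi>') (a + c) \<longleftrightarrow> is_fact_cut b \<xi>' c"
proof -
  obtain \<sigma> \<tau> \<sigma>' \<tau>' where x: "\<xi> = (\<sigma>, \<tau>)" "\<xi>' = (\<sigma>', \<tau>')" by (cases \<xi>, cases \<xi>')
  have perm: "\<sigma> permutes {1..half_up a}" "\<tau> permutes {0..half_down a}" "\<sigma>' permutes {1..half_up b}" "\<tau>' permutes {0..half_down b}"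
    using assms(4,5) x by (auto simp: decorations_def)
  let ?A = "half_up a" and ?B = "half_up b" and ?C = "half_up c"
  have 1: "dsum ?A \<sigma> \<sigma>' ` {1..?A + ?C} = {1..?A + ?C} \<longleftrightarrow> \<sigma>' ` {1..?C} = {1..?C}"
  proof -
    have split: "{1..?A + ?C} = {1..?A} \<union> (+) ?A ` {1..?C}" by (auto simp: image_iff Bex_def)
    have "dsum ?A \<sigma> \<sigma>' ` (+) ?A ` {1..?C} = (+) ?A ` \<sigma>' ` {1..?C}"
      unfolding image_image by (intro image_cong) (auto simp: dsum_def)
    then have img: "dsum ?A \<sigma> \<sigma>' ` {1..?A + ?C} = {1..?A} \<union> (+) ?A ` \<sigma>' ` {1..?C}"
      unfolding split image_Un dsum_permutes(2)[OF perm(1,3)] by simp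
    have pos: "0 < \<sigma>' x" if "x \<in> {1..?C}" for x
      using that permutes_not_in[OF perm(3), of x] permutes_in_image[OF perm(3), of x] by (cases "x \<in> {1..?B}") auto
    have disj: "{1..?A} \<inter> (+) ?A ` \<sigma>' ` {1..?C} = {}" "{1..?A} \<inter> (+) ?A ` {1..?C} = {}"
    proof -
      show "{1..?A} \<inter> (+) ?A ` {1..?C} = {}" by auto
      have "y \<notin> {1..?A}" if y: "y \<in> (+) ?A ` \<sigma>' ` {1..?C}" for y
      proof -
        obtain x where x: "x \<in> {1..?C}" "y = ?A + \<sigma>' x" using y by blast
        then show ?thesis using pos[OF x(1)] by simp
      qed
      then show "{1..?A} \<inter> (+) ?A ` \<sigma>' ` {1..?C} = {}" by blast
    qed
    have "dsum ?A \<sigma> \<sigma>' ` {1..?A + ?C} = {1..?A + ?C} \<longleftrightarrow> (+) ?A ` \<sigma>' ` {1..?C} = (+) ?A ` {1..?C}"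
    proof -
      have "P \<union> Q = P \<union> R \<longleftrightarrow> Q = R" if "P \<inter> Q = {}" "P \<inter> R = {}" for P Q R :: "nat set" using that by blast
      from this[OF disj] show ?thesis unfolding img by (simp only: split)
    qed
    also have "\<dots> \<longleftrightarrow> \<sigma>' ` {1..?C} = {1..?C}" by (rule inj_image_eq_iff) simp
    finally show ?thesis .
  qed
  let ?a = "half_down a" and ?b = "half_down b" and ?c = "half_down c"
  have 2: "(wedge_shift ?a \<tau>' \<circ> \<tau>) ` {?a + ?c + 1..?a + ?b} \<subseteq> insert 0 {?a + ?c + 1..?a + ?b} \<longleftrightarrow>
     \<tau>' ` {?c + 1..?b} \<subseteq> insert 0 {?c + 1..?b}"
  proof -
    have set: "{?a + ?c + 1..?a + ?b} = (+) ?a ` {?c + 1..?b}" by (simp add: add.assoc)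
    have "(wedge_shift ?a \<tau>' \<circ> \<tau>) ` {?a + ?c + 1..?a + ?b} = wedge_letter ?a ` \<tau>' ` {?c + 1..?b}"
      unfolding set image_image by (intro image_cong refl wedge_comp_high[OF perm(2)]) simp
    moreover have "insert 0 {?a + ?c + 1..?a + ?b} = wedge_letter ?a ` insert 0 {?c + 1..?b}"
    proof -
      have "wedge_letter ?a ` {?c + 1..?b} = (+) ?a ` {?c + 1..?b}"
        by (intro image_cong refl) (simp add: wedge_letter_def)
      then show ?thesis by (simp only: set image_insert wedge_letter_simps)
    qed
    moreover have "inj (wedge_letter ?a)" by (rule injI) simp
    ultimately show ?thesis by (simp only: inj_image_subset_iff)
  qed
  have mem: "(dsum ?A \<sigma> \<sigma>', wedge_shift ?a \<tau>' \<circ> \<tau>) \<in> decorations (a + b)"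
    using deco_prod_mem(1)[OF assms(1,4,5)] deco_prod_eq assms(4,5) x by metis
  show ?thesis using 1 2 deco_prod_eq[of \<sigma> \<tau> a \<sigma>' \<tau>' b] is_fact_cut_iff[OF mem, of "a + c"] is_fact_cut_iff[of \<sigma>' \<tau>' b c] assms(4,5)
    by (simp only: x half_add[OF assms(1)] half_add[OF assms(2)])
qed

text \<open>
  Shifting is functorial, so the second component is a composition of three maps in either
  bracketing.
\<close>
lemma deco_prod_assoc:
  assumes "not_both_odd a b" "not_both_odd b c"
    "\<xi> \<in> decorations a" "\<xi>' \<in> decorations b" "\<xi>'' \<in> decorations c"
  shows "deco_prod (a + b) (deco_prod a \<xi> \<xi>') \<xi>'' = deco_prod a \<xi> (deco_prod b \<xi>' \<xi>'')"
proof -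
  obtain \<sigma> \<tau> \<sigma>' \<tau>' \<sigma>'' \<tau>'' where x: "\<xi> = (\<sigma>, \<tau>)" "\<xi>' = (\<sigma>', \<tau>')" "\<xi>'' = (\<sigma>'', \<tau>'')" by (cases \<xi>, cases \<xi>', cases \<xi>'')
  have l: "deco_prod a \<xi> \<xi>' \<in> decorations (a + b)" "deco_prod b \<xi>' \<xi>'' \<in> decorations (b + c)"
    using deco_prod_mem(1) assms by blast+
  have "dsum (half_up a + half_up b) (dsum (half_up a) \<sigma> \<sigma>') \<sigma>'' = dsum (half_up a) \<sigma> (dsum (half_up b) \<sigma>' \<sigma>'')"
    by (auto simp: dsum_def fun_eq_iff add.assoc)
  moreover have "wedge_shift (half_down a + half_down b) \<tau>'' \<circ> (wedge_shift (half_down a) \<tau>' \<circ> \<tau>) =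
    wedge_shift (half_down a) (wedge_shift (half_down b) \<tau>'' \<circ> \<tau>') \<circ> \<tau>"
    by (simp add: wedge_shift_comp wedge_shift_shift comp_assoc)
  ultimately show ?thesis
    using assms(3-5) l unfolding x
    by (simp add: deco_prod_eq[where b = b] deco_prod_eq[where b = c] deco_prod_eq[where b = "b + c"] half_add[OF assms(1)] Suc_half_add[OF assms(1)])
qed


section \<open>Bidegrees, and iterated products of decorations\<close>

lemma orbit_conjugate:
  assumes "x \<in> A" "\<And>y. y \<in> A \<Longrightarrow> h y \<in> A" "\<And>y. y \<in> A \<Longrightarrow> g (f y) = f (h y)"
  shows "orbit g (f x) = f ` orbit h x"
proof -
  have "(g ^^ n) (f x) = f ((h ^^ n) x) \<and> (h ^^ n) x \<in> A" for n
    by (induction n) (use assms in auto)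
  then show ?thesis unfolding orbit_altdef by (auto simp: image_iff)
qed

lemma cycles_on_subset: "p permutes X \<Longrightarrow> Z \<in> cycles_on X p \<Longrightarrow> Z \<subseteq> X \<and> Z \<noteq> {}"
  using permutes_orbit_subset orbit_nonempty unfolding cycles_on_def by (metis imageE)

lemma finite_cycles_on [simp]: "finite X \<Longrightarrow> finite (cycles_on X p)"
  by (simp add: cycles_on_def)

lemma card_cycles_on_le: "finite X \<Longrightarrow> card (cycles_on X p) \<le> card X"
  unfolding cycles_on_def by (rule card_image_le)

text \<open>
  The cycles of a direct sum are those of the first summand and the shifted ones of the second.
\<close>
lemma card_cycles_dsum:
  assumes s: "\<sigma> permutes {1..a}" "\<sigma>' permutes {1..b}"
  shows "card (cycles_on {1..a+b} (dsum a \<sigma> \<sigma>')) = card (cycles_on {1..a} \<sigma>) + card (cycles_on {1..b} \<sigma>')"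
proof -
  let ?d = "dsum a \<sigma> \<sigma>'"
  have "orbit ?d (id x) = id ` orbit \<sigma> x" if "x \<in> {1..a}" for x
  proof (rule orbit_conjugate[where A = "{1..a}"])
    show "\<sigma> y \<in> {1..a}" if "y \<in> {1..a}" for y using permutes_in_image[OF s(1)] that by blast
  qed (use that in \<open>simp_all add: dsum_def\<close>)
  then have 1: "orbit ?d ` {1..a} = cycles_on {1..a} \<sigma>" by (auto simp: cycles_on_def image_iff)
  have "orbit ?d (a + x) = (+) a ` orbit \<sigma>' x" if "x \<in> {1..b}" for x
  proof (rule orbit_conjugate[where A = "{1..b}"])
    show "\<sigma>' y \<in> {1..b}" if "y \<in> {1..b}" for y using permutes_in_image[OF s(2)] that by blast
  qed (use that in \<open>simp_all add: dsum_def\<close>)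
  then have 2: "orbit ?d ` (+) a ` {1..b} = (`) ((+) a) ` cycles_on {1..b} \<sigma>'" 
    unfolding cycles_on_def image_image by (intro image_cong refl)
  have "{1..a+b} = {1..a} \<union> (+) a ` {1..b}" by (auto simp: image_iff Bex_def)
  then have "cycles_on {1..a+b} ?d = cycles_on {1..a} \<sigma> \<union> (`) ((+) a) ` cycles_on {1..b} \<sigma>'"
    unfolding cycles_on_def[of "{1..a+b}"] by (simp only: image_Un 1 2)
  moreover have "Z \<notin> (`) ((+) a) ` cycles_on {1..b} \<sigma>'" if Z: "Z \<in> cycles_on {1..a} \<sigma>" for Z
  proof
    assume "Z \<in> (`) ((+) a) ` cycles_on {1..b} \<sigma>'"
    then obtain Y where Y: "Z = (+) a ` Y" "Y \<in> cycles_on {1..b} \<sigma>'" by blast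
    then obtain y where "y \<in> Y" "0 < y" using cycles_on_subset[OF s(2) Y(2)] by fastforce
    moreover have "a + y \<in> {1..a}" using cycles_on_subset[OF s(1) Z] Y(1) \<open>y \<in> Y\<close> by blast
    ultimately show False by simp
  qed
  then have "cycles_on {1..a} \<sigma> \<inter> (`) ((+) a) ` cycles_on {1..b} \<sigma>' = {}" by blast
  moreover have "inj_on ((`) ((+) a)) (cycles_on {1..b} \<sigma>')" by (rule inj_onI) (simp add: inj_image_eq_iff)
  ultimately show ?thesis by (simp add: card_Un_disjoint card_image)
qed

definition nonroot_cycles :: "nat \<Rightarrow> (nat \<Rightarrow> nat) \<Rightarrow> nat set set" where
  "nonroot_cycles m p = {orbit p x | x. x \<in> {1..m} \<and> 0 \<notin> orbit p x}"

lemma card_cycles_root: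
  assumes p: "p permutes {0..m}"
  shows "card (cycles_on {0..m} p) = Suc (card (nonroot_cycles m p))"
proof -
  have self: "x \<in> orbit p x" for x using permutation_self_in_orbit[OF permutes_imp_permutation[OF p]] .
  have root: "orbit p x = orbit p 0" if "0 \<in> orbit p x" for x using orbit_same(1)[OF _ p that] by simp
  have "cycles_on {0..m} p = insert (orbit p 0) (nonroot_cycles m p)"
  proof (rule subset_antisym)
    show "cycles_on {0..m} p \<subseteq> insert (orbit p 0) (nonroot_cycles m p)"
    proof
      fix Z assume "Z \<in> cycles_on {0..m} p"
      then obtain x where x: "x \<in> {0..m}" "Z = orbit p x" by (auto simp: cycles_on_def)
      show "Z \<in> insert (orbit p 0) (nonroot_cycles m p)"
      proof (cases "0 \<in> orbit p x")
        case False
        then have "x \<in> {1..m}" using x self[of x] by (cases "x = 0") auto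
        then show ?thesis using False x(2) unfolding nonroot_cycles_def by blast
      qed (use root x in simp)
    qed
    show "insert (orbit p 0) (nonroot_cycles m p) \<subseteq> cycles_on {0..m} p"
      unfolding nonroot_cycles_def cycles_on_def by auto
  qed
  moreover have "orbit p 0 \<notin> nonroot_cycles m p" using self[of 0] by (auto simp: nonroot_cycles_def)
  moreover have "finite (nonroot_cycles m p)" unfolding nonroot_cycles_def by simp
  ultimately show ?thesis by simp
qed

text \<open>
  On a nonroot cycle of either factor the composition agrees with that factor. The two root cycles
  are merged into the root cycle of the product, so no further nonroot cycles arise.
\<close>
lemma nonroot_cycles_wedge:
  assumes \<tau>: "\<tau> permutes {0..a}" and \<upsilon>: "\<upsilon> permutes {0..b}"
  shows "nonroot_cycles (a + b) (wedge_shift a \<upsilon> \<circ> \<tau>) = nonroot_cycles a \<tau> \<union> (`) ((+) a) ` nonroot_cycles b \<upsilon>"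
proof -
  let ?\<pi> = "wedge_shift a \<upsilon> \<circ> \<tau>"
  have \<pi>: "?\<pi> permutes {0..a+b}" by (rule wedge_comp_permutes[OF \<tau> \<upsilon>])
  have fin: "finite {0..m}" for m :: nat by simp
  have self: "x \<in> orbit p x" if "p permutes {0..m}" for p x and m :: nat
    using permutation_self_in_orbit[OF permutes_imp_permutation[OF that]] .
  have low: "orbit ?\<pi> x = orbit \<tau> x" if x: "x \<in> {1..a}" "0 \<notin> orbit \<tau> x" for x
  proof -
    have sub: "orbit \<tau> x \<subseteq> {1..a}"
    proof
      fix y assume y: "y \<in> orbit \<tau> x"
      then have "y \<in> {0..a}" using permutes_orbit_subset[OF \<tau>, of x] x(1) by auto
      moreover have "y \<noteq> 0" using y x(2) by metis
      ultimately show "y \<in> {1..a}" by simp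
    qed
    have "orbit ?\<pi> (id x) = id ` orbit \<tau> x"
    proof (rule orbit_conjugate[where A = "orbit \<tau> x"])
      show "x \<in> orbit \<tau> x" by (rule self[OF \<tau>])
      show "\<tau> y \<in> orbit \<tau> x" if "y \<in> orbit \<tau> x" for y using that by (rule orbit.step)
      fix y assume "y \<in> orbit \<tau> x"
      then have "\<tau> y \<in> {1..a}" using sub orbit.step[of y \<tau> x] by blast
      then show "?\<pi> (id y) = id (\<tau> y)" by (simp add: wedge_shift_low)
    qed
    then show ?thesis by simp
  qed
  have high: "orbit ?\<pi> (a + x) = (+) a ` orbit \<upsilon> x" if x: "x \<in> {1..b}" "0 \<notin> orbit \<upsilon> x" for x
  proof (rule orbit_conjugate[where A = "orbit \<upsilon> x"])
    show "x \<in> orbit \<upsilon> x" by (rule self[OF \<upsilon>])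
    show "\<upsilon> y \<in> orbit \<upsilon> x" if "y \<in> orbit \<upsilon> x" for y using that by (rule orbit.step)
    fix y assume y: "y \<in> orbit \<upsilon> x"
    then have "0 < y" "0 < \<upsilon> y" using x(2) orbit.step[OF y] by (auto intro: gr0I)
    then show "?\<pi> (a + y) = a + \<upsilon> y" using wedge_comp_high[OF \<tau>] by (simp add: wedge_letter_def)
  qed
  \<comment> \<open>The two root cycles are strung together.\<close>
  let ?W = "orbit ?\<pi> 0"
  have W0: "0 \<in> ?W" by (rule self[OF \<pi>])
  have rootlow: "y \<in> ?W" if "y \<in> orbit \<tau> 0" for y
    using that W0
  proof (rule orbit_within)
    fix z assume z: "z \<in> ?W" "z \<in> insert 0 (orbit \<tau> 0)"
    show "\<tau> z \<in> ?W"
    proof (cases "\<tau> z = 0")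
      case False
      have "z \<in> {0..a}" using z(2) permutes_orbit_subset[OF \<tau>, of 0] by auto
      then have "\<tau> z \<le> a" using permutes_in_image[OF \<tau>, of z] by simp
      then have "?\<pi> z = \<tau> z" using False by (simp add: wedge_shift_low)
      then show ?thesis using orbit.step[OF z(1)] by simp
    qed (use W0 in simp)
  qed
  have roothigh: "wedge_letter a y \<in> ?W" if "y \<in> orbit \<upsilon> 0" for y
  proof -
    have "y \<in> {y. wedge_letter a y \<in> ?W}" using that
    proof (rule orbit_within)
      show "0 \<in> {y. wedge_letter a y \<in> ?W}" using W0 by simp
      fix z assume z: "z \<in> {y. wedge_letter a y \<in> ?W}"
      show "\<upsilon> z \<in> {y. wedge_letter a y \<in> ?W}"
      proof (cases "z = 0")
        case True
        obtain x where x: "\<tau> x = 0" using permutes_surj[OF \<tau>] by (metis surjD)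
        have "0 \<in> orbit \<tau> x" using orbit.base[of \<tau> x] x by simp
        then have "x \<in> orbit \<tau> 0" using orbit_same(2)[OF fin \<tau>] by blast
        then have "?\<pi> x \<in> ?W" using rootlow orbit.step by metis
        then show ?thesis using x True by (simp add: wedge_shift_def)
      next
        case False
        then have "?\<pi> (wedge_letter a z) = wedge_letter a (\<upsilon> z)"
          using wedge_comp_high[OF \<tau>, of z] by (simp add: wedge_letter_def)
        then show ?thesis using orbit.step[of "wedge_letter a z" ?\<pi> 0] z by simp
      qed
    qed
    then show ?thesis by simp
  qed
  have nonroot: "0 \<notin> orbit p x" if "p permutes {0..m}" "x \<notin> orbit p 0" for p x and m :: nat
    using orbit_same(2)[OF fin that(1)] that(2) by blast
  show ?thesis
  proof (rule subset_antisym)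
    show "nonroot_cycles (a + b) ?\<pi> \<subseteq> nonroot_cycles a \<tau> \<union> (`) ((+) a) ` nonroot_cycles b \<upsilon>"
    proof
      fix Z assume "Z \<in> nonroot_cycles (a + b) ?\<pi>"
      then obtain x where x: "Z = orbit ?\<pi> x" "x \<in> {1..a+b}" "0 \<notin> orbit ?\<pi> x" by (auto simp: nonroot_cycles_def)
      have xW: "x \<notin> ?W" using orbit_same(2)[OF fin \<pi>] x(3) by blast
      show "Z \<in> nonroot_cycles a \<tau> \<union> (`) ((+) a) ` nonroot_cycles b \<upsilon>"
      proof (cases "x \<le> a")
        case True
        then have "x \<in> {1..a}" "0 \<notin> orbit \<tau> x" using x xW rootlow nonroot[OF \<tau>] by auto
        then show ?thesis using low x(1) unfolding nonroot_cycles_def by blast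
      next
        case False
        then obtain y where y: "x = a + y" "y \<in> {1..b}" using x(2)
          by (metis One_nat_def atLeastAtMost_iff le_add_diff_inverse nat_add_left_cancel_le nat_le_linear not_less_eq_eq zero_less_diff Suc_leI add_0_right le_zero_eq not0_implies_Suc Suc_le_mono le0)
        have "0 \<notin> orbit \<upsilon> y"
          using nonroot[OF \<upsilon>] roothigh[of y] xW y by (auto simp: wedge_letter_def)
        then show ?thesis using high[OF y(2)] x(1) y unfolding nonroot_cycles_def by blast
      qed
    qed
    show "nonroot_cycles a \<tau> \<union> (`) ((+) a) ` nonroot_cycles b \<upsilon> \<subseteq> nonroot_cycles (a + b) ?\<pi>"
    proof
      fix Z assume "Z \<in> nonroot_cycles a \<tau> \<union> (`) ((+) a) ` nonroot_cycles b \<upsilon>"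
      then show "Z \<in> nonroot_cycles (a + b) ?\<pi>"
      proof
        assume "Z \<in> nonroot_cycles a \<tau>"
        then obtain x where x: "Z = orbit \<tau> x" "x \<in> {1..a}" "0 \<notin> orbit \<tau> x" by (auto simp: nonroot_cycles_def)
        then have "Z = orbit ?\<pi> x" "0 \<notin> orbit ?\<pi> x" "x \<in> {1..a+b}" using low[of x] by simp_all
        then show ?thesis unfolding nonroot_cycles_def by blast
      next
        assume "Z \<in> (`) ((+) a) ` nonroot_cycles b \<upsilon>"
        then obtain x where x: "Z = (+) a ` orbit \<upsilon> x" "x \<in> {1..b}" "0 \<notin> orbit \<upsilon> x" by (auto simp: nonroot_cycles_def)
        then have "Z = orbit ?\<pi> (a + x)" "0 \<notin> orbit ?\<pi> (a + x)" "a + x \<in> {1..a+b}" using high[OF x(2,3)] by auto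
        then show ?thesis unfolding nonroot_cycles_def by blast
      qed
    qed
  qed
qed

lemma card_cycles_wedge:
  assumes \<tau>: "\<tau> permutes {0..a}" and \<upsilon>: "\<upsilon> permutes {0..b}"
  shows "Suc (card (cycles_on {0..a+b} (wedge_shift a \<upsilon> \<circ> \<tau>))) = card (cycles_on {0..a} \<tau>) + card (cycles_on {0..b} \<upsilon>)"
proof -
  have fin: "finite (nonroot_cycles m p)" for m p unfolding nonroot_cycles_def by simp
  have "Z \<notin> (`) ((+) a) ` nonroot_cycles b \<upsilon>" if "Z \<in> nonroot_cycles a \<tau>" for Z
  proof
    assume "Z \<in> (`) ((+) a) ` nonroot_cycles b \<upsilon>"
    then obtain x where x: "Z = (+) a ` orbit \<upsilon> x" "0 \<notin> orbit \<upsilon> x" by (auto simp: nonroot_cycles_def)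
    have "\<upsilon> x \<in> orbit \<upsilon> x" by (rule orbit.base)
    then have "a + \<upsilon> x \<in> Z" "0 < \<upsilon> x" using x by (auto intro: gr0I)
    moreover have "Z \<subseteq> {0..a}" using that permutes_orbit_subset[OF \<tau>] by (fastforce simp: nonroot_cycles_def)
    ultimately show False by auto
  qed
  then have "nonroot_cycles a \<tau> \<inter> (`) ((+) a) ` nonroot_cycles b \<upsilon> = {}" by blast
  moreover have "inj_on ((`) ((+) a)) (nonroot_cycles b \<upsilon>)" by (rule inj_onI) (simp add: inj_image_eq_iff)
  ultimately show ?thesis
    unfolding card_cycles_root[OF wedge_comp_permutes[OF assms]] card_cycles_root[OF \<tau>] card_cycles_root[OF \<upsilon>]
      nonroot_cycles_wedge[OF assms] by (simp add: card_Un_disjoint card_image fin)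
qed

lemma deg_deco_prod:
  assumes "not_both_odd a b" "\<xi> \<in> decorations a" "\<xi>' \<in> decorations b"
  shows "deg_q (a + b) (deco_prod a \<xi> \<xi>') = deg_q a \<xi> + deg_q b \<xi>'"
    "deg_t (a + b) (deco_prod a \<xi> \<xi>') = deg_t a \<xi> + deg_t b \<xi>'"
proof -
  obtain \<sigma> \<tau> \<sigma>' \<tau>' where x: "\<xi> = (\<sigma>, \<tau>)" "\<xi>' = (\<sigma>', \<tau>')" by (cases \<xi>, cases \<xi>')
  have perm: "\<sigma> permutes {1..half_up a}" "\<tau> permutes {0..half_down a}" "\<sigma>' permutes {1..half_up b}" "\<tau>' permutes {0..half_down b}"
    using assms(2,3) x by (auto simp: decorations_def)
  have prod: "deco_prod a (\<sigma>, \<tau>) (\<sigma>', \<tau>') = (dsum (half_up a) \<sigma> \<sigma>', wedge_shift (half_down a) \<tau>' \<circ> \<tau>)"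
    using deco_prod_eq assms(2,3) x by blast
  have le: "card (cycles_on {1..half_up a} \<sigma>) \<le> half_up a" "card (cycles_on {1..half_up b} \<sigma>') \<le> half_up b"
    using card_cycles_on_le[of "{1..half_up a}" \<sigma>] card_cycles_on_le[of "{1..half_up b}" \<sigma>'] by simp_all
  have pos: "0 < card (cycles_on {0..half_down a} \<tau>)" "0 < card (cycles_on {0..half_down b} \<tau>')"
    using card_cycles_root perm(2,4) by simp_all
  show "deg_q (a + b) (deco_prod a \<xi> \<xi>') = deg_q a \<xi> + deg_q b \<xi>'"
    unfolding x prod deg_q_def prod.case half_add[OF assms(1)] card_cycles_dsum[OF perm(1,3)] using le by linarith
  show "deg_t (a + b) (deco_prod a \<xi> \<xi>') = deg_t a \<xi> + deg_t b \<xi>'"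
    unfolding x prod deg_t_def prod.case half_add[OF assms(1)] card_cycles_dsum[OF perm(1,3)]
    using card_cycles_wedge[OF perm(2,4)] pos by linarith
qed

text \<open>
  The iterated product, bracketed to the right. The second clause gives the product of the empty
  list, which is the only decoration of size \<open>0\<close>.
\<close>
fun deco_fold :: "nat list \<Rightarrow> decoration list \<Rightarrow> decoration" where
  "deco_fold (b # \<beta>) (\<xi> # \<xi>s) = deco_prod b \<xi> (deco_fold \<beta> \<xi>s)"
| "deco_fold _ _ = (id, id)"

definition deco_lists :: "nat list \<Rightarrow> decoration list set" where
  "deco_lists \<beta> = {\<xi>s. list_all2 (\<lambda>b \<xi>. \<xi> \<in> decorations b) \<beta> \<xi>s}"

text \<open>
  The cut set together with the total size, in a form suited to induction along the list.
\<close>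
fun partial_sums :: "nat list \<Rightarrow> nat set" where
  "partial_sums [] = {}"
| "partial_sums (b # \<beta>) = insert b ((+) b ` partial_sums \<beta>)"

definition at_most_one_odd :: "nat list \<Rightarrow> bool" where
  "at_most_one_odd \<beta> \<longleftrightarrow> length (filter odd \<beta>) \<le> 1"

lemma partial_sums_le: "c \<in> partial_sums \<beta> \<Longrightarrow> c \<le> sum_list \<beta>"
  by (induction \<beta> arbitrary: c) auto

lemma all_even_sums:
  assumes "\<forall>b\<in>set \<beta>. even b"
  shows "even (sum_list \<beta>)" "\<And>c. c \<in> partial_sums \<beta> \<Longrightarrow> even c"
proof -
  have "even (sum_list \<beta>) \<and> (\<forall>c\<in>partial_sums \<beta>. even c)"
    using assms by (induction \<beta>) simp_all
  then show "even (sum_list \<beta>)" "\<And>c. c \<in> partial_sums \<beta> \<Longrightarrow> even c" by blast+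
qed

lemma at_most_one_odd_Cons:
  assumes "at_most_one_odd (b # \<beta>)"
  shows "at_most_one_odd \<beta>" "not_both_odd b (sum_list \<beta>)" "c \<in> partial_sums \<beta> \<Longrightarrow> not_both_odd b c"
proof -
  show "at_most_one_odd \<beta>" using assms by (simp add: at_most_one_odd_def split: if_splits)
  have "\<forall>c\<in>set \<beta>. even c" if "odd b"
    using assms that by (simp add: at_most_one_odd_def filter_empty_conv)
  then show "not_both_odd b (sum_list \<beta>)" "c \<in> partial_sums \<beta> \<Longrightarrow> not_both_odd b c"
    using all_even_sums[of \<beta>] unfolding not_both_odd_def by blast+
qed

text \<open>
  The values of the iterated product: the decorations which can be cut at every partial sum.
\<close>
definition fold_image :: "nat list \<Rightarrow> decoration set" where
  "fold_image \<beta> = {\<theta> \<in> decorations (sum_list \<beta>). \<forall>c\<in>partial_sums \<beta>. is_fact_cut (sum_list \<beta>) \<theta> c}"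

lemma decorations_0: "decorations 0 = {(id, id)}"
proof -
  have "{\<tau>. \<tau> permutes {0 :: nat}} = {id}" by auto
  then show ?thesis by (simp add: decorations_def)
qed

text \<open>
  The first cut allows splitting off the first factor, and by \<open>is_fact_cut_deco_prod\<close> the other cuts
  are conditions on the remaining factor.
\<close>
lemma bij_betw_fold_image_Cons:
  assumes "at_most_one_odd (b # \<beta>)"
  shows "bij_betw (\<lambda>(\<xi>, \<xi>'). deco_prod b \<xi> \<xi>') (decorations b \<times> fold_image \<beta>) (fold_image (b # \<beta>))"
    (is "bij_betw ?f _ _")
proof -
  note o = at_most_one_odd_Cons[OF assms]
  let ?n = "sum_list \<beta>"
  have bij: "bij_betw ?f (decorations b \<times> decorations ?n) {\<theta> \<in> decorations (b + ?n). is_fact_cut (b + ?n) \<theta> b}"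
    by (rule bij_betw_deco_prod[OF o(2)])
  have sub: "decorations b \<times> fold_image \<beta> \<subseteq> decorations b \<times> decorations ?n" by (auto simp: fold_image_def)
  have mem: "?f p \<in> fold_image (b # \<beta>) \<longleftrightarrow> p \<in> decorations b \<times> fold_image \<beta>" if p0: "p \<in> decorations b \<times> decorations ?n" for p
  proof -
    obtain \<xi> \<xi>' where p: "p = (\<xi>, \<xi>')" "\<xi> \<in> decorations b" "\<xi>' \<in> decorations ?n" using p0 by blast
    have "is_fact_cut (b + ?n) (deco_prod b \<xi> \<xi>') (b + c) \<longleftrightarrow> is_fact_cut ?n \<xi>' c" if "c \<in> partial_sums \<beta>" for c
      using is_fact_cut_deco_prod[OF o(2) o(3)[OF that] partial_sums_le[OF that] p(2,3)] .
    then show ?thesis using deco_prod_mem[OF o(2) p(2,3)] p by (auto simp: fold_image_def)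
  qed
  have "?f ` (decorations b \<times> fold_image \<beta>) = fold_image (b # \<beta>)"
  proof (rule subset_antisym)
    show "?f ` (decorations b \<times> fold_image \<beta>) \<subseteq> fold_image (b # \<beta>)" using mem sub by blast
    show "fold_image (b # \<beta>) \<subseteq> ?f ` (decorations b \<times> fold_image \<beta>)"
    proof
      fix \<theta> assume \<theta>: "\<theta> \<in> fold_image (b # \<beta>)"
      then have "\<theta> \<in> {\<theta> \<in> decorations (b + ?n). is_fact_cut (b + ?n) \<theta> b}" by (auto simp: fold_image_def)
      then obtain p where "p \<in> decorations b \<times> decorations ?n" "\<theta> = ?f p"
        using bij_betw_imp_surj_on[OF bij] by (metis (no_types, lifting) imageE)
      then show "\<theta> \<in> ?f ` (decorations b \<times> fold_image \<beta>)" using mem \<theta> by blast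
    qed
  qed
  then show ?thesis using inj_on_subset[OF bij_betw_imp_inj_on[OF bij] sub] by (simp add: bij_betw_def)
qed

lemma bij_betw_deco_fold:
  assumes "at_most_one_odd \<beta>"
  shows "bij_betw (deco_fold \<beta>) (deco_lists \<beta>) (fold_image \<beta>)"
  using assms
proof (induction \<beta>)
  case Nil
  have "deco_lists [] = {[]}" by (simp add: deco_lists_def)
  then show ?case by (simp add: fold_image_def decorations_0 bij_betw_def)
next
  case (Cons b \<beta>)
  note o = at_most_one_odd_Cons[OF Cons.prems]
  let ?f = "\<lambda>(\<xi>, \<xi>'). deco_prod b \<xi> \<xi>'"
  have "bij_betw (\<lambda>\<xi>s. (hd \<xi>s, tl \<xi>s)) (deco_lists (b # \<beta>)) (decorations b \<times> deco_lists \<beta>)"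
    by (rule bij_betwI[where g = "\<lambda>(\<xi>, \<xi>s). \<xi> # \<xi>s"]) (auto simp: deco_lists_def list_all2_Cons1)
  moreover have "bij_betw (map_prod id (deco_fold \<beta>)) (decorations b \<times> deco_lists \<beta>) (decorations b \<times> fold_image \<beta>)"
    using Cons.IH[OF o(1)] by (intro bij_betw_map_prod) auto
  moreover have "bij_betw ?f (decorations b \<times> fold_image \<beta>) (fold_image (b # \<beta>))"
    by (rule bij_betw_fold_image_Cons[OF Cons.prems])
  ultimately have "bij_betw (?f \<circ> (map_prod id (deco_fold \<beta>) \<circ> (\<lambda>\<xi>s. (hd \<xi>s, tl \<xi>s)))) (deco_lists (b # \<beta>)) (fold_image (b # \<beta>))"
    by (blast intro: bij_betw_trans)
  then show ?case
  proof (rule bij_betw_cong[THEN iffD1, rotated])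
    fix \<xi>s assume "\<xi>s \<in> deco_lists (b # \<beta>)"
    then obtain \<xi> \<xi>s' where "\<xi>s = \<xi> # \<xi>s'" by (auto simp: deco_lists_def list_all2_Cons1)
    then show "(?f \<circ> (map_prod id (deco_fold \<beta>) \<circ> (\<lambda>\<xi>s. (hd \<xi>s, tl \<xi>s)))) \<xi>s = deco_fold (b # \<beta>) \<xi>s" by simp
  qed
qed

lemma deco_fold_mem: "at_most_one_odd \<beta> \<Longrightarrow> \<xi>s \<in> deco_lists \<beta> \<Longrightarrow> deco_fold \<beta> \<xi>s \<in> decorations (sum_list \<beta>)"
  using bij_betwE[OF bij_betw_deco_fold] by (auto simp: fold_image_def)

lemma deg_unit: "deg_q 0 (id, id) = 0" "deg_t 0 (id, id) = 0"
  by (simp_all add: deg_q_def deg_t_def cycles_on_def)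

lemma deg_deco_fold:
  assumes "at_most_one_odd \<beta>" "\<xi>s \<in> deco_lists \<beta>"
  shows "deg_q (sum_list \<beta>) (deco_fold \<beta> \<xi>s) = sum_list (map2 deg_q \<beta> \<xi>s) \<and>
    deg_t (sum_list \<beta>) (deco_fold \<beta> \<xi>s) = sum_list (map2 deg_t \<beta> \<xi>s)"
  using assms
proof (induction \<beta> arbitrary: \<xi>s)
  case Nil
  then show ?case by (simp add: deco_lists_def deg_unit)
next
  case (Cons b \<beta>)
  note o = at_most_one_odd_Cons[OF Cons.prems(1)]
  obtain \<xi> \<xi>s' where x: "\<xi>s = \<xi> # \<xi>s'" "\<xi> \<in> decorations b" "\<xi>s' \<in> deco_lists \<beta>"
    using Cons.prems(2) by (auto simp: deco_lists_def list_all2_Cons1)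
  show ?case using deg_deco_prod[OF o(2) x(2) deco_fold_mem[OF o(1) x(3)]] Cons.IH[OF o(1) x(3)] x(1) by simp
qed

text \<open>
  Replacing two neighbouring decorations by their product is a change of brackets. This is why the
  differential preserves the iterated product.
\<close>
lemma deco_fold_merge:
  assumes "at_most_one_odd \<beta>" "\<xi>s \<in> deco_lists \<beta>" "Suc i < length \<beta>"
  shows "deco_fold (take i \<beta> @ [\<beta> ! i + \<beta> ! Suc i] @ drop (i + 2) \<beta>)
     (take i \<xi>s @ [deco_prod (\<beta> ! i) (\<xi>s ! i) (\<xi>s ! Suc i)] @ drop (i + 2) \<xi>s) = deco_fold \<beta> \<xi>s"
  using assms
proof (induction i arbitrary: \<beta> \<xi>s)
  case 0
  then obtain b c \<beta>' where \<beta>: "\<beta> = b # c # \<beta>'" by (metis Suc_length_conv less_imp_Suc_add list.exhaust list.size(3) not_less_zero length_Cons Suc_less_eq)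
  with 0 obtain \<xi> \<xi>' \<xi>s' where x: "\<xi>s = \<xi> # \<xi>' # \<xi>s'" "\<xi> \<in> decorations b" "\<xi>' \<in> decorations c" "\<xi>s' \<in> deco_lists \<beta>'"
    by (auto simp: deco_lists_def list_all2_Cons1)
  note o = at_most_one_odd_Cons[OF 0(1)[unfolded \<beta>]]
  note o' = at_most_one_odd_Cons[OF o(1)]
  have "not_both_odd b c" using o(3)[of c] by simp
  then show ?case unfolding \<beta> x(1)
    using deco_prod_assoc[OF _ o'(2) x(2,3) deco_fold_mem[OF o'(1) x(4)]] by simp
next
  case (Suc i)
  then obtain b \<beta>' where \<beta>: "\<beta> = b # \<beta>'" by (cases \<beta>) auto
  with Suc.prems obtain \<xi> \<xi>s' where x: "\<xi>s = \<xi> # \<xi>s'" "\<xi>s' \<in> deco_lists \<beta>'"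
    by (auto simp: deco_lists_def list_all2_Cons1)
  show ?case using Suc.IH[OF at_most_one_odd_Cons(1)[OF Suc.prems(1)[unfolded \<beta>]] x(2)] Suc.prems(3) by (simp add: \<beta> x(1))
qed


section \<open>Cuts, compositions and flags of initial unions\<close>

definition flags_of_type :: "nat \<Rightarrow> nat set \<Rightarrow> nat set set set" where
  "flags_of_type n S = {\<Gamma> \<in> flags n S. card ` \<Gamma> = S}"

lemma partial_sums_eq: "partial_sums \<beta> = (\<lambda>i. sum_list (take i \<beta>)) ` {1..length \<beta>}"
proof (induction \<beta>)
  case (Cons b \<beta>)
  have "{1..length (b # \<beta>)} = insert 1 (Suc ` {1..length \<beta>})"
    by (auto simp: image_iff Bex_def)
  then have "(\<lambda>i. sum_list (take i (b # \<beta>))) ` {1..length (b # \<beta>)} =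
      insert (sum_list (take 1 (b # \<beta>))) ((\<lambda>i. sum_list (take (Suc i) (b # \<beta>))) ` {1..length \<beta>})"
    by (simp only: image_insert image_image)
  then show ?case by (simp add: Cons image_image)
qed simp

lemma cuts_eq: "cuts \<beta> = (\<lambda>i. sum_list (take i \<beta>)) ` {1..<length \<beta>}"
  by (auto simp: cuts_def)

lemma partial_sums_cuts: "\<beta> \<noteq> [] \<Longrightarrow> partial_sums \<beta> = insert (sum_list \<beta>) (cuts \<beta>)"
proof -
  assume "\<beta> \<noteq> []"
  then have "{1..length \<beta>} = insert (length \<beta>) {1..<length \<beta>}" by (cases \<beta>) auto
  then show ?thesis by (simp add: partial_sums_eq cuts_eq)
qed

lemma sum_take_less:
  assumes "composition n \<beta>" "i < j" "j \<le> length \<beta>"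
  shows "sum_list (take i \<beta>) < sum_list (take j \<beta>)"
  using assms(2,3)
proof (induction j rule: less_induct)
  case (less j)
  then obtain m where m: "j = Suc m" by (cases j) auto
  have "0 < \<beta> ! m" using assms(1) less.prems m by (auto simp: composition_def)
  then have "sum_list (take m \<beta>) < sum_list (take j \<beta>)" using less.prems m by (simp add: take_Suc_conv_app_nth)
  then show ?case using less.IH[of m] less.prems m by (cases "i = m") auto
qed

lemma sum_take_inj:
  assumes "composition n \<beta>"
  shows "inj_on (\<lambda>i. sum_list (take i \<beta>)) {0..length \<beta>}"
  using sum_take_less[OF assms] by (intro linorder_inj_onI) fastforce+

lemma card_cuts: "composition n \<beta> \<Longrightarrow> card (cuts \<beta>) = length \<beta> - 1"
  unfolding cuts_eq by (subst card_image) (auto intro: inj_on_subset[OF sum_take_inj])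

lemma composition_nonempty: "composition n \<beta> \<Longrightarrow> 0 < n \<Longrightarrow> \<beta> \<noteq> []"
  by (auto simp: composition_def)

lemma cuts_range:
  assumes "composition n \<beta>"
  shows "cuts \<beta> \<subseteq> {1..<n}"
proof -
  have "sum_list (take i \<beta>) \<in> {1..<n}" if "i \<in> {1..<length \<beta>}" for i
    using sum_take_less[OF assms, of 0 i] sum_take_less[OF assms, of i "length \<beta>"] that assms
    by (simp add: composition_def)
  then show ?thesis by (auto simp: cuts_eq)
qed

lemma partial_sums_inj:
  assumes "\<forall>b\<in>set \<beta>. 0 < b" "\<forall>c\<in>set \<gamma>. 0 < c" "partial_sums \<beta> = partial_sums \<gamma>"
  shows "\<beta> = \<gamma>"
  using assms
proof (induction \<beta> arbitrary: \<gamma>)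
  case Nil
  then show ?case by (cases \<gamma>) auto
next
  case (Cons b \<beta>)
  then obtain c \<gamma>' where \<gamma>: "\<gamma> = c # \<gamma>'" by (cases \<gamma>) auto
  have pos: "0 < s" if "s \<in> partial_sums \<delta>" "\<forall>b\<in>set \<delta>. 0 < b" for s \<delta>
    using that by (cases \<delta>) auto
  have eq: "insert b ((+) b ` partial_sums \<beta>) = insert c ((+) c ` partial_sums \<gamma>')"
    using Cons.prems(3) \<gamma> by simp
  have "b \<in> insert c ((+) c ` partial_sums \<gamma>')" "c \<in> insert b ((+) b ` partial_sums \<beta>)"
    using eq by blast+
  then have "c \<le> b" "b \<le> c" by auto
  then have "b = c" by simp
  have "b \<notin> (+) b ` partial_sums \<beta>" "b \<notin> (+) b ` partial_sums \<gamma>'"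
    using pos Cons.prems(1,2) \<gamma> by fastforce+
  then have "(+) b ` partial_sums \<beta> = (+) b ` partial_sums \<gamma>'"
    using eq \<open>b = c\<close> by (metis insert_ident)
  then have "partial_sums \<beta> = partial_sums \<gamma>'" by (simp add: inj_image_eq_iff)
  then show ?case using Cons.IH[of \<gamma>'] Cons.prems(1,2) \<gamma> \<open>b = c\<close> by simp
qed

text \<open>The parts are the successive differences of the given numbers.\<close>
lemma partial_sums_exists:
  assumes "finite P" "\<forall>c\<in>P. 0 < c"
  shows "\<exists>\<beta>. (\<forall>b\<in>set \<beta>. 0 < b) \<and> partial_sums \<beta> = P"
  using assms
proof (induction "card P" arbitrary: P)
  case 0
  then show ?case by (intro exI[of _ "[]"]) simp
next
  case (Suc k)
  then have ne: "P \<noteq> {}" by auto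
  define m where "m = Min P"
  have m: "m \<in> P" "\<And>c. c \<in> P \<Longrightarrow> m \<le> c" using ne Suc.prems(1) by (simp_all add: m_def)
  define P' where "P' = (\<lambda>c. c - m) ` (P - {m})"
  have "inj_on (\<lambda>c. c - m) (P - {m})" using m(2) by (intro inj_on_diff_nat) auto
  then have "k = card P'" using Suc.hyps(2) m(1) Suc.prems(1) by (simp add: P'_def card_image)
  moreover have "0 < c" if cP: "c \<in> P'" for c
  proof -
    obtain x where "x \<in> P" "x \<noteq> m" "c = x - m" using cP by (auto simp: P'_def)
    then show ?thesis using m(2)[of x] by simp
  qed
  ultimately obtain \<beta> where \<beta>: "\<forall>b\<in>set \<beta>. 0 < b" "partial_sums \<beta> = P'"
    using Suc.hyps(1)[of P'] Suc.prems(1) by (auto simp: P'_def)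
  have "(+) m ` P' = P - {m}"
    unfolding P'_def image_image using m(2) by (auto simp: image_iff)
  then have "partial_sums (m # \<beta>) = P" using \<beta>(2) m(1) by auto
  moreover have "\<forall>b\<in>set (m # \<beta>). 0 < b" using \<beta>(1) m(1) Suc.prems(2) by simp
  ultimately show ?case by blast
qed

lemma sum_in_partial_sums: "\<beta> \<noteq> [] \<Longrightarrow> sum_list \<beta> \<in> partial_sums \<beta>"
  by (simp add: partial_sums_cuts)

lemma composition_of_cuts:
  assumes "0 < n" "S \<subseteq> {1..<n}"
  shows "composition n (comp_of_cuts n S) \<and> cuts (comp_of_cuts n S) = S"
proof -
  have "\<exists>!\<gamma>. composition n \<gamma> \<and> cuts \<gamma> = S"
  proof -
    have "finite (insert n S)" using assms(2) finite_subset by auto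
    then obtain \<beta> where \<beta>: "\<forall>b\<in>set \<beta>. 0 < b" "partial_sums \<beta> = insert n S"
      using partial_sums_exists[of "insert n S"] assms by (force simp del: One_nat_def)
    then have ne: "\<beta> \<noteq> []" by auto
    have "sum_list \<beta> \<in> insert n S" using sum_in_partial_sums[OF ne] \<beta>(2) by simp
    moreover have "n \<le> sum_list \<beta>" using partial_sums_le[of n \<beta>] \<beta>(2) by simp
    ultimately have n: "sum_list \<beta> = n" using assms(2) by auto
    then have comp: "composition n \<beta>" using \<beta>(1) by (simp add: composition_def)
    have "insert n (cuts \<beta>) = insert n S" using partial_sums_cuts[OF ne] \<beta>(2) n by simp
    moreover have "n \<notin> cuts \<beta>" "n \<notin> S" using cuts_range[OF comp] assms(2) by auto
    ultimately have "cuts \<beta> = S" by (metis insert_ident)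
    moreover have "\<gamma> = \<beta>" if "composition n \<gamma>" "cuts \<gamma> = S" for \<gamma>
    proof -
      have "\<gamma> \<noteq> []" using composition_nonempty[OF that(1) assms(1)] .
      then have "partial_sums \<gamma> = partial_sums \<beta>"
        using that \<beta>(2) partial_sums_cuts[of \<gamma>] by (simp add: composition_def)
      then show ?thesis using that(1) \<beta>(1) by (intro partial_sums_inj) (auto simp: composition_def)
    qed
    ultimately show ?thesis using comp by blast
  qed
  then show ?thesis unfolding comp_of_cuts_def by (rule theI')
qed

lemma composition_eqI:
  assumes "composition n \<beta>" "composition n \<gamma>" "cuts \<beta> = cuts \<gamma>"
  shows "\<beta> = \<gamma>"
proof (cases "n = 0")
  case True
  then have "\<delta> = []" if "composition n \<delta>" for \<delta> using that by (cases \<delta>) (auto simp: composition_def)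
  then show ?thesis using assms by metis
next
  case False
  then have "\<beta> \<noteq> []" "\<gamma> \<noteq> []" using composition_nonempty assms(1,2) by blast+
  then have "partial_sums \<beta> = partial_sums \<gamma>"
    using assms by (simp add: partial_sums_cuts composition_def)
  then show ?thesis using assms(1,2) by (intro partial_sums_inj) (auto simp: composition_def)
qed

lemma comp_of_cuts_cuts:
  assumes "composition n \<beta>" "0 < n"
  shows "comp_of_cuts n (cuts \<beta>) = \<beta>"
  using composition_of_cuts[OF assms(2) cuts_range[OF assms(1)]] assms(1) by (intro composition_eqI[of n]) auto

lemma bij_betw_cuts_coarsening:
  assumes "composition n \<alpha>" "0 < n"
  shows "bij_betw cuts {\<beta>. coarsening \<beta> \<alpha>} (Pow (cuts \<alpha>))"
proof (rule bij_betwI[where g = "comp_of_cuts n"])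
  have n: "sum_list \<alpha> = n" using assms(1) by (simp add: composition_def)
  show "cuts \<in> {\<beta>. coarsening \<beta> \<alpha>} \<rightarrow> Pow (cuts \<alpha>)" by (auto simp: coarsening_def)
  have T: "composition n (comp_of_cuts n T) \<and> cuts (comp_of_cuts n T) = T" if "T \<subseteq> cuts \<alpha>" for T
    using composition_of_cuts[OF assms(2)] cuts_range[OF assms(1)] that by blast
  then show "comp_of_cuts n \<in> Pow (cuts \<alpha>) \<rightarrow> {\<beta>. coarsening \<beta> \<alpha>}" by (auto simp: coarsening_def n)
  show "comp_of_cuts n (cuts \<beta>) = \<beta>" if "\<beta> \<in> {\<beta>. coarsening \<beta> \<alpha>}" for \<beta>
    using that comp_of_cuts_cuts assms(2) by (simp add: coarsening_def n)
  show "cuts (comp_of_cuts n T) = T" if "T \<in> Pow (cuts \<alpha>)" for T using T that by simp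
qed

text \<open>
  The partial sums change parity exactly at the odd parts. At most one odd part therefore means that
  a partial sum, once odd, stays odd; in this form the property passes to subsets of the partial
  sums.
\<close>
lemma at_most_one_odd_iff:
  "at_most_one_odd \<beta> \<longleftrightarrow> (\<forall>c\<in>partial_sums \<beta>. \<forall>c'\<in>partial_sums \<beta>. c \<le> c' \<longrightarrow> odd c \<longrightarrow> odd c')"
proof (induction \<beta>)
  case (Cons b \<beta>)
  have ev: "(\<forall>c\<in>partial_sums \<beta>. even c) \<longleftrightarrow> (\<forall>b\<in>set \<beta>. even b)" for \<beta>
    by (induction \<beta>) (auto simp: all_even_sums)
  show ?case
  proof (cases "odd b")
    case True
    have "at_most_one_odd (b # \<beta>) \<longleftrightarrow> (\<forall>b\<in>set \<beta>. even b)"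
      using True by (auto simp: at_most_one_odd_def filter_empty_conv)
    also have "\<dots> \<longleftrightarrow> (\<forall>c\<in>partial_sums \<beta>. even c)" by (rule ev[symmetric])
    also have "\<dots> \<longleftrightarrow> (\<forall>c\<in>partial_sums (b # \<beta>). \<forall>c'\<in>partial_sums (b # \<beta>). c \<le> c' \<longrightarrow> odd c \<longrightarrow> odd c')"
      using True by auto
    finally show ?thesis .
  next
    case False
    then have "at_most_one_odd (b # \<beta>) \<longleftrightarrow> at_most_one_odd \<beta>" by (simp add: at_most_one_odd_def)
    then show ?thesis using False unfolding Cons by auto
  qed
qed (simp add: at_most_one_odd_def)

lemma coarsening_at_most_one_odd:
  assumes "coarsening \<beta> \<alpha>" "composition n \<alpha>" "at_most_one_odd \<alpha>" "0 < n"
  shows "at_most_one_odd \<beta>"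
proof -
  have n: "sum_list \<alpha> = n" "composition n \<beta>" "cuts \<beta> \<subseteq> cuts \<alpha>" using assms(1,2) by (auto simp: coarsening_def composition_def)
  have "\<alpha> \<noteq> []" "\<beta> \<noteq> []" using composition_nonempty assms(2,4) n(2) by blast+
  then have "partial_sums \<beta> \<subseteq> partial_sums \<alpha>" using n by (auto simp: partial_sums_cuts composition_def)
  then show ?thesis using assms(3) unfolding at_most_one_odd_iff by blast
qed

subsection \<open>Ordered set partitions as flags\<close>

definition initial_union :: "nat set list \<Rightarrow> nat \<Rightarrow> nat set" where
  "initial_union Bs i = \<Union> (set (take i Bs))"

text \<open>
  Only the proper initial unions, so that neither \<open>\<emptyset>\<close> nor the whole set is a member.
\<close>
definition flag_of :: "nat set list \<Rightarrow> nat set set" where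
  "flag_of Bs = initial_union Bs ` {1..<length Bs}"

lemma initial_union_Suc: "i < length Bs \<Longrightarrow> initial_union Bs (Suc i) = initial_union Bs i \<union> Bs ! i"
  by (simp add: initial_union_def take_Suc_conv_app_nth Un_commute)

lemma initial_union_mono: "i \<le> j \<Longrightarrow> initial_union Bs i \<subseteq> initial_union Bs j"
  unfolding initial_union_def by (intro Union_mono set_take_subset_set_take)

context
  fixes n :: nat and \<beta> :: "nat list" and Bs :: "nat set list"
  assumes comp: "composition n \<beta>" and Bs: "Bs \<in> osp n \<beta>"
begin

lemma osp_length: "length Bs = length \<beta>" using Bs by (simp add: osp_def)

lemma osp_card: "i < length \<beta> \<Longrightarrow> card (Bs ! i) = \<beta> ! i" using Bs by (simp add: osp_def)

lemma osp_map_card: "map card Bs = \<beta>"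
  using osp_length osp_card by (intro nth_equalityI) auto

lemma osp_finite: "i < length \<beta> \<Longrightarrow> finite (Bs ! i)"
  using Bs finite_subset[of "Bs ! i" "{1..n}"] by (force simp: osp_def)

lemma initial_union_all: "initial_union Bs (length \<beta>) = {1..n}"
  using Bs by (simp add: initial_union_def osp_def)

lemma initial_union_sub: "initial_union Bs i \<subseteq> {1..n}"
proof -
  have "initial_union Bs i \<subseteq> \<Union> (set Bs)"
    unfolding initial_union_def by (intro Union_mono set_take_subset)
  then show ?thesis using Bs by (simp add: osp_def)
qed

lemma initial_union_disjoint: "i < length \<beta> \<Longrightarrow> initial_union Bs i \<inter> Bs ! i = {}"
proof -
  assume i: "i < length \<beta>"
  have "A \<inter> Bs ! i = {}" if A: "A \<in> set (take i Bs)" for A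
  proof -
    obtain j where "j < i" "A = Bs ! j" using A i osp_length by (auto simp: in_set_conv_nth)
    then show ?thesis using Bs i by (simp add: osp_def)
  qed
  then show ?thesis unfolding initial_union_def by blast
qed

lemma block_eq: "i < length \<beta> \<Longrightarrow> Bs ! i = initial_union Bs (Suc i) - initial_union Bs i"
  using initial_union_disjoint[of i] osp_length by (auto simp: initial_union_Suc)

lemma card_initial_union: "i \<le> length \<beta> \<Longrightarrow> card (initial_union Bs i) = sum_list (take i \<beta>)"
proof (induction i)
  case 0
  then show ?case by (simp add: initial_union_def)
next
  case (Suc i)
  have "finite (initial_union Bs i)" using initial_union_sub finite_subset by blast
  then show ?case using Suc osp_length osp_finite[of i] osp_card[of i] initial_union_disjoint[of i]
    by (simp add: initial_union_Suc card_Un_disjoint take_Suc_conv_app_nth)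
qed

lemma initial_union_inj: "inj_on (initial_union Bs) {0..length \<beta>}"
proof (rule inj_onI)
  fix i j assume "i \<in> {0..length \<beta>}" "j \<in> {0..length \<beta>}" "initial_union Bs i = initial_union Bs j"
  then show "i = j" using card_initial_union[of i] card_initial_union[of j] inj_onD[OF sum_take_inj[OF comp], of i j] by simp
qed

lemma flag_of_type: "flag_of Bs \<in> flags_of_type n (cuts \<beta>)"
proof -
  have "card ` flag_of Bs = cuts \<beta>"
    unfolding flag_of_def cuts_eq image_image osp_length using card_initial_union by (intro image_cong) auto
  moreover have "A \<subseteq> G \<or> G \<subseteq> A" if AG: "A \<in> flag_of Bs" "G \<in> flag_of Bs" for A G
  proof -
    obtain i j where "A = initial_union Bs i" "G = initial_union Bs j" using AG by (auto simp: flag_of_def)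
    then show ?thesis using initial_union_mono[of i j Bs] initial_union_mono[of j i Bs] by (cases "i \<le> j") auto
  qed
  moreover have "flag_of Bs \<subseteq> Pow {1..n}" using initial_union_sub by (auto simp: flag_of_def)
  ultimately show ?thesis by (simp add: flags_of_type_def flags_def)
qed

lemma card_flag_of: "card (flag_of Bs) = length \<beta> - 1"
  unfolding flag_of_def osp_length by (subst card_image) (auto intro: inj_on_subset[OF initial_union_inj])

text \<open>
  The number of members below an initial union is determined by its index; this identifies the signs
  of the two boundaries.
\<close>
lemma flag_of_below:
  assumes "i < length \<beta>"
  shows "{G \<in> flag_of Bs. G \<subset> initial_union Bs i} = initial_union Bs ` {1..<i}"
proof -
  have lt: "initial_union Bs j \<subset> initial_union Bs i \<longleftrightarrow> j < i" if "j < length \<beta>" for j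
    using inj_onD[OF initial_union_inj, of i j] initial_union_mono[of i j Bs] initial_union_mono[of j i Bs] that assms
    by (cases "j < i") (auto simp: psubset_eq)
  have "{j \<in> {1..<length \<beta>}. initial_union Bs j \<subset> initial_union Bs i} = {1..<i}"
  proof (rule Set.set_eqI)
    fix j show "j \<in> {j \<in> {1..<length \<beta>}. initial_union Bs j \<subset> initial_union Bs i} \<longleftrightarrow> j \<in> {1..<i}"
      unfolding mem_Collect_eq atLeastLessThan_iff using lt[of j] assms by (metis order.strict_trans)
  qed
  then show ?thesis unfolding flag_of_def osp_length Compr_image_eq by simp
qed

lemma card_flag_of_below: "i < length \<beta> \<Longrightarrow> card {G \<in> flag_of Bs. G \<subset> initial_union Bs i} = i - 1"
  by (subst flag_of_below, assumption, subst card_image) (auto intro: inj_on_subset[OF initial_union_inj])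

text \<open>
  Merging the blocks \<open>i\<close> and \<open>i + 1\<close> deletes the initial union that ends between them and keeps all
  others.
\<close>
lemma merge_osp:
  assumes i: "Suc i < length \<beta>"
  defines "Bs' \<equiv> take i Bs @ [Bs ! i \<union> Bs ! Suc i] @ drop (i + 2) Bs"
    and "\<beta>' \<equiv> take i \<beta> @ [\<beta> ! i + \<beta> ! Suc i] @ drop (i + 2) \<beta>"
  shows "initial_union Bs' j = (if j \<le> i then initial_union Bs j else initial_union Bs (Suc j))"
    "flag_of Bs' = flag_of Bs - {initial_union Bs (Suc i)}"
    "composition n \<beta>'" "Bs' \<in> osp n \<beta>'" "cuts \<beta>' \<subseteq> cuts \<beta>"
proof -
  have Bsd: "Bs = take i Bs @ Bs ! i # Bs ! Suc i # drop (i + 2) Bs"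
    using i osp_length by (metis Cons_nth_drop_Suc Suc_lessD add_2_eq_Suc' append_take_drop_id)
  have \<beta>d: "\<beta> = take i \<beta> @ \<beta> ! i # \<beta> ! Suc i # drop (i + 2) \<beta>"
    using i by (metis Cons_nth_drop_Suc Suc_lessD add_2_eq_Suc' append_take_drop_id)
  have len: "length Bs' = length \<beta> - 1" "length \<beta>' = length \<beta> - 1" using i osp_length by (auto simp: Bs'_def \<beta>'_def)
  have tk: "take j Bs' = take j Bs" if "j \<le> i" for j using that i osp_length by (simp add: Bs'_def)
  show iu: "initial_union Bs' j = (if j \<le> i then initial_union Bs j else initial_union Bs (Suc j))" for j
  proof (cases "j \<le> i")
    case True
    then show ?thesis using tk by (simp add: initial_union_def)
  next
    case False
    define m where "m = j - Suc i"
    have j: "j = Suc (i + m)" using False by (simp add: m_def)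
    have "take (Suc j) Bs = take i Bs @ Bs ! i # Bs ! Suc i # take m (drop (i + 2) Bs)"
      by (subst Bsd) (use i osp_length j in simp)
    moreover have "take j Bs' = take i Bs @ (Bs ! i \<union> Bs ! Suc i) # take m (drop (i + 2) Bs)"
      using i osp_length j by (simp add: Bs'_def)
    ultimately show ?thesis using False by (simp add: initial_union_def Un_assoc)
  qed
  show "flag_of Bs' = flag_of Bs - {initial_union Bs (Suc i)}"
  proof -
    have "flag_of Bs' = initial_union Bs ` ({1..<length \<beta>} - {Suc i})"
    proof -
      have "{1..<length \<beta> - 1} = {1..i} \<union> {Suc i..<length \<beta> - 1}" using i by auto
      then have "flag_of Bs' = initial_union Bs' ` {1..i} \<union> initial_union Bs' ` {Suc i..<length \<beta> - 1}"
        by (simp add: flag_of_def len image_Un)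
      also have "initial_union Bs' ` {1..i} = initial_union Bs ` {1..i}" by (intro image_cong) (auto simp: iu)
      also have "initial_union Bs' ` {Suc i..<length \<beta> - 1} = initial_union Bs ` Suc ` {Suc i..<length \<beta> - 1}"
        unfolding image_image by (intro image_cong) (auto simp: iu)
      also have "Suc ` {Suc i..<length \<beta> - 1} = {Suc (Suc i)..<length \<beta>}"
      proof -
        have "Suc (length \<beta> - 1) = length \<beta>" using i by linarith
        then show ?thesis by (metis image_Suc_atLeastLessThan)
      qed
      finally have "flag_of Bs' = initial_union Bs ` ({1..i} \<union> {Suc (Suc i)..<length \<beta>})" by (simp add: image_Un)
      moreover have "{1..i} \<union> {Suc (Suc i)..<length \<beta>} = {1..<length \<beta>} - {Suc i}" using i by auto
      ultimately show ?thesis by simp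
    qed
    also have "\<dots> = initial_union Bs ` {1..<length \<beta>} - initial_union Bs ` {Suc i}"
      using i by (intro inj_on_image_set_diff[OF initial_union_inj]) auto
    finally show ?thesis by (simp add: flag_of_def osp_length)
  qed
  show "composition n \<beta>'"
  proof -
    have "sum_list \<beta>' = sum_list \<beta>" using arg_cong[OF \<beta>d, of sum_list] by (simp add: \<beta>'_def)
    moreover have "0 < b" if "b \<in> set \<beta>'" for b
      using that comp i by (auto simp: \<beta>'_def composition_def dest!: in_set_takeD in_set_dropD)
    ultimately show ?thesis using comp by (simp add: composition_def)
  qed
  have nthB: "Bs' ! j = initial_union Bs' (Suc j) - initial_union Bs' j" if "j < length \<beta>'" for j
  proof -
    consider "j < i" | "j = i" | "i < j" by linarith
    then show ?thesis
    proof cases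
      case 1
      then have "Bs' ! j = Bs ! j" using i osp_length by (simp add: Bs'_def nth_append)
      then show ?thesis using 1 block_eq[of j] i by (simp add: iu)
    next
      case 2
      then have "Bs' ! j = Bs ! i \<union> Bs ! Suc i" using i osp_length by (simp add: Bs'_def nth_append)
      moreover have "initial_union Bs (Suc (Suc i)) = initial_union Bs i \<union> Bs ! i \<union> Bs ! Suc i"
        using i osp_length by (simp add: initial_union_Suc)
      moreover have "initial_union Bs i \<inter> Bs ! i = {}" "initial_union Bs i \<inter> Bs ! Suc i = {}"
        using initial_union_disjoint[of i] initial_union_disjoint[of "Suc i"] initial_union_mono[of i "Suc i" Bs] i by auto
      ultimately show ?thesis using 2 by (auto simp: iu)
    next
      case 3
      then have "Bs' ! j = Bs ! Suc j" using i osp_length by (simp add: Bs'_def nth_append)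
      then show ?thesis using 3 block_eq[of "Suc j"] that len by (simp add: iu)
    qed
  qed
  show "Bs' \<in> osp n \<beta>'"
  proof -
    have "map card Bs' = \<beta>'"
    proof -
      have "card (Bs ! i \<union> Bs ! Suc i) = \<beta> ! i + \<beta> ! Suc i"
      proof -
        have "Bs ! i \<inter> Bs ! Suc i = {}" using Bs i by (simp add: osp_def)
        then show ?thesis using osp_card[of i] osp_card[of "Suc i"] osp_finite[of i] osp_finite[of "Suc i"] i
          by (simp add: card_Un_disjoint)
      qed
      then show ?thesis by (simp add: Bs'_def \<beta>'_def osp_map_card flip: take_map drop_map)
    qed
    then have "card (Bs' ! j) = \<beta>' ! j" if "j < length \<beta>'" for j using that len by (metis nth_map)
    moreover have "Bs' ! j \<inter> Bs' ! l = {}" if "j < l" "l < length \<beta>'" for j l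
      using nthB[of j] nthB[of l] initial_union_mono[of "Suc j" l Bs'] that by auto
    then have "Bs' ! j \<inter> Bs' ! l = {}" if "j < length \<beta>'" "l < length \<beta>'" "j \<noteq> l" for j l
      using that by (metis Int_commute linorder_neqE_nat)
    moreover have "\<Union> (set Bs') = {1..n}"
    proof -
      have "\<Union> (set Bs') = initial_union Bs' (length Bs')" by (simp add: initial_union_def)
      also have "\<dots> = {1..n}"
      proof -
        have "\<not> length \<beta> - 1 \<le> i" "Suc (length \<beta> - 1) = length \<beta>" using i by linarith+
        then show ?thesis using initial_union_all by (simp only: iu len if_False)
      qed
      finally show ?thesis .
    qed
    ultimately show ?thesis using len by (simp add: osp_def)
  qed
  then have "card ` flag_of Bs' = cuts \<beta>'"
  proof -
    have "card (initial_union Bs' j) = sum_list (take j \<beta>')" if "j < length \<beta>'" for j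
    proof (cases "j \<le> i")
      case True
      then show ?thesis using card_initial_union[of j] i by (simp add: iu \<beta>'_def)
    next
      case False
      define m where "m = j - Suc i"
      have j: "j = Suc (i + m)" using False by (simp add: m_def)
      have "take (Suc j) \<beta> = take i \<beta> @ \<beta> ! i # \<beta> ! Suc i # take m (drop (i + 2) \<beta>)"
        by (subst \<beta>d) (use i j in simp)
      moreover have "take j \<beta>' = take i \<beta> @ (\<beta> ! i + \<beta> ! Suc i) # take m (drop (i + 2) \<beta>)"
        using i j by (simp add: \<beta>'_def)
      ultimately show ?thesis using False card_initial_union[of "Suc j"] that len by (simp add: iu)
    qed
    then show ?thesis unfolding flag_of_def cuts_eq image_image len by (intro image_cong) (auto simp: len)
  qed
  then show "cuts \<beta>' \<subseteq> cuts \<beta>"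
    using flag_of_type \<open>flag_of Bs' = _\<close> by (auto simp: flags_of_type_def)
qed

end

lemma flag_of_image: "flag_of (map ((`) w) Bs) = (`) w ` flag_of Bs"
proof -
  have "initial_union (map ((`) w) Bs) i = w ` initial_union Bs i" for i
    by (simp add: initial_union_def take_map image_Union)
  then show ?thesis by (simp add: flag_of_def image_image)
qed

lemma flag_element_unique:
  assumes "\<Gamma> \<in> flags n S" "A \<in> \<Gamma>" "G \<in> \<Gamma>" "card A = card G"
  shows "A = G"
proof -
  have "A \<subseteq> {1..n}" "G \<subseteq> {1..n}" "A \<subseteq> G \<or> G \<subseteq> A" using assms(1-3) by (auto simp: flags_def)
  then show ?thesis using assms(4) by (metis card_subset_eq finite_atLeastAtMost finite_subset)
qed

text \<open>
  The blocks are the differences of consecutive members of the flag, completed by \<open>\<emptyset>\<close> at the bottom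
  and by \<open>{1..n}\<close> at the top.
\<close>
lemma bij_betw_flag_of:
  assumes comp: "composition n \<beta>" and n: "0 < n"
  shows "bij_betw flag_of (osp n \<beta>) (flags_of_type n (cuts \<beta>))"
proof -
  let ?k = "length \<beta>"
  have k: "0 < ?k" using composition_nonempty[OF comp n] by simp
  have "inj_on flag_of (osp n \<beta>)"
  proof (rule inj_onI)
    fix Bs Cs assume Bs: "Bs \<in> osp n \<beta>" and Cs: "Cs \<in> osp n \<beta>" and eq: "flag_of Bs = flag_of Cs"
    have iu: "initial_union Bs i = initial_union Cs i" if "i \<le> ?k" for i
    proof -
      consider "i = 0" | "i = ?k" | "i \<in> {1..<?k}" using \<open>i \<le> ?k\<close> by force
      then show ?thesis
      proof cases
        case 3
        have f1: "flag_of Bs \<in> flags n (cuts \<beta>)" using flag_of_type[OF comp Bs] by (simp add: flags_of_type_def)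
        have f2: "initial_union Bs i \<in> flag_of Bs" using 3 osp_length[OF comp Bs] by (simp add: flag_of_def)
        have f3: "initial_union Cs i \<in> flag_of Bs" unfolding eq using 3 osp_length[OF comp Cs] by (simp add: flag_of_def)
        show ?thesis
          by (rule flag_element_unique[OF f1 f2 f3])
            (simp add: card_initial_union[OF comp Bs \<open>i \<le> ?k\<close>] card_initial_union[OF comp Cs \<open>i \<le> ?k\<close>])
      qed (use initial_union_all[OF comp Bs] initial_union_all[OF comp Cs] in \<open>auto simp: initial_union_def\<close>)
    qed
    show "Bs = Cs"
    proof (rule nth_equalityI)
      show "length Bs = length Cs" using osp_length[OF comp Bs] osp_length[OF comp Cs] by simp
      show "Bs ! i = Cs ! i" if "i < length Bs" for i
        using that block_eq[OF comp Bs, of i] block_eq[OF comp Cs, of i] iu[of i] iu[of "Suc i"] osp_length[OF comp Bs] by simp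
    qed
  qed
  moreover have "\<Gamma> \<in> flag_of ` osp n \<beta>" if \<Gamma>: "\<Gamma> \<in> flags_of_type n (cuts \<beta>)" for \<Gamma>
  proof -
    let ?s = "\<lambda>i. sum_list (take i \<beta>)"
    have flag: "\<Gamma> \<in> flags n (cuts \<beta>)" and type: "card ` \<Gamma> = cuts \<beta>" using \<Gamma> by (auto simp: flags_of_type_def)
    have "\<exists>A\<in>\<Gamma>. card A = ?s i" if "i \<in> {1..<?k}" for i
    proof -
      have "?s i \<in> card ` \<Gamma>" unfolding type cuts_eq using that by blast
      then show ?thesis by auto
    qed
    then obtain W where W: "\<And>i. i \<in> {1..<?k} \<Longrightarrow> W i \<in> \<Gamma> \<and> card (W i) = ?s i" by metis
    define V where "V i = (if i = 0 then {} else if i < ?k then W i else {1..n})" for i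
    have sk: "?s ?k = n" using comp by (simp add: composition_def)
    have V: "V i \<subseteq> {1..n}" "i \<le> ?k \<Longrightarrow> card (V i) = ?s i" for i
      using W[of i] flag sk by (auto simp: V_def flags_def)
    have V_flag: "V i \<in> \<Gamma>" if "i \<in> {1..<?k}" for i using W[OF that] that by (simp add: V_def)
    have Vmono: "V i \<subseteq> V j" if ij: "i \<le> j" "j \<le> ?k" for i j
    proof -
      consider "i = 0" | "j = ?k" | "i = j" | "i \<in> {1..<?k}" "j \<in> {1..<?k}" "i < j" using ij by force
      then show ?thesis
      proof cases
        case 4
        then have "V i \<subseteq> V j \<or> V j \<subseteq> V i" using V_flag[of i] V_flag[of j] flag by (auto simp: flags_def)
        moreover have "card (V i) < card (V j)" using V(2) 4 ij sum_take_less[OF comp 4(3) ij(2)] by simp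
        moreover have "finite (V i)" using V(1) finite_subset by blast
        ultimately show ?thesis using card_mono[of "V i" "V j"] by auto
      qed (use V(1)[of i] k in \<open>auto simp: V_def\<close>)
    qed
    define Bs where "Bs = map (\<lambda>i. V (Suc i) - V i) [0..<?k]"
    have len: "length Bs = ?k" by (simp add: Bs_def)
    have nth: "Bs ! i = V (Suc i) - V i" if "i < ?k" for i using that by (simp add: Bs_def)
    have iu: "initial_union Bs i = V i" if "i \<le> ?k" for i
      using that
    proof (induction i)
      case (Suc i)
      then show ?case using nth[of i] Vmono[of i "Suc i"] len by (auto simp: initial_union_Suc)
    qed (simp add: initial_union_def V_def)
    have "Bs \<in> osp n \<beta>"
    proof -
      have "card (Bs ! i) = \<beta> ! i" if "i < ?k" for i
      proof -
        have "finite (V i)" using V(1) finite_subset by blast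
        then have "card (Bs ! i) = ?s (Suc i) - ?s i"
          using nth[OF that] Vmono[of i "Suc i"] V(2)[of i] V(2)[of "Suc i"] that by (simp add: card_Diff_subset)
        then show ?thesis using that by (simp add: take_Suc_conv_app_nth)
      qed
      moreover have "Bs ! j \<inter> Bs ! l = {}" if "j < l" "l < ?k" for j l
        using nth[of j] nth[of l] Vmono[of "Suc j" l] that by auto
      then have "Bs ! j \<inter> Bs ! l = {}" if "j < ?k" "l < ?k" "j \<noteq> l" for j l
        using that by (metis Int_commute linorder_neqE_nat)
      moreover have "\<Union> (set Bs) = {1..n}"
      proof -
        have "\<Union> (set Bs) = initial_union Bs ?k" using len by (simp add: initial_union_def)
        then show ?thesis using iu[of ?k] k by (simp add: V_def)
      qed
      ultimately show ?thesis using len by (simp add: osp_def)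
    qed
    moreover have "flag_of Bs = \<Gamma>"
    proof
      show "flag_of Bs \<subseteq> \<Gamma>" using iu V_flag len by (auto simp: flag_of_def)
      show "\<Gamma> \<subseteq> flag_of Bs"
      proof
        fix A assume A: "A \<in> \<Gamma>"
        then have "card A \<in> cuts \<beta>" using type by blast
        then obtain i where i: "i \<in> {1..<?k}" "card A = ?s i" by (auto simp: cuts_eq)
        then have "A = V i" using flag_element_unique[OF flag A V_flag[OF i(1)]] V(2)[of i] by simp
        then show "A \<in> flag_of Bs" using iu[of i] i(1) len by (auto simp: flag_of_def)
      qed
    qed
    ultimately show ?thesis by blast
  qed
  moreover have "flag_of ` osp n \<beta> \<subseteq> flags_of_type n (cuts \<beta>)" using flag_of_type[OF comp] by blast
  ultimately show ?thesis unfolding bij_betw_def by blast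
qed


section \<open>Cells as labelled flags\<close>

text \<open>The block sizes, which the iterated product needs, are read off from the blocks.\<close>
definition cell_flag :: "cell \<Rightarrow> nat set set \<times> decoration" where
  "cell_flag = (\<lambda>(Bs, \<xi>s). (flag_of Bs, deco_fold (map card Bs) \<xi>s))"

definition graded_decorations :: "nat \<Rightarrow> nat \<Rightarrow> nat \<Rightarrow> decoration set" where
  "graded_decorations n d e = {\<theta> \<in> decorations n. deg_t n \<theta> = d \<and> deg_q n \<theta> = e}"

lemma cell_deg_map2:
  assumes "length Bs = length \<xi>s"
  shows "cell_deg deg (Bs, \<xi>s) = sum_list (map2 deg (map card Bs) \<xi>s)"
  using assms by (simp add: cell_deg_def sum_list_sum_nth atLeast0LessThan)

lemma is_fact_cut_full:
  assumes "\<theta> \<in> decorations n"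
  shows "is_fact_cut n \<theta> n"
proof -
  obtain \<sigma> \<tau> where x: "\<theta> = (\<sigma>, \<tau>)" by (cases \<theta>)
  then have "\<sigma> permutes {1..half_up n}" using assms by (simp add: decorations_def)
  then show ?thesis using is_fact_cut_iff[of \<sigma> \<tau> n n] assms x permutes_image[of \<sigma> "{1..half_up n}"] by simp
qed

lemma fold_image_eq:
  assumes "composition n \<beta>" "0 < n"
  shows "fold_image \<beta> = {\<theta> \<in> decorations n. \<forall>c\<in>cuts \<beta>. is_fact_cut n \<theta> c}"
proof -
  have "sum_list \<beta> = n" using assms(1) by (simp add: composition_def)
  moreover have "partial_sums \<beta> = insert n (cuts \<beta>)"
    using partial_sums_cuts[OF composition_nonempty[OF assms]] \<open>sum_list \<beta> = n\<close> by simp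
  ultimately show ?thesis using is_fact_cut_full by (auto simp: fold_image_def)
qed

lemma at_most_one_odd_nth:
  assumes "at_most_one_odd \<beta>" "Suc i < length \<beta>"
  shows "not_both_odd (\<beta> ! i) (\<beta> ! Suc i)"
  using assms
proof (induction i arbitrary: \<beta>)
  case 0
  then obtain b c \<gamma> where "\<beta> = b # c # \<gamma>" by (metis One_nat_def Suc_le_eq length_0_conv less_irrefl list.exhaust list.size(3) length_Cons not_less_zero Suc_less_eq)
  then show ?case using at_most_one_odd_Cons(3)[of b "c # \<gamma>" c] 0 by simp
next
  case (Suc i)
  then obtain b \<gamma> where "\<beta> = b # \<gamma>" by (cases \<beta>) auto
  then show ?case using Suc.IH[of \<gamma>] at_most_one_odd_Cons(1)[of b \<gamma>] Suc.prems by simp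
qed

lemma face_relabel:
  assumes "inj w" "Suc i < length Bs"
  shows "face i (map ((`) w) Bs, \<xi>s) = relabel w (face i (Bs, \<xi>s))"
proof -
  have "card (w ` B) = card B" for B using assms(1) by (simp add: card_image inj_on_subset)
  then have c: "card (map ((`) w) Bs ! i) = card (Bs ! i)" "card (map ((`) w) Bs ! (i + 1)) = card (Bs ! (i + 1))"
    using assms(2) by simp_all
  have m: "merge_cell i (map ((`) w) Bs, \<xi>s) =
     (map ((`) w) (fst (merge_cell i (Bs, \<xi>s))), snd (merge_cell i (Bs, \<xi>s)))"
    using assms(2) c by (simp add: merge_cell_def take_map drop_map image_Un)
  show ?thesis
    unfolding face_def fst_conv c m by (simp add: relabel_def pm.linear_0[OF linmap_lin_extend] case_prod_unfold)
qed

lemma boundary_unitvec: "boundary (unitvec c) = (\<Sum>i<length (fst c) - 1. scale_vec ((-1) ^ i) (face i c))"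
  by (simp add: boundary_def)

lemma linmap_boundary [simp]: "linmap boundary"
  by (simp add: boundary_def)

lemma linmap_relabel [simp]: "linmap (relabel w)"
  by (simp add: relabel_def)

lemma chains_eq: "chains \<alpha> k d e = supported_on (cells \<alpha> k d e)"
  by (simp add: chains_def supported_on_def)

lemma boundary_relabel:
  fixes x :: "cell \<Rightarrow>\<^sub>0 'a::field"
  assumes "inj w"
  shows "boundary (relabel w x) = relabel w (boundary x)"
proof -
  have "(boundary \<circ> relabel w) x = (relabel w \<circ> boundary) x"
  proof (rule linmap_eq_on[OF linmap_compose[OF linmap_relabel linmap_boundary] linmap_compose[OF linmap_boundary linmap_relabel]])
    show "x \<in> supported_on UNIV" by (simp add: supported_on_def)
    fix c :: cell
    obtain Bs \<xi>s where c: "c = (Bs, \<xi>s)" by (cases c)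
    have "relabel w (unitvec c) = (unitvec (map ((`) w) Bs, \<xi>s) :: cell \<Rightarrow>\<^sub>0 'a)" by (simp add: relabel_def c)
    then show "(boundary \<circ> relabel w) (unitvec c :: cell \<Rightarrow>\<^sub>0 'a) = (relabel w \<circ> boundary) (unitvec c)"
      using assms by (simp add: boundary_unitvec c face_relabel pm.linear_sum[OF linmap_relabel] pm.linear_scale[OF linmap_relabel])
  qed
  then show ?thesis by simp
qed

lemma relabel_relabel: "relabel w (relabel v x) = relabel (w \<circ> v) x"
proof -
  have "(relabel w \<circ> relabel v) x = relabel (w \<circ> v) x"
  proof (rule linmap_eq_on[OF linmap_compose[OF linmap_relabel linmap_relabel] linmap_relabel])
    show "x \<in> supported_on UNIV" by (simp add: supported_on_def)
    show "(relabel w \<circ> relabel v) (unitvec c) = relabel (w \<circ> v) (unitvec c)" for c :: cell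
      by (cases c) (simp add: relabel_def image_comp[symmetric] o_def image_image)
  qed
  then show ?thesis by simp
qed

lemma relabel_id: "relabel id x = x"
proof -
  have "relabel id x = id x"
  proof (rule linmap_eq_on[OF linmap_relabel pm.linear_id])
    show "x \<in> supported_on UNIV" by (simp add: supported_on_def)
    show "relabel id (unitvec c) = id (unitvec c)" for c :: cell
      by (cases c) (simp add: relabel_def)
  qed
  then show ?thesis by simp
qed

lemma osp_relabel:
  assumes "w permutes {1..n}" "Bs \<in> osp n \<beta>"
  shows "map ((`) w) Bs \<in> osp n \<beta>"
proof -
  have inj: "inj w" using permutes_inj[OF assms(1)] .
  have "w ` A \<inter> w ` B = {}" if "A \<inter> B = {}" for A B using that inj by (simp add: image_Int[symmetric])
  moreover have "card (w ` A) = card A" for A using inj by (simp add: card_image inj_on_subset)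
  moreover have "\<Union> (set (map ((`) w) Bs)) = w ` \<Union> (set Bs)" by (simp add: image_Union)
  ultimately show ?thesis using assms(2) permutes_image[OF assms(1)] by (simp add: osp_def)
qed

definition flag_map :: "(cell \<Rightarrow>\<^sub>0 'a::field) \<Rightarrow> (nat set set \<times> decoration \<Rightarrow>\<^sub>0 'a)" where
  "flag_map = lin_extend (\<lambda>c. unitvec (cell_flag c))"

definition flag_map_inv :: "nat list \<Rightarrow> nat \<Rightarrow> nat \<Rightarrow> nat \<Rightarrow> (nat set set \<times> decoration \<Rightarrow>\<^sub>0 'a::field) \<Rightarrow> (cell \<Rightarrow>\<^sub>0 'a)" where
  "flag_map_inv \<alpha> j d e = lin_extend (\<lambda>b. unitvec (inv_into (cells \<alpha> (Suc j) d e) cell_flag b))"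

lemma linmap_flag_map [simp]: "linmap flag_map" by (simp add: flag_map_def)
lemma linmap_flag_map_inv [simp]: "linmap (flag_map_inv \<alpha> j d e)" by (simp add: flag_map_inv_def)

context
  fixes n :: nat and \<alpha> :: "nat list"
  assumes comp: "composition n \<alpha>" and n: "0 < n" and odd: "at_most_one_odd \<alpha>"
begin

lemma sum_alpha: "sum_list \<alpha> = n" using comp by (simp add: composition_def)

text \<open>
  All data attached to a cell: the type of its ordered set partition and the iterated product of its
  decorations, whose bidegree is that of the cell and which has the cuts of the type as
  factorization cuts.
\<close>
lemma cellE:
  assumes "(Bs, \<xi>s) \<in> cells \<alpha> k d e"
  obtains \<beta> where "coarsening \<beta> \<alpha>" "composition n \<beta>" "length \<beta> = k" "Bs \<in> osp n \<beta>" "\<xi>s \<in> deco_lists \<beta>"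
    "map card Bs = \<beta>" "at_most_one_odd \<beta>" "sum_list \<beta> = n" "length \<xi>s = k"
    "deco_fold \<beta> \<xi>s \<in> graded_decorations n d e" "cuts \<beta> \<subseteq> fact_cuts \<alpha> (deco_fold \<beta> \<xi>s)"
proof -
  from assms obtain \<beta> where \<beta>: "coarsening \<beta> \<alpha>" "length \<beta> = k" "Bs \<in> osp n \<beta>" "length \<xi>s = k"
    "\<forall>i<k. \<xi>s ! i \<in> decorations (\<beta> ! i)" and deg: "cell_deg deg_t (Bs, \<xi>s) = d" "cell_deg deg_q (Bs, \<xi>s) = e"
    by (auto simp: cells_def sum_alpha)
  have c: "composition n \<beta>" using \<beta>(1) by (simp add: coarsening_def sum_alpha)
  have l: "\<xi>s \<in> deco_lists \<beta>" using \<beta> by (simp add: deco_lists_def list_all2_conv_all_nth)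
  have o: "at_most_one_odd \<beta>" by (rule coarsening_at_most_one_odd[OF \<beta>(1) comp odd n])
  have m: "map card Bs = \<beta>" by (rule osp_map_card[OF c \<beta>(3)])
  have s: "sum_list \<beta> = n" using c by (simp add: composition_def)
  have \<theta>: "deco_fold \<beta> \<xi>s \<in> fold_image \<beta>" using bij_betwE[OF bij_betw_deco_fold[OF o]] l by blast
  have "length Bs = length \<xi>s" using m \<beta>(2,4) by (metis length_map)
  then have "deco_fold \<beta> \<xi>s \<in> graded_decorations n d e"
    using deg_deco_fold[OF o l] deg \<theta> s m by (auto simp: graded_decorations_def fold_image_def cell_deg_map2)
  moreover have "cuts \<beta> \<subseteq> fact_cuts \<alpha> (deco_fold \<beta> \<xi>s)"
    using \<theta> \<beta>(1) by (auto simp: fact_cuts_def sum_alpha fold_image_eq[OF c n] coarsening_def)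
  ultimately show thesis using that \<beta> c l o m s by blast
qed

text \<open>
  For fixed block sizes the flag determines the blocks and the iterated product determines the
  decorations; the block sizes themselves are determined by the ranks of the flag. The image is
  described by the condition that all ranks are factorization cuts. Cells with \<open>j + 1\<close> blocks
  correspond to flags with \<open>j\<close> members.
\<close>
lemma cell_flag_bij:
  "bij_betw cell_flag (cells \<alpha> (Suc j) d e) (labelled_flags n (fact_cuts \<alpha>) (graded_decorations n d e) j)"
    (is "bij_betw _ ?C ?X")
proof -
  have "inj_on cell_flag ?C"
  proof (rule inj_onI)
    fix c c' assume c: "c \<in> ?C" "c' \<in> ?C" "cell_flag c = cell_flag c'"
    obtain Bs \<xi>s Bs' \<xi>s' where p: "c = (Bs, \<xi>s)" "c' = (Bs', \<xi>s')" by (cases c, cases c')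
    from c(1)[unfolded p] obtain \<beta> where \<beta>: "composition n \<beta>" "Bs \<in> osp n \<beta>" "\<xi>s \<in> deco_lists \<beta>" "map card Bs = \<beta>" "at_most_one_odd \<beta>"
      by (rule cellE)
    from c(2)[unfolded p] obtain \<gamma> where \<gamma>: "composition n \<gamma>" "Bs' \<in> osp n \<gamma>" "\<xi>s' \<in> deco_lists \<gamma>" "map card Bs' = \<gamma>"
      by (rule cellE)
    have eq: "flag_of Bs = flag_of Bs'" "deco_fold \<beta> \<xi>s = deco_fold \<gamma> \<xi>s'"
      using c(3) \<beta>(4) \<gamma>(4) by (simp_all add: cell_flag_def p)
    have "cuts \<beta> = cuts \<gamma>"
      using flag_of_type[OF \<beta>(1,2)] flag_of_type[OF \<gamma>(1,2)] eq(1) by (simp add: flags_of_type_def)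
    then have bg: "\<beta> = \<gamma>" by (rule composition_eqI[OF \<beta>(1) \<gamma>(1)])
    then have "Bs = Bs'"
      using inj_onD[OF bij_betw_imp_inj_on[OF bij_betw_flag_of[OF \<beta>(1) n]] eq(1)] \<beta>(2) \<gamma>(2) by simp
    moreover have "\<xi>s = \<xi>s'"
      using inj_onD[OF bij_betw_imp_inj_on[OF bij_betw_deco_fold[OF \<beta>(5)]], of \<xi>s \<xi>s'] eq(2) \<beta>(3) \<gamma>(3) bg by simp
    ultimately show "c = c'" by (simp add: p)
  qed
  moreover have "cell_flag c \<in> ?X" if c: "c \<in> ?C" for c
  proof -
    obtain Bs \<xi>s where p: "c = (Bs, \<xi>s)" by (cases c)
    from c[unfolded p] obtain \<beta> where \<beta>: "composition n \<beta>" "length \<beta> = Suc j" "Bs \<in> osp n \<beta>" "map card Bs = \<beta>"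
      "deco_fold \<beta> \<xi>s \<in> graded_decorations n d e" "cuts \<beta> \<subseteq> fact_cuts \<alpha> (deco_fold \<beta> \<xi>s)" by (rule cellE)
    have "flag_of Bs \<in> flags n (fact_cuts \<alpha> (deco_fold \<beta> \<xi>s))"
      using flag_of_type[OF \<beta>(1,3)] \<beta>(6) by (auto simp: flags_of_type_def flags_def)
    then show ?thesis using \<beta> card_flag_of[OF \<beta>(1,3)] by (simp add: labelled_flags_def cell_flag_def p)
  qed
  moreover have "b \<in> cell_flag ` ?C" if b: "b \<in> ?X" for b
  proof -
    obtain \<Gamma> \<theta> where p: "b = (\<Gamma>, \<theta>)" by (cases b)
    have \<theta>: "\<theta> \<in> graded_decorations n d e" and \<Gamma>: "\<Gamma> \<in> flags n (fact_cuts \<alpha> \<theta>)" "card \<Gamma> = j"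
      using b by (auto simp: p labelled_flags_def)
    let ?T = "card ` \<Gamma>"
    define \<beta> where "\<beta> = comp_of_cuts n ?T"
    have T: "?T \<subseteq> fact_cuts \<alpha> \<theta>" using \<Gamma>(1) by (auto simp: flags_def)
    then have T\<alpha>: "?T \<subseteq> cuts \<alpha>" by (auto simp: fact_cuts_def)
    have \<beta>: "composition n \<beta>" "cuts \<beta> = ?T"
      using composition_of_cuts[OF n] T\<alpha> cuts_range[OF comp] unfolding \<beta>_def by blast+
    have coarse: "coarsening \<beta> \<alpha>" using \<beta> T\<alpha> by (simp add: coarsening_def sum_alpha)
    have o: "at_most_one_odd \<beta>" by (rule coarsening_at_most_one_odd[OF coarse comp odd n])
    have "card ?T = j" using flag_element_unique[OF \<Gamma>(1)] \<Gamma>(2) by (subst card_image) (auto intro: inj_onI)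
    then have "length \<beta> = Suc j" using card_cuts[OF \<beta>(1)] \<beta>(2) composition_nonempty[OF \<beta>(1) n] by (cases \<beta>) auto
    have "\<Gamma> \<in> flags_of_type n (cuts \<beta>)" using \<Gamma>(1) \<beta>(2) by (auto simp: flags_of_type_def flags_def)
    then obtain Bs where Bs: "Bs \<in> osp n \<beta>" "flag_of Bs = \<Gamma>"
      using bij_betw_imp_surj_on[OF bij_betw_flag_of[OF \<beta>(1) n]] by (metis imageE)
    have "\<theta> \<in> fold_image \<beta>"
      using \<theta> T \<beta>(2) by (auto simp: fold_image_eq[OF \<beta>(1) n] graded_decorations_def fact_cuts_def sum_alpha)
    then obtain \<xi>s where \<xi>s: "\<xi>s \<in> deco_lists \<beta>" "deco_fold \<beta> \<xi>s = \<theta>"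
      using bij_betw_imp_surj_on[OF bij_betw_deco_fold[OF o]] by (metis imageE)
    have m: "map card Bs = \<beta>" by (rule osp_map_card[OF \<beta>(1) Bs(1)])
    have len: "length \<xi>s = Suc j" "length Bs = Suc j"
      using \<xi>s(1) \<open>length \<beta> = Suc j\<close> m by (auto simp: deco_lists_def list_all2_conv_all_nth)
    have "sum_list \<beta> = n" using \<beta>(1) by (simp add: composition_def)
    then have "cell_deg deg_t (Bs, \<xi>s) = d" "cell_deg deg_q (Bs, \<xi>s) = e"
      using deg_deco_fold[OF o \<xi>s(1)] \<theta> \<xi>s(2) m len by (simp_all add: cell_deg_map2 graded_decorations_def)
    then have "(Bs, \<xi>s) \<in> ?C"
      using coarse \<open>length \<beta> = Suc j\<close> Bs(1) \<xi>s(1) len unfolding cells_def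
      by (auto simp: sum_alpha deco_lists_def list_all2_conv_all_nth intro!: exI[of _ \<beta>])
    moreover have "cell_flag (Bs, \<xi>s) = b" using Bs(2) \<xi>s(2) m by (simp add: cell_flag_def p)
    ultimately show ?thesis by (metis imageI)
  qed
  ultimately show ?thesis unfolding bij_betw_def by blast
qed

text \<open>
  Neighbouring blocks are never both odd, so no face vanishes, and merging two blocks acts on flags
  as the deletion of one member while the label stays the same.
\<close>
lemma merge_cell_props:
  assumes c: "(Bs, \<xi>s) \<in> cells \<alpha> (Suc j) d e" and i: "i < j"
  shows "face i (Bs, \<xi>s) = unitvec (merge_cell i (Bs, \<xi>s))"
    "merge_cell i (Bs, \<xi>s) \<in> cells \<alpha> j d e"
    "cell_flag (merge_cell i (Bs, \<xi>s)) = (flag_of Bs - {initial_union Bs (Suc i)}, deco_fold (map card Bs) \<xi>s)"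
proof -
  from c obtain \<beta> where \<beta>: "coarsening \<beta> \<alpha>" "composition n \<beta>" "length \<beta> = Suc j" "Bs \<in> osp n \<beta>" "\<xi>s \<in> deco_lists \<beta>"
    "map card Bs = \<beta>" "at_most_one_odd \<beta>" "sum_list \<beta> = n" "length \<xi>s = Suc j"
    "deco_fold \<beta> \<xi>s \<in> graded_decorations n d e" "cuts \<beta> \<subseteq> fact_cuts \<alpha> (deco_fold \<beta> \<xi>s)" by (rule cellE)
  have len: "length Bs = Suc j" using \<beta>(3,6) by (metis length_map)
  have si: "Suc i < length \<beta>" using i \<beta>(3) by simp
  have nth: "card (Bs ! i) = \<beta> ! i" "card (Bs ! Suc i) = \<beta> ! Suc i" using osp_card[OF \<beta>(2,4)] si by simp_all
  have nbo: "not_both_odd (\<beta> ! i) (\<beta> ! Suc i)" by (rule at_most_one_odd_nth[OF \<beta>(7) si])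
  then show "face i (Bs, \<xi>s) = unitvec (merge_cell i (Bs, \<xi>s))" using nth by (auto simp: face_def not_both_odd_def)
  define Bs' where "Bs' = take i Bs @ [Bs ! i \<union> Bs ! Suc i] @ drop (i + 2) Bs"
  define \<beta>' where "\<beta>' = take i \<beta> @ [\<beta> ! i + \<beta> ! Suc i] @ drop (i + 2) \<beta>"
  define \<xi>s' where "\<xi>s' = take i \<xi>s @ [deco_prod (\<beta> ! i) (\<xi>s ! i) (\<xi>s ! Suc i)] @ drop (i + 2) \<xi>s"
  have mc: "merge_cell i (Bs, \<xi>s) = (Bs', \<xi>s')" using nth by (simp add: merge_cell_def Bs'_def \<xi>s'_def)
  note m = merge_osp[OF \<beta>(2,4) si, folded Bs'_def \<beta>'_def]
  have map': "map card Bs' = \<beta>'" by (rule osp_map_card[OF m(3,4)])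
  have fold': "deco_fold \<beta>' \<xi>s' = deco_fold \<beta> \<xi>s"
    unfolding \<beta>'_def \<xi>s'_def by (rule deco_fold_merge[OF \<beta>(7,5) si])
  show "cell_flag (merge_cell i (Bs, \<xi>s)) = (flag_of Bs - {initial_union Bs (Suc i)}, deco_fold (map card Bs) \<xi>s)"
    using m(2) fold' by (simp add: mc cell_flag_def map' \<beta>(6))
  have len': "length \<beta>' = j" "length \<xi>s' = j" "length Bs' = j" using i \<beta>(3,9) len by (simp_all add: \<beta>'_def \<xi>s'_def Bs'_def)
  have coarse: "coarsening \<beta>' \<alpha>" using m(3,5) \<beta>(1) by (auto simp: coarsening_def sum_alpha)
  have o': "at_most_one_odd \<beta>'" by (rule coarsening_at_most_one_odd[OF coarse comp odd n])
  have nthd: "\<xi>s ! l \<in> decorations (\<beta> ! l)" if "l < Suc j" for l using \<beta>(3,5) that by (simp add: deco_lists_def list_all2_conv_all_nth)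
  have "deco_prod (\<beta> ! i) (\<xi>s ! i) (\<xi>s ! Suc i) \<in> decorations (\<beta> ! i + \<beta> ! Suc i)"
    using deco_prod_mem(1)[OF nbo] nthd i by simp
  then have l': "\<xi>s' \<in> deco_lists \<beta>'"
    using \<beta>(3,5,9) i unfolding deco_lists_def \<beta>'_def \<xi>s'_def mem_Collect_eq
    by (intro list_all2_appendI list_all2_takeI list_all2_dropI) (auto intro: list_all2_takeI list_all2_dropI)
  have sum': "sum_list \<beta>' = n" using m(3) by (simp add: composition_def)
  have "cell_deg deg_t (Bs', \<xi>s') = d" "cell_deg deg_q (Bs', \<xi>s') = e"
    using deg_deco_fold[OF o' l'] \<beta>(10) fold' sum' by (simp_all add: cell_deg_map2 len' map' graded_decorations_def)
  then show "merge_cell i (Bs, \<xi>s) \<in> cells \<alpha> j d e"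
    using coarse len' m(4) l' unfolding mc cells_def
    by (auto simp: sum_alpha deco_lists_def list_all2_conv_all_nth intro!: exI[of _ \<beta>'])
qed

abbreviation "all_flags d e \<equiv> labelled_flags n (fact_cuts \<alpha>) (graded_decorations n d e)"

lemma flag_map_supported:
  assumes "x \<in> chains \<alpha> (Suc j) d e"
  shows "flag_map x \<in> supported_on (all_flags d e j)"
  by (rule linmap_maps_into[OF linmap_flag_map assms[unfolded chains_eq] subspace_supported_on])
    (use bij_betwE[OF cell_flag_bij] in \<open>auto simp: flag_map_def\<close>)

lemma flag_map_inv_chains:
  assumes "y \<in> supported_on (all_flags d e j)"
  shows "flag_map_inv \<alpha> j d e y \<in> chains \<alpha> (Suc j) d e"
  unfolding chains_eq
  by (rule linmap_maps_into[OF linmap_flag_map_inv assms subspace_supported_on])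
    (use bij_betwE[OF bij_betw_inv_into[OF cell_flag_bij]] in \<open>auto simp: flag_map_inv_def\<close>)

lemma flag_map_flag_map_inv:
  fixes y :: "nat set set \<times> decoration \<Rightarrow>\<^sub>0 'a::field"
  assumes "y \<in> supported_on (all_flags d e j)"
  shows "flag_map (flag_map_inv \<alpha> j d e y) = y"
proof -
  have "(flag_map \<circ> flag_map_inv \<alpha> j d e) y = id y"
    by (rule linmap_eq_on[OF linmap_compose[OF linmap_flag_map_inv linmap_flag_map] pm.linear_id assms])
      (simp add: flag_map_def flag_map_inv_def bij_betw_inv_into_right[OF cell_flag_bij])
  then show ?thesis by simp
qed

lemma flag_map_inv_flag_map:
  fixes x :: "cell \<Rightarrow>\<^sub>0 'a::field"
  assumes "x \<in> chains \<alpha> (Suc j) d e"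
  shows "flag_map_inv \<alpha> j d e (flag_map x) = x"
proof -
  have "(flag_map_inv \<alpha> j d e \<circ> flag_map) x = id x"
    by (rule linmap_eq_on[OF linmap_compose[OF linmap_flag_map linmap_flag_map_inv] pm.linear_id assms[unfolded chains_eq]])
      (simp add: flag_map_def flag_map_inv_def bij_betw_inv_into_left[OF cell_flag_bij])
  then show ?thesis by simp
qed

lemma flag_map_eqD:
  fixes x :: "cell \<Rightarrow>\<^sub>0 'a::field"
  assumes "x \<in> chains \<alpha> (Suc j) d e" "y \<in> chains \<alpha> (Suc j) d e" "flag_map x = flag_map y"
  shows "x = y"
  using assms flag_map_inv_flag_map by metis

lemma boundary_chains:
  assumes "x \<in> chains \<alpha> (Suc j) d e"
  shows "boundary x \<in> chains \<alpha> j d e"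
  unfolding chains_eq
proof (rule linmap_maps_into[OF linmap_boundary assms[unfolded chains_eq] subspace_supported_on])
  fix c assume c: "c \<in> cells \<alpha> (Suc j) d e"
  obtain Bs \<xi>s where p: "c = (Bs, \<xi>s)" by (cases c)
  have len: "length Bs - 1 = j" using c unfolding p by (rule cellE) (metis length_map diff_Suc_1)
  show "boundary (unitvec c) \<in> supported_on (cells \<alpha> j d e)"
    unfolding boundary_unitvec p fst_conv len using c[unfolded p]
    by (intro pm.subspace_sum pm.subspace_scale subspace_supported_on) (simp add: merge_cell_props)
qed

text \<open>
  The summand for \<open>i\<close> deletes the member of index \<open>i + 1\<close>, which has \<open>i\<close> members below it.
\<close>
lemma flag_map_boundary:
  fixes x :: "cell \<Rightarrow>\<^sub>0 'a::field"
  assumes "x \<in> chains \<alpha> (Suc j) d e"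
  shows "flag_map (boundary x) = flag_boundary (flag_map x)"
proof -
  have "(flag_map \<circ> boundary) x = (flag_boundary \<circ> flag_map) x"
  proof (rule linmap_eq_on[OF linmap_compose[OF linmap_boundary linmap_flag_map]
        linmap_compose[OF linmap_flag_map linmap_flag_boundary] assms[unfolded chains_eq]])
    fix c assume c: "c \<in> cells \<alpha> (Suc j) d e"
    obtain Bs \<xi>s where p: "c = (Bs, \<xi>s)" by (cases c)
    from c[unfolded p] obtain \<beta> where \<beta>: "composition n \<beta>" "length \<beta> = Suc j" "Bs \<in> osp n \<beta>" "map card Bs = \<beta>" by (rule cellE)
    have len: "length Bs = Suc j" using \<beta>(2,4) by (metis length_map)
    let ?\<theta> = "deco_fold (map card Bs) \<xi>s"
    have inj: "inj_on (\<lambda>i. initial_union Bs (Suc i)) {..<j}"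
    proof (rule inj_onI)
      fix x y assume "x \<in> {..<j}" "y \<in> {..<j}" "initial_union Bs (Suc x) = initial_union Bs (Suc y)"
      then have "Suc x = Suc y" using \<beta>(2) by (intro inj_onD[OF initial_union_inj[OF \<beta>(1,3)]]) auto
      then show "x = y" by simp
    qed
    have flag: "flag_of Bs = (\<lambda>i. initial_union Bs (Suc i)) ` {..<j}"
    proof -
      have "{1..<Suc j} = Suc ` {..<j}" by (simp add: lessThan_atLeast0)
      then show ?thesis by (simp add: flag_of_def len image_image)
    qed
    have sign: "flag_sign (flag_of Bs) (initial_union Bs (Suc i)) = ((-1) ^ i :: 'a)" if "i < j" for i
      using card_flag_of_below[OF \<beta>(1,3), of "Suc i"] that \<beta>(2) by (simp add: flag_sign_def)
    have "flag_map (boundary (unitvec c :: cell \<Rightarrow>\<^sub>0 'a)) =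
        (\<Sum>i<j. scale_vec ((-1) ^ i) (unitvec (flag_of Bs - {initial_union Bs (Suc i)}, ?\<theta>)))"
      unfolding boundary_unitvec p fst_conv len
      by (simp add: pm.linear_sum[OF linmap_flag_map] pm.linear_scale[OF linmap_flag_map]
          merge_cell_props[OF c[unfolded p]]) (simp add: flag_map_def merge_cell_props[OF c[unfolded p]])
    also have "\<dots> = (\<Sum>A\<in>flag_of Bs. scale_vec (flag_sign (flag_of Bs) A) (unitvec (flag_of Bs - {A}, ?\<theta>)))"
    proof -
      have "(\<Sum>A\<in>flag_of Bs. scale_vec (flag_sign (flag_of Bs) A) (unitvec (flag_of Bs - {A}, ?\<theta>)) :: _ \<Rightarrow>\<^sub>0 'a) =
        (\<Sum>i<j. scale_vec (flag_sign (flag_of Bs) (initial_union Bs (Suc i))) (unitvec (flag_of Bs - {initial_union Bs (Suc i)}, ?\<theta>)))"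
        by (subst (1) flag) (simp add: sum.reindex[OF inj])
      then show ?thesis using sign by simp
    qed
    also have "\<dots> = flag_boundary (flag_map (unitvec c))"
      by (simp add: flag_map_def cell_flag_def p flag_boundary_unitvec)
    finally show "(flag_map \<circ> boundary) (unitvec c :: cell \<Rightarrow>\<^sub>0 'a) = (flag_boundary \<circ> flag_map) (unitvec c)" by simp
  qed
  then show ?thesis by simp
qed

lemma relabel_chains:
  assumes w: "w permutes {1..n}" and x: "x \<in> chains \<alpha> k d e"
  shows "relabel w x \<in> chains \<alpha> k d e"
  unfolding chains_eq
proof (rule linmap_maps_into[OF linmap_relabel x[unfolded chains_eq] subspace_supported_on])
  fix c assume c: "c \<in> cells \<alpha> k d e"
  obtain Bs \<xi>s where p: "c = (Bs, \<xi>s)" by (cases c)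
  have "card (w ` A) = card A" for A using permutes_inj[OF w] by (simp add: card_image inj_on_subset)
  then have "cell_deg deg (map ((`) w) Bs, \<xi>s) = cell_deg deg (Bs, \<xi>s)" for deg by (simp add: cell_deg_def)
  then have "(map ((`) w) Bs, \<xi>s) \<in> cells \<alpha> k d e"
    using c osp_relabel[OF w] unfolding p cells_def by (auto simp: sum_alpha)
  then show "relabel w (unitvec c) \<in> supported_on (cells \<alpha> k d e)" by (simp add: relabel_def p)
qed

lemma flag_map_relabel:
  fixes x :: "cell \<Rightarrow>\<^sub>0 'a::field"
  assumes w: "w permutes {1..n}"
  shows "flag_map (relabel w x) = flag_relabel w (flag_map x)"
proof -
  have "(flag_map \<circ> relabel w) x = (flag_relabel w \<circ> flag_map) x"
  proof (rule linmap_eq_on[OF linmap_compose[OF linmap_relabel linmap_flag_map] linmap_compose[OF linmap_flag_map linmap_flag_relabel]])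
    show "x \<in> supported_on UNIV" by (simp add: supported_on_def)
    fix c :: cell
    obtain Bs \<xi>s where p: "c = (Bs, \<xi>s)" by (cases c)
    have "card (w ` A) = card A" for A using permutes_inj[OF w] by (simp add: card_image inj_on_subset)
    then show "(flag_map \<circ> relabel w) (unitvec c :: cell \<Rightarrow>\<^sub>0 'a) = (flag_relabel w \<circ> flag_map) (unitvec c)"
      by (simp add: p relabel_def flag_map_def flag_relabel_def cell_flag_def flag_image_def flag_of_image o_def)
  qed
  then show ?thesis by simp
qed

end


section \<open>Homology of the decorated complex\<close>

text \<open>
  The projection onto the summands of the direct sum over all labels whose label is in \<open>L\<close>.
\<close>
definition label_filter :: "'l set \<Rightarrow> ('g \<times> 'l \<Rightarrow>\<^sub>0 'a::field) \<Rightarrow> ('g \<times> 'l \<Rightarrow>\<^sub>0 'a)" where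
  "label_filter L = lin_extend (\<lambda>b. if snd b \<in> L then unitvec b else 0)"

lemma linmap_label_filter [simp]: "linmap (label_filter L)"
  by (simp add: label_filter_def)

lemma label_filter_unitvec: "label_filter L (unitvec b) = (if snd b \<in> L then unitvec b else 0)"
  by (simp add: label_filter_def)

lemma label_filter_id:
  fixes x :: "'g \<times> 'l \<Rightarrow>\<^sub>0 'a::field"
  assumes "x \<in> supported_on X" "\<And>b. b \<in> X \<Longrightarrow> snd b \<in> L"
  shows "label_filter L x = x"
proof -
  have "label_filter L x = id x"
    by (rule linmap_eq_on[OF linmap_label_filter pm.linear_id assms(1)]) (simp add: label_filter_unitvec assms(2))
  then show ?thesis by simp
qed

lemma label_filter_zero:
  fixes x :: "'g \<times> 'l \<Rightarrow>\<^sub>0 'a::field"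
  assumes "x \<in> supported_on X" "\<And>b. b \<in> X \<Longrightarrow> snd b \<notin> L"
  shows "label_filter L x = 0"
proof -
  have "label_filter L x \<in> {0}"
    by (rule linmap_maps_into[OF linmap_label_filter assms(1)]) (simp_all add: label_filter_unitvec assms(2))
  then show ?thesis by simp
qed

lemma label_filter_boundary:
  fixes x :: "nat set set \<times> 'l \<Rightarrow>\<^sub>0 'a::field"
  shows "label_filter L (flag_boundary x) = flag_boundary (label_filter L x)"
proof -
  have "(label_filter L \<circ> flag_boundary) x = (flag_boundary \<circ> label_filter L) x"
  proof (rule linmap_eq_on[OF linmap_compose[OF linmap_flag_boundary linmap_label_filter]
        linmap_compose[OF linmap_label_filter linmap_flag_boundary]])
    show "x \<in> supported_on UNIV" by (simp add: supported_on_def)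
    fix b :: "nat set set \<times> 'l"
    show "(label_filter L \<circ> flag_boundary) (unitvec b :: _ \<Rightarrow>\<^sub>0 'a) = (flag_boundary \<circ> label_filter L) (unitvec b)"
      by (cases b) (simp add: label_filter_unitvec flag_boundary_unitvec pm.linear_sum[OF linmap_label_filter]
          pm.linear_scale[OF linmap_label_filter] pm.linear_0[OF linmap_flag_boundary])
  qed
  then show ?thesis by simp
qed

lemma label_filter_supported:
  assumes "x \<in> supported_on (labelled_flags n F L j)"
  shows "label_filter L' x \<in> supported_on (labelled_flags n F (L \<inter> L') j)"
  by (rule linmap_maps_into[OF linmap_label_filter assms subspace_supported_on])
    (auto simp: label_filter_unitvec labelled_flags_def pm.subspace_0[OF subspace_supported_on])

lemma card_flag_le:
  assumes "\<Gamma> \<in> flags n S" "finite S"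
  shows "card \<Gamma> \<le> card S"
proof -
  have "inj_on card \<Gamma>" using flag_element_unique[OF assms(1)] by (auto intro: inj_onI)
  then show ?thesis using assms by (metis (no_types, lifting) card_image card_mono flags_def mem_Collect_eq)
qed

lemma finite_fact_cuts: "finite (fact_cuts \<alpha> \<theta>)"
  by (rule finite_subset[of _ "cuts \<alpha>"]) (auto simp: fact_cuts_def cuts_eq)

lemma finite_decorations: "finite (decorations n)"
  by (simp add: decorations_def finite_permutations)

lemma finite_graded_decorations: "finite (graded_decorations n d e)"
  by (simp add: graded_decorations_def finite_decorations)

definition cycle_space :: "nat list \<Rightarrow> nat \<Rightarrow> nat \<Rightarrow> nat \<Rightarrow> (cell \<Rightarrow>\<^sub>0 'a::field) set" where
  "cycle_space \<alpha> m d e = {x \<in> chains \<alpha> (Suc m) d e. boundary x = 0}"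

definition boundary_space :: "nat list \<Rightarrow> nat \<Rightarrow> nat \<Rightarrow> nat \<Rightarrow> (cell \<Rightarrow>\<^sub>0 'a::field) set" where
  "boundary_space \<alpha> m d e = boundary ` chains \<alpha> (Suc (Suc m)) d e"

lemma homology_eq: "homology \<alpha> (Suc m) d e = quotient_space (cycle_space \<alpha> m d e) (boundary_space \<alpha> m d e)"
  by (simp add: homology_def cycle_space_def boundary_space_def)

text \<open>
  The labels for which flags with \<open>m\<close> members are the largest possible ones. These are the labels
  that contribute to the homology in this degree.
\<close>
definition top_decorations :: "nat \<Rightarrow> nat list \<Rightarrow> nat \<Rightarrow> nat \<Rightarrow> nat \<Rightarrow> decoration set" where
  "top_decorations n \<alpha> m d e = {\<theta> \<in> graded_decorations n d e. card (fact_cuts \<alpha> \<theta>) = m}"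

context
  fixes n :: nat and \<alpha> :: "nat list"
  assumes comp: "composition n \<alpha>" and n: "0 < n" and odd: "at_most_one_odd \<alpha>"
begin

lemma fact_cuts_range: "fact_cuts \<alpha> \<theta> \<subseteq> {1..<n}"
  using cuts_range[OF comp] by (auto simp: fact_cuts_def)

lemma boundary_boundary:
  fixes x :: "cell \<Rightarrow>\<^sub>0 'a::field_char_0"
  assumes "x \<in> chains \<alpha> (Suc (Suc j)) d e"
  shows "boundary (boundary x) = 0"
proof (cases j)
  case 0
  then have "boundary (boundary x) \<in> chains \<alpha> 0 d e"
    using boundary_chains[OF comp n odd] assms by blast
  moreover have "cells \<alpha> 0 d e = {}"
    using sum_alpha[OF comp n odd] n by (auto simp: cells_def coarsening_def composition_def)
  ultimately show ?thesis by (simp add: chains_def)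
next
  case (Suc i)
  have bx: "boundary x \<in> chains \<alpha> (Suc j) d e" by (rule boundary_chains[OF comp n odd assms])
  show ?thesis
  proof (rule flag_map_eqD[OF comp n odd])
    show "boundary (boundary x) \<in> chains \<alpha> (Suc i) d e" using boundary_chains[OF comp n odd bx] Suc by simp
    show "0 \<in> chains \<alpha> (Suc i) d e" by (simp add: chains_def)
    show "flag_map (boundary (boundary x)) = flag_map 0"
      using flag_boundary_boundary[OF flag_map_supported[OF comp n odd assms]]
      by (simp add: flag_map_boundary[OF comp n odd bx] flag_map_boundary[OF comp n odd assms] pm.linear_0[OF linmap_flag_map])
  qed
qed

text \<open>
  Cells with a single block correspond to the empty flag; there both boundaries vanish for lack of a
  target. In all other degrees \<open>flag_map\<close> is an injective chain map.
\<close>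
lemma boundary_zero_iff:
  fixes x :: "cell \<Rightarrow>\<^sub>0 'a::field_char_0"
  assumes "x \<in> chains \<alpha> (Suc j) d e"
  shows "boundary x = 0 \<longleftrightarrow> flag_boundary (flag_map x) = 0"
proof (cases j)
  case 0
  have "boundary x \<in> chains \<alpha> 0 d e" using boundary_chains[OF comp n odd assms] 0 by simp
  moreover have "cells \<alpha> 0 d e = {}"
    using sum_alpha[OF comp n odd] n by (auto simp: cells_def coarsening_def composition_def)
  ultimately have "boundary x = 0" by (simp add: chains_def)
  moreover have "flag_boundary (flag_map x) = 0"
    using flag_boundary_zero flag_map_supported[OF comp n odd assms] 0 by metis
  ultimately show ?thesis by simp
next
  case (Suc i)
  have bx: "boundary x \<in> chains \<alpha> (Suc i) d e" using boundary_chains[OF comp n odd assms] Suc by simp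
  have "boundary x = 0 \<longleftrightarrow> flag_map (boundary x) = 0"
    using flag_map_eqD[OF comp n odd bx, of 0] by (auto simp: chains_def pm.linear_0[OF linmap_flag_map])
  then show ?thesis by (simp add: flag_map_boundary[OF comp n odd assms])
qed

lemma homology_subspaces:
  "pm.subspace (cycle_space \<alpha> m d e :: (cell \<Rightarrow>\<^sub>0 'a::field_char_0) set)"
  "pm.subspace (boundary_space \<alpha> m d e :: (cell \<Rightarrow>\<^sub>0 'a::field_char_0) set)"
  "boundary_space \<alpha> m d e \<subseteq> (cycle_space \<alpha> m d e :: (cell \<Rightarrow>\<^sub>0 'a::field_char_0) set)"
proof -
  show "pm.subspace (cycle_space \<alpha> m d e :: (cell \<Rightarrow>\<^sub>0 'a) set)"
    unfolding cycle_space_def chains_eq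
    by (intro pm.subspaceI) (auto simp: pm.linear_add[OF linmap_boundary] pm.linear_scale[OF linmap_boundary]
        pm.linear_0[OF linmap_boundary] intro: pm.subspace_add[OF subspace_supported_on]
        pm.subspace_scale[OF subspace_supported_on] pm.subspace_0[OF subspace_supported_on])
  show "pm.subspace (boundary_space \<alpha> m d e :: (cell \<Rightarrow>\<^sub>0 'a) set)"
    unfolding boundary_space_def chains_eq by (intro pm.linear_subspace_image linmap_boundary subspace_supported_on)
  show "boundary_space \<alpha> m d e \<subseteq> (cycle_space \<alpha> m d e :: (cell \<Rightarrow>\<^sub>0 'a) set)"
    unfolding boundary_space_def cycle_space_def
    using boundary_boundary boundary_chains[OF comp n odd] by blast
qed

lemma relabel_cycles:
  fixes z :: "cell \<Rightarrow>\<^sub>0 'a::field_char_0"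
  assumes "w permutes {1..n}" "z \<in> cycle_space \<alpha> m d e"
  shows "relabel w z \<in> cycle_space \<alpha> m d e"
  using assms(2) boundary_relabel[OF permutes_inj[OF assms(1)], of z]
  by (simp add: cycle_space_def relabel_chains[OF comp n odd assms(1)] pm.linear_0[OF linmap_relabel])

lemma relabel_boundaries:
  assumes w: "w permutes {1..n}"
  shows "relabel w ` boundary_space \<alpha> m d e = (boundary_space \<alpha> m d e :: (cell \<Rightarrow>\<^sub>0 'a::field_char_0) set)"
proof -
  have sub: "relabel v b \<in> boundary_space \<alpha> m d e" if v: "v permutes {1..n}" and b: "b \<in> boundary_space \<alpha> m d e"
    for v and b :: "cell \<Rightarrow>\<^sub>0 'a"
  proof -
    obtain y where y: "y \<in> chains \<alpha> (Suc (Suc m)) d e" "b = boundary y" using b by (auto simp: boundary_space_def)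
    have "relabel v b = boundary (relabel v y)" unfolding y(2) by (rule boundary_relabel[OF permutes_inj[OF v], symmetric])
    then show ?thesis using relabel_chains[OF comp n odd v y(1)] by (simp add: boundary_space_def)
  qed
  show ?thesis
  proof
    show "relabel w ` boundary_space \<alpha> m d e \<subseteq> (boundary_space \<alpha> m d e :: (cell \<Rightarrow>\<^sub>0 'a) set)" using sub[OF w] by blast
    show "(boundary_space \<alpha> m d e :: (cell \<Rightarrow>\<^sub>0 'a) set) \<subseteq> relabel w ` boundary_space \<alpha> m d e"
    proof
      fix b :: "cell \<Rightarrow>\<^sub>0 'a" assume b: "b \<in> boundary_space \<alpha> m d e"
      have "b = relabel w (relabel (inv_into UNIV w) b)"
        by (simp add: relabel_relabel permutes_inv_o[OF w] relabel_id)
      then show "b \<in> relabel w ` boundary_space \<alpha> m d e"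
        using sub[OF permutes_inv[OF w] b] by (rule image_eqI)
    qed
  qed
qed

lemma homology_trivial_trace:
  assumes w: "w permutes {1..n}"
    and triv: "carrier (homology \<alpha> (Suc m) d e :: ('a::field_char_0, _) module) = {\<zero>\<^bsub>homology \<alpha> (Suc m) d e\<^esub>}"
  shows "lin_trace (homology \<alpha> (Suc m) d e :: ('a::field_char_0, _) module) ((`) (relabel w)) = 0"
proof -
  let ?Z = "cycle_space \<alpha> m d e :: (cell \<Rightarrow>\<^sub>0 'a) set" and ?B = "boundary_space \<alpha> m d e :: (cell \<Rightarrow>\<^sub>0 'a) set"
  note sub = homology_subspaces[of m d e, where 'a = 'a]
  have "z \<in> ?B" if "z \<in> ?Z" for z
  proof -
    have "coset ?B z \<in> {coset ?B 0}"
      using triv that unfolding homology_eq quotient_carrier[OF sub] quotient_zero[OF sub] by blast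
    then show ?thesis using coset_eq_iff[OF sub, of z 0] by simp
  qed
  \<comment> \<open>A zero quotient is a retract of the functions on the empty set.\<close>
  then have "lin_trace (quotient_space ?Z ?B) ((`) (relabel w)) =
      trace_on ({} :: unit set) (\<lambda>x :: unit \<Rightarrow>\<^sub>0 'a. (\<lambda>_. 0) (relabel w ((\<lambda>_. 0) x)))"
    using pm.subspace_0[OF sub(1)]
    by (intro lin_trace_quotient[OF sub linmap_relabel pm.linear_zero pm.linear_zero _
          relabel_cycles[OF w] relabel_boundaries[OF w]]) (auto simp: supported_on_def)
  then show ?thesis by (simp add: homology_eq trace_on_def)
qed

text \<open>This makes the sum over all bidegrees in the bigraded characteristic finite.\<close>
lemma homology_trivial_degrees:
  assumes "(d, e) \<notin> (\<lambda>\<theta>. (deg_t n \<theta>, deg_q n \<theta>)) ` decorations n"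
  shows "carrier (homology \<alpha> (Suc m) d e :: ('a::field_char_0, _) module) = {\<zero>\<^bsub>homology \<alpha> (Suc m) d e\<^esub>}"
proof -
  note sub = homology_subspaces[of m d e, where 'a = 'a]
  have "graded_decorations n d e = {}" using assms by (auto simp: graded_decorations_def)
  then have "cells \<alpha> (Suc m) d e = {}"
    using bij_betw_imp_surj_on[OF cell_flag_bij[OF comp n odd, of m d e]] by (auto simp: labelled_flags_def)
  then have "(cycle_space \<alpha> m d e :: (cell \<Rightarrow>\<^sub>0 'a) set) = {0}"
    by (auto simp: cycle_space_def chains_def pm.linear_0[OF linmap_boundary])
  then show ?thesis unfolding homology_eq quotient_carrier[OF sub] quotient_zero[OF sub] by simp
qed

abbreviation "top_flags m d e \<equiv> labelled_flags n (fact_cuts \<alpha>) (top_decorations n \<alpha> m d e)"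

text \<open>
  The homology is a retract of the top flags with labels that have exactly \<open>m\<close> cuts. To project onto
  them (\<open>P\<close>), discard all other labels: those with fewer cuts have no flags of this size, and those
  with more contribute exact complexes. This kills the boundaries, because the remaining labels
  admit no larger flag. To go back (\<open>J\<close>), apply the projection \<open>Q\<close> onto the cycles. The trace is
  then the number of fixed top flags minus the trace on a complement of the cycles, which
  \<open>trace_flag_section\<close> computes.
\<close>
theorem homology_trace:
  assumes w: "w permutes {1..n}"
  shows "lin_trace (homology \<alpha> (Suc m) d e :: ('a::field_char_0, _) module) ((`) (relabel w)) =
    (\<Sum>i\<le>m. (-1) ^ (m - i) * of_nat (card {b \<in> top_flags m d e i. flag_image w b = b}))"
proof -
  let ?F = "fact_cuts \<alpha>" and ?L = "graded_decorations n d e" and ?T = "top_decorations n \<alpha> m d e"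
  let ?Z = "cycle_space \<alpha> m d e :: (cell \<Rightarrow>\<^sub>0 'a) set"
  let ?B = "boundary_space \<alpha> m d e :: (cell \<Rightarrow>\<^sub>0 'a) set"
  let ?X = "top_flags m d e m"
  note K = comp n odd
  have TL: "?T \<subseteq> ?L" by (auto simp: top_decorations_def)
  have finT: "finite ?T" using TL finite_graded_decorations finite_subset by blast
  from flag_section_exists[of n ?F ?T m, where 'a = 'a]
  obtain s :: "(nat set set \<times> decoration \<Rightarrow>\<^sub>0 'a) \<Rightarrow> (nat set set \<times> decoration \<Rightarrow>\<^sub>0 'a)" where
    s: "linmap s" "range s \<subseteq> supported_on ?X"
    "\<And>y. y \<in> supported_on ?X \<Longrightarrow> flag_boundary (s (flag_boundary y)) = flag_boundary y"
    by (elim exE conjE) (rule that, auto)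
  \<comment> \<open>The projection of the top flags onto the cycles.\<close>
  define Q where "Q x = x - s (flag_boundary x)" for x
  have linQ: "linmap Q" unfolding Q_def[abs_def]
    by (intro pm.linear_compose_sub pm.linear_id[unfolded id_def] linmap_compose[OF linmap_flag_boundary s(1), unfolded o_def])
  define P where "P z = label_filter ?T (flag_map z)" for z :: "cell \<Rightarrow>\<^sub>0 'a"
  define J where "J x = flag_map_inv \<alpha> m d e (Q x)" for x :: "nat set set \<times> decoration \<Rightarrow>\<^sub>0 'a"
  have linP: "linmap P" unfolding P_def[abs_def]
    using linmap_compose[OF linmap_flag_map linmap_label_filter] by (simp add: o_def)
  have linJ: "linmap J" unfolding J_def[abs_def]
    using linmap_compose[OF linQ linmap_flag_map_inv] by (simp add: o_def)
  have QX: "Q x \<in> supported_on ?X" if "x \<in> supported_on ?X" for x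
    unfolding Q_def using that s(2) by (intro pm.subspace_diff subspace_supported_on) auto
  have Xall: "x \<in> supported_on (labelled_flags n ?F ?L j)" if "x \<in> supported_on (labelled_flags n ?F ?T j)" for x :: "_ \<Rightarrow>\<^sub>0 'a" and j
    using that TL by (auto simp: supported_on_def labelled_flags_def)
  have bdQ: "flag_boundary (Q x) = 0" if "x \<in> supported_on ?X" for x
    unfolding Q_def using s(3)[OF that] by (simp add: pm.linear_diff[OF linmap_flag_boundary])
  have flagJ: "flag_map (J x) = Q x" if "x \<in> supported_on ?X" for x
    unfolding J_def by (rule flag_map_flag_map_inv[OF K Xall[OF QX[OF that]]])
  have JZ: "J x \<in> ?Z" if x: "x \<in> supported_on ?X" for x
  proof -
    have J: "J x \<in> chains \<alpha> (Suc m) d e" unfolding J_def by (rule flag_map_inv_chains[OF K Xall[OF QX[OF x]]])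
    then show ?thesis using boundary_zero_iff[OF J] flagJ[OF x] bdQ[OF x] by (simp add: cycle_space_def)
  qed
  have PX: "P z \<in> supported_on ?X" if "z \<in> chains \<alpha> (Suc m) d e" for z
  proof -
    have "?L \<inter> ?T = ?T" using TL by blast
    then show ?thesis using label_filter_supported[OF flag_map_supported[OF K that], of ?T] by (simp add: P_def)
  qed
  have PB: "P b = 0" if "b \<in> ?B" for b
  proof -
    obtain y where y: "y \<in> chains \<alpha> (Suc (Suc m)) d e" "b = boundary y" using \<open>b \<in> ?B\<close> unfolding boundary_space_def by blast
    have "label_filter ?T (flag_map y) = 0"
    proof (rule label_filter_zero[OF flag_map_supported[OF K y(1)]])
      fix b assume "b \<in> labelled_flags n ?F ?L (Suc m)"
      then have "Suc m \<le> card (?F (snd b))"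
        using card_flag_le[OF _ finite_fact_cuts] by (fastforce simp: labelled_flags_def)
      then show "snd b \<notin> ?T" by (simp add: top_decorations_def)
    qed
    then show ?thesis using flag_map_boundary[OF K y(1)]
      by (simp add: P_def y(2) label_filter_boundary pm.linear_0[OF linmap_flag_boundary])
  qed
  have JP: "z - J (P z) \<in> ?B" if z: "z \<in> ?Z" for z
  proof -
    have zc: "z \<in> chains \<alpha> (Suc m) d e" using z by (simp add: cycle_space_def)
    have bz: "flag_boundary (flag_map z) = 0" using z boundary_zero_iff[OF zc] by (simp add: cycle_space_def)
    have "flag_boundary (P z) = 0"
      unfolding P_def label_filter_boundary[symmetric] bz by (rule pm.linear_0[OF linmap_label_filter])
    then have QP: "Q (P z) = P z" by (simp add: Q_def pm.linear_0[OF s(1)])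
    define y where "y = flag_map z - P z"
    have y: "y \<in> supported_on (labelled_flags n ?F (?L - ?T) m)"
    proof -
      have "y = label_filter (- ?T) (flag_map z)"
      proof -
        have "(\<lambda>x. x - label_filter ?T x) (flag_map z) = label_filter (- ?T) (flag_map z)"
          by (rule linmap_eq_on[where X = UNIV])
            (auto simp: supported_on_def label_filter_unitvec intro!: pm.linear_compose_sub pm.linear_id[unfolded id_def])
        then show ?thesis by (simp add: y_def P_def)
      qed
      then show ?thesis
        using label_filter_supported[OF flag_map_supported[OF K zc], of "- ?T"] by (simp add: Diff_eq)
    qed
    have "flag_boundary y = 0"
      unfolding y_def using bz \<open>flag_boundary (P z) = 0\<close> by (simp add: pm.linear_diff[OF linmap_flag_boundary])
    moreover have "?F \<theta> \<subseteq> {..n} \<and> m < card (?F \<theta>)" if "\<theta> \<in> {\<theta> \<in> ?L - ?T. \<exists>\<Gamma>. \<Gamma> \<in> flags n (?F \<theta>) \<and> card \<Gamma> = m}" for \<theta>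
    proof -
      have "m \<le> card (?F \<theta>)" using that card_flag_le[OF _ finite_fact_cuts] by blast
      moreover have "card (?F \<theta>) \<noteq> m" using that by (auto simp: top_decorations_def)
      ultimately show ?thesis using fact_cuts_range[of \<theta>] by auto
    qed
    moreover have "y \<in> supported_on (labelled_flags n ?F {\<theta> \<in> ?L - ?T. \<exists>\<Gamma>. \<Gamma> \<in> flags n (?F \<theta>) \<and> card \<Gamma> = m} m)"
      using y by (auto simp: supported_on_def labelled_flags_def)
    ultimately obtain v where v: "v \<in> supported_on (labelled_flags n ?F {\<theta> \<in> ?L - ?T. \<exists>\<Gamma>. \<Gamma> \<in> flags n (?F \<theta>) \<and> card \<Gamma> = m} (Suc m))"
        "flag_boundary v = y"
      using flag_complex_exact by blast
    have v': "v \<in> supported_on (labelled_flags n ?F ?L (Suc m))"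
      using v(1) by (auto simp: supported_on_def labelled_flags_def)
    let ?u = "flag_map_inv \<alpha> (Suc m) d e v"
    have u: "?u \<in> chains \<alpha> (Suc (Suc m)) d e" by (rule flag_map_inv_chains[OF K v'])
    have "boundary ?u = z - J (P z)"
    proof (rule flag_map_eqD[OF K])
      show "boundary ?u \<in> chains \<alpha> (Suc m) d e" by (rule boundary_chains[OF K u])
      show "z - J (P z) \<in> chains \<alpha> (Suc m) d e"
        using zc JZ[OF PX[OF zc]] unfolding chains_eq cycle_space_def by (intro pm.subspace_diff subspace_supported_on) auto
      show "flag_map (boundary ?u) = flag_map (z - J (P z))"
        unfolding flag_map_boundary[OF K u] flag_map_flag_map_inv[OF K v'] v(2)
        by (simp add: pm.linear_diff[OF linmap_flag_map] flagJ[OF PX[OF zc]] QP y_def)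
    qed
    then show ?thesis using u unfolding boundary_space_def by (metis imageI)
  qed
  have "lin_trace (quotient_space ?Z ?B) ((`) (relabel w)) = trace_on ?X (\<lambda>x. P (relabel w (J x)))"
    by (rule lin_trace_quotient[OF homology_subspaces linmap_relabel linP linJ finite_labelled_flags[OF finT]
          relabel_cycles[OF w] relabel_boundaries[OF w] _ JZ PB JP])
      (use PX in \<open>auto simp: cycle_space_def\<close>)
  also have "\<dots> = trace_on ?X (\<lambda>x. flag_relabel w x - flag_relabel w (s (flag_boundary x)))"
  proof (rule trace_on_cong)
    fix b assume "b \<in> ?X"
    then have b: "unitvec b \<in> supported_on ?X" by simp
    have "P (relabel w (J (unitvec b))) = label_filter ?T (flag_relabel w (Q (unitvec b)))"
      by (simp add: P_def flag_map_relabel[OF K w] flagJ[OF b])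
    also have "\<dots> = flag_relabel w (Q (unitvec b))"
      by (rule label_filter_id[OF flag_relabel_supported[OF w QX[OF b]]]) (auto simp: labelled_flags_def)
    finally show "P (relabel w (J (unitvec b))) = flag_relabel w (unitvec b) - flag_relabel w (s (flag_boundary (unitvec b)))"
      by (simp add: Q_def pm.linear_diff[OF linmap_flag_relabel])
  qed
  also have "\<dots> = trace_on ?X (flag_relabel w) - trace_on ?X (\<lambda>x. flag_relabel w (s (flag_boundary x)))"
    by (rule trace_on_diff)
  also have "trace_on ?X (\<lambda>x. flag_relabel w (s (flag_boundary x))) =
      (\<Sum>i<m. (-1) ^ (m - 1 - i) * of_nat (card {b \<in> top_flags m d e i. flag_image w b = b}))"
  proof (rule trace_flag_section[OF w finT _ s])
    show "?F \<theta> \<subseteq> {..n} \<and> m \<le> card (?F \<theta>)" if "\<theta> \<in> ?T" for \<theta>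
      using fact_cuts_range[of \<theta>] that by (auto simp: top_decorations_def)
  qed
  also have "trace_on ?X (flag_relabel w) = (of_nat (card {b \<in> ?X. flag_image w b = b}) :: 'a)"
    unfolding flag_relabel_def by (rule trace_on_lin_extend_unitvec[OF finite_labelled_flags[OF finT]])
  also have "of_nat (card {b \<in> ?X. flag_image w b = b}) -
      (\<Sum>i<m. (-1) ^ (m - 1 - i) * of_nat (card {b \<in> top_flags m d e i. flag_image w b = b})) =
    (\<Sum>i\<le>m. (-1) ^ (m - i) * of_nat (card {b \<in> top_flags m d e i. flag_image w b = b}) :: 'a)"
  proof -
    have "(- 1) ^ (m - i) = - ((- 1) ^ (m - 1 - i) :: 'a)" if "i < m" for i
    proof -
      have "m - i = Suc (m - 1 - i)" using that by simp
      then show ?thesis by (metis mult_minus1 power_Suc)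
    qed
    then have "(\<Sum>i<m. (-1) ^ (m - i) * of_nat (card {b \<in> top_flags m d e i. flag_image w b = b})) =
      - (\<Sum>i<m. (-1) ^ (m - 1 - i) * of_nat (card {b \<in> top_flags m d e i. flag_image w b = b}) :: 'a)"
      by (simp flip: sum_negf)
    then show ?thesis by (simp add: lessThan_Suc_atMost[symmetric])
  qed
  finally show ?thesis by (simp only: homology_eq)
qed

end


section \<open>Frobenius characteristic of the homology\<close>

lemma fixed_flags_of_type:
  assumes w: "w permutes {1..n}" and n: "0 < n" and S: "S \<subseteq> {1..<n}"
  shows "card {\<Gamma> \<in> flags_of_type n S. (`) w ` \<Gamma> = \<Gamma>} =
    card {Bs \<in> osp n (comp_of_cuts n S). map ((`) w) Bs = Bs}"
proof -
  let ?\<gamma> = "comp_of_cuts n S"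
  have \<gamma>: "composition n ?\<gamma>" "cuts ?\<gamma> = S" using composition_of_cuts[OF n S] by simp_all
  have bij: "bij_betw flag_of (osp n ?\<gamma>) (flags_of_type n S)" using bij_betw_flag_of[OF \<gamma>(1) n] \<gamma>(2) by simp
  have fixed: "(`) w ` flag_of Bs = flag_of Bs \<longleftrightarrow> map ((`) w) Bs = Bs" if "Bs \<in> osp n ?\<gamma>" for Bs
    using inj_on_eq_iff[OF bij_betw_imp_inj_on[OF bij] osp_relabel[OF w that] that] by (simp add: flag_of_image)
  have "bij_betw flag_of {Bs \<in> osp n ?\<gamma>. map ((`) w) Bs = Bs} {\<Gamma> \<in> flags_of_type n S. (`) w ` \<Gamma> = \<Gamma>}"
    unfolding bij_betw_def
  proof
    show "inj_on flag_of {Bs \<in> osp n ?\<gamma>. map ((`) w) Bs = Bs}"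
      by (rule inj_on_subset[OF bij_betw_imp_inj_on[OF bij]]) blast
    show "flag_of ` {Bs \<in> osp n ?\<gamma>. map ((`) w) Bs = Bs} = {\<Gamma> \<in> flags_of_type n S. (`) w ` \<Gamma> = \<Gamma>}"
      unfolding bij_betw_imp_surj_on[OF bij, symmetric] using fixed by blast
  qed
  then show ?thesis by (rule bij_betw_same_card[symmetric])
qed

lemma finite_subset_range: "S \<subseteq> {1..<n :: nat} \<Longrightarrow> finite S"
  by (rule finite_subset) auto

text \<open>
  Group the flags by label and by rank set, and turn each flag into an ordered set partition; this
  correspondence commutes with the permutation \<open>w\<close>.
\<close>
lemma fixed_labelled_flags:
  assumes w: "w permutes {1..n}" and n: "0 < n" and L: "finite L" "\<And>l. l \<in> L \<Longrightarrow> F l \<subseteq> {1..<n}"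
  shows "card {b \<in> labelled_flags n F L i. flag_image w b = b} =
    (\<Sum>l\<in>L. \<Sum>S | S \<subseteq> F l \<and> card S = i. card {Bs \<in> osp n (comp_of_cuts n S). map ((`) w) Bs = Bs})"
proof -
  let ?fix = "\<lambda>S. {\<Gamma> \<in> flags_of_type n S. (`) w ` \<Gamma> = \<Gamma>}"
  let ?G = "\<lambda>l. {\<Gamma> \<in> flags n (F l). card \<Gamma> = i \<and> (`) w ` \<Gamma> = \<Gamma>}"
  have finG: "finite (?G l)" for l using finite_flags[of n "F l"] by simp
  have "{b \<in> labelled_flags n F L i. flag_image w b = b} = prod.swap ` (SIGMA l:L. ?G l)"
  proof (rule Set.set_eqI)
    fix b
    show "b \<in> {b \<in> labelled_flags n F L i. flag_image w b = b} \<longleftrightarrow> b \<in> prod.swap ` (SIGMA l:L. ?G l)"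
      by (cases b) (simp only: pair_in_swap_image, simp add: labelled_flags_def flag_image_def conj_ac)
  qed
  then have "card {b \<in> labelled_flags n F L i. flag_image w b = b} = card (SIGMA l:L. ?G l)"
    by (simp add: card_image)
  also have "\<dots> = (\<Sum>l\<in>L. card (?G l))" using L(1) finG by simp
  also have "\<dots> = (\<Sum>l\<in>L. \<Sum>S | S \<subseteq> F l \<and> card S = i. card (?fix S))"
  proof (rule sum.cong)
    fix l assume l: "l \<in> L"
    have finF: "finite (F l)" using finite_subset_range[OF L(2)[OF l]] .
    have "?G l = (\<Union>S\<in>{S. S \<subseteq> F l \<and> card S = i}. ?fix S)"
    proof -
      have "card (card ` \<Gamma>) = card \<Gamma>" if "\<Gamma> \<in> flags n S" for \<Gamma> S
        using flag_element_unique[OF that] by (intro card_image inj_onI) auto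
      moreover have "\<Gamma> \<in> flags n S \<Longrightarrow> \<Gamma> \<in> flags_of_type n (card ` \<Gamma>) \<and> card ` \<Gamma> \<subseteq> S" for \<Gamma> S
        by (simp add: flags_of_type_def flags_def)
      moreover have "\<Gamma> \<in> flags_of_type n S \<Longrightarrow> S \<subseteq> S' \<Longrightarrow> \<Gamma> \<in> flags n S' \<and> card ` \<Gamma> = S" for \<Gamma> S S'
        by (simp add: flags_of_type_def flags_def)
      ultimately show ?thesis by (intro Set.set_eqI iffI; clarsimp) metis+
    qed
    moreover have "card (\<Union>S\<in>{S. S \<subseteq> F l \<and> card S = i}. ?fix S) = (\<Sum>S | S \<subseteq> F l \<and> card S = i. card (?fix S))"
    proof (rule card_UN_disjoint)
      show "finite {S. S \<subseteq> F l \<and> card S = i}" using finF by simp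
      show "\<forall>S\<in>{S. S \<subseteq> F l \<and> card S = i}. finite (?fix S)"
        using finite_flags by (auto simp: flags_of_type_def)
      show "\<forall>S\<in>{S. S \<subseteq> F l \<and> card S = i}. \<forall>T\<in>{S. S \<subseteq> F l \<and> card S = i}. S \<noteq> T \<longrightarrow> ?fix S \<inter> ?fix T = {}"
        by (auto simp: flags_of_type_def)
    qed
    ultimately show "card (?G l) = (\<Sum>S | S \<subseteq> F l \<and> card S = i. card (?fix S))" by simp
  qed simp
  also have "\<dots> = (\<Sum>l\<in>L. \<Sum>S | S \<subseteq> F l \<and> card S = i. card {Bs \<in> osp n (comp_of_cuts n S). map ((`) w) Bs = Bs})"
    using L(2) by (intro sum.cong refl fixed_flags_of_type[OF w n]) blast
  finally show ?thesis .
qed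

lemma mconst_simps:
  "mconst 0 = 0" "mconst (a + b) = mconst a + mconst b" "mconst (- a) = - mconst a" "mconst 1 = 1" "mconst (a * b) = mconst a * mconst b"
proof -
  show "mconst 0 = 0" "mconst (a + b) = mconst a + mconst b" "mconst (- a) = - mconst a" "mconst 1 = 1"
    by (auto intro!: mpser_eqI simp: mconst_def zero_mpser_def plus_mpser_def uminus_mpser_def one_mpser_def)
  show "mconst (a * b) = mconst a * mconst b"
    by (rule mpser_eqI) (simp add: mcoeff_mconst_mult, simp add: mconst_def)
qed

lemma mconst_sum: "mconst (\<Sum>i\<in>I. f i) = (\<Sum>i\<in>I. mconst (f i))"
  by (induction I rule: infinite_finite_induct) (simp_all add: mconst_simps)

lemma mconst_neg_one_power: "mconst ((- 1) ^ k) = (- 1) ^ k"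
  by (induction k) (simp_all add: mconst_simps)

text \<open>
  Coarsenings are subsets of the cut set, so the defining sum of a ribbon is an alternating sum over
  a power set.
\<close>
lemma ribbon_comp_of_cuts:
  assumes n: "0 < n" and S: "S \<subseteq> {1..<n}"
  shows "ribbon (comp_of_cuts n S) =
    (\<Sum>T\<in>Pow S. (-1) ^ (card S - card T) * prod_list (map complete_sym (comp_of_cuts n T)) :: 'a::comm_ring_1 mpser)"
proof -
  let ?\<gamma> = "comp_of_cuts n S"
  have \<gamma>: "composition n ?\<gamma>" "cuts ?\<gamma> = S" using composition_of_cuts[OF n S] by simp_all
  have sum: "sum_list ?\<gamma> = n" using \<gamma>(1) by (simp add: composition_def)
  have len: "length \<beta> = Suc (card (cuts \<beta>))" if "composition n \<beta>" for \<beta>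
    using card_cuts[OF that] composition_nonempty[OF that n] by (cases \<beta>) auto
  have "ribbon ?\<gamma> = (\<Sum>\<beta>\<in>{\<beta>. coarsening \<beta> ?\<gamma>}. (-1) ^ (card S - card (cuts \<beta>)) *
      prod_list (map complete_sym (comp_of_cuts n (cuts \<beta>))) :: 'a mpser)"
    unfolding ribbon_def
  proof (rule sum.cong)
    fix \<beta> assume "\<beta> \<in> {\<beta>. coarsening \<beta> ?\<gamma>}"
    then have "composition n \<beta>" by (simp add: coarsening_def sum)
    then show "(-1) ^ (length ?\<gamma> - length \<beta>) * prod_list (map complete_sym \<beta>) = (-1) ^ (card S - card (cuts \<beta>)) *
      (prod_list (map complete_sym (comp_of_cuts n (cuts \<beta>))) :: 'a mpser)"
      using len[OF \<gamma>(1)] len[of \<beta>] comp_of_cuts_cuts[OF _ n] \<gamma>(2) by simp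
  qed simp
  also have "\<dots> = (\<Sum>T\<in>Pow S. (-1) ^ (card S - card T) * prod_list (map complete_sym (comp_of_cuts n T)))"
    using sum.reindex_bij_betw[OF bij_betw_cuts_coarsening[OF \<gamma>(1) n],
        of "\<lambda>T. (-1) ^ (card S - card T) * (prod_list (map complete_sym (comp_of_cuts n T)) :: 'a mpser)"]
    by (simp add: \<gamma>(2))
  finally show ?thesis .
qed

lemma sum_Pow_by_card:
  assumes "finite A" "card A = m"
  shows "(\<Sum>i\<le>m. \<Sum>S | S \<subseteq> A \<and> card S = i. f i S) = (\<Sum>S\<in>Pow A. f (card S) S)"
proof -
  have "(\<Sum>i\<le>m. \<Sum>S | S \<subseteq> A \<and> card S = i. f i S) = (\<Sum>i\<le>m. \<Sum>S | S \<in> Pow A \<and> card S = i. f (card S) S)"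
    by (intro sum.cong) auto
  also have "\<dots> = (\<Sum>S\<in>Pow A. f (card S) S)"
    using assms by (intro sum.group) (auto simp: card_mono)
  finally show ?thesis .
qed

context
  fixes n :: nat and \<alpha> :: "nat list"
  assumes comp: "composition n \<alpha>" and n: "0 < n" and odd: "at_most_one_odd \<alpha>"
begin

lemma finite_top_decorations: "finite (top_decorations n \<alpha> m d e)"
  by (rule finite_subset[OF _ finite_graded_decorations[of n d e]]) (auto simp: top_decorations_def)

lemma homology_trace_osp:
  assumes w: "w permutes {1..n}"
  shows "lin_trace (homology \<alpha> (Suc m) d e :: ('a::field_char_0, _) module) ((`) (relabel w)) =
    (\<Sum>\<theta>\<in>top_decorations n \<alpha> m d e. \<Sum>S\<in>Pow (fact_cuts \<alpha> \<theta>). (-1) ^ (m - card S) *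
       of_nat (card {Bs \<in> osp n (comp_of_cuts n S). map ((`) w) Bs = Bs}))"
proof -
  let ?T = "top_decorations n \<alpha> m d e"
  let ?g = "\<lambda>S. of_nat (card {Bs \<in> osp n (comp_of_cuts n S). map ((`) w) Bs = Bs}) :: 'a"
  have "lin_trace (homology \<alpha> (Suc m) d e :: ('a, _) module) ((`) (relabel w)) =
    (\<Sum>i\<le>m. (-1) ^ (m - i) * of_nat (\<Sum>\<theta>\<in>?T. \<Sum>S | S \<subseteq> fact_cuts \<alpha> \<theta> \<and> card S = i.
      card {Bs \<in> osp n (comp_of_cuts n S). map ((`) w) Bs = Bs}))"
    unfolding homology_trace[OF comp n odd w]
    by (intro sum.cong refl arg_cong2[of _ _ _ _ "(*)"] arg_cong[of _ _ of_nat]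
        fixed_labelled_flags[OF w n finite_top_decorations] fact_cuts_range[OF comp n odd])
  also have "\<dots> = (\<Sum>\<theta>\<in>?T. \<Sum>i\<le>m. \<Sum>S | S \<subseteq> fact_cuts \<alpha> \<theta> \<and> card S = i. (-1) ^ (m - i) * ?g S)"
    by (simp add: sum_distrib_left) (rule sum.swap)
  also have "\<dots> = (\<Sum>\<theta>\<in>?T. \<Sum>S\<in>Pow (fact_cuts \<alpha> \<theta>). (-1) ^ (m - card S) * ?g S)"
    by (intro sum.cong refl sum_Pow_by_card finite_fact_cuts) (simp add: top_decorations_def)
  finally show ?thesis .
qed

text \<open>
  Each label contributes an alternating sum, over the subsets \<open>S\<close> of its cut set, of characteristics
  of permutation modules on ordered set partitions, and this sum is a ribbon.
\<close>
lemma frobenius_homology: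
  "frobenius_ch n (homology \<alpha> (Suc m) d e :: ('a::field_char_0, _) module) (\<lambda>w. (`) (relabel w)) =
    (\<Sum>\<theta>\<in>top_decorations n \<alpha> m d e. ribbon (comp_of_cuts n (fact_cuts \<alpha> \<theta>)))"
proof -
  let ?T = "top_decorations n \<alpha> m d e" and ?c = "mconst (1 / fact n) :: 'a mpser"
  let ?p = "\<lambda>w. \<Prod>Z\<in>cycles_on {1..n} w. power_sum (card Z) :: 'a mpser"
  let ?f = "\<lambda>S w. mconst (of_nat (card {Bs \<in> osp n (comp_of_cuts n S). map ((`) w) Bs = Bs})) :: 'a mpser"
  have "frobenius_ch n (homology \<alpha> (Suc m) d e :: ('a, _) module) (\<lambda>w. (`) (relabel w)) =
    ?c * (\<Sum>w | w permutes {1..n}. (\<Sum>\<theta>\<in>?T. \<Sum>S\<in>Pow (fact_cuts \<alpha> \<theta>). (-1) ^ (m - card S) * ?f S w) * ?p w)"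
    unfolding frobenius_ch_def
    by (intro arg_cong2[of _ _ _ _ "(*)"] sum.cong refl)
      (simp add: homology_trace_osp mconst_sum mconst_simps(5) mconst_neg_one_power)
  also have "\<dots> = ?c * (\<Sum>\<theta>\<in>?T. \<Sum>S\<in>Pow (fact_cuts \<alpha> \<theta>). \<Sum>w | w permutes {1..n}. (-1) ^ (m - card S) * (?f S w * ?p w))"
  proof -
    have swap: "(\<Sum>w | w permutes {1..n}. \<Sum>\<theta>\<in>?T. \<Sum>S\<in>Pow (fact_cuts \<alpha> \<theta>). g w S) =
        (\<Sum>\<theta>\<in>?T. \<Sum>S\<in>Pow (fact_cuts \<alpha> \<theta>). \<Sum>w | w permutes {1..n}. g w S)" for g :: "_ \<Rightarrow> _ \<Rightarrow> 'a mpser"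
      by (subst sum.swap) (intro sum.cong refl sum.swap)
    show ?thesis unfolding swap[symmetric] by (simp add: sum_distrib_right mult.assoc)
  qed
  also have "\<dots> = (\<Sum>\<theta>\<in>?T. \<Sum>S\<in>Pow (fact_cuts \<alpha> \<theta>). (-1) ^ (m - card S) * (?c * (\<Sum>w | w permutes {1..n}. ?f S w * ?p w)))"
    by (simp add: sum_distrib_left mult.left_commute)
  also have "\<dots> = (\<Sum>\<theta>\<in>?T. ribbon (comp_of_cuts n (fact_cuts \<alpha> \<theta>)))"
  proof (rule sum.cong)
    fix \<theta> assume \<theta>: "\<theta> \<in> ?T"
    have F: "fact_cuts \<alpha> \<theta> \<subseteq> {1..<n}" "card (fact_cuts \<alpha> \<theta>) = m"
      using fact_cuts_range[OF comp n odd] \<theta> by (auto simp: top_decorations_def)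
    have "?c * (\<Sum>w | w permutes {1..n}. ?f S w * ?p w) = prod_list (map complete_sym (comp_of_cuts n S))"
      if "S \<in> Pow (fact_cuts \<alpha> \<theta>)" for S
    proof -
      have "S \<subseteq> {1..<n}" using that F(1) by blast
      then have "sum_list (comp_of_cuts n S) = n" using composition_of_cuts[OF n] by (simp add: composition_def)
      then show ?thesis by (rule frobenius_osp)
    qed
    then show "(\<Sum>S\<in>Pow (fact_cuts \<alpha> \<theta>). (-1) ^ (m - card S) * (?c * (\<Sum>w | w permutes {1..n}. ?f S w * ?p w))) =
        ribbon (comp_of_cuts n (fact_cuts \<alpha> \<theta>))"
      unfolding ribbon_comp_of_cuts[OF n F(1)] F(2) by (intro sum.cong refl) simp
  qed simp
  finally show ?thesis .
qed

lemma tq_monom_sum: "tq_monom (\<Sum>i\<in>I. f i) d e = (\<Sum>i\<in>I. tq_monom (f i) d e :: 'b::comm_ring_1 poly poly)"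
  by (induction I rule: infinite_finite_induct) (simp_all add: add_monom[symmetric])

lemma ch_homology_Suc:
  "(ch_homology \<alpha> (Suc m) :: 'a::field_char_0 mpser poly poly) =
    (\<Sum>\<theta> | \<theta> \<in> decorations n \<and> card (fact_cuts \<alpha> \<theta>) = m.
      tq_monom (ribbon (comp_of_cuts n (fact_cuts \<alpha> \<theta>))) (deg_t n \<theta>) (deg_q n \<theta>))"
proof -
  let ?H = "homology \<alpha> (Suc m) :: nat \<Rightarrow> nat \<Rightarrow> ('a, (cell \<Rightarrow>\<^sub>0 'a) set) module"
  let ?ch = "\<lambda>p. frobenius_ch n (?H (fst p) (snd p)) (\<lambda>w. (`) (relabel w))"
  let ?deg = "\<lambda>\<theta>. (deg_t n \<theta>, deg_q n \<theta>)"
  let ?D = "{\<theta> \<in> decorations n. card (fact_cuts \<alpha> \<theta>) = m}"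
  let ?r = "\<lambda>\<theta>. ribbon (comp_of_cuts n (fact_cuts \<alpha> \<theta>)) :: 'a mpser"
  have s: "sum_list \<alpha> = n" using comp by (simp add: composition_def)
  have "(ch_homology \<alpha> (Suc m) :: 'a mpser poly poly) =
     (\<Sum>p\<in>{(d, e). carrier (?H d e) \<noteq> {\<zero>\<^bsub>?H d e\<^esub>}}. tq_monom (?ch p) (fst p) (snd p))"
    by (simp add: ch_homology_def frobenius_ch_tq_def s case_prod_unfold)
  also have "\<dots> = (\<Sum>p\<in>?deg ` decorations n. tq_monom (?ch p) (fst p) (snd p))"
  proof (rule sum.mono_neutral_left)
    show "finite (?deg ` decorations n)" using finite_decorations by simp
    show "{(d, e). carrier (?H d e) \<noteq> {\<zero>\<^bsub>?H d e\<^esub>}} \<subseteq> ?deg ` decorations n"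
    proof
      fix p assume p: "p \<in> {(d, e). carrier (?H d e) \<noteq> {\<zero>\<^bsub>?H d e\<^esub>}}"
      show "p \<in> ?deg ` decorations n"
      proof (rule ccontr)
        assume "p \<notin> ?deg ` decorations n"
        then have "carrier (?H (fst p) (snd p)) = {\<zero>\<^bsub>?H (fst p) (snd p)\<^esub>}"
          by (intro homology_trivial_degrees[OF comp n odd]) simp
        then show False using p by (simp add: case_prod_unfold)
      qed
    qed
    show "\<forall>p\<in>?deg ` decorations n - {(d, e). carrier (?H d e) \<noteq> {\<zero>\<^bsub>?H d e\<^esub>}}. tq_monom (?ch p) (fst p) (snd p) = 0"
    proof
      fix p assume "p \<in> ?deg ` decorations n - {(d, e). carrier (?H d e) \<noteq> {\<zero>\<^bsub>?H d e\<^esub>}}"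
      then have "carrier (?H (fst p) (snd p)) = {\<zero>\<^bsub>?H (fst p) (snd p)\<^esub>}" by (simp add: case_prod_unfold)
      then have "?ch p = 0"
        unfolding frobenius_ch_def
        by (simp add: homology_trivial_trace[OF comp n odd] mconst_simps(1))
      then show "tq_monom (?ch p) (fst p) (snd p) = 0" by simp
    qed
  qed
  also have "\<dots> = (\<Sum>p\<in>?deg ` decorations n. \<Sum>\<theta> | \<theta> \<in> ?D \<and> ?deg \<theta> = p. tq_monom (?r \<theta>) (deg_t n \<theta>) (deg_q n \<theta>))"
  proof (rule sum.cong)
    fix p
    have "top_decorations n \<alpha> m (fst p) (snd p) = {\<theta>. \<theta> \<in> ?D \<and> ?deg \<theta> = p}"
      by (cases p) (auto simp: top_decorations_def graded_decorations_def)
    then show "tq_monom (?ch p) (fst p) (snd p) = (\<Sum>\<theta> | \<theta> \<in> ?D \<and> ?deg \<theta> = p. tq_monom (?r \<theta>) (deg_t n \<theta>) (deg_q n \<theta>))"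
      unfolding frobenius_homology tq_monom_sum by (intro sum.cong) auto
  qed simp
  also have "\<dots> = (\<Sum>\<theta>\<in>?D. tq_monom (?r \<theta>) (deg_t n \<theta>) (deg_q n \<theta>))"
    using finite_decorations by (intro sum.group) auto
  finally show ?thesis by simp
qed

end

text \<open>
  Expand the product; each choice of decorations is recorded by its iterated product, which has the
  sum of the bidegrees.
\<close>
lemma prod_local_enum:
  assumes "at_most_one_odd \<beta>"
  shows "prod_list (map local_enum \<beta>) = (\<Sum>\<theta>\<in>fold_image \<beta>. tq_monom 1 (deg_t (sum_list \<beta>) \<theta>) (deg_q (sum_list \<beta>) \<theta>))"
  using assms
proof (induction \<beta>)
  case Nil
  then show ?case by (simp add: fold_image_def decorations_0 deg_unit one_pCons monom_0)
next
  case (Cons b \<beta>)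
  note o = at_most_one_odd_Cons[OF Cons.prems]
  let ?n = "sum_list \<beta>"
  let ?wt = "\<lambda>n \<theta>. tq_monom (1::int) (deg_t n \<theta>) (deg_q n \<theta>)"
  have "prod_list (map local_enum (b # \<beta>)) = (\<Sum>\<xi>\<in>decorations b. ?wt b \<xi>) * (\<Sum>\<theta>\<in>fold_image \<beta>. ?wt ?n \<theta>)"
    by (simp add: Cons.IH[OF o(1)] local_enum_def[of b])
  also have "\<dots> = (\<Sum>p\<in>decorations b \<times> fold_image \<beta>. ?wt b (fst p) * ?wt ?n (snd p))"
    by (simp add: sum_product sum.cartesian_product case_prod_unfold)
  also have "\<dots> = (\<Sum>p\<in>decorations b \<times> fold_image \<beta>. ?wt (b + ?n) ((\<lambda>(\<xi>, \<xi>'). deco_prod b \<xi> \<xi>') p))"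
  proof (rule sum.cong)
    fix p assume "p \<in> decorations b \<times> fold_image \<beta>"
    then obtain \<xi> \<xi>' where p: "p = (\<xi>, \<xi>')" "\<xi> \<in> decorations b" "\<xi>' \<in> decorations ?n" by (auto simp: fold_image_def)
    show "?wt b (fst p) * ?wt ?n (snd p) = ?wt (b + ?n) ((\<lambda>(\<xi>, \<xi>'). deco_prod b \<xi> \<xi>') p)"
      using deg_deco_prod[OF o(2) p(2,3)] by (simp add: p(1) mult_monom)
  qed simp
  also have "\<dots> = (\<Sum>\<theta>\<in>fold_image (b # \<beta>). ?wt (b + ?n) \<theta>)"
    by (rule sum.reindex_bij_betw[OF bij_betw_fold_image_Cons[OF Cons.prems]])
  finally show ?case by simp
qed

lemma alternating_sum_Pow:
  assumes "finite A" "A \<noteq> {}"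
  shows "(\<Sum>U\<in>Pow A. (-1) ^ card U) = (0 :: 'b::comm_ring_1)"
proof -
  obtain a B where A: "A = insert a B" "a \<notin> B" using assms(2) by (metis Set.set_insert ex_in_conv)
  have fin: "finite B" using A assms(1) by simp
  have "Pow A = Pow B \<union> insert a ` Pow B" by (simp add: A Pow_insert)
  moreover have "Pow B \<inter> insert a ` Pow B = {}" using A(2) by auto
  moreover have "inj_on (insert a) (Pow B)" using A(2) by (intro inj_onI) (metis Diff_insert_absorb PowD subsetD)
  moreover have "(-1) ^ card (insert a U) = - ((-1) ^ card U :: 'b)" if "U \<in> Pow B" for U
  proof -
    have "finite U" "a \<notin> U" using that A(2) fin finite_subset by auto
    then show ?thesis by simp
  qed
  ultimately show ?thesis using fin
    by (simp add: sum.union_disjoint sum.reindex sum_negf)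
qed

text \<open>
  Moebius inversion in a Boolean lattice: the sum runs over the interval from \<open>S\<close> to \<open>F\<close>.
\<close>
lemma moebius_Pow:
  assumes "finite D" "S \<subseteq> D" "F \<subseteq> D"
  shows "(\<Sum>T | S \<subseteq> T \<and> T \<subseteq> D. if T \<subseteq> F then (-1) ^ (card T - card S) else 0) = (if F = S then 1 else 0 :: 'b::comm_ring_1)"
proof -
  have fin: "finite F" "finite S" using assms finite_subset by blast+
  have "(\<Sum>T | S \<subseteq> T \<and> T \<subseteq> D. if T \<subseteq> F then (-1) ^ (card T - card S) else 0) =
      (\<Sum>T | S \<subseteq> T \<and> T \<subseteq> F. (-1) ^ (card T - card S) :: 'b)"
    using assms by (subst sum.inter_filter[symmetric]) (auto intro!: sum.cong intro: finite_subset[of _ "Pow D"])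
  also have "\<dots> = (if F = S then 1 else 0)"
  proof (cases "S \<subseteq> F")
    case True
    have "bij_betw ((\<union>) S) (Pow (F - S)) {T. S \<subseteq> T \<and> T \<subseteq> F}"
      by (rule bij_betwI[where g = "\<lambda>T. T - S"]) (use True in auto)
    then have "(\<Sum>T | S \<subseteq> T \<and> T \<subseteq> F. (-1) ^ (card T - card S) :: 'b) = (\<Sum>U\<in>Pow (F - S). (-1) ^ (card (S \<union> U) - card S))"
      by (rule sum.reindex_bij_betw[symmetric])
    also have "\<dots> = (\<Sum>U\<in>Pow (F - S). (-1) ^ card U)"
    proof (rule sum.cong)
      fix U assume U: "U \<in> Pow (F - S)"
      then have "finite U" "S \<inter> U = {}" using fin finite_subset by auto
      then show "(-1) ^ (card (S \<union> U) - card S) = ((-1) ^ card U :: 'b)" using fin by (simp add: card_Un_disjoint)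
    qed simp
    also have "\<dots> = (if F = S then 1 else 0)"
    proof (cases "F = S")
      case False
      then have "F - S \<noteq> {}" using True by blast
      then show ?thesis using False alternating_sum_Pow[of "F - S"] fin by simp
    qed simp
    finally show ?thesis .
  next
    case False
    then have "{T. S \<subseteq> T \<and> T \<subseteq> F} = {}" "F \<noteq> S" by blast+
    then show ?thesis by (simp only: sum.empty if_False)
  qed
  finally show ?thesis .
qed

text \<open>
  The product indexed by \<open>T\<close> counts the decorations whose factorization cuts contain \<open>T\<close>; the
  alternating sum extracts those whose factorization cuts are exactly \<open>S\<close>.
\<close>
theorem G_poly_enumerates:
  assumes comp: "composition n \<alpha>" and n: "0 < n" and odd: "at_most_one_odd \<alpha>" and S: "S \<subseteq> cuts \<alpha>"
  shows "G_poly \<alpha> S = (\<Sum>\<theta> | \<theta> \<in> decorations n \<and> fact_cuts \<alpha> \<theta> = S. tq_monom 1 (deg_t n \<theta>) (deg_q n \<theta>))"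
proof -
  let ?wt = "\<lambda>\<theta>. tq_monom (1::int) (deg_t n \<theta>) (deg_q n \<theta>)"
  have s: "sum_list \<alpha> = n" using comp by (simp add: composition_def)
  have fin: "finite (cuts \<alpha>)" by (simp add: cuts_eq)
  have prod: "prod_list (map local_enum (comp_of_cuts n T)) = (\<Sum>\<theta>\<in>decorations n. if T \<subseteq> fact_cuts \<alpha> \<theta> then ?wt \<theta> else 0)"
    if T: "T \<subseteq> cuts \<alpha>" for T
  proof -
    let ?\<beta> = "comp_of_cuts n T"
    have \<beta>: "composition n ?\<beta>" "cuts ?\<beta> = T" using composition_of_cuts[OF n] T cuts_range[OF comp] by blast+
    have "coarsening ?\<beta> \<alpha>" using \<beta> T by (simp add: coarsening_def s)
    then have o: "at_most_one_odd ?\<beta>" by (rule coarsening_at_most_one_odd[OF _ comp odd n])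
    have "fold_image ?\<beta> = {\<theta> \<in> decorations n. T \<subseteq> fact_cuts \<alpha> \<theta>}"
      using T by (auto simp: fold_image_eq[OF \<beta>(1) n] \<beta>(2) fact_cuts_def s)
    moreover have "sum_list ?\<beta> = n" using \<beta>(1) by (simp add: composition_def)
    ultimately show ?thesis using prod_local_enum[OF o] finite_decorations[of n] by (simp add: sum.inter_filter)
  qed
  have "G_poly \<alpha> S = (\<Sum>T | S \<subseteq> T \<and> T \<subseteq> cuts \<alpha>. \<Sum>\<theta>\<in>decorations n.
      (-1) ^ (card T - card S) * (if T \<subseteq> fact_cuts \<alpha> \<theta> then ?wt \<theta> else 0))"
    unfolding G_poly_def s by (intro sum.cong refl) (simp add: prod sum_distrib_left)
  also have "\<dots> = (\<Sum>\<theta>\<in>decorations n. \<Sum>T | S \<subseteq> T \<and> T \<subseteq> cuts \<alpha>.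
      (if T \<subseteq> fact_cuts \<alpha> \<theta> then (-1) ^ (card T - card S) else 0) * ?wt \<theta>)"
    by (subst sum.swap) (intro sum.cong refl, simp)
  also have "\<dots> = (\<Sum>\<theta>\<in>decorations n. (if fact_cuts \<alpha> \<theta> = S then 1 else 0) * ?wt \<theta>)"
    unfolding sum_distrib_right[symmetric]
    by (intro sum.cong refl arg_cong2[of _ _ _ _ "(*)"] moebius_Pow[OF fin S]) (auto simp: fact_cuts_def)
  also have "\<dots> = (\<Sum>\<theta>\<in>decorations n. if fact_cuts \<alpha> \<theta> = S then ?wt \<theta> else 0)"
    by (intro sum.cong refl) simp
  also have "\<dots> = (\<Sum>\<theta> | \<theta> \<in> decorations n \<and> fact_cuts \<alpha> \<theta> = S. ?wt \<theta>)"
    using finite_decorations[of n] by (simp add: sum.inter_filter)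
  finally show ?thesis .
qed

lemma tq_times_add: "(P + Q) \<cdot>\<^sub>t\<^sub>q s = P \<cdot>\<^sub>t\<^sub>q s + Q \<cdot>\<^sub>t\<^sub>q s"
proof -
  have "map_poly (map_poly of_int) (P + Q) = map_poly (map_poly of_int) P + map_poly (map_poly (of_int :: int \<Rightarrow> 'a mpser)) Q"
    by (intro poly_eqI) (simp add: coeff_map_poly)
  then show ?thesis by (simp only: tq_times_def distrib_right)
qed

lemma tq_times_zero: "0 \<cdot>\<^sub>t\<^sub>q s = 0"
  by (simp add: tq_times_def)

lemma tq_times_sum: "(\<Sum>i\<in>I. P i) \<cdot>\<^sub>t\<^sub>q s = (\<Sum>i\<in>I. P i \<cdot>\<^sub>t\<^sub>q s)"
  by (induction I rule: infinite_finite_induct) (simp_all add: tq_times_add tq_times_zero)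

lemma tq_times_monom: "tq_monom 1 d e \<cdot>\<^sub>t\<^sub>q s = tq_monom s d e"
proof -
  have "map_poly (map_poly of_int) (tq_monom 1 d e) = (tq_monom 1 d e :: 'a mpser poly poly)"
    by (simp add: map_poly_monom)
  then show ?thesis by (simp add: tq_times_def mult_monom flip: monom_0)
qed

text \<open>
  Group the decorations in \<open>ch_homology_Suc\<close> by their sets of factorization cuts. In degree \<open>0\<close>
  there are no cells, and every cell with one block is a cycle.
\<close>
theorem ch_homology_eq:
  assumes comp: "composition n \<alpha>" and n: "0 < n" and odd: "at_most_one_odd \<alpha>"
  shows "(ch_homology \<alpha> k :: 'a::field_char_0 mpser poly poly) =
    (\<Sum>S | S \<subseteq> cuts \<alpha> \<and> card S + 1 = k. G_poly \<alpha> S \<cdot>\<^sub>t\<^sub>q ribbon (comp_of_cuts n S))"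
proof (cases k)
  case 0
  have s: "sum_list \<alpha> = n" using comp by (simp add: composition_def)
  have none: "cells \<alpha> 0 d e = {}" for d e using n by (auto simp: cells_def coarsening_def composition_def s)
  have "cells \<alpha> 1 d e \<subseteq> {c. length (fst c) = 1}" for d e by (auto simp: cells_def osp_def)
  then have zero: "boundary x = 0" if "x \<in> chains \<alpha> 1 d e" for x :: "cell \<Rightarrow>\<^sub>0 'a" and d e
    using that linmap_maps_into[OF linmap_boundary, of x "{c. length (fst c) = 1}" "{0}"]
    by (fastforce simp: chains_def supported_on_def boundary_unitvec)
  have "0 \<in> (chains \<alpha> 1 d e :: (cell \<Rightarrow>\<^sub>0 'a) set)" for d e by (simp add: chains_def)
  moreover have "boundary (0 :: cell \<Rightarrow>\<^sub>0 'a) = 0" by (rule pm.linear_0[OF linmap_boundary])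
  ultimately have "boundary ` (chains \<alpha> 1 d e :: (cell \<Rightarrow>\<^sub>0 'a) set) = {0}" for d e
    using zero by (metis (no_types, lifting) image_cong image_constant)
  then have "carrier (homology \<alpha> 0 d e :: ('a, _) module) = {\<zero>\<^bsub>homology \<alpha> 0 d e\<^esub>}" for d e
    by (auto simp: none homology_def quotient_space_def chains_def pm.linear_0[OF linmap_boundary])
  then show ?thesis using 0 by (simp add: ch_homology_def frobenius_ch_tq_def)
next
  case (Suc m)
  let ?C = "{S. S \<subseteq> cuts \<alpha> \<and> card S = m}" and ?D = "{\<theta> \<in> decorations n. card (fact_cuts \<alpha> \<theta>) = m}"
  let ?r = "\<lambda>S. ribbon (comp_of_cuts n S) :: 'a mpser"
  have fin: "finite ?C" by (rule finite_subset[of _ "Pow (cuts \<alpha>)"]) (auto simp: cuts_eq)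
  have "(\<Sum>S\<in>?C. G_poly \<alpha> S \<cdot>\<^sub>t\<^sub>q ?r S) =
     (\<Sum>S\<in>?C. \<Sum>\<theta> | \<theta> \<in> ?D \<and> fact_cuts \<alpha> \<theta> = S. tq_monom (?r (fact_cuts \<alpha> \<theta>)) (deg_t n \<theta>) (deg_q n \<theta>))"
  proof (rule sum.cong)
    fix S assume S: "S \<in> ?C"
    then have "{\<theta>. \<theta> \<in> decorations n \<and> fact_cuts \<alpha> \<theta> = S} = {\<theta>. \<theta> \<in> ?D \<and> fact_cuts \<alpha> \<theta> = S}" by auto
    moreover have "G_poly \<alpha> S \<cdot>\<^sub>t\<^sub>q ?r S =
        (\<Sum>\<theta> | \<theta> \<in> decorations n \<and> fact_cuts \<alpha> \<theta> = S. tq_monom (?r S) (deg_t n \<theta>) (deg_q n \<theta>))"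
      using S by (simp add: G_poly_enumerates[OF comp n odd] tq_times_sum tq_times_monom)
    ultimately show "G_poly \<alpha> S \<cdot>\<^sub>t\<^sub>q ?r S =
       (\<Sum>\<theta> | \<theta> \<in> ?D \<and> fact_cuts \<alpha> \<theta> = S. tq_monom (?r (fact_cuts \<alpha> \<theta>)) (deg_t n \<theta>) (deg_q n \<theta>))"
      by (auto intro: sum.cong)
  qed simp
  also have "\<dots> = (\<Sum>\<theta>\<in>?D. tq_monom (?r (fact_cuts \<alpha> \<theta>)) (deg_t n \<theta>) (deg_q n \<theta>))"
    using finite_decorations[of n] fin by (intro sum.group) (auto simp: fact_cuts_def)
  finally show ?thesis using ch_homology_Suc[OF comp n odd, of m, where 'a = 'a] Suc by simp
qed

text \<open>
  Only \<open>S = cuts \<alpha>\<close> has enough elements, and its alternating sum has a single term.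
\<close>
theorem ch_homology_top:
  assumes comp: "composition n \<alpha>" and n: "0 < n" and odd: "at_most_one_odd \<alpha>"
  shows "(ch_homology \<alpha> (length \<alpha>) :: 'a::field_char_0 mpser poly poly) = prod_list (map local_enum \<alpha>) \<cdot>\<^sub>t\<^sub>q ribbon \<alpha>"
proof -
  have s: "sum_list \<alpha> = n" using comp by (simp add: composition_def)
  have fin: "finite (cuts \<alpha>)" by (simp add: cuts_eq)
  have len: "card (cuts \<alpha>) + 1 = length \<alpha>"
    using card_cuts[OF comp] composition_nonempty[OF comp n] by (cases \<alpha>) auto
  have "S \<subseteq> cuts \<alpha> \<and> card S + 1 = length \<alpha> \<longleftrightarrow> S = cuts \<alpha>" for S
    using len card_subset_eq[OF fin, of S] by (metis add_right_cancel order_refl)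
  then have "{S. S \<subseteq> cuts \<alpha> \<and> card S + 1 = length \<alpha>} = {cuts \<alpha>}" by (simp only: singleton_conv)
  moreover have "{T. cuts \<alpha> \<subseteq> T \<and> T \<subseteq> cuts \<alpha>} = {cuts \<alpha>}" by auto
  then have "G_poly \<alpha> (cuts \<alpha>) = prod_list (map local_enum \<alpha>)"
    by (simp add: G_poly_def s comp_of_cuts_cuts[OF comp n])
  ultimately show ?thesis
    by (simp add: ch_homology_eq[OF comp n odd] comp_of_cuts_cuts[OF comp n])
qed

lemma local_enum_1: "local_enum 1 = tq_monom 1 1 0"
proof -
  have "{p. p permutes {k}} = {id}" for k :: nat by auto
  then have "decorations 1 = {(id, id)}" by (simp add: decorations_def)
  then show ?thesis by (simp add: local_enum_def deg_t_def deg_q_def cycles_on_def)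
qed

text \<open>
  The two decorations of size \<open>2\<close> differ in whether the letter \<open>1\<close> is in the root cycle.
\<close>
lemma local_enum_2: "local_enum 2 = tq_monom 1 1 0 * (1 + tq_monom 1 1 0)"
proof -
  let ?s = "transpose 0 1 :: nat \<Rightarrow> nat"
  have "{p. p permutes {k}} = {id}" for k :: nat by auto
  moreover have perms: "{id, ?s} = {p. p permutes {0..1 :: nat}}"
  proof (rule card_seteq)
    show "finite {p. p permutes {0..1 :: nat}}" by (rule finite_permutations) simp
    show "{id, ?s} \<subseteq> {p. p permutes {0..1 :: nat}}"
      by (auto intro: permutes_id permutes_swap_id)
    have "?s 0 \<noteq> id (0 :: nat)" by simp
    then have "id \<noteq> ?s" by metis
    then show "card {p. p permutes {0..1 :: nat}} \<le> card {id, ?s}"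
      using card_permutations[of "{0..1 :: nat}" 2] by (simp add: fact_2)
  qed
  ultimately have dec: "decorations 2 = {(id, id), (id, ?s)}" by (auto simp: decorations_def)
  have p: "id permutes {0..1 :: nat}" "?s permutes {0..1}" using perms by blast+
  have "orbit id x = {x}" for x :: nat by (simp add: orbit_eq_singleton_iff)
  then have "nonroot_cycles 1 id = {{1}}" by (auto simp: nonroot_cycles_def)
  then have c1: "card (cycles_on {0..1 :: nat} id) = 2" using card_cycles_root[OF p(1)] by simp
  have "0 \<in> orbit ?s 1" using orbit.base[of ?s 1] by simp
  then have "nonroot_cycles 1 ?s = {}" by (auto simp: nonroot_cycles_def)
  then have c2: "card (cycles_on {0..1 :: nat} ?s) = 1" using card_cycles_root[OF p(2)] by simp
  have "id \<noteq> ?s" by (metis id_apply transpose_apply_first zero_neq_one)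
  moreover have "card (cycles_on {Suc 0} id) = 1" by (simp add: cycles_on_def)
  ultimately have "deg_t 2 (id, id) = 2" "deg_t 2 (id, ?s) = 1" "deg_q 2 (id, id) = 0" "deg_q 2 (id, ?s) = 0"
    using c1 c2 by (simp_all add: deg_t_def deg_q_def)
  then have "local_enum 2 = tq_monom 1 2 0 + tq_monom 1 1 0"
    using \<open>id \<noteq> ?s\<close> unfolding local_enum_def dec by simp
  also have "\<dots> = tq_monom 1 1 0 * (1 + tq_monom 1 1 0)"
    by (simp add: distrib_left mult_monom numeral_2_eq_2)
  finally show ?thesis .
qed

lemma zigzag_composition: "composition N (zigzag N)" "at_most_one_odd (zigzag N)"
proof -
  have "N = N div 2 * 2 + (if odd N then 1 else 0)" by presburger
  then show "composition N (zigzag N)" by (auto simp: composition_def zigzag_def sum_list_replicate)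
  show "at_most_one_odd (zigzag N)" by (simp add: zigzag_def at_most_one_odd_def)
qed

lemma zigzag_enum:
  "prod_list (map local_enum (zigzag N)) = tq_monom 1 1 0 ^ half_up N * (1 + tq_monom 1 1 0) ^ half_down N"
proof -
  let ?t = "tq_monom (1 :: int) 1 0"
  have "prod_list (map local_enum (zigzag N)) = (?t * (1 + ?t)) ^ (N div 2) * (if odd N then ?t else 1)"
    by (simp add: zigzag_def map_replicate_const local_enum_1[unfolded One_nat_def] local_enum_2)
  also have "\<dots> = ?t ^ half_up N * (1 + ?t) ^ half_down N"
    by (cases "odd N") (auto simp: power_mult_distrib elim!: oddE evenE)
  finally show ?thesis .
qed

text \<open>
  The inner variable of these polynomials is \<open>q\<close>, so this says that \<open>q\<close> does not occur.
\<close>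
definition q_free :: "'b::comm_ring_1 poly poly \<Rightarrow> bool" where
  "q_free P \<longleftrightarrow> (\<forall>d. degree (Polynomial.coeff P d) = 0)"

lemma q_free_const: "q_free [:[:s:]:]"
  by (simp add: q_free_def coeff_pCons split: nat.splits)

lemma q_free_mult: "q_free P \<Longrightarrow> q_free Q \<Longrightarrow> q_free (P * Q)"
proof -
  assume PQ: "q_free P" "q_free Q"
  have "degree (Polynomial.coeff (P * Q) d) \<le> 0" for d
    unfolding coeff_mult
  proof (rule degree_sum_le)
    fix i
    have "degree (Polynomial.coeff P i * Polynomial.coeff Q (d - i)) \<le> degree (Polynomial.coeff P i) + degree (Polynomial.coeff Q (d - i))"
      by (rule degree_mult_le)
    then show "degree (Polynomial.coeff P i * Polynomial.coeff Q (d - i)) \<le> 0" using PQ by (simp add: q_free_def)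
  qed simp
  then show ?thesis by (simp add: q_free_def)
qed

lemma q_free_power: "q_free P \<Longrightarrow> q_free (P ^ k)"
  by (induction k) (simp_all add: q_free_mult one_pCons q_free_const)

lemma q_free_tq_times: "q_free P \<Longrightarrow> q_free (P \<cdot>\<^sub>t\<^sub>q s)"
  unfolding tq_times_def
proof (rule q_free_mult)
  assume P: "q_free P"
  have "degree (map_poly of_int (Polynomial.coeff P d) :: 'a mpser poly) \<le> degree (Polynomial.coeff P d)" for d
    by (rule degree_le) (simp add: coeff_map_poly coeff_eq_0)
  then show "q_free (map_poly (map_poly of_int) P :: 'a mpser poly poly)"
    using P by (simp add: q_free_def coeff_map_poly)
  show "q_free [:[:s:]:]" by (rule q_free_const)
qed

theorem corollary3p12:
  fixes n :: nat and \<alpha> :: "nat list"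
  assumes "composition n \<alpha>" and "\<alpha> \<noteq> []" and "length (filter odd \<alpha>) \<le> 1"
  shows "(\<forall>S. S \<subseteq> cuts \<alpha> \<longrightarrow>
            (\<forall>d e. 0 \<le> Polynomial.coeff (Polynomial.coeff (G_poly \<alpha> S) d) e) \<and>
            G_poly \<alpha> S =
              (\<Sum>\<theta> | \<theta> \<in> decorations n \<and> fact_cuts \<alpha> \<theta> = S. tq_monom 1 (deg_t n \<theta>) (deg_q n \<theta>))) \<and>
         (\<forall>k. (ch_homology \<alpha> k :: 'a::field_char_0 mpser poly poly) =
            (\<Sum>S | S \<subseteq> cuts \<alpha> \<and> card S + 1 = k. G_poly \<alpha> S \<cdot>\<^sub>t\<^sub>q ribbon (comp_of_cuts n S))) \<and>
         (ch_homology \<alpha> (length \<alpha>) :: 'a mpser poly poly) =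
            prod_list (map local_enum \<alpha>) \<cdot>\<^sub>t\<^sub>q ribbon \<alpha> \<and>
         (\<forall>N\<ge>1.
            (ch_homology (zigzag N) (length (zigzag N)) :: 'a mpser poly poly) =
              (tq_monom 1 1 0 ^ half_up N * (1 + tq_monom 1 1 0) ^ half_down N) \<cdot>\<^sub>t\<^sub>q ribbon (zigzag N) \<and>
            (\<forall>d e. 0 < e \<longrightarrow>
              Polynomial.coeff
                (Polynomial.coeff (ch_homology (zigzag N) (length (zigzag N)) :: 'a mpser poly poly) d) e = 0))"
proof (intro conjI allI impI)
  have odd: "at_most_one_odd \<alpha>" using assms(3) by (simp add: at_most_one_odd_def)
  have n: "0 < n" using assms(1,2) by (cases \<alpha>) (auto simp: composition_def)
  show enum: "G_poly \<alpha> S = (\<Sum>\<theta> | \<theta> \<in> decorations n \<and> fact_cuts \<alpha> \<theta> = S. tq_monom 1 (deg_t n \<theta>) (deg_q n \<theta>))"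
    if "S \<subseteq> cuts \<alpha>" for S
    by (rule G_poly_enumerates[OF assms(1) n odd that])
  show "0 \<le> Polynomial.coeff (Polynomial.coeff (G_poly \<alpha> S) d) e" if "S \<subseteq> cuts \<alpha>" for S d e
    unfolding enum[OF that] by (simp add: coeff_sum sum_nonneg)
  show "(ch_homology \<alpha> k :: 'a mpser poly poly) =
      (\<Sum>S | S \<subseteq> cuts \<alpha> \<and> card S + 1 = k. G_poly \<alpha> S \<cdot>\<^sub>t\<^sub>q ribbon (comp_of_cuts n S))" for k
    by (rule ch_homology_eq[OF assms(1) n odd])
  show "(ch_homology \<alpha> (length \<alpha>) :: 'a mpser poly poly) = prod_list (map local_enum \<alpha>) \<cdot>\<^sub>t\<^sub>q ribbon \<alpha>"
    by (rule ch_homology_top[OF assms(1) n odd])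
  fix N :: nat assume N: "1 \<le> N"
  then have N0: "0 < N" by simp
  let ?t = "tq_monom (1 :: int) 1 0"
  show zigzag: "(ch_homology (zigzag N) (length (zigzag N)) :: 'a mpser poly poly) =
      (?t ^ half_up N * (1 + ?t) ^ half_down N) \<cdot>\<^sub>t\<^sub>q ribbon (zigzag N)"
    using ch_homology_top[OF zigzag_composition(1) N0 zigzag_composition(2), where 'a = 'a] by (simp only: zigzag_enum)
  fix d e :: nat assume "0 < e"
  have t: "q_free ?t" "q_free (1 + ?t)" by (simp_all add: q_free_def one_pCons coeff_pCons degree_monom_eq split: nat.splits)
  then have "q_free (ch_homology (zigzag N) (length (zigzag N)) :: 'a mpser poly poly)"
    unfolding zigzag by (intro q_free_tq_times q_free_mult q_free_power)
  then show "Polynomial.coeff (Polynomial.coeff (ch_homology (zigzag N) (length (zigzag N)) :: 'a mpser poly poly) d) e = 0"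
    using \<open>0 < e\<close> by (simp add: q_free_def coeff_eq_0)
qed

end
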